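(* There are universal constants $C,c,c'>0$ such that the following holds. Let $k,d_1,\dots,d_k$ be positive integers, $D=\prod_a d_a$, $d_{\max}=\max_ad_a$, $d_{\min}=\min_ad_a$. Let $x=(x_1,\dots,x_n)$ be independent standard Gaussian random variables in $\mathbb R^D$, where $n\ge Ck\frac{d_{\max}^2}{D}$. Then, with probability at least $1-k^2\left(\frac{\sqrt{nD}}{k\,d_{\max}}\right)^{-c'd_{\min}}$, the function $f_x$ is $\frac12$-strongly (geodesically) convex at every point $\Theta\in\mathbb P$ such that $d_{\mathrm{op}}(\Theta,I_D)\le c$.
   Context: $\mathrm{PD}(d)$: real symmetric positive definite $d\times d$ matrices. $\mathbb P=\{\Theta_1\otimes\cdots\otimes\Theta_k:\Theta_a\in\mathrm{PD}(d_a)\}$. For $x_i\in\mathbb R^D=\mathbb R^{d_1}\otimes\cdots\otimes\mathbb R^{d_k}$, $f_x(\Theta)=\frac1{nD}\sum_{i=1}^nx_i^T\Theta x_i-\frac1D\log\det\Theta$ for $\Theta\in\mathbb P$. Let $\mathbb H$ be the real inner product space of tuples $H=(H_0;H_1,\dots,H_k)$ with $H_0\in\mathbb R$ and $H_a$ a symmetric traceless real $d_a\times d_a$ matrix, with $\langle H,K\rangle=H_0K_0+\sum_a\mathrm{Tr}\,H_a^TK_a$ and $\|H\|_F=\langle H,H\rangle^{1/2}$. The exponential map at $\Theta=\Theta_1\otimes\cdots\otimes\Theta_k$ is $\exp_\Theta(H)=e^{H_0}\cdot(\Theta_1^{1/2}e^{\sqrt{d_1}H_1}\Theta_1^{1/2})\otimes\cdots\otimes(\Theta_k^{1/2}e^{\sqrt{d_k}H_k}\Theta_k^{1/2})$.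 A twice differentiable $f:\mathbb P\to\mathbb R$ is $\lambda$-strongly (geodesically) convex at $\Theta$ if $\partial_{t=0}^2f(\exp_\Theta(tH))\ge\lambda\|H\|_F^2$ for all $H\in\mathbb H$. $d_{\mathrm{op}}(A,B)=\|\log(B^{-1/2}AB^{-1/2})\|_{\mathrm{op}}$. *)

theory Defs
  imports "HOL-Probability.Probability" "Jordan_Normal_Form.Gauss_Jordan_Elimination"
    "Jordan_Normal_Form.Determinant"
begin

(* Matrix, Determinant etc. of Jordan_Normal_Form are used because the dimensions d_1, ..., d_k
   (and k itself) are bound inside the scope of the universal constants. *)

definition sym_mats :: "nat \<Rightarrow> real mat set" where
  "sym_mats d = {A \<in> carrier_mat d d. transpose_mat A = A}"

definition PD :: "nat \<Rightarrow> real mat set" where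
  "PD d = {A \<in> sym_mats d. \<forall>v \<in> carrier_vec d. v \<noteq> 0\<^sub>v d \<longrightarrow> scalar_prod v (A *\<^sub>v v) > 0}"

definition mat_trace :: "real mat \<Rightarrow> real" where
  "mat_trace A = (\<Sum>i<dim_row A. A $$ (i, i))"

(* The power series sum_m A^m / m!, taken entrywise (A is square). *)
definition mat_exp :: "real mat \<Rightarrow> real mat" where
  "mat_exp A = Matrix.mat (dim_row A) (dim_row A) (\<lambda>(i, j). \<Sum>m. (A ^\<^sub>m m) $$ (i, j) / fact m)"

(* Positive definite square root and symmetric logarithm; both exist and are unique for
   positive definite A, the only case in which they are used. *)
definition mat_sqrt :: "real mat \<Rightarrow> real mat" where
  "mat_sqrt A = (THE B. B \<in> PD (dim_row A) \<and> B * B = A)"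

definition mat_log :: "real mat \<Rightarrow> real mat" where
  "mat_log A = (THE L. L \<in> sym_mats (dim_row A) \<and> mat_exp L = A)"

(* Operator norm with respect to the Euclidean norms. *)
definition op_norm :: "real mat \<Rightarrow> real" where
  "op_norm A = (SUP v \<in> {v \<in> carrier_vec (dim_col A). scalar_prod v v \<le> 1}.
     sqrt (scalar_prod (A *\<^sub>v v) (A *\<^sub>v v)))"

definition d_op :: "real mat \<Rightarrow> real mat \<Rightarrow> real" where
  "d_op A B = (let R = the (mat_inverse (mat_sqrt B)) in op_norm (mat_log (R * A * R)))"

(* Kronecker product; it identifies the tensor product of R^m and R^n with R^(m*n) through the
   lexicographic order on the standard basis e_i \<otimes> e_j. *)
definition kron :: "real mat \<Rightarrow> real mat \<Rightarrow> real mat" where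
  "kron A B = Matrix.mat (dim_row A * dim_row B) (dim_col A * dim_col B)
     (\<lambda>(i, j). A $$ (i div dim_row B, j div dim_col B) * B $$ (i mod dim_row B, j mod dim_col B))"

definition kron_list :: "real mat list \<Rightarrow> real mat" where
  "kron_list As = foldr kron As (1\<^sub>m 1)"

(* In what follows ds = [d_1, ..., d_k]; tuples are lists, so indices run over a < k. *)
definition PD_tuples :: "nat list \<Rightarrow> real mat list set" where
  "PD_tuples ds = {Ts. length Ts = length ds \<and> (\<forall>a < length ds. Ts ! a \<in> PD (ds ! a))}"

definition PP :: "nat list \<Rightarrow> real mat set" where
  "PP ds = kron_list ` PD_tuples ds"

definition HH :: "nat list \<Rightarrow> (real \<times> real mat list) set" where
  "HH ds = {(h, Hs). length Hs = length ds \<and>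
     (\<forall>a < length ds. Hs ! a \<in> sym_mats (ds ! a) \<and> mat_trace (Hs ! a) = 0)}"

definition HH_inner :: "real \<times> real mat list \<Rightarrow> real \<times> real mat list \<Rightarrow> real" where
  "HH_inner H K = fst H * fst K +
     (\<Sum>a < length (snd H). mat_trace (transpose_mat (snd H ! a) * (snd K ! a)))"

definition HH_norm :: "real \<times> real mat list \<Rightarrow> real" where
  "HH_norm H = sqrt (HH_inner H H)"

definition HH_scale :: "real \<Rightarrow> real \<times> real mat list \<Rightarrow> real \<times> real mat list" where
  "HH_scale t H = (t * fst H, map (\<lambda>A. t \<cdot>\<^sub>m A) (snd H))"

(* The exponential map at kron_list Ts. Its value depends only on that product: two tuples of
   factors of the same point differ by positive scalars with product 1. *)
definition exp_map :: "nat list \<Rightarrow> real mat list \<Rightarrow> real \<times> real mat list \<Rightarrow> real mat" where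
  "exp_map ds Ts H = exp (fst H) \<cdot>\<^sub>m
     kron_list (map (\<lambda>a. mat_sqrt (Ts ! a) * mat_exp (sqrt (real (ds ! a)) \<cdot>\<^sub>m (snd H ! a)) *
       mat_sqrt (Ts ! a)) [0..<length ds])"

(* g is the derivative of t |-> f (exp_T (t H)) near 0 and s its second derivative at 0, so the
   second derivative is required to exist. *)
definition strongly_convex_at :: "nat list \<Rightarrow> real \<Rightarrow> (real mat \<Rightarrow> real) \<Rightarrow> real mat \<Rightarrow> bool" where
  "strongly_convex_at ds lam f T \<longleftrightarrow>
     (\<forall>Ts \<in> PD_tuples ds. kron_list Ts = T \<longrightarrow> (\<forall>H \<in> HH ds. \<exists>g s.
        (\<forall>\<^sub>F t in nhds 0. ((\<lambda>u. f (exp_map ds Ts (HH_scale u H))) has_real_derivative g t) (at t)) \<and>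
        (g has_real_derivative s) (at 0) \<and>
        s \<ge> lam * (HH_norm H)\<^sup>2))"

(* The objective f_x, for the samples x 0, ..., x (n - 1) in R^D. *)
definition objective :: "nat \<Rightarrow> nat \<Rightarrow> (nat \<Rightarrow> real Matrix.vec) \<Rightarrow> real mat \<Rightarrow> real" where
  "objective n D x T = 1 / (real n * real D) * (\<Sum>i<n. scalar_prod (x i) (T *\<^sub>v x i))
     - 1 / real D * ln (Determinant.det T)"

(* Joint law of n independent standard Gaussian vectors in R^D; w i j is coordinate j of
   sample i. *)
definition gaussian_samples :: "nat \<Rightarrow> nat \<Rightarrow> (nat \<Rightarrow> nat \<Rightarrow> real) measure" where
  "gaussian_samples n D = PiM {..<n} (\<lambda>_. PiM {..<D} (\<lambda>_. density lborel std_normal_density))"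

definition samples :: "nat \<Rightarrow> (nat \<Rightarrow> nat \<Rightarrow> real) \<Rightarrow> nat \<Rightarrow> real Matrix.vec" where
  "samples D w i = Matrix.vec D (w i)"

end

theory Submission
  imports Defs "Jordan_Normal_Form.Spectral_Radius"
begin

text \<open>The second derivative of \<open>f\<^sub>x\<close> along the geodesic from \<open>\<Theta>\<close> in direction \<open>H\<close> is
  \<open>(1 / (n D)) \<Sum>\<^sub>i \<bar>M \<Theta>\<^bsup>1/2\<^esup> x\<^sub>i\<bar>\<^sup>2\<close> where \<open>M\<close> is \<open>H\<^sub>0\<close> plus the sum of the matrices \<open>\<surd>d\<^sub>a H\<^sub>a\<close> acting on leg \<open>a\<close>.
  Now \<open>M \<Theta>\<^bsup>1/2\<^esup> = \<Theta>\<^bsup>1/2\<^esup> M'\<close>, where \<open>M'\<close> is built in the same way from \<open>K\<^sub>a = \<Theta>\<^sub>a\<^bsup>-1/2\<^esup> H\<^sub>a \<Theta>\<^sub>a\<^bsup>1/2\<^esup>\<close>.  These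
  matrices are traceless, not symmetric, and at least as large as \<open>H\<^sub>a\<close> in Frobenius norm.  As
  \<open>\<Theta> \<ge> e\<^bsup>-c\<^esup>\<close>, it remains to bound \<open>(1 / (n D)) \<Sum>\<^sub>i \<bar>M' x\<^sub>i\<bar>\<^sup>2\<close> from below by \<open>3/4 (H\<^sub>0\<^sup>2 + \<Sum>\<^sub>a \<bar>K\<^sub>a\<bar>\<^sup>2)\<close>, uniformly
  in all traceless \<open>K\<^sub>a\<close> and without reference to \<open>\<Theta>\<close>.

  Expanding the square, the diagonal terms are governed by the least eigenvalue of a Wishart
  matrix.  The mixed term of legs \<open>a\<close> and \<open>b\<close> is a bilinear form in \<open>K\<^sub>a\<close> and \<open>K\<^sub>b\<close> and, one of them being
  traceless, can be decoupled; its norm is then that of \<open>\<Sum>\<^sub>i U\<^sub>i \<otimes> V\<^sub>i\<close> with independent Gaussian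
  matrices, which Pisier's method compares with a single Gaussian matrix through trace moments of
  order about \<open>max d\<^sub>a d\<^sub>b\<close>.  Markov's inequality for these moments gives the exponent \<open>d\<^sub>m\<^sub>i\<^sub>n\<close>.  The
  union over all pairs of legs costs the factor \<open>k\<^sup>2\<close>, and requires the mixed terms to be smaller by
  a factor \<open>1/k\<close> unless one of the two legs has the largest dimension; this is available because
  \<open>d\<^sub>m\<^sub>i\<^sub>n \<ge> 2\<close> makes \<open>D\<close> exponentially large in \<open>k\<close>, while for \<open>d\<^sub>m\<^sub>i\<^sub>n = 1\<close> the claimed bound is trivial
  unless \<open>\<surd>(n D) / (k d\<^sub>m\<^sub>a\<^sub>x)\<close> is large.\<close>

section \<open>Gaussian vectors\<close>

text \<open>The lower bound for traceless \<open>K\<close> does not mention the point, so one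
  exceptional event serves every point near the identity and every direction at once. The scalar
  \<open>H_0\<close> is treated as a further leg, number 0, of dimension 1; of two distinct legs at
  least one is then traceless, which is what gives a mixed term mean zero. Trace moments have order
  \<open>2 m\<close> with \<open>m\<close> the larger of the two dimensions: at that order the
  dimension factor lost by a trace is only a constant after the \<open>m\<close>-th root, while
  moments of Gaussian norms are still of the size of the norms themselves. Budget: the diagonal
  keeps \<open>15/16\<close> of its mean, the mixed terms cost at most \<open>5/32\<close>, which
  leaves \<open>25/32 \<ge> 3/4\<close>; with \<open>exp (- 1/4) \<ge> 3/4\<close> this gives
  \<open>9/16 \<ge> 1/2\<close>. Each of the \<open>k (k + 2)\<close> bad events has probability at
  most \<open>(4096 / \<rho>) ^ (2 m)\<close> with \<open>m\<close> at least the smallest dimension;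
  as \<open>\<rho> \<ge> 2 ^ 24 = 4096 ^ 2\<close>, half of the exponent absorbs the
  constant.\<close>

definition std_gauss :: "real measure" where
  "std_gauss = density lborel std_normal_density"

abbreviation gauss :: "'s set \<Rightarrow> ('s \<Rightarrow> real) measure" where
  "gauss S \<equiv> PiM S (\<lambda>_. std_gauss)"

lemma sets_std_gauss[simp, measurable_cong]: "sets std_gauss = sets borel"
  by (simp add: std_gauss_def)

lemma space_std_gauss[simp]: "space std_gauss = UNIV"
  by (simp add: std_gauss_def)

interpretation std_gauss: prob_space std_gauss
  unfolding std_gauss_def by (rule prob_space_normal_density) simp

interpretation gauss: product_sigma_finite "\<lambda>_. std_gauss"
  by standard

lemma prob_space_gauss: "prob_space (gauss S)"
  by (rule prob_space_PiM) (rule std_gauss.prob_space_axioms)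

section \<open>Moments of the normal distribution; \<open>gmom k\<close> is \<open>(k - 1)!!\<close>
  for even \<open>k\<close>\<close>

definition gmom :: "nat \<Rightarrow> real" where
  "gmom k = (if even k then fact k / (2 ^ (k div 2) * fact (k div 2)) else 0)"

lemma integrable_std_gauss_power: "integrable std_gauss (\<lambda>x. x ^ k)"
  unfolding std_gauss_def
  by (subst integrable_density) (auto simp: integrable_std_normal_moment)

lemma integral_std_gauss_power: "(\<integral>x. x ^ k \<partial>std_gauss) = gmom k"
proof -
  have "(\<integral>x. x ^ k \<partial>std_gauss) = (\<integral>x. std_normal_density x * x ^ k \<partial>lborel)"
    unfolding std_gauss_def by (subst integral_density) auto
  also have "\<dots> = gmom k"
  proof (cases "even k")
    case True
    then obtain m where "k = 2 * m" by (elim evenE)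
    then show ?thesis by (simp add: gmom_def integral_std_normal_moment_even)
  next
    case False
    then obtain m where "k = 2 * m + 1" by (elim oddE)
    then show ?thesis using integral_std_normal_moment_odd[of m] by (simp add: gmom_def)
  qed
  finally show ?thesis .
qed

lemma gmom_0[simp]: "gmom 0 = 1" by (simp add: gmom_def)

lemma gmom_nonneg: "gmom k \<ge> 0" by (simp add: gmom_def)

lemma gmom_even_Suc: "gmom (2 * Suc m) = (2 * real m + 1) * gmom (2 * m)"
proof -
  have "fact (2 * Suc m) = 2 * (real m + 1) * (2 * real m + 1) * fact (2 * m)"
    by (simp add: algebra_simps)
  moreover have "fact (Suc m) = (real m + 1) * fact m" by simp
  ultimately have "gmom (2 * Suc m) = 2 * (real m + 1) * (2 * real m + 1) * fact (2 * m)
      / (2 * 2 ^ m * ((real m + 1) * fact m))"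
    by (simp add: gmom_def del: fact_Suc mult_Suc_right)
  also have "\<dots> = (2 * real m + 1) * (fact (2 * m) / (2 ^ m * fact m))"
    using of_nat_0_le_iff[of m, where 'a = real] by (simp add: divide_simps del: of_nat_0_le_iff)
  finally show ?thesis by (simp add: gmom_def)
qed

lemma gmom_even_pos: "gmom (2 * m) > 0" by (simp add: gmom_def)

lemma gmom_even_add: "gmom (2 * a) * gmom (2 * b) \<le> gmom (2 * (a + b))"
proof (induction b)
  case (Suc b)
  have "gmom (2 * a) * gmom (2 * Suc b) = (2 * real b + 1) * (gmom (2 * a) * gmom (2 * b))"
    unfolding gmom_even_Suc by (simp only: ac_simps)
  also have "\<dots> \<le> (2 * real (a + b) + 1) * gmom (2 * (a + b))"
    using Suc gmom_nonneg by (intro mult_mono) auto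
  also have "\<dots> = gmom (2 * (a + Suc b))"
    by (simp only: gmom_even_Suc add_Suc_right)
  finally show ?case .
qed simp

text \<open>Merging two independent normal variables into one can only raise a moment. Applied
  monomial by monomial, this inequality is the analytic input of Pisier's comparison. If one
  exponent is odd, the left side is 0.\<close>

lemma gmom_add: "gmom a * gmom b \<le> gmom (a + b)"
proof (cases "even a \<and> even b")
  case True
  then obtain x y where "a = 2 * x" "b = 2 * y" by (auto elim!: evenE)
  then show ?thesis using gmom_even_add[of x y] by (simp add: algebra_simps)
next
  case False
  then have "gmom a * gmom b = 0" by (auto simp: gmom_def)
  then show ?thesis using gmom_nonneg[of "a + b"] by linarith
qed

lemma gmom_sum: "finite I \<Longrightarrow> (\<Prod>i\<in>I. gmom (k i)) \<le> gmom (\<Sum>i\<in>I. k i)"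
proof (induction I rule: finite_induct)
  case (insert i I)
  have "(\<Prod>i\<in>insert i I. gmom (k i)) \<le> gmom (k i) * gmom (\<Sum>i\<in>I. k i)"
    using insert by (auto intro!: mult_left_mono gmom_nonneg)
  also have "\<dots> \<le> gmom (k i + (\<Sum>i\<in>I. k i))" by (rule gmom_add)
  finally show ?case using insert by simp
qed simp

text \<open>\<open>(2 m)! / m!\<close> is a product of \<open>m\<close> factors, each at least
  \<open>m\<close>. This keeps the averaging over Gaussian vectors lossless up to a constant per
  power, because their squared norms are of order \<open>m\<close> as well.\<close>

lemma gmom_lower: "(real m / 2) ^ m \<le> gmom (2 * m)"
proof -
  have *: "real n ^ j * fact n \<le> fact (n + j)" for n j
  proof (induction j)
    case (Suc j)
    have "real n ^ Suc j * fact n = real n * (real n ^ j * fact n)" by simp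
    also have "\<dots> \<le> real (Suc (n + j)) * fact (n + j)"
      using Suc by (intro mult_mono) auto
    finally show ?case by simp
  qed simp
  have "(real m / 2) ^ m = real m ^ m * fact m / (2 ^ m * fact m)"
    by (simp add: power_divide)
  also have "\<dots> \<le> fact (m + m) / (2 ^ m * fact m)"
    by (intro divide_right_mono *) auto
  finally show ?thesis by (simp add: gmom_def mult_2)
qed

lemma
  assumes "finite S"
  shows integrable_gauss_monomial: "integrable (gauss S) (\<lambda>x. \<Prod>s\<in>S. x s ^ k s)"
    and integral_gauss_monomial: "(\<integral>x. (\<Prod>s\<in>S. x s ^ k s) \<partial>gauss S) = (\<Prod>s\<in>S. gmom (k s))"
  using gauss.product_integrable_prod[OF assms, of "\<lambda>s x. x ^ k s"]
    gauss.product_integral_prod[OF assms, of "\<lambda>s x. x ^ k s"]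
  by (simp_all add: integrable_std_gauss_power integral_std_gauss_power)

section \<open>Rotation invariance\<close>

lemma std_gauss_rotation:
  fixes f :: "real \<Rightarrow> real \<Rightarrow> ennreal"
  assumes ab: "a\<^sup>2 + b\<^sup>2 = 1" "a \<noteq> 0"
    and [measurable]: "case_prod f \<in> borel_measurable (borel \<Otimes>\<^sub>M borel)"
  shows "(\<integral>\<^sup>+x. \<integral>\<^sup>+y. f (a * x + b * y) (a * y - b * x) \<partial>std_gauss \<partial>std_gauss)
    = (\<integral>\<^sup>+x. \<integral>\<^sup>+y. f x y \<partial>std_gauss \<partial>std_gauss)"
proof -
  let ?p = "\<lambda>x. ennreal (std_normal_density x)"
  have pp: "?p (a * u - b * v) * ?p (a * v + b * u) = ?p u * ?p v" for u v
  proof -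
    have "(a * u - b * v)\<^sup>2 + (a * v + b * u)\<^sup>2 = (a\<^sup>2 + b\<^sup>2) * (u\<^sup>2 + v\<^sup>2)"
      by (simp add: power2_eq_square algebra_simps)
    then have "(a * u - b * v)\<^sup>2 + (a * v + b * u)\<^sup>2 = u\<^sup>2 + v\<^sup>2" using ab by simp
    then have "exp (- (a * u - b * v)\<^sup>2 / 2) * exp (- (a * v + b * u)\<^sup>2 / 2)
        = exp (- u\<^sup>2 / 2) * exp (- v\<^sup>2 / 2)"
      by (simp add: exp_add[symmetric] add_divide_distrib[symmetric] flip: minus_add_distrib)
    then show ?thesis
      by (simp add: std_normal_density_def ennreal_mult''[symmetric] mult_ac)
  qed
  have "(\<integral>\<^sup>+x. \<integral>\<^sup>+y. f (a * x + b * y) (a * y - b * x) \<partial>std_gauss \<partial>std_gauss)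
    = (\<integral>\<^sup>+x. \<integral>\<^sup>+y. ?p x * ?p y * f (a * x + b * y) (a * y - b * x) \<partial>lborel \<partial>lborel)"
    unfolding std_gauss_def
    by (subst nn_integral_density, measurable)
      (auto intro!: nn_integral_cong simp: nn_integral_density nn_integral_cmult[symmetric] mult_ac)
  also have "\<dots> = (\<integral>\<^sup>+y. \<integral>\<^sup>+x. ?p x * ?p y * f (a * x + b * y) (a * y - b * x) \<partial>lborel \<partial>lborel)"
    by (rule lborel_pair.Fubini') measurable
  \<comment> \<open>The rotation is carried out as two one-dimensional substitutions: first
    \<open>u = a x + b y\<close> for fixed \<open>y\<close>, then \<open>y = b u + a v\<close> for
    fixed \<open>u\<close>. The first divides by \<open>a\<close>, whence
    \<open>a \<noteq> 0\<close>, and the two Jacobian factors cancel.\<close>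
  also have "\<dots> = (\<integral>\<^sup>+y. \<bar>1/a\<bar> * (\<integral>\<^sup>+u. ?p ((u - b * y) / a) * ?p y * f u ((y - b * u) / a) \<partial>lborel) \<partial>lborel)"
  proof (intro nn_integral_cong)
    fix y
    have 1: "a * ((u - b * y) / a) + b * y = u" for u using ab by simp
    have 2: "a * y - b * ((u - b * y) / a) = (y - b * u) / a" for u
    proof -
      have "a * y - b * ((u - b * y) / a) = ((a\<^sup>2 + b\<^sup>2) * y - b * u) / a"
        using ab(2) by (simp add: field_simps power2_eq_square)
      then show ?thesis using ab by simp
    qed
    have 3: "- (b * y / a) + 1 / a * u = (u - b * y) / a" for u by (simp add: diff_divide_distrib)
    show "(\<integral>\<^sup>+x. ?p x * ?p y * f (a * x + b * y) (a * y - b * x) \<partial>lborel)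
      = \<bar>1/a\<bar> * (\<integral>\<^sup>+u. ?p ((u - b * y) / a) * ?p y * f u ((y - b * u) / a) \<partial>lborel)"
      by (subst nn_integral_real_affine[where c = "1/a" and t = "- (b * y / a)"])
         (use ab in \<open>simp_all only: 1 2 3, auto simp: diff_divide_distrib\<close>)
  qed
  also have "\<dots> = \<bar>1/a\<bar> * (\<integral>\<^sup>+y. (\<integral>\<^sup>+u. ?p ((u - b * y) / a) * ?p y * f u ((y - b * u) / a) \<partial>lborel) \<partial>lborel)"
    by (rule nn_integral_cmult) measurable
  also have "(\<integral>\<^sup>+y. (\<integral>\<^sup>+u. ?p ((u - b * y) / a) * ?p y * f u ((y - b * u) / a) \<partial>lborel) \<partial>lborel)
    = (\<integral>\<^sup>+u. (\<integral>\<^sup>+y. ?p ((u - b * y) / a) * ?p y * f u ((y - b * u) / a) \<partial>lborel) \<partial>lborel)"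
    by (rule lborel_pair.Fubini') measurable
  also have "\<dots> = (\<integral>\<^sup>+u. \<bar>a\<bar> * (\<integral>\<^sup>+v. ?p u * ?p v * f u v \<partial>lborel) \<partial>lborel)"
  proof (intro nn_integral_cong)
    fix u
    have 1: "(b * u + a * v - b * u) / a = v" for v using ab by simp
    have 2: "(u - b * (b * u + a * v)) / a = a * u - b * v" for v
    proof -
      have "u - b * (b * u + a * v) = (a\<^sup>2 + b\<^sup>2) * u - b * (b * u + a * v)" using ab by simp
      then show ?thesis using ab(2) by (simp add: field_simps power2_eq_square)
    qed
    show "(\<integral>\<^sup>+y. ?p ((u - b * y) / a) * ?p y * f u ((y - b * u) / a) \<partial>lborel)
      = \<bar>a\<bar> * (\<integral>\<^sup>+v. ?p u * ?p v * f u v \<partial>lborel)"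
    proof -
      have "(\<integral>\<^sup>+y. ?p ((u - b * y) / a) * ?p y * f u ((y - b * u) / a) \<partial>lborel)
        = \<bar>a\<bar> * (\<integral>\<^sup>+v. ?p ((u - b * (b * u + a * v)) / a) * ?p (b * u + a * v) * f u ((b * u + a * v - b * u) / a) \<partial>lborel)"
        using ab by (intro nn_integral_real_affine) auto
      then show ?thesis
        unfolding 1 2 using pp[of u] by (simp add: add.commute[of "b * u"])
    qed
  qed
  also have "\<dots> = \<bar>a\<bar> * (\<integral>\<^sup>+u. (\<integral>\<^sup>+v. ?p u * ?p v * f u v \<partial>lborel) \<partial>lborel)"
    by (rule nn_integral_cmult) measurable
  also have "(\<integral>\<^sup>+u. (\<integral>\<^sup>+v. ?p u * ?p v * f u v \<partial>lborel) \<partial>lborel) 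
    = (\<integral>\<^sup>+x. \<integral>\<^sup>+y. f x y \<partial>std_gauss \<partial>std_gauss)"
    unfolding std_gauss_def
    by (subst nn_integral_density, measurable)
      (auto intro!: nn_integral_cong simp: nn_integral_density nn_integral_cmult[symmetric] mult_ac)
  finally show ?thesis
    using ab by (simp add: mult.assoc[symmetric] ennreal_mult''[symmetric])
qed

text \<open>Induction on \<open>S\<close>: the hypothesis replaces the sum over \<open>S\<close> by
  one variable, and a rotation merges that variable with the new one. A vanishing new coefficient is
  treated apart, as the rotation lemma asks for \<open>a \<noteq> 0\<close>.\<close>

lemma nn_integral_gauss_linear:
  assumes "finite S" and [measurable]: "f \<in> borel_measurable borel"
  shows "(\<integral>\<^sup>+x. f (\<Sum>s\<in>S. c s * x s) \<partial>gauss S) = (\<integral>\<^sup>+t. f (sqrt (\<Sum>s\<in>S. (c s)\<^sup>2) * t) \<partial>std_gauss)"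
  using assms
proof (induction S arbitrary: f rule: finite_induct)
  case empty
  then show ?case
    by (simp add: prob_space.emeasure_space_1[OF prob_space_gauss] std_gauss.emeasure_space_1[simplified])
next
  case (insert j S)
  note [measurable] = insert.prems
  let ?q = "sqrt (\<Sum>s\<in>S. (c s)\<^sup>2)"
  let ?r = "sqrt (\<Sum>s\<in>insert j S. (c s)\<^sup>2)"
  have S[simp]: "finite S" "j \<notin> S" using insert by auto
  have "(\<integral>\<^sup>+x. f (\<Sum>s\<in>insert j S. c s * x s) \<partial>gauss (insert j S))
    = (\<integral>\<^sup>+y. \<integral>\<^sup>+x. f (\<Sum>s\<in>insert j S. c s * (x(j := y)) s) \<partial>gauss S \<partial>std_gauss)"
    by (rule gauss.product_nn_integral_insert_rev) auto
  also have "\<dots> = (\<integral>\<^sup>+y. \<integral>\<^sup>+x. f (c j * y + (\<Sum>s\<in>S. c s * x s)) \<partial>gauss S \<partial>std_gauss)"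
    by (intro nn_integral_cong) (auto intro!: arg_cong[where f = f] sum.cong)
  also have "\<dots> = (\<integral>\<^sup>+y. \<integral>\<^sup>+t. f (c j * y + ?q * t) \<partial>std_gauss \<partial>std_gauss)"
    by (intro nn_integral_cong insert.IH[where f = "\<lambda>z. f (c j * _ + z)"]) measurable
  also have "\<dots> = (\<integral>\<^sup>+t. f (?r * t) \<partial>std_gauss)"
  proof (cases "c j = 0")
    case True
    then show ?thesis by (simp add: std_gauss.emeasure_space_1[simplified])
  next
    case False
    define a b where "a = c j / ?r" and "b = ?q / ?r"
    have r2: "?r\<^sup>2 = (c j)\<^sup>2 + ?q\<^sup>2" by (simp add: sum_nonneg)
    have r: "?r > 0" using False by (simp add: sum_nonneg add_pos_nonneg)
    have ab: "a\<^sup>2 + b\<^sup>2 = 1" "a \<noteq> 0"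
      using r2 r False by (simp_all add: a_def b_def power_divide add_divide_distrib[symmetric])
    have *: "c j * y + ?q * t = ?r * (a * y + b * t)" for y t
      using r by (simp add: a_def b_def field_simps)
    have "(\<integral>\<^sup>+y. \<integral>\<^sup>+t. f (c j * y + ?q * t) \<partial>std_gauss \<partial>std_gauss)
      = (\<integral>\<^sup>+y. \<integral>\<^sup>+t. f (?r * (a * y + b * t)) \<partial>std_gauss \<partial>std_gauss)"
      unfolding * ..
    also have "\<dots> = (\<integral>\<^sup>+y. \<integral>\<^sup>+t. f (?r * y) \<partial>std_gauss \<partial>std_gauss)"
      by (rule std_gauss_rotation[OF ab, where f = "\<lambda>y t. f (?r * y)"]) measurable
    finally show ?thesis by (simp add: std_gauss.emeasure_space_1[simplified])
  qed
  finally show ?case .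
qed

section \<open>Products over pairs of indices\<close>

lemma emeasure_gauss_box:
  assumes "finite S" "\<And>s. s \<in> S \<Longrightarrow> A s \<in> sets std_gauss"
  shows "emeasure (gauss S) (Pi\<^sub>E S A) = (\<Prod>s\<in>S. emeasure std_gauss (A s))"
  using assms by (intro gauss.emeasure_PiM) auto

lemma borel_measurable_gauss_component:
  "s \<in> S \<Longrightarrow> (\<lambda>x. x s) \<in> borel_measurable (gauss S)"
  using measurable_component_singleton[of s S "\<lambda>_. std_gauss"] by (simp cong: measurable_cong_sets)

lemma measurable_gauss_flatten:
  "(\<lambda>x. \<lambda>p\<in>J\<times>I. x (fst p) (snd p)) \<in> PiM J (\<lambda>_. gauss I) \<rightarrow>\<^sub>M gauss (J \<times> I)"
proof (intro measurable_restrict)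
  fix p assume p: "p \<in> J \<times> I"
  have 1: "(\<lambda>x. x (fst p)) \<in> PiM J (\<lambda>_. gauss I) \<rightarrow>\<^sub>M gauss I"
    using p by (intro measurable_component_singleton) auto
  have 2: "(\<lambda>x. x (snd p)) \<in> gauss I \<rightarrow>\<^sub>M std_gauss"
    using p by (intro measurable_component_singleton) auto
  show "(\<lambda>x. x (fst p) (snd p)) \<in> PiM J (\<lambda>_. gauss I) \<rightarrow>\<^sub>M std_gauss"
    using measurable_compose[OF 1 2] .
qed

lemma measurable_gauss_pair_flatten:
  "(\<lambda>(x, y). \<lambda>p\<in>S\<times>UNIV. if snd p then x (fst p) else y (fst p))
    \<in> gauss S \<Otimes>\<^sub>M gauss S \<rightarrow>\<^sub>M gauss (S \<times> (UNIV :: bool set))"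
  unfolding split_beta'
proof (intro measurable_restrict)
  fix p :: "'a \<times> bool" assume "p \<in> S \<times> UNIV"
  then have "(\<lambda>x. x (fst p)) \<in> gauss S \<rightarrow>\<^sub>M std_gauss"
    by (intro measurable_component_singleton) auto
  then have [measurable]: "(\<lambda>z. fst z (fst p)) \<in> gauss S \<Otimes>\<^sub>M gauss S \<rightarrow>\<^sub>M std_gauss"
    "(\<lambda>z. snd z (fst p)) \<in> gauss S \<Otimes>\<^sub>M gauss S \<rightarrow>\<^sub>M std_gauss"
    by (auto intro: measurable_compose[OF measurable_fst] measurable_compose[OF measurable_snd])
  show "(\<lambda>z. if snd p then fst z (fst p) else snd z (fst p)) \<in> gauss S \<Otimes>\<^sub>M gauss S \<rightarrow>\<^sub>M std_gauss"
    by measurable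
qed

text \<open>Both measures give every box the same product, and boxes determine a finite product
  measure. The samples form a nested product, whereas rotations and reindexings act on a flat index
  set.\<close>

lemma distr_gauss_nested:
  assumes "finite J" "finite I"
  shows "distr (PiM J (\<lambda>_. gauss I)) (gauss (J \<times> I)) (\<lambda>x. \<lambda>p\<in>J\<times>I. x (fst p) (snd p)) = gauss (J \<times> I)"
proof (rule gauss.PiM_eqI)
  interpret I: prob_space "gauss I" by (rule prob_space_gauss)
  interpret N: product_sigma_finite "\<lambda>_. gauss I" by standard
  have [measurable]: "(\<lambda>x. \<lambda>p\<in>J\<times>I. x (fst p) (snd p)) \<in> PiM J (\<lambda>_. gauss I) \<rightarrow>\<^sub>M gauss (J \<times> I)" by (rule measurable_gauss_flatten)
  fix A assume A: "\<And>p. p \<in> J \<times> I \<Longrightarrow> A p \<in> sets std_gauss"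
  have "emeasure (distr (PiM J (\<lambda>_. gauss I)) (gauss (J \<times> I)) (\<lambda>x. \<lambda>p\<in>J\<times>I. x (fst p) (snd p))) (Pi\<^sub>E (J \<times> I) A)
    = emeasure (PiM J (\<lambda>_. gauss I)) ((\<lambda>x. \<lambda>p\<in>J\<times>I. x (fst p) (snd p)) -` Pi\<^sub>E (J \<times> I) A \<inter> space (PiM J (\<lambda>_. gauss I)))"
    using A assms by (intro emeasure_distr sets_PiM_I_finite) auto
  also have "(\<lambda>x. \<lambda>p\<in>J\<times>I. x (fst p) (snd p)) -` Pi\<^sub>E (J \<times> I) A \<inter> space (PiM J (\<lambda>_. gauss I))
    = Pi\<^sub>E J (\<lambda>j. Pi\<^sub>E I (\<lambda>i. A (j, i)))"
    by (auto simp: space_PiM PiE_iff extensional_def split: if_splits)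
  also have "emeasure (PiM J (\<lambda>_. gauss I)) \<dots> = (\<Prod>j\<in>J. emeasure (gauss I) (Pi\<^sub>E I (\<lambda>i. A (j, i))))"
    using A assms by (intro N.emeasure_PiM) auto
  also have "\<dots> = (\<Prod>j\<in>J. \<Prod>i\<in>I. emeasure std_gauss (A (j, i)))"
    using A assms by (intro prod.cong refl emeasure_gauss_box) auto
  also have "\<dots> = (\<Prod>p\<in>J\<times>I. emeasure std_gauss (A p))"
    by (simp add: prod.cartesian_product)
  finally show "emeasure (distr (PiM J (\<lambda>_. gauss I)) (gauss (J \<times> I)) (\<lambda>x. \<lambda>p\<in>J\<times>I. x (fst p) (snd p))) (Pi\<^sub>E (J \<times> I) A)
    = (\<Prod>p\<in>J\<times>I. emeasure std_gauss (A p))" .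
qed (use assms in auto)

lemma distr_gauss_pair:
  assumes "finite S"
  shows "distr (gauss S \<Otimes>\<^sub>M gauss S) (gauss (S \<times> UNIV)) (\<lambda>(x, y). \<lambda>p\<in>S\<times>UNIV. if snd p then x (fst p) else y (fst p))
    = gauss (S \<times> (UNIV :: bool set))" (is "distr ?P ?G ?f = _")
proof (rule gauss.PiM_eqI)
  interpret I: prob_space "gauss S" by (rule prob_space_gauss)
  have [measurable]: "?f \<in> ?P \<rightarrow>\<^sub>M ?G" by (rule measurable_gauss_pair_flatten)
  fix A :: "'a \<times> bool \<Rightarrow> real set" assume A: "\<And>p. p \<in> S \<times> UNIV \<Longrightarrow> A p \<in> sets std_gauss"
  have "emeasure (distr ?P ?G ?f) (Pi\<^sub>E (S \<times> UNIV) A) = emeasure ?P (?f -` Pi\<^sub>E (S \<times> UNIV) A \<inter> space ?P)"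
    using A assms by (intro emeasure_distr sets_PiM_I_finite) auto
  also have "?f -` Pi\<^sub>E (S \<times> UNIV) A \<inter> space ?P
    = Pi\<^sub>E S (\<lambda>s. A (s, True)) \<times> Pi\<^sub>E S (\<lambda>s. A (s, False))"
    by (auto simp: space_PiM space_pair_measure PiE_iff extensional_def split: if_splits) (metis (full_types))+
  also have "emeasure ?P \<dots> = emeasure (gauss S) (Pi\<^sub>E S (\<lambda>s. A (s, True))) * emeasure (gauss S) (Pi\<^sub>E S (\<lambda>s. A (s, False)))"
    using A assms by (intro I.emeasure_pair_measure_Times sets_PiM_I_finite) auto
  also have "\<dots> = (\<Prod>s\<in>S. emeasure std_gauss (A (s, True))) * (\<Prod>s\<in>S. emeasure std_gauss (A (s, False)))"
    using A assms by (subst (1 2) emeasure_gauss_box) auto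
  also have "\<dots> = (\<Prod>p\<in>S\<times>UNIV. emeasure std_gauss (A p))"
    by (simp add: prod.cartesian_product' UNIV_bool prod.distrib mult.commute)
  finally show "emeasure (distr ?P ?G ?f) (Pi\<^sub>E (S \<times> UNIV) A) = (\<Prod>p\<in>S\<times>UNIV. emeasure std_gauss (A p))" .
qed (use assms in auto)

text \<open>Currying \<open>J \<times> I\<close> turns the map into \<open>h\<close> on each of the
  independent blocks, and a product of measure preserving maps is measure preserving. A plane
  rotation and a unit linear combination are the two instances.\<close>

lemma distr_gauss_componentwise:
  fixes h :: "('i \<Rightarrow> real) \<Rightarrow> ('k \<Rightarrow> real)"
  assumes fin: "finite J" "finite I" "finite K"
    and [measurable]: "h \<in> gauss I \<rightarrow>\<^sub>M gauss K"
    and h: "distr (gauss I) (gauss K) h = gauss K"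
  shows "distr (gauss (J \<times> I)) (gauss (J \<times> K)) (\<lambda>x. \<lambda>p\<in>J\<times>K. h (\<lambda>i\<in>I. x (fst p, i)) (snd p)) = gauss (J \<times> K)"
proof -
  let ?nI = "\<lambda>x. \<lambda>p\<in>J\<times>I. x (fst p) (snd p)" and ?nK = "\<lambda>x. \<lambda>p\<in>J\<times>K. x (fst p) (snd p)"
  let ?H = "\<lambda>x. \<lambda>p\<in>J\<times>K. h (\<lambda>i\<in>I. x (fst p, i)) (snd p)"
  have mI: "?nI \<in> PiM J (\<lambda>_. gauss I) \<rightarrow>\<^sub>M gauss (J \<times> I)" by (rule measurable_gauss_flatten)
  have mK: "?nK \<in> PiM J (\<lambda>_. gauss K) \<rightarrow>\<^sub>M gauss (J \<times> K)" by (rule measurable_gauss_flatten)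
  have mc: "compose J h \<in> PiM J (\<lambda>_. gauss I) \<rightarrow>\<^sub>M PiM J (\<lambda>_. gauss K)"
    unfolding compose_def
    by (intro measurable_restrict measurable_compose[OF measurable_component_singleton]) auto
  have mH: "?H \<in> gauss (J \<times> I) \<rightarrow>\<^sub>M gauss (J \<times> K)"
  proof (rule measurable_restrict)
    fix p assume p: "p \<in> J \<times> K"
    have "(\<lambda>x. \<lambda>i\<in>I. x (fst p, i)) \<in> gauss (J \<times> I) \<rightarrow>\<^sub>M gauss I"
      using p by (intro measurable_restrict measurable_component_singleton) auto
    then show "(\<lambda>x. h (\<lambda>i\<in>I. x (fst p, i)) (snd p)) \<in> gauss (J \<times> I) \<rightarrow>\<^sub>M std_gauss"
      using p by (intro measurable_compose[OF _ measurable_compose[OF assms(4) measurable_component_singleton]]) auto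
  qed
  have "distr (gauss (J \<times> I)) (gauss (J \<times> K)) ?H
      = distr (distr (PiM J (\<lambda>_. gauss I)) (gauss (J \<times> I)) ?nI) (gauss (J \<times> K)) ?H"
    using fin by (simp only: distr_gauss_nested)
  also have "\<dots> = distr (PiM J (\<lambda>_. gauss I)) (gauss (J \<times> K)) (?H \<circ> ?nI)"
    by (rule distr_distr[OF mH mI])
  also have "\<dots> = distr (PiM J (\<lambda>_. gauss I)) (gauss (J \<times> K)) (?nK \<circ> compose J h)"
  proof (rule distr_cong)
    fix x assume x: "x \<in> space (PiM J (\<lambda>_. gauss I))"
    have "(\<lambda>i\<in>I. x j i) = x j" if "j \<in> J" for j
      using x that by (auto simp: space_PiM PiE_iff extensional_def)
    then show "(?H \<circ> ?nI) x = (?nK \<circ> compose J h) x"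
      by (auto simp: fun_eq_iff compose_def restrict_def cong: if_cong)
  qed auto
  also have "\<dots> = distr (distr (PiM J (\<lambda>_. gauss I)) (PiM J (\<lambda>_. gauss K)) (compose J h)) (gauss (J \<times> K)) ?nK"
    by (rule distr_distr[OF mK mc, symmetric])
  also have "distr (PiM J (\<lambda>_. gauss I)) (PiM J (\<lambda>_. gauss K)) (compose J h) = PiM J (\<lambda>_. distr (gauss I) (gauss K) h)"
    using fin by (intro distr_PiM_finite_prob_space') (auto simp: prob_space_gauss)
  also have "\<dots> = PiM J (\<lambda>_. gauss K)" by (simp add: h)
  finally show ?thesis using fin by (simp only: distr_gauss_nested)
qed

text \<open>Two independent copies of a vector are encoded as one vector with a Boolean index, so
  the joint rotation acts coordinate by coordinate and \<open>distr_gauss_componentwise\<close>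
  reduces it to the plane.\<close>

lemma distr_gauss_rotation:
  assumes fin: "finite S"
  shows "distr (gauss (S \<times> UNIV)) (gauss (S \<times> UNIV))
      (\<lambda>x. \<lambda>p\<in>S\<times>UNIV. if snd p then (x (fst p, True) + x (fst p, False)) / sqrt 2
        else (x (fst p, False) - x (fst p, True)) / sqrt 2) = gauss (S \<times> (UNIV :: bool set))"
proof -
  let ?a = "1 / sqrt 2 :: real"
  define h :: "(bool \<Rightarrow> real) \<Rightarrow> bool \<Rightarrow> real"
    where "h x = (\<lambda>b\<in>UNIV. if b then ?a * x True + ?a * x False else ?a * x False - ?a * x True)" for x
  have [measurable]: "h \<in> gauss UNIV \<rightarrow>\<^sub>M gauss UNIV"
    unfolding h_def by (intro measurable_restrict) auto
  have "distr (gauss UNIV) (gauss UNIV) h = gauss UNIV"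
  proof (rule gauss.PiM_eqI)
    fix A :: "bool \<Rightarrow> real set" assume A: "\<And>i. i \<in> UNIV \<Longrightarrow> A i \<in> sets std_gauss"
    then have [measurable]: "A i \<in> sets borel" for i by simp
    have ind: "indicator (Pi\<^sub>E UNIV A) x = (indicator (A True) (x True) * indicator (A False) (x False) :: ennreal)" for x
      by (auto simp: indicator_def PiE_iff) (metis (full_types))+
    have two: "(\<integral>\<^sup>+x. f (x True) (x False) \<partial>gauss UNIV) = (\<integral>\<^sup>+x. \<integral>\<^sup>+y. f x y \<partial>std_gauss \<partial>std_gauss)"
      if [measurable]: "case_prod f \<in> borel_measurable (borel \<Otimes>\<^sub>M borel)" for f :: "real \<Rightarrow> real \<Rightarrow> ennreal"
    proof -
      have "(\<integral>\<^sup>+x. f (x True) (x False) \<partial>gauss {True, False}) = (\<integral>\<^sup>+z. f (fst z) (snd z) \<partial>(std_gauss \<Otimes>\<^sub>M std_gauss))"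
        by (rule gauss.product_nn_integral_pair) auto
      also have "\<dots> = (\<integral>\<^sup>+x. \<integral>\<^sup>+y. f x y \<partial>std_gauss \<partial>std_gauss)"
        by (subst std_gauss.nn_integral_fst[symmetric]) auto
      finally show ?thesis by (simp add: UNIV_bool insert_commute)
    qed
    have "emeasure (distr (gauss UNIV) (gauss UNIV) h) (Pi\<^sub>E UNIV A) 
        = (\<integral>\<^sup>+x. indicator (Pi\<^sub>E UNIV A) x \<partial>distr (gauss UNIV) (gauss UNIV) h)"
      by (subst nn_integral_indicator) (auto intro!: sets_PiM_I_finite)
    also have "\<dots> = (\<integral>\<^sup>+x. indicator (Pi\<^sub>E UNIV A) (h x) \<partial>gauss UNIV)"
      by (subst nn_integral_distr) (auto intro!: sets_PiM_I_finite borel_measurable_indicator)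
    also have "\<dots> = (\<integral>\<^sup>+x. indicator (A True) (?a * x True + ?a * x False) * indicator (A False) (?a * x False - ?a * x True) \<partial>gauss UNIV)"
      unfolding ind by (simp add: h_def)
    also have "\<dots> = (\<integral>\<^sup>+x. \<integral>\<^sup>+y. indicator (A True) (?a * x + ?a * y) * indicator (A False) (?a * y - ?a * x) \<partial>std_gauss \<partial>std_gauss)"
      by (rule two) measurable
    also have "\<dots> = (\<integral>\<^sup>+x. \<integral>\<^sup>+y. indicator (A True) x * indicator (A False) y \<partial>std_gauss \<partial>std_gauss)"
      by (rule std_gauss_rotation) (auto simp: power_divide)
    also have "\<dots> = emeasure std_gauss (A True) * emeasure std_gauss (A False)"
      by (simp add: nn_integral_cmult nn_integral_multc)
    finally show "emeasure (distr (gauss UNIV) (gauss UNIV) h) (Pi\<^sub>E UNIV A) = (\<Prod>i\<in>UNIV. emeasure std_gauss (A i))"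
      by (simp add: UNIV_bool mult.commute)
  qed auto
  from distr_gauss_componentwise[OF fin _ _ _ this] 
  have *: "distr (gauss (S \<times> UNIV)) (gauss (S \<times> UNIV)) (\<lambda>x. \<lambda>p\<in>S \<times> UNIV. h (\<lambda>i\<in>UNIV. x (fst p, i)) (snd p)) = gauss (S \<times> UNIV)"
    by simp
  have "(\<lambda>x. \<lambda>p\<in>S\<times>UNIV. if snd p then (x (fst p, True) + x (fst p, False)) / sqrt 2
        else (x (fst p, False) - x (fst p, True)) / sqrt 2) = 
      (\<lambda>x. \<lambda>p\<in>S \<times> UNIV. h (\<lambda>i\<in>UNIV. x (fst p, i)) (snd p))"
    by (auto simp: fun_eq_iff h_def restrict_def field_simps)
  then show ?thesis using * by simp
qed

text \<open>The change of variables behind decoupling: normalised sum and difference of two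
  independent copies are again a pair of independent standard vectors.\<close>

lemma nn_integral_gauss_rotation:
  fixes f :: "('s \<Rightarrow> real) \<Rightarrow> ('s \<Rightarrow> real) \<Rightarrow> ennreal"
  assumes fin: "finite S" and f[measurable]: "case_prod f \<in> borel_measurable (gauss S \<Otimes>\<^sub>M gauss S)"
  shows "(\<integral>\<^sup>+x. \<integral>\<^sup>+y. f (\<lambda>s\<in>S. (x s + y s) / sqrt 2) (\<lambda>s\<in>S. (y s - x s) / sqrt 2) \<partial>gauss S \<partial>gauss S)
    = (\<integral>\<^sup>+x. \<integral>\<^sup>+y. f x y \<partial>gauss S \<partial>gauss S)"
proof -
  interpret S: prob_space "gauss S" by (rule prob_space_gauss)
  let ?B = "gauss (S \<times> (UNIV :: bool set))"
  let ?P = "gauss S \<Otimes>\<^sub>M gauss S"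
  let ?j = "\<lambda>(x, y). \<lambda>p\<in>S\<times>(UNIV :: bool set). if snd p then x (fst p) else (y (fst p) :: real)"
  let ?R = "\<lambda>x. \<lambda>p\<in>S\<times>UNIV. if snd p then (x (fst p, True) + x (fst p, False)) / sqrt 2
        else (x (fst p, False) - x (fst p, True)) / sqrt 2"
  define g where "g z = f (\<lambda>s\<in>S. z (s, True)) (\<lambda>s\<in>S. z (s, False))" for z :: "'s \<times> bool \<Rightarrow> real"
  have mb: "(\<lambda>z. \<lambda>s\<in>S. z (s, b)) \<in> ?B \<rightarrow>\<^sub>M gauss S" for b
    by (intro measurable_restrict measurable_component_singleton) auto
  have [measurable]: "g \<in> borel_measurable ?B"
  proof -
    have "(\<lambda>z. case_prod f (\<lambda>s\<in>S. z (s, True), \<lambda>s\<in>S. z (s, False))) \<in> borel_measurable ?B"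
      using mb by (intro measurable_compose[OF measurable_Pair f]) 
    then show ?thesis by (simp add: g_def[abs_def])
  qed
  have [measurable]: "?j \<in> ?P \<rightarrow>\<^sub>M ?B" by (rule measurable_gauss_pair_flatten)
  have mR[measurable]: "?R \<in> ?B \<rightarrow>\<^sub>M ?B"
  proof (intro measurable_restrict)
    fix p :: "'s \<times> bool" assume "p \<in> S \<times> UNIV"
    then have [measurable]: "(\<lambda>x. x (fst p, b)) \<in> borel_measurable ?B" for b
      by (intro borel_measurable_gauss_component) auto
    show "(\<lambda>x. if snd p then (x (fst p, True) + x (fst p, False)) / sqrt 2
        else (x (fst p, False) - x (fst p, True)) / sqrt 2) \<in> ?B \<rightarrow>\<^sub>M std_gauss"
      by measurable
  qed
  have 1: "(\<integral>\<^sup>+z. h z \<partial>?B) = (\<integral>\<^sup>+x. \<integral>\<^sup>+y. h (?j (x, y)) \<partial>gauss S \<partial>gauss S)" 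
    if [measurable]: "h \<in> borel_measurable ?B" for h :: "_ \<Rightarrow> ennreal"
  proof -
    have "(\<integral>\<^sup>+z. h z \<partial>?B) = (\<integral>\<^sup>+z. h z \<partial>distr ?P ?B ?j)"
      using distr_gauss_pair[OF fin] by (simp only:)
    also have "\<dots> = (\<integral>\<^sup>+z. h (?j z) \<partial>?P)"
      by (rule nn_integral_distr) measurable
    also have "\<dots> = (\<integral>\<^sup>+x. \<integral>\<^sup>+y. h (?j (x, y)) \<partial>gauss S \<partial>gauss S)"
      by (rule S.nn_integral_fst[symmetric]) measurable
    finally show ?thesis .
  qed
  have ext: "(\<lambda>s\<in>S. x s) = x" if "x \<in> space (gauss S)" for x
    using that by (auto simp: space_PiM PiE_iff extensional_def)
  have "(\<integral>\<^sup>+z. g z \<partial>?B) = (\<integral>\<^sup>+z. g z \<partial>distr ?B ?B ?R)"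
    using distr_gauss_rotation[OF fin] by (simp only:)
  also have "\<dots> = (\<integral>\<^sup>+z. g (?R z) \<partial>?B)"
    by (rule nn_integral_distr) measurable
  also have "\<dots> = (\<integral>\<^sup>+x. \<integral>\<^sup>+y. g (?R (?j (x, y))) \<partial>gauss S \<partial>gauss S)"
    by (rule 1) (rule measurable_compose[OF mR], simp)
  also have "\<dots> = (\<integral>\<^sup>+x. \<integral>\<^sup>+y. f (\<lambda>s\<in>S. (x s + y s) / sqrt 2) (\<lambda>s\<in>S. (y s - x s) / sqrt 2) \<partial>gauss S \<partial>gauss S)"
    by (intro nn_integral_cong) (auto simp: g_def intro!: arg_cong2[where f = f])
  finally have "(\<integral>\<^sup>+z. g z \<partial>?B) = \<dots>" .
  moreover have "(\<integral>\<^sup>+z. g z \<partial>?B) = (\<integral>\<^sup>+x. \<integral>\<^sup>+y. f x y \<partial>gauss S \<partial>gauss S)"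
    by (subst 1) (auto intro!: nn_integral_cong simp: g_def ext cong: restrict_cong)
  ultimately show ?thesis by simp
qed

text \<open>With equal coefficients this evaluates the sum over all words of a given length; with
  the coordinates of a unit vector it integrates out one side of a Wishart form.\<close>

lemma nn_integral_gauss_rows:
  fixes f :: "('j \<Rightarrow> real) \<Rightarrow> ennreal"
  assumes fin: "finite J" "finite I" and c: "(\<Sum>i\<in>I. (c i)\<^sup>2) = 1"
    and [measurable]: "f \<in> borel_measurable (gauss J)"
  shows "(\<integral>\<^sup>+x. f (\<lambda>j\<in>J. \<Sum>i\<in>I. c i * x (j, i)) \<partial>gauss (J \<times> I)) = (\<integral>\<^sup>+x. f x \<partial>gauss J)"
proof -
  \<comment> \<open>A one-point index set for the target, so that a single linear combination
    becomes a map between Gaussian product spaces.\<close>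
  define h :: "('a \<Rightarrow> real) \<Rightarrow> unit \<Rightarrow> real" where "h x = (\<lambda>_\<in>UNIV. \<Sum>i\<in>I. c i * x i)" for x
  have [measurable]: "h \<in> gauss I \<rightarrow>\<^sub>M gauss UNIV"
    unfolding h_def by (intro measurable_restrict) auto
  have "distr (gauss I) (gauss UNIV) h = gauss UNIV"
  proof (rule gauss.PiM_eqI)
    fix A :: "unit \<Rightarrow> real set" assume A: "\<And>i. i \<in> UNIV \<Longrightarrow> A i \<in> sets std_gauss"
    then have [measurable]: "A i \<in> sets borel" for i by simp
    have "emeasure (distr (gauss I) (gauss UNIV) h) (Pi\<^sub>E UNIV A) 
        = (\<integral>\<^sup>+x. indicator (Pi\<^sub>E UNIV A) x \<partial>distr (gauss I) (gauss UNIV) h)"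
      by (subst nn_integral_indicator) (auto intro!: sets_PiM_I_finite)
    also have "\<dots> = (\<integral>\<^sup>+x. indicator (Pi\<^sub>E UNIV A) (h x) \<partial>gauss I)"
      by (subst nn_integral_distr) (auto intro!: sets_PiM_I_finite borel_measurable_indicator)
    also have "\<dots> = (\<integral>\<^sup>+x. indicator (A ()) (\<Sum>i\<in>I. c i * x i) \<partial>gauss I)"
      by (intro nn_integral_cong) (auto simp: h_def indicator_def PiE_iff)
    also have "\<dots> = (\<integral>\<^sup>+t. indicator (A ()) t \<partial>std_gauss)"
      using c by (subst nn_integral_gauss_linear[OF fin(2)]) auto
    finally show "emeasure (distr (gauss I) (gauss UNIV) h) (Pi\<^sub>E UNIV A) = (\<Prod>i\<in>UNIV. emeasure std_gauss (A i))"
      by (simp add: UNIV_unit)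
  qed auto
  from distr_gauss_componentwise[OF fin _ _ this]
  have 1: "distr (gauss (J \<times> I)) (gauss (J \<times> UNIV)) (\<lambda>x. \<lambda>p\<in>J\<times>UNIV. h (\<lambda>i\<in>I. x (fst p, i)) (snd p)) = gauss (J \<times> UNIV)"
    by simp
  have 2: "distr (gauss (J \<times> UNIV)) (gauss J) (\<lambda>x. \<lambda>j\<in>J. x (j, ())) = gauss J"
    by (rule distr_PiM_reindex) (auto simp: inj_on_def std_gauss.prob_space_axioms)
  have m1: "(\<lambda>x. \<lambda>p\<in>J\<times>UNIV. h (\<lambda>i\<in>I. x (fst p, i)) (snd p)) \<in> gauss (J \<times> I) \<rightarrow>\<^sub>M gauss (J \<times> UNIV)"
    unfolding h_def
    by (intro measurable_restrict) (auto intro!: borel_measurable_sum borel_measurable_times 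
      borel_measurable_gauss_component)
  have m2: "(\<lambda>x. \<lambda>j\<in>J. x (j, ())) \<in> gauss (J \<times> UNIV) \<rightarrow>\<^sub>M gauss J"
    by (intro measurable_restrict measurable_component_singleton) auto
  have "(\<integral>\<^sup>+x. f x \<partial>gauss J) = (\<integral>\<^sup>+x. f x \<partial>distr (gauss (J \<times> UNIV)) (gauss J) (\<lambda>x. \<lambda>j\<in>J. x (j, ())))"
    by (simp only: 2)
  also have "\<dots> = (\<integral>\<^sup>+x. f (\<lambda>j\<in>J. x (j, ())) \<partial>gauss (J \<times> UNIV))"
    by (rule nn_integral_distr[OF m2]) measurable
  also have "\<dots> = (\<integral>\<^sup>+x. f (\<lambda>j\<in>J. x (j, ())) \<partial>distr (gauss (J \<times> I)) (gauss (J \<times> UNIV)) (\<lambda>x. \<lambda>p\<in>J\<times>UNIV. h (\<lambda>i\<in>I. x (fst p, i)) (snd p)))"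
    by (simp only: 1)
  also have "\<dots> = (\<integral>\<^sup>+x. f (\<lambda>j\<in>J. (\<lambda>p\<in>J\<times>UNIV. h (\<lambda>i\<in>I. x (fst p, i)) (snd p)) (j, ())) \<partial>gauss (J \<times> I))"
    by (rule nn_integral_distr[OF m1]) (use measurable_compose[OF m2, of f borel] in simp)
  also have "\<dots> = (\<integral>\<^sup>+x. f (\<lambda>j\<in>J. \<Sum>i\<in>I. c i * x (j, i)) \<partial>gauss (J \<times> I))"
    by (intro nn_integral_cong arg_cong[where f = f]) (auto simp: h_def fun_eq_iff)
  finally show ?thesis by simp
qed

section \<open>Moments of linear forms and of Euclidean norms\<close>

lemma nn_integral_gauss_linear_power:
  assumes "finite S"
  shows "(\<integral>\<^sup>+x. ennreal ((\<Sum>s\<in>S. c s * x s) ^ (2 * m)) \<partial>gauss S) = ennreal (gmom (2 * m) * (\<Sum>s\<in>S. (c s)\<^sup>2) ^ m)"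
proof -
  have "(\<integral>\<^sup>+x. ennreal ((\<Sum>s\<in>S. c s * x s) ^ (2 * m)) \<partial>gauss S)
    = (\<integral>\<^sup>+t. ennreal ((sqrt (\<Sum>s\<in>S. (c s)\<^sup>2) * t) ^ (2 * m)) \<partial>std_gauss)"
    by (rule nn_integral_gauss_linear[OF assms]) measurable
  also have "\<dots> = ennreal (\<integral>t. (sqrt (\<Sum>s\<in>S. (c s)\<^sup>2) * t) ^ (2 * m) \<partial>std_gauss)"
    by (rule nn_integral_eq_integral) (auto simp: power_mult_distrib integrable_std_gauss_power zero_le_even_power)
  also have "(\<integral>t. (sqrt (\<Sum>s\<in>S. (c s)\<^sup>2) * t) ^ (2 * m) \<partial>std_gauss) = (\<Sum>s\<in>S. (c s)\<^sup>2) ^ m * gmom (2 * m)"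
    by (simp add: power_mult_distrib integral_std_gauss_power power_mult[of "sqrt _"] sum_nonneg)
  finally show ?thesis by (simp add: mult.commute)
qed

lemma nn_integral_std_gauss_exp_square:
  assumes "l < 1/2"
  shows "(\<integral>\<^sup>+x. ennreal (exp (l * x\<^sup>2)) \<partial>std_gauss) = ennreal (1 / sqrt (1 - 2 * l))"
proof -
  let ?s = "1 / sqrt (1 - 2 * l)"
  define v where "v = 1 - 2 * l"
  have v: "v > 0" "l = (1 - v) / 2" using assms by (auto simp: v_def)
  have s: "?s > 0" using assms by simp
  have "std_normal_density x * exp (l * x\<^sup>2) = ?s * normal_density 0 ?s x" for x
  proof -
    have "std_normal_density x * exp (l * x\<^sup>2) = 1 / sqrt (2 * pi) * (exp (- x\<^sup>2 / 2) * exp (l * x\<^sup>2))"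
      by (simp add: std_normal_density_def)
    also have "exp (- x\<^sup>2 / 2) * exp (l * x\<^sup>2) = exp (- (v * x\<^sup>2) / 2)"
      unfolding exp_add[symmetric] v(2) by (simp add: algebra_simps diff_divide_distrib)
    also have "1 / sqrt (2 * pi) * exp (- (v * x\<^sup>2) / 2) = 1 / sqrt v * normal_density 0 (1 / sqrt v) x"
      using v(1) by (simp add: normal_density_def power_divide real_sqrt_divide real_sqrt_mult mult.commute)
    finally show ?thesis by (simp add: v_def)
  qed
  then have "(\<integral>\<^sup>+x. ennreal (exp (l * x\<^sup>2)) \<partial>std_gauss) = (\<integral>\<^sup>+x. ennreal ?s * ennreal (normal_density 0 ?s x) \<partial>lborel)"
    unfolding std_gauss_def using s
    by (subst nn_integral_density) (auto simp: ennreal_mult''[symmetric] ennreal_mult'[symmetric] intro!: nn_integral_cong)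
  also have "\<dots> = ennreal ?s"
    using s by (subst nn_integral_cmult) (auto simp: nn_integral_eq_integral)
  finally show ?thesis .
qed

text \<open>Chernoff: \<open>(s / (4 d)) ^ m \<le> exp (l * s - m)\<close> for \<open>l = m / (4 d) \<le> 1/4\<close>.\<close>

lemma nn_integral_gauss_norm_power:
  assumes fin: "finite S" and d: "card S \<le> d" "m \<le> d"
  shows "(\<integral>\<^sup>+x. ennreal ((\<Sum>s\<in>S. (x s)\<^sup>2) ^ m) \<partial>gauss S) \<le> ennreal ((4 * real d) ^ m)"
proof (cases "m = 0")
  case True
  then show ?thesis by (simp add: prob_space.emeasure_space_1[OF prob_space_gauss])
next
  case False
  define l where "l = real m / (4 * real d)"
  have d0: "real d > 0" "real m > 0" using False d by auto
  have l: "0 < l" "l \<le> 1/4" using d d0 by (auto simp: l_def field_simps)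
  have pt: "(\<Sum>s\<in>S. (x s)\<^sup>2) ^ m \<le> (4 * real d) ^ m * exp (- real m) * (\<Prod>s\<in>S. exp (l * (x s)\<^sup>2))" for x
  proof -
    let ?s = "\<Sum>s\<in>S. (x s)\<^sup>2"
    have s: "?s \<ge> 0" by (simp add: sum_nonneg)
    have "?s / (4 * real d) \<le> exp (?s / (4 * real d) - 1)"
      using exp_ge_add_one_self[of "?s / (4 * real d) - 1"] by simp
    then have "(?s / (4 * real d)) ^ m \<le> exp (?s / (4 * real d) - 1) ^ m"
      using s d0 by (intro power_mono) auto
    also have "\<dots> = exp (l * ?s - real m)"
      using d0 by (simp add: exp_of_nat_mult[symmetric] l_def field_simps)
    finally show ?thesis
      using d0 by (simp add: power_divide field_simps exp_diff exp_minus exp_sum[OF fin, symmetric] sum_distrib_left)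
  qed
  have "(\<integral>\<^sup>+x. ennreal ((\<Sum>s\<in>S. (x s)\<^sup>2) ^ m) \<partial>gauss S)
    \<le> (\<integral>\<^sup>+x. ennreal ((4 * real d) ^ m * exp (- real m)) * (\<Prod>s\<in>S. ennreal (exp (l * (x s)\<^sup>2))) \<partial>gauss S)"
    by (intro nn_integral_mono) (use pt in \<open>auto simp: prod_ennreal ennreal_mult[symmetric] prod_nonneg intro!: ennreal_leI\<close>)
  also have "\<dots> = ennreal ((4 * real d) ^ m * exp (- real m)) * (\<integral>\<^sup>+x. (\<Prod>s\<in>S. ennreal (exp (l * (x s)\<^sup>2))) \<partial>gauss S)"
    by (rule nn_integral_cmult) measurable
  also have "(\<integral>\<^sup>+x. (\<Prod>s\<in>S. ennreal (exp (l * (x s)\<^sup>2))) \<partial>gauss S) = (\<Prod>s\<in>S. ennreal (1 / sqrt (1 - 2 * l)))"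
    using l by (subst gauss.product_nn_integral_prod[OF fin]) (auto simp: nn_integral_std_gauss_exp_square)
  also have "\<dots> = ennreal ((1 / sqrt (1 - 2 * l)) ^ card S)"
    using l by (simp add: ennreal_power)
  also have "\<dots> \<le> ennreal (exp (real m))"
  proof (rule ennreal_leI)
    have "(1 / sqrt (1 - 2 * l))\<^sup>2 = 1 / (1 - 2 * l)" using l by (simp add: power_divide)
    also have "\<dots> \<le> 1 + 4 * l"
    proof -
      have "0 \<le> 2 * l * (1 - 4 * l)" using l by (intro mult_nonneg_nonneg) auto
      then have "1 \<le> (1 + 4 * l) * (1 - 2 * l)" by (simp add: algebra_simps)
      then show ?thesis using l by (simp add: field_simps)
    qed
    also have "\<dots> \<le> exp (4 * l)" using exp_ge_add_one_self[of "4 * l"] by simp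
    also have "\<dots> \<le> exp (4 * l) ^ 2" using l by (intro self_le_power) auto
    finally have "1 / sqrt (1 - 2 * l) \<le> exp (4 * l)"
      by (rule power2_le_imp_le) simp
    then have "(1 / sqrt (1 - 2 * l)) ^ card S \<le> exp (4 * l) ^ card S"
      using l by (intro power_mono) auto
    also have "\<dots> = exp (real (card S) * (4 * l))" by (simp add: exp_of_nat_mult)
    also have "\<dots> \<le> exp (real d * (4 * l))" using d l by simp
    also have "real d * (4 * l) = real m" using d0 by (simp add: l_def)
    finally show "(1 / sqrt (1 - 2 * l)) ^ card S \<le> exp (real m)" .
  qed
  finally have "(\<integral>\<^sup>+x. ennreal ((\<Sum>s\<in>S. (x s)\<^sup>2) ^ m) \<partial>gauss S)
    \<le> ennreal ((4 * real d) ^ m * exp (- real m)) * ennreal (exp (real m))"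
    by (simp add: mult_left_mono)
  also have "\<dots> = ennreal ((4 * real d) ^ m)"
    by (simp add: ennreal_mult[symmetric] mult.assoc exp_add[symmetric])
  finally show ?thesis .
qed

section \<open>Trace moments of sums of tensor products\<close>

primrec word :: "'z set \<Rightarrow> ('i \<Rightarrow> 'z \<Rightarrow> 'z \<Rightarrow> real) \<Rightarrow> 'i list \<Rightarrow> 'z \<Rightarrow> 'z \<Rightarrow> real" where
  "word Z A [] z y = (if z = y then 1 else 0)"
| "word Z A (i # is) z y = (\<Sum>w\<in>Z. A i z w * word Z A is w y)"

primrec mpow :: "'z set \<Rightarrow> ('z \<Rightarrow> 'z \<Rightarrow> real) \<Rightarrow> nat \<Rightarrow> 'z \<Rightarrow> 'z \<Rightarrow> real" where
  "mpow Z A 0 z y = (if z = y then 1 else 0)"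
| "mpow Z A (Suc n) z y = (\<Sum>w\<in>Z. A z w * mpow Z A n w y)"

definition words :: "'i set \<Rightarrow> nat \<Rightarrow> 'i list set" where
  "words I n = {xs. set xs \<subseteq> I \<and> length xs = n}"

definition tr :: "'z set \<Rightarrow> ('z \<Rightarrow> 'z \<Rightarrow> real) \<Rightarrow> real" where
  "tr Z A = (\<Sum>z\<in>Z. A z z)"

lemma sum_words_Suc:
  assumes "finite I"
  shows "(\<Sum>is\<in>words I (Suc n). f is) = (\<Sum>i\<in>I. \<Sum>is\<in>words I n. f (i # is))"
proof -
  have "words I (Suc n) = (\<lambda>(i, is). i # is) ` (I \<times> words I n)"
    unfolding words_def by (auto simp: length_Suc_conv image_iff)
  moreover have "inj_on (\<lambda>(i, is). i # is) (I \<times> words I n)"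
    by (auto simp: inj_on_def)
  ultimately show ?thesis
    by (simp add: sum.reindex sum.cartesian_product split_beta')
qed

lemma sum_word:
  assumes "finite I"
  shows "(\<Sum>is\<in>words I n. word Z A is z y) = mpow Z (\<lambda>z y. \<Sum>i\<in>I. A i z y) n z y"
proof (induction n arbitrary: z)
  case 0
  have "words I 0 = {[]}" by (auto simp: words_def)
  then show ?case by simp
next
  case (Suc n)
  have "(\<Sum>is\<in>words I (Suc n). word Z A is z y)
    = (\<Sum>i\<in>I. \<Sum>w\<in>Z. A i z w * (\<Sum>is\<in>words I n. word Z A is w y))"
    by (simp add: sum_words_Suc[OF assms] sum.swap[of _ _ "words I n"] sum_distrib_left)
  also have "\<dots> = (\<Sum>w\<in>Z. (\<Sum>i\<in>I. A i z w) * (\<Sum>is\<in>words I n. word Z A is w y))"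
    by (subst sum.swap) (simp add: sum_distrib_right)
  finally show ?case by (simp add: Suc)
qed

text \<open>Expanding the power of a sum gives words, and within each word the two tensor factors
  multiply separately. Matrices are functions on arbitrary sets precisely so that
  \<open>Z \<times> Z\<close> can index a tensor product.\<close>

lemma mpow_tensor:
  assumes "finite I" "finite Z"
  shows "mpow (Z \<times> Z) (\<lambda>p q. \<Sum>i\<in>I. A i (fst p) (fst q) * B i (snd p) (snd q)) n (z, z') (y, y')
    = (\<Sum>is\<in>words I n. word Z A is z y * word Z B is z' y')"
proof (induction n arbitrary: z z')
  case 0
  have "words I 0 = {[]}" by (auto simp: words_def)
  then show ?case by simp
next
  case (Suc n)
  have "mpow (Z \<times> Z) (\<lambda>p q. \<Sum>i\<in>I. A i (fst p) (fst q) * B i (snd p) (snd q)) (Suc n) (z, z') (y, y')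
    = (\<Sum>(w, w')\<in>Z\<times>Z. (\<Sum>i\<in>I. A i z w * B i z' w') * (\<Sum>is\<in>words I n. word Z A is w y * word Z B is w' y'))"
    by (auto simp: Suc intro!: sum.cong)
  also have "\<dots> = (\<Sum>i\<in>I. \<Sum>is\<in>words I n. \<Sum>(w, w')\<in>Z\<times>Z. (A i z w * word Z A is w y) * (B i z' w' * word Z B is w' y'))"
    (is "_ = (\<Sum>i\<in>I. \<Sum>is\<in>_. \<Sum>(w, w')\<in>_. ?f i is w w')")
  proof -
    have "(\<Sum>(w, w')\<in>Z\<times>Z. (\<Sum>i\<in>I. A i z w * B i z' w') * (\<Sum>is\<in>words I n. word Z A is w y * word Z B is w' y'))
      = (\<Sum>(w, w')\<in>Z\<times>Z. \<Sum>i\<in>I. \<Sum>is\<in>words I n. ?f i is w w')"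
      by (auto simp: sum_product mult_ac intro!: sum.cong)
    also have "\<dots> = (\<Sum>i\<in>I. \<Sum>(w, w')\<in>Z\<times>Z. \<Sum>is\<in>words I n. ?f i is w w')"
      unfolding split_beta' by (rule sum.swap)
    also have "\<dots> = (\<Sum>i\<in>I. \<Sum>is\<in>words I n. \<Sum>(w, w')\<in>Z\<times>Z. ?f i is w w')"
      unfolding split_beta' by (intro sum.cong refl sum.swap)
    finally show ?thesis .
  qed
  also have "\<dots> = (\<Sum>i\<in>I. \<Sum>is\<in>words I n. word Z A (i # is) z y * word Z B (i # is) z' y')"
    by (auto simp: sum_product sum.cartesian_product intro!: sum.cong)
  finally show ?case by (simp add: sum_words_Suc[OF assms(1)])
qed

lemma tr_mpow_tensor:
  assumes "finite I" "finite Z"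
  shows "tr (Z \<times> Z) (mpow (Z \<times> Z) (\<lambda>p q. \<Sum>i\<in>I. A i (fst p) (fst q) * B i (snd p) (snd q)) n)
    = (\<Sum>is\<in>words I n. tr Z (word Z A is) * tr Z (word Z B is))"
proof -
  have "tr (Z \<times> Z) (mpow (Z \<times> Z) (\<lambda>p q. \<Sum>i\<in>I. A i (fst p) (fst q) * B i (snd p) (snd q)) n)
    = (\<Sum>z\<in>Z. \<Sum>z'\<in>Z. \<Sum>is\<in>words I n. word Z A is z z * word Z B is z' z')"
    unfolding tr_def by (simp add: sum.cartesian_product' mpow_tensor[OF assms])
  also have "\<dots> = (\<Sum>is\<in>words I n. \<Sum>z\<in>Z. \<Sum>z'\<in>Z. word Z A is z z * word Z B is z' z')"
    by (subst (2) sum.swap, subst sum.swap) simp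
  finally show ?thesis by (simp add: tr_def sum_product)
qed

lemma mpow_scale: "mpow Z (\<lambda>z y. c * A z y) n z y = c ^ n * mpow Z A n z y"
  by (induction n arbitrary: z) (auto simp: sum_distrib_left mult_ac intro!: sum.cong)

lemma mpow_cong:
  assumes "\<And>z y. z \<in> Z \<Longrightarrow> y \<in> Z \<Longrightarrow> A z y = B z y" "z \<in> Z"
  shows "mpow Z A n z y = mpow Z B n z y"
  using assms(2) by (induction n arbitrary: z) (auto simp: assms(1))

lemma mpow_add:
  assumes "finite Z" "z \<in> Z"
  shows "mpow Z A (m + n) z y = (\<Sum>w\<in>Z. mpow Z A m z w * mpow Z A n w y)"
  using assms(2)
proof (induction m arbitrary: z)
  case 0
  then show ?case using assms(1) by (simp add: if_distrib[of "\<lambda>c. c * _"] cong: if_cong)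
next
  case (Suc m)
  have "mpow Z A (Suc m + n) z y = (\<Sum>v\<in>Z. \<Sum>w\<in>Z. A z v * (mpow Z A m v w * mpow Z A n w y))"
    using Suc by (simp add: sum_distrib_left)
  also have "\<dots> = (\<Sum>w\<in>Z. \<Sum>v\<in>Z. A z v * (mpow Z A m v w * mpow Z A n w y))"
    by (rule sum.swap)
  finally show ?case by (simp add: sum_distrib_right mult.assoc)
qed

lemma mpow_Suc_right:
  assumes "finite Z" "z \<in> Z" "y \<in> Z"
  shows "mpow Z A (Suc n) z y = (\<Sum>w\<in>Z. mpow Z A n z w * A w y)"
  using mpow_add[OF assms(1,2), of A n 1 y] assms
  by (simp add: if_distrib[of "\<lambda>c. _ * c"] cong: if_cong)

lemma mpow_sym:
  assumes Z: "finite Z" and A: "\<And>z y. z \<in> Z \<Longrightarrow> y \<in> Z \<Longrightarrow> A z y = A y z"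
    and "z \<in> Z" "y \<in> Z"
  shows "mpow Z A n z y = mpow Z A n y z"
  using assms(3,4)
proof (induction n arbitrary: z y)
  case (Suc n)
  have "mpow Z A (Suc n) z y = (\<Sum>w\<in>Z. mpow Z A n w y * A z w)"
    by (simp add: mult.commute)
  also have "\<dots> = (\<Sum>w\<in>Z. mpow Z A n y w * A w z)"
    using Suc A by (intro sum.cong) auto
  also have "\<dots> = mpow Z A (Suc n) y z"
    using Suc Z by (subst mpow_Suc_right) auto
  finally show ?case .
qed auto

text \<open>For symmetric \<open>A\<close> the trace of \<open>A^m A^m\<close> is a squared
  Frobenius norm; the positivity of all trace moments comes from here.\<close>

lemma tr_mpow_double:
  assumes Z: "finite Z" and A: "\<And>z y. z \<in> Z \<Longrightarrow> y \<in> Z \<Longrightarrow> A z y = A y z"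
  shows "tr Z (mpow Z A (2 * m)) = (\<Sum>z\<in>Z. \<Sum>y\<in>Z. (mpow Z A m y z)\<^sup>2)"
  unfolding tr_def mult_2 
  by (intro sum.cong refl, subst mpow_add[OF Z]) (auto simp: power2_eq_square mpow_sym[OF Z A] intro!: sum.cong)

text \<open>Each column of \<open>A^m\<close> arises from a basis vector by \<open>m\<close>
  applications of \<open>A\<close>, and each application multiplies the squared norm by at most
  \<open>c\<close>.\<close>

lemma tr_mpow_le:
  assumes Z: "finite Z" and A: "\<And>z y. z \<in> Z \<Longrightarrow> y \<in> Z \<Longrightarrow> A z y = A y z"
    and c: "\<And>x. (\<Sum>z\<in>Z. (\<Sum>y\<in>Z. A z y * x y)\<^sup>2) \<le> c * (\<Sum>z\<in>Z. (x z)\<^sup>2)" "c \<ge> 0"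
  shows "tr Z (mpow Z A (2 * m)) \<le> real (card Z) * c ^ m"
proof -
  have "(\<Sum>y\<in>Z. (mpow Z A m y z)\<^sup>2) \<le> c ^ m" if z: "z \<in> Z" for z m
  proof (induction m)
    case 0
    then show ?case using Z z by (simp add: if_distrib[of "\<lambda>c. c\<^sup>2"] cong: if_cong)
  next
    case (Suc m)
    have "(\<Sum>y\<in>Z. (mpow Z A (Suc m) y z)\<^sup>2) \<le> c * (\<Sum>y\<in>Z. (mpow Z A m y z)\<^sup>2)"
      by (simp add: c)
    also have "\<dots> \<le> c * c ^ m" using Suc c by (intro mult_left_mono)
    finally show ?case by simp
  qed
  then have "(\<Sum>z\<in>Z. \<Sum>y\<in>Z. (mpow Z A m y z)\<^sup>2) \<le> (\<Sum>z\<in>Z. c ^ m)" by (intro sum_mono)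
  then show ?thesis using tr_mpow_double[OF Z A] by simp
qed

lemma sum_Cauchy_Schwarz: "(\<Sum>z\<in>Z. f z * g z)\<^sup>2 \<le> (\<Sum>z\<in>Z. (f z :: real)\<^sup>2) * (\<Sum>z\<in>Z. (g z)\<^sup>2)"
  by (rule Cauchy_Schwarz_ineq_sum)

text \<open>The operator norm is bounded by a trace moment without diagonalising. The squared norms
  \<open>s j\<close> of \<open>A^j w\<close> are log-convex in \<open>j\<close>, so the first ratio
  \<open>s 1 / s 0\<close> is the smallest one and its \<open>m\<close>-th power is at most
  \<open>s m / s 0\<close>, which the Frobenius norm of \<open>A^m\<close> controls.\<close>

lemma bilinear_le_tr_mpow:
  assumes Z: "finite Z" and A: "\<And>z y. z \<in> Z \<Longrightarrow> y \<in> Z \<Longrightarrow> A z y = A y z" and m: "m > 0"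
  shows "(\<Sum>z\<in>Z. \<Sum>y\<in>Z. u z * A z y * w y) ^ (2 * m)
    \<le> (\<Sum>z\<in>Z. (u z)\<^sup>2) ^ m * (\<Sum>z\<in>Z. (w z)\<^sup>2) ^ m * tr Z (mpow Z A (2 * m))"
proof -
  define v where "v j z = (\<Sum>y\<in>Z. mpow Z A j z y * w y)" for j z
  define s where "s j = (\<Sum>z\<in>Z. (v j z)\<^sup>2)" for j
  have v0: "v 0 z = w z" if "z \<in> Z" for z
    using that Z by (simp add: v_def if_distrib[of "\<lambda>c. c * _"] cong: if_cong)
  have vS: "v (Suc j) z = (\<Sum>y\<in>Z. A z y * v j y)" for j z
  proof -
    have "v (Suc j) z = (\<Sum>y\<in>Z. \<Sum>x\<in>Z. A z x * mpow Z A j x y * w y)"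
      by (simp add: v_def sum_distrib_right)
    also have "\<dots> = (\<Sum>x\<in>Z. \<Sum>y\<in>Z. A z x * mpow Z A j x y * w y)" by (rule sum.swap)
    finally show ?thesis by (simp add: v_def sum_distrib_left mult.assoc)
  qed
  have s_nonneg: "s j \<ge> 0" for j by (simp add: s_def sum_nonneg)
  have s0: "s 0 = (\<Sum>z\<in>Z. (w z)\<^sup>2)" by (simp add: s_def v0)
  \<comment> \<open>Cauchy-Schwarz after one factor \<open>A\<close> has been moved across the inner
    product by symmetry.\<close>
  have conv: "(s (Suc j))\<^sup>2 \<le> s j * s (Suc (Suc j))" for j
  proof -
    have "s (Suc j) = (\<Sum>z\<in>Z. \<Sum>y\<in>Z. v (Suc j) z * (A z y * v j y))"
      by (simp add: s_def power2_eq_square vS sum_distrib_left)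
    also have "\<dots> = (\<Sum>y\<in>Z. \<Sum>z\<in>Z. v (Suc j) z * (A z y * v j y))" by (rule sum.swap)
    also have "\<dots> = (\<Sum>y\<in>Z. v j y * v (Suc (Suc j)) y)"
      unfolding vS[of "Suc j"] sum_distrib_left
      by (intro sum.cong refl) (use A in \<open>auto simp: mult_ac\<close>)
    finally show ?thesis unfolding s_def[of j] s_def[of "Suc (Suc j)"] by (simp add: sum_Cauchy_Schwarz)
  qed
  \<comment> \<open>Monotonicity of the ratios \<open>s (Suc j) / s j\<close>, with the denominators
    cleared because they may vanish.\<close>
  have ratio: "s 1 * s j \<le> s 0 * s (Suc j)" for j
  proof (induction j)
    case (Suc j)
    show ?case
    proof (cases "s j = 0")
      case True
      then have "s (Suc j) = 0" using conv[of j] s_nonneg by auto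
      then show ?thesis using s_nonneg by simp
    next
      case False
      then have "s j > 0" using s_nonneg[of j] by simp
      have "s 1 * s (Suc j) * s j = s 1 * s j * s (Suc j)" by simp
      also have "\<dots> \<le> s 0 * s (Suc j) * s (Suc j)"
        using Suc s_nonneg by (intro mult_right_mono)
      also have "\<dots> \<le> s 0 * (s j * s (Suc (Suc j)))"
        using conv[of j] s_nonneg by (simp add: mult_left_mono power2_eq_square mult.assoc)
      finally have "s 1 * s (Suc j) * s j \<le> s 0 * s (Suc (Suc j)) * s j" by (simp add: mult_ac)
      then show ?thesis using \<open>s j > 0\<close> by simp
    qed
  qed simp
  have pow: "s 1 ^ n * s 0 \<le> s 0 ^ n * s n" for n
  proof (induction n)
    case (Suc n)
    have "s 1 ^ Suc n * s 0 = s 1 * (s 1 ^ n * s 0)" by simp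
    also have "\<dots> \<le> s 1 * (s 0 ^ n * s n)" using Suc s_nonneg by (intro mult_left_mono)
    also have "\<dots> = s 0 ^ n * (s 1 * s n)" by simp
    also have "\<dots> \<le> s 0 ^ n * (s 0 * s (Suc n))"
      using ratio s_nonneg by (intro mult_left_mono) auto
    finally show ?case by (simp add: mult_ac)
  qed simp
  have sm: "s m \<le> s 0 * tr Z (mpow Z A (2 * m))"
  proof -
    have "s m \<le> (\<Sum>z\<in>Z. (\<Sum>y\<in>Z. (mpow Z A m z y)\<^sup>2) * (\<Sum>y\<in>Z. (w y)\<^sup>2))"
      unfolding s_def v_def by (intro sum_mono sum_Cauchy_Schwarz)
    also have "\<dots> = s 0 * (\<Sum>z\<in>Z. \<Sum>y\<in>Z. (mpow Z A m z y)\<^sup>2)"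
      by (simp add: s0 sum_distrib_right[symmetric])
    also have "(\<Sum>z\<in>Z. \<Sum>y\<in>Z. (mpow Z A m z y)\<^sup>2) = tr Z (mpow Z A (2 * m))"
        by (subst tr_mpow_double[OF Z A]) (auto intro: sum.swap)
    finally show ?thesis .
  qed
  have s1: "s 1 ^ m \<le> s 0 ^ m * tr Z (mpow Z A (2 * m))"
  proof (cases "s 0 = 0")
    case True
    then have "s 1 = 0" using conv[of 0] s_nonneg by auto
    then show ?thesis using True m by (simp add: power_0_left)
  next
    case False
    then have "s 0 > 0" using s_nonneg[of 0] by simp
    have "s 1 ^ m * s 0 \<le> s 0 ^ m * (s 0 * tr Z (mpow Z A (2 * m)))"
      using pow[of m] sm s_nonneg by (meson mult_left_mono order_trans zero_le_power)
    then show ?thesis using \<open>s 0 > 0\<close> by (simp add: mult_ac)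
  qed
  have "(\<Sum>z\<in>Z. \<Sum>y\<in>Z. u z * A z y * w y) = (\<Sum>z\<in>Z. u z * v 1 z)"
    by (simp add: vS sum_distrib_left mult.assoc v0)
  then have "(\<Sum>z\<in>Z. \<Sum>y\<in>Z. u z * A z y * w y)\<^sup>2 \<le> (\<Sum>z\<in>Z. (u z)\<^sup>2) * s 1"
    unfolding s_def by (simp only: sum_Cauchy_Schwarz)
  then have "((\<Sum>z\<in>Z. \<Sum>y\<in>Z. u z * A z y * w y)\<^sup>2) ^ m \<le> ((\<Sum>z\<in>Z. (u z)\<^sup>2) * s 1) ^ m"
    by (intro power_mono) auto
  also have "\<dots> = (\<Sum>z\<in>Z. (u z)\<^sup>2) ^ m * s 1 ^ m" by (rule power_mult_distrib)
  also have "\<dots> \<le> (\<Sum>z\<in>Z. (u z)\<^sup>2) ^ m * (s 0 ^ m * tr Z (mpow Z A (2 * m)))"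
    by (intro mult_left_mono s1) (simp add: sum_nonneg)
  finally show ?thesis by (simp add: s0 power_mult mult.assoc)
qed

section \<open>Moments of Gaussian monomials and words\<close>

lemma prod_list_map_eq_prod_count:
  fixes f :: "'s \<Rightarrow> real"
  assumes "finite S" "set ps \<subseteq> S"
  shows "prod_list (map f ps) = (\<Prod>s\<in>S. f s ^ count_list ps s)"
  using assms(2)
proof (induction ps)
  case (Cons p ps)
  then have p: "p \<in> S" and IH: "prod_list (map f ps) = (\<Prod>s\<in>S. f s ^ count_list ps s)" by auto
  have "(\<Prod>s\<in>S. f s ^ count_list (p # ps) s) = (\<Prod>s\<in>S. (if s = p then f p else 1) * f s ^ count_list ps s)"
    by (intro prod.cong) auto
  also have "\<dots> = f p * (\<Prod>s\<in>S. f s ^ count_list ps s)"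
    using p assms(1) by (simp add: prod.distrib)
  finally show ?case using IH by simp
qed simp

lemma
  assumes "finite S" "set ps \<subseteq> S"
  shows integrable_gauss_prod_list: "integrable (gauss S) (\<lambda>x. prod_list (map x ps))"
    and integral_gauss_prod_list: "(\<integral>x. prod_list (map x ps) \<partial>gauss S) = (\<Prod>s\<in>S. gmom (count_list ps s))"
  using integrable_gauss_monomial[OF assms(1)] integral_gauss_monomial[OF assms(1)]
  by (simp_all add: prod_list_map_eq_prod_count[OF assms])

lemma count_list_map_fst:
  assumes "finite I" "set ps \<subseteq> J \<times> I"
  shows "count_list (map fst ps) j = (\<Sum>i\<in>I. count_list ps (j, i))"
  using assms(2)
proof (induction ps)
  case (Cons p ps)
  obtain a b where p: "p = (a, b)" by force
  with Cons have b: "b \<in> I" by auto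
  have "(\<Sum>i\<in>I. count_list (p # ps) (j, i)) = (\<Sum>i\<in>I. (if i = b then (if a = j then 1 else 0) else 0) + count_list ps (j, i))"
    by (intro sum.cong) (auto simp: p)
  also have "\<dots> = (if a = j then 1 else 0) + (\<Sum>i\<in>I. count_list ps (j, i))"
    using b assms(1) by (simp add: sum.distrib)
  finally show ?case using Cons by (simp add: p)
qed simp

text \<open>Forgetting the second index identifies independent variables. The moment factorises over
  \<open>J \<times> I\<close>, and for each \<open>j\<close> the factors with different
  \<open>i\<close> are merged by \<open>gmom_sum\<close>.\<close>

lemma gauss_prod_list_merge:
  assumes fin: "finite J" "finite I" and ps: "set ps \<subseteq> J \<times> I"
  shows "0 \<le> (\<integral>x. prod_list (map x ps) \<partial>gauss (J \<times> I))"
    and "(\<integral>x. prod_list (map x ps) \<partial>gauss (J \<times> I)) \<le> (\<integral>g. prod_list (map g (map fst ps)) \<partial>gauss J)"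
proof -
  have 1: "(\<integral>x. prod_list (map x ps) \<partial>gauss (J \<times> I)) = (\<Prod>j\<in>J. \<Prod>i\<in>I. gmom (count_list ps (j, i)))"
    using fin ps by (subst integral_gauss_prod_list) (auto simp: prod.cartesian_product)
  then show "0 \<le> (\<integral>x. prod_list (map x ps) \<partial>gauss (J \<times> I))"
    by (simp add: prod_nonneg gmom_nonneg)
  have "(\<Prod>j\<in>J. \<Prod>i\<in>I. gmom (count_list ps (j, i))) \<le> (\<Prod>j\<in>J. gmom (\<Sum>i\<in>I. count_list ps (j, i)))"
    by (intro prod_mono conjI prod_nonneg gmom_nonneg gmom_sum fin)
  also have "\<dots> = (\<Prod>j\<in>J. gmom (count_list (map fst ps) j))"
    using count_list_map_fst[OF fin(2) ps] by simp
  also have "\<dots> = (\<integral>g. prod_list (map g (map fst ps)) \<partial>gauss J)"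
    using fin ps by (intro integral_gauss_prod_list[symmetric]) auto
  finally show "(\<integral>x. prod_list (map x ps) \<partial>gauss (J \<times> I)) \<le> (\<integral>g. prod_list (map g (map fst ps)) \<partial>gauss J)"
    using 1 by simp
qed

text \<open>The pattern \<open>e\<close> says which Gaussian variable, if any, sits at each position of the matrix.\<close>

definition pat_mat :: "('z \<Rightarrow> 'z \<Rightarrow> 'j option) \<Rightarrow> ('j \<Rightarrow> real) \<Rightarrow> 'z \<Rightarrow> 'z \<Rightarrow> real" where
  "pat_mat e x z y = (case e z y of None \<Rightarrow> 0 | Some j \<Rightarrow> x j)"

abbreviation pat_word :: "'z set \<Rightarrow> ('z \<Rightarrow> 'z \<Rightarrow> 'j option) \<Rightarrow> ('j \<times> 'i \<Rightarrow> real) \<Rightarrow> 'i list \<Rightarrow> 'z \<Rightarrow> 'z \<Rightarrow> real" where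
  "pat_word Z e x \<equiv> word Z (\<lambda>i. pat_mat e (\<lambda>j. x (j, i)))"

text \<open>Every entry is zero or a single variable with coefficient 1, so a word expands into
  monomials with coefficient 1 and has nonnegative expectation. Symmetry makes the traces of even
  powers nonnegative.\<close>

locale pattern =
  fixes Z :: "'z set" and J :: "'j set" and e :: "'z \<Rightarrow> 'z \<Rightarrow> 'j option"
  assumes finZ: "finite Z" and finJ: "finite J"
    and range: "\<And>z y j. z \<in> Z \<Longrightarrow> y \<in> Z \<Longrightarrow> e z y = Some j \<Longrightarrow> j \<in> J"
    and sym: "\<And>z y. z \<in> Z \<Longrightarrow> y \<in> Z \<Longrightarrow> e z y = e y z"
begin

lemma pat_mat_sym: "z \<in> Z \<Longrightarrow> y \<in> Z \<Longrightarrow> pat_mat e x z y = pat_mat e x y z"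
  using sym[of z y] by (simp add: pat_mat_def)

lemma pat_word_step:
  assumes "i \<in> I" "z \<in> Z" "w \<in> Z"
  shows "prod_list (map x ps) * (pat_mat e (\<lambda>j. x (j, i)) z w * W) =
    (case e z w of None \<Rightarrow> 0 | Some j \<Rightarrow> prod_list (map x (ps @ [(j, i)])) * W)"
  by (simp add: pat_mat_def mult.assoc split: option.split)

text \<open>The list \<open>ps\<close> collects the variables already peeled off the front of the
  word; this accumulator is what lets the induction on the length close.\<close>

lemma integrable_pat_word:
  assumes fin: "finite I" and "set ps \<subseteq> J \<times> I" "is \<in> words I n" "z \<in> Z"
  shows "integrable (gauss (J \<times> I)) (\<lambda>x. prod_list (map x ps) * pat_word Z e x is z y)"
  using assms(2-)
proof (induction n arbitrary: ps "is" z)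
  case 0
  then have "is = []" by (auto simp: words_def)
  then show ?case
    using 0 fin finJ by (auto intro!: integrable_mult_left integrable_gauss_prod_list)
next
  case (Suc n)
  then obtain i js where "is": "is = i # js" "i \<in> I" "js \<in> words I n" by (auto simp: words_def length_Suc_conv)
  have "integrable (gauss (J \<times> I)) (\<lambda>x. prod_list (map x ps) * (pat_mat e (\<lambda>j. x (j, i)) z w * pat_word Z e x js w y))"
    if "w \<in> Z" for w
  proof (cases "e z w")
    case None
    then show ?thesis by (simp add: pat_mat_def)
  next
    case (Some j)
    then have "set (ps @ [(j, i)]) \<subseteq> J \<times> I" using Suc.prems "is" that range by auto
    from Suc.IH[OF this "is"(3) that] show ?thesis
      unfolding pat_word_step[OF "is"(2) Suc.prems(3) that] by (simp add: Some)
  qed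
  then show ?case by (simp add: "is" sum_distrib_left)
qed

lemma integrable_pat_mpow:
  assumes "set ps \<subseteq> J" "z \<in> Z"
  shows "integrable (gauss J) (\<lambda>x. prod_list (map x ps) * mpow Z (pat_mat e x) n z y)"
  using assms
proof (induction n arbitrary: ps z)
  case 0
  then show ?case
    using finJ by (auto intro!: integrable_mult_left integrable_gauss_prod_list)
next
  case (Suc n)
  have "integrable (gauss J) (\<lambda>x. prod_list (map x ps) * (pat_mat e x z w * mpow Z (pat_mat e x) n w y))"
    if "w \<in> Z" for w
  proof (cases "e z w")
    case None
    then show ?thesis by (simp add: pat_mat_def)
  next
    case (Some j)
    then have "set (ps @ [j]) \<subseteq> J" using Suc.prems that range by auto
    have "pat_mat e x z w = x j" for x by (simp add: pat_mat_def Some)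
    with Suc.IH[OF \<open>set (ps @ [j]) \<subseteq> J\<close> that] show ?thesis
      by (simp add: mult.assoc)
  qed
  then show ?case by (simp add: sum_distrib_left)
qed

text \<open>Word and matrix power are peeled in parallel along the same index paths. At the end of a
  path one monomial is left on each side, and \<open>gauss_prod_list_merge\<close> compares the
  two.\<close>

lemma pat_word_bounds:
  assumes fin: "finite I" and "set ps \<subseteq> J \<times> I" "is \<in> words I n" "z \<in> Z"
  shows "0 \<le> (\<integral>x. prod_list (map x ps) * pat_word Z e x is z y \<partial>gauss (J \<times> I)) \<and>
    (\<integral>x. prod_list (map x ps) * pat_word Z e x is z y \<partial>gauss (J \<times> I))
      \<le> (\<integral>g. prod_list (map g (map fst ps)) * mpow Z (pat_mat e g) n z y \<partial>gauss J)"
  using assms(2-)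
proof (induction n arbitrary: ps "is" z)
  case 0
  then have "is = []" by (auto simp: words_def)
  then show ?case
    using gauss_prod_list_merge[OF finJ fin 0(1)] by simp
next
  case (Suc n)
  then obtain i js where "is": "is = i # js" "i \<in> I" "js \<in> words I n" by (auto simp: words_def length_Suc_conv)
  let ?L = "\<lambda>w x. prod_list (map x ps) * (pat_mat e (\<lambda>j. x (j, i)) z w * pat_word Z e x js w y)"
  let ?R = "\<lambda>w g. prod_list (map g (map fst ps)) * (pat_mat e g z w * mpow Z (pat_mat e g) n w y)"
  have *: "integrable (gauss (J \<times> I)) (?L w) \<and> integrable (gauss J) (?R w) \<and>
      0 \<le> (\<integral>x. ?L w x \<partial>gauss (J \<times> I)) \<and> (\<integral>x. ?L w x \<partial>gauss (J \<times> I)) \<le> (\<integral>g. ?R w g \<partial>gauss J)"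
    if w: "w \<in> Z" for w
  proof (cases "e z w")
    case None
    then show ?thesis by (simp add: pat_mat_def)
  next
    case (Some j)
    then have ps: "set (ps @ [(j, i)]) \<subseteq> J \<times> I" using Suc.prems "is" that range by auto
    then have "set (map fst (ps @ [(j, i)])) \<subseteq> J" by auto
    from integrable_pat_mpow[OF this w, of n y] integrable_pat_word[OF fin ps "is"(3) w, of y] Suc.IH[OF ps "is"(3) w]
    moreover have "pat_mat e x z w = x j" for x by (simp add: pat_mat_def Some)
    ultimately show ?thesis
      by (simp add: mult.assoc)
  qed
  have "(\<integral>x. prod_list (map x ps) * pat_word Z e x is z y \<partial>gauss (J \<times> I)) = (\<Sum>w\<in>Z. \<integral>x. ?L w x \<partial>gauss (J \<times> I))"
    using * by (simp add: "is" sum_distrib_left)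
  moreover have "(\<integral>g. prod_list (map g (map fst ps)) * mpow Z (pat_mat e g) (Suc n) z y \<partial>gauss J) = (\<Sum>w\<in>Z. \<integral>g. ?R w g \<partial>gauss J)"
    using * by (simp add: sum_distrib_left)
  ultimately show ?case using * by (auto intro!: sum_nonneg sum_mono)
qed

definition F0 :: "nat \<Rightarrow> real" where
  "F0 n = (\<integral>g. tr Z (mpow Z (pat_mat e g) n) \<partial>gauss J)"

definition F :: "'i set \<Rightarrow> 'i list \<Rightarrow> real" where
  "F I is = (\<integral>x. tr Z (pat_word Z e x is) \<partial>gauss (J \<times> I))"

lemma integrable_tr_pat_word:
  "finite I \<Longrightarrow> is \<in> words I n \<Longrightarrow> integrable (gauss (J \<times> I)) (\<lambda>x. tr Z (pat_word Z e x is))"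
  unfolding tr_def using integrable_pat_word[of I "[]" "is" n] by auto

lemma integrable_tr_pat_mpow: "integrable (gauss J) (\<lambda>x. tr Z (mpow Z (pat_mat e x) n))"
  unfolding tr_def using integrable_pat_mpow[of "[]" _ n] by auto

lemma F_bounds:
  assumes "finite I" "is \<in> words I n"
  shows "0 \<le> F I is" "F I is \<le> F0 n"
proof -
  have 1: "integrable (gauss (J \<times> I)) (\<lambda>x. pat_word Z e x is z z)"
    "integrable (gauss J) (\<lambda>x. mpow Z (pat_mat e x) n z z)"
    "0 \<le> (\<integral>x. pat_word Z e x is z z \<partial>gauss (J \<times> I))"
    "(\<integral>x. pat_word Z e x is z z \<partial>gauss (J \<times> I)) \<le> (\<integral>x. mpow Z (pat_mat e x) n z z \<partial>gauss J)" if "z \<in> Z" for z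
    using integrable_pat_word[of I "[]" "is" n z z] pat_word_bounds[of I "[]" "is" n z z]
      integrable_pat_mpow[of "[]" z n z] assms that by auto
  have 2: "F I is = (\<Sum>z\<in>Z. \<integral>x. pat_word Z e x is z z \<partial>gauss (J \<times> I))"
     "F0 n = (\<Sum>z\<in>Z. \<integral>x. mpow Z (pat_mat e x) n z z \<partial>gauss J)"
    unfolding F_def F0_def tr_def using 1 by auto
  show "0 \<le> F I is" "F I is \<le> F0 n"
    unfolding 2 using 1 by (auto intro!: sum_nonneg sum_mono)
qed

text \<open>Summed over all words, the traces give a power of the sum of \<open>card I\<close>
  independent copies of the matrix, and that sum is distributed as \<open>sqrt (card I)\<close>
  times one copy.\<close>

lemma sum_F:
  assumes fin: "finite I" and I: "I \<noteq> {}"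
  shows "(\<Sum>is\<in>words I (2 * m). F I is) = real (card I) ^ m * F0 (2 * m)"
proof -
  let ?N = "real (card I)"
  have N: "?N > 0" using fin I by (simp add: card_gt_0_iff)
  let ?f = "\<lambda>g. tr Z (mpow Z (pat_mat e g) (2 * m))"
  let ?y = "\<lambda>x. \<lambda>j\<in>J. \<Sum>i\<in>I. (1 / sqrt ?N) * x (j, i)"
  have nonneg: "?f g \<ge> 0" for g
    using pat_mat_sym finZ by (subst tr_mpow_double) (auto intro!: sum_nonneg)
  have eq: "(\<Sum>is\<in>words I (2 * m). tr Z (pat_word Z e x is)) = ?N ^ m * ?f (?y x)" for x
  proof -
    have "(\<Sum>is\<in>words I (2 * m). tr Z (pat_word Z e x is)) 
      = tr Z (mpow Z (\<lambda>z y. \<Sum>i\<in>I. pat_mat e (\<lambda>j. x (j, i)) z y) (2 * m))"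
      unfolding tr_def by (subst sum.swap) (simp add: sum_word[OF fin])
    also have "\<dots> = tr Z (mpow Z (\<lambda>z y. sqrt ?N * pat_mat e (?y x) z y) (2 * m))"
    proof -
      have "(\<Sum>i\<in>I. pat_mat e (\<lambda>j. x (j, i)) z y) = sqrt ?N * pat_mat e (?y x) z y"
        if "z \<in> Z" "y \<in> Z" for z y
        using that range[OF that] N
        by (auto simp: pat_mat_def sum_distrib_left[symmetric] sum_divide_distrib[symmetric] split: option.split)
      then show ?thesis
        unfolding tr_def by (intro sum.cong refl mpow_cong)
    qed
    also have "\<dots> = sqrt ?N ^ (2 * m) * ?f (?y x)"
      unfolding tr_def mpow_scale by (simp add: sum_distrib_left)
    finally show ?thesis using N by (simp add: power_mult)
  qed
  have meas: "?f \<in> borel_measurable (gauss J)"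
    using integrable_tr_pat_mpow by (rule borel_measurable_integrable)
  have sumF: "(\<Sum>is\<in>words I (2 * m). F I is) = (\<integral>x. ?N ^ m * ?f (?y x) \<partial>gauss (J \<times> I))"
    unfolding F_def using integrable_tr_pat_word[OF fin]
    by (subst Bochner_Integration.integral_sum[symmetric]) (auto simp: eq)
  have intg: "integrable (gauss (J \<times> I)) (\<lambda>x. ?N ^ m * ?f (?y x))"
    unfolding eq[symmetric] using integrable_tr_pat_word[OF fin] by auto
  have F_nonneg: "(\<Sum>is\<in>words I (2 * m). F I is) \<ge> 0" using F_bounds[OF fin] by (auto intro!: sum_nonneg)
  have "ennreal (\<Sum>is\<in>words I (2 * m). F I is) = (\<integral>\<^sup>+x. ennreal (?N ^ m * ?f (?y x)) \<partial>gauss (J \<times> I))"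
    unfolding sumF using intg nonneg N by (intro nn_integral_eq_integral[symmetric]) auto
  also have "\<dots> = (\<integral>\<^sup>+x. ennreal (?N ^ m * ?f x) \<partial>gauss J)"
    using N meas by (intro nn_integral_gauss_rows finJ fin) (auto simp: power_divide sum_divide_distrib)
  also have "\<dots> = ennreal (\<integral>x. ?N ^ m * ?f x \<partial>gauss J)"
    using integrable_tr_pat_mpow nonneg N by (intro nn_integral_eq_integral) auto
  also have "\<dots> = ennreal (?N ^ m * F0 (2 * m))" by (simp add: F0_def)
  finally show ?thesis
    using F_nonneg nonneg N by (subst (asm) ennreal_inj) (auto simp: F0_def intro!: Bochner_Integration.integral_nonneg)
qed

abbreviation tens :: "'i set \<Rightarrow> ('j \<times> 'i \<Rightarrow> real) \<Rightarrow> ('j \<times> 'i \<Rightarrow> real) \<Rightarrow> 'z \<times> 'z \<Rightarrow> 'z \<times> 'z \<Rightarrow> real" where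
  "tens I u v \<equiv> \<lambda>p q. \<Sum>i\<in>I. pat_mat e (\<lambda>j. u (j, i)) (fst p) (fst q) * pat_mat e (\<lambda>j. v (j, i)) (snd p) (snd q)"

lemma tens_sym:
  "p \<in> Z \<times> Z \<Longrightarrow> q \<in> Z \<times> Z \<Longrightarrow> tens I u v p q = tens I u v q p"
  using pat_mat_sym by (auto intro!: sum.cong)

text \<open>Pisier's argument: the trace is a sum over words of a product of two traces, one in
  \<open>u\<close> and one in \<open>v\<close>.  Since moments of Gaussian words are nonnegative, one factor may be
  replaced by its maximum; the sum of the other is the moment of a single Gaussian matrix.\<close>

theorem tensor_trace_moment:
  assumes fin: "finite I" "I \<noteq> {}"
  shows "(\<integral>\<^sup>+u. \<integral>\<^sup>+v. ennreal (tr (Z \<times> Z) (mpow (Z \<times> Z) (tens I u v) (2 * m))) \<partial>gauss (J \<times> I) \<partial>gauss (J \<times> I))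
    \<le> ennreal (real (card I) ^ m * (F0 (2 * m))\<^sup>2)"
proof -
  have nonneg: "0 \<le> tr (Z \<times> Z) (mpow (Z \<times> Z) (tens I u v) (2 * m))" for u v
    using finZ by (subst tr_mpow_double[OF _ tens_sym]) (auto intro!: sum_nonneg)
  have tens: "tr (Z \<times> Z) (mpow (Z \<times> Z) (tens I u v) (2 * m)) = 
      (\<Sum>is\<in>words I (2 * m). tr Z (pat_word Z e u is) * tr Z (pat_word Z e v is))" for u v
    by (rule tr_mpow_tensor[OF fin(1) finZ])
  have inner: "(\<integral>\<^sup>+v. ennreal (tr (Z \<times> Z) (mpow (Z \<times> Z) (tens I u v) (2 * m))) \<partial>gauss (J \<times> I))
      = ennreal (\<Sum>is\<in>words I (2 * m). tr Z (pat_word Z e u is) * F I is)" and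
    inner_nonneg: "0 \<le> (\<Sum>is\<in>words I (2 * m). tr Z (pat_word Z e u is) * F I is)" for u
  proof -
    have i: "integrable (gauss (J \<times> I)) (\<lambda>v. \<Sum>is\<in>words I (2 * m). tr Z (pat_word Z e u is) * tr Z (pat_word Z e v is))"
      using integrable_tr_pat_word[OF fin(1)] by auto
    have e: "(\<integral>v. (\<Sum>is\<in>words I (2 * m). tr Z (pat_word Z e u is) * tr Z (pat_word Z e v is)) \<partial>gauss (J \<times> I))
      = (\<Sum>is\<in>words I (2 * m). tr Z (pat_word Z e u is) * F I is)"
      using integrable_tr_pat_word[OF fin(1)] by (simp add: F_def)
    show "(\<integral>\<^sup>+v. ennreal (tr (Z \<times> Z) (mpow (Z \<times> Z) (tens I u v) (2 * m))) \<partial>gauss (J \<times> I))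
      = ennreal (\<Sum>is\<in>words I (2 * m). tr Z (pat_word Z e u is) * F I is)"
      using i nonneg[of u] unfolding tens e[symmetric] by (intro nn_integral_eq_integral) auto
    show "0 \<le> (\<Sum>is\<in>words I (2 * m). tr Z (pat_word Z e u is) * F I is)"
      unfolding e[symmetric] using nonneg[of u] unfolding tens by (intro Bochner_Integration.integral_nonneg) auto
  qed
  have "(\<integral>\<^sup>+u. ennreal (\<Sum>is\<in>words I (2 * m). tr Z (pat_word Z e u is) * F I is) \<partial>gauss (J \<times> I))
    = ennreal (\<integral>u. (\<Sum>is\<in>words I (2 * m). tr Z (pat_word Z e u is) * F I is) \<partial>gauss (J \<times> I))"
    using integrable_tr_pat_word[OF fin(1)] inner_nonneg by (intro nn_integral_eq_integral) auto
  also have "(\<integral>u. (\<Sum>is\<in>words I (2 * m). tr Z (pat_word Z e u is) * F I is) \<partial>gauss (J \<times> I))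
    = (\<Sum>is\<in>words I (2 * m). F I is * F I is)"
    using integrable_tr_pat_word[OF fin(1)] by (simp add: F_def)
  also have "ennreal \<dots> \<le> ennreal (\<Sum>is\<in>words I (2 * m). F I is * F0 (2 * m))"
    using F_bounds[OF fin(1)] by (intro ennreal_leI sum_mono mult_left_mono) auto
  also have "(\<Sum>is\<in>words I (2 * m). F I is * F0 (2 * m)) = real (card I) ^ m * (F0 (2 * m))\<^sup>2"
    unfolding sum_distrib_right[symmetric] sum_F[OF fin] by (simp add: power2_eq_square)
  finally show ?thesis unfolding inner .
qed

end

section \<open>Operator norms through Gaussian averages\<close>

definition bilin_moment :: "'a set \<Rightarrow> 'b set \<Rightarrow> nat \<Rightarrow> ('a \<Rightarrow> 'b \<Rightarrow> real) \<Rightarrow> ennreal" where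
  "bilin_moment A B m G =
    (\<integral>\<^sup>+s. \<integral>\<^sup>+t. ennreal ((\<Sum>a\<in>A. \<Sum>b\<in>B. s a * G a b * t b) ^ (2 * m)) \<partial>gauss B \<partial>gauss A)"

text \<open>The operator norm of \<open>G\<close> is controlled by averaging the bilinear form over independent
  Gaussian vectors, which replaces a net argument.\<close>

lemma bilinear_le_bilin_moment:
  assumes fin: "finite A" "finite B"
  shows "ennreal ((gmom (2 * m))\<^sup>2 * (\<Sum>a\<in>A. \<Sum>b\<in>B. v a * G a b * w b) ^ (2 * m))
    \<le> ennreal ((\<Sum>a\<in>A. (v a)\<^sup>2) ^ m * (\<Sum>b\<in>B. (w b)\<^sup>2) ^ m) * bilin_moment A B m G"
proof -
  let ?g = "gmom (2 * m)"
  let ?V = "(\<Sum>a\<in>A. (v a)\<^sup>2) ^ m" and ?W = "(\<Sum>b\<in>B. (w b)\<^sup>2) ^ m"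
  have CS: "(\<Sum>z\<in>Z. f z * h z) ^ (2 * m) \<le> (\<Sum>z\<in>Z. (f z)\<^sup>2) ^ m * (\<Sum>z\<in>Z. (h z)\<^sup>2) ^ m" for Z and f h :: "_ \<Rightarrow> real"
    unfolding power_mult power_mult_distrib[symmetric] by (intro power_mono sum_Cauchy_Schwarz) simp
  have V: "?V \<ge> 0" "?W \<ge> 0" by (simp_all add: sum_nonneg)
  \<comment> \<open>Averaging a linear form in \<open>t\<close> to the power \<open>2 m\<close>
    gives \<open>gmom (2 m)\<close> times the same power of the norm of its coefficient vector.
    Cauchy-Schwarz is applied against \<open>w\<close> here; the step against \<open>v\<close> below
    has the same shape.\<close>
  have inner: "ennreal (?g * (\<Sum>a\<in>A. (\<Sum>b\<in>B. G a b * w b) * s a) ^ (2 * m))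
    \<le> ennreal ?W * (\<integral>\<^sup>+t. ennreal ((\<Sum>a\<in>A. \<Sum>b\<in>B. s a * G a b * t b) ^ (2 * m)) \<partial>gauss B)" for s
  proof -
    have "(\<Sum>a\<in>A. (\<Sum>b\<in>B. G a b * w b) * s a) = (\<Sum>b\<in>B. (\<Sum>a\<in>A. s a * G a b) * w b)"
      unfolding sum_distrib_right by (subst sum.swap) (simp add: mult_ac)
    then have "(\<Sum>a\<in>A. (\<Sum>b\<in>B. G a b * w b) * s a) ^ (2 * m)
      \<le> (\<Sum>b\<in>B. (\<Sum>a\<in>A. s a * G a b)\<^sup>2) ^ m * ?W" by (simp add: CS)
    then have "ennreal (?g * (\<Sum>a\<in>A. (\<Sum>b\<in>B. G a b * w b) * s a) ^ (2 * m))
      \<le> ennreal (?g * ((\<Sum>b\<in>B. (\<Sum>a\<in>A. s a * G a b)\<^sup>2) ^ m * ?W))"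
      using gmom_nonneg by (intro ennreal_leI mult_left_mono)
    also have "\<dots> = ennreal ?W * ennreal (?g * (\<Sum>b\<in>B. (\<Sum>a\<in>A. s a * G a b)\<^sup>2) ^ m)"
      using V gmom_nonneg by (subst ennreal_mult[symmetric]) (auto simp: mult_ac sum_nonneg)
    also have "ennreal (?g * (\<Sum>b\<in>B. (\<Sum>a\<in>A. s a * G a b)\<^sup>2) ^ m)
      = (\<integral>\<^sup>+t. ennreal ((\<Sum>b\<in>B. (\<Sum>a\<in>A. s a * G a b) * t b) ^ (2 * m)) \<partial>gauss B)"
      by (rule nn_integral_gauss_linear_power[OF fin(2), symmetric])
    also have "\<dots> = (\<integral>\<^sup>+t. ennreal ((\<Sum>a\<in>A. \<Sum>b\<in>B. s a * G a b * t b) ^ (2 * m)) \<partial>gauss B)"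
      unfolding sum_distrib_right by (subst sum.swap) simp
    finally show ?thesis .
  qed
  have "(\<Sum>a\<in>A. \<Sum>b\<in>B. v a * G a b * w b) ^ (2 * m) = (\<Sum>a\<in>A. v a * (\<Sum>b\<in>B. G a b * w b)) ^ (2 * m)"
    by (simp add: sum_distrib_left mult.assoc)
  also have "\<dots> \<le> ?V * (\<Sum>a\<in>A. (\<Sum>b\<in>B. G a b * w b)\<^sup>2) ^ m" by (rule CS)
  finally have "ennreal (?g\<^sup>2 * (\<Sum>a\<in>A. \<Sum>b\<in>B. v a * G a b * w b) ^ (2 * m))
    \<le> ennreal (?g\<^sup>2 * (?V * (\<Sum>a\<in>A. (\<Sum>b\<in>B. G a b * w b)\<^sup>2) ^ m))"
    by (intro ennreal_leI mult_left_mono) auto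
  also have "\<dots> = ennreal ?V * (ennreal ?g * ennreal (?g * (\<Sum>a\<in>A. (\<Sum>b\<in>B. G a b * w b)\<^sup>2) ^ m))"
    using V gmom_nonneg by (subst ennreal_mult[symmetric], simp, simp add: sum_nonneg, subst ennreal_mult[symmetric])
      (auto simp: mult_ac sum_nonneg power2_eq_square)
  also have "ennreal ?g * ennreal (?g * (\<Sum>a\<in>A. (\<Sum>b\<in>B. G a b * w b)\<^sup>2) ^ m)
    = ennreal ?g * (\<integral>\<^sup>+s. ennreal ((\<Sum>a\<in>A. (\<Sum>b\<in>B. G a b * w b) * s a) ^ (2 * m)) \<partial>gauss A)"
    by (subst nn_integral_gauss_linear_power[OF fin(1)]) simp
  also have "\<dots> = (\<integral>\<^sup>+s. ennreal (?g * (\<Sum>a\<in>A. (\<Sum>b\<in>B. G a b * w b) * s a) ^ (2 * m)) \<partial>gauss A)"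
    using gmom_nonneg by (subst nn_integral_cmult[symmetric]) (auto simp: ennreal_mult zero_le_even_power)
  also have "\<dots> \<le> (\<integral>\<^sup>+s. ennreal ?W * (\<integral>\<^sup>+t. ennreal ((\<Sum>a\<in>A. \<Sum>b\<in>B. s a * G a b * t b) ^ (2 * m)) \<partial>gauss B) \<partial>gauss A)"
    by (intro nn_integral_mono inner)
  also have "\<dots> = ennreal ?W * bilin_moment A B m G"
  proof -
    interpret B: prob_space "gauss B" by (rule prob_space_gauss)
    show ?thesis unfolding bilin_moment_def by (rule nn_integral_cmult) measurable
  qed
  finally have "ennreal (?g\<^sup>2 * (\<Sum>a\<in>A. \<Sum>b\<in>B. v a * G a b * w b) ^ (2 * m))
    \<le> ennreal ?V * (ennreal ?W * bilin_moment A B m G)"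
    by (simp add: mult_left_mono)
  then show ?thesis using V by (simp add: ennreal_mult mult.assoc)
qed

text \<open>For fixed \<open>s\<close> and \<open>t\<close> the form is linear in \<open>g\<close>,
  with variance the product of their squared norms. Integrating over \<open>g\<close> first
  therefore leaves two independent norm moments, and the order \<open>m \<le> d\<close> keeps each
  of them below \<open>(4 d)^m\<close>.\<close>

lemma bilin_moment_gauss:
  assumes fin: "finite A" "finite B" and d: "card A \<le> d" "card B \<le> d" "m \<le> d"
  shows "(\<integral>\<^sup>+g. bilin_moment A B m (\<lambda>a b. g (a, b)) \<partial>gauss (A \<times> B)) \<le> ennreal (gmom (2 * m) * (4 * real d) ^ (2 * m))"
proof -
  let ?G = "gauss (A \<times> B)"
  interpret A: prob_space "gauss A" by (rule prob_space_gauss)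
  interpret B: prob_space "gauss B" by (rule prob_space_gauss)
  interpret G: prob_space ?G by (rule prob_space_gauss)
  interpret GA: pair_prob_space "gauss A" ?G by standard
  interpret GB: pair_prob_space "gauss B" ?G by standard
  let ?f = "\<lambda>g s t. ennreal ((\<Sum>a\<in>A. \<Sum>b\<in>B. s a * g (a, b) * t b) ^ (2 * m))"
  have "(\<integral>\<^sup>+g. bilin_moment A B m (\<lambda>a b. g (a, b)) \<partial>?G) = (\<integral>\<^sup>+g. \<integral>\<^sup>+s. \<integral>\<^sup>+t. ?f g s t \<partial>gauss B \<partial>gauss A \<partial>?G)"
    by (simp add: bilin_moment_def)
  also have "\<dots> = (\<integral>\<^sup>+s. \<integral>\<^sup>+g. \<integral>\<^sup>+t. ?f g s t \<partial>gauss B \<partial>?G \<partial>gauss A)"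
    by (rule GA.Fubini') measurable
  also have "\<dots> = (\<integral>\<^sup>+s. \<integral>\<^sup>+t. \<integral>\<^sup>+g. ?f g s t \<partial>?G \<partial>gauss B \<partial>gauss A)"
    by (intro nn_integral_cong GB.Fubini') measurable
  also have "\<dots> = (\<integral>\<^sup>+s. \<integral>\<^sup>+t. ennreal (gmom (2 * m)) * (ennreal ((\<Sum>a\<in>A. (s a)\<^sup>2) ^ m) * ennreal ((\<Sum>b\<in>B. (t b)\<^sup>2) ^ m)) \<partial>gauss B \<partial>gauss A)"
  proof (intro nn_integral_cong)
    fix s t
    have 1: "(\<Sum>a\<in>A. \<Sum>b\<in>B. s a * g (a, b) * t b) = (\<Sum>p\<in>A\<times>B. (s (fst p) * t (snd p)) * g p)" for g :: "_ \<Rightarrow> real"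
      by (auto simp: sum.cartesian_product split_beta' mult.assoc mult.commute[of "g _"] intro!: sum.cong)
    have 2: "(\<Sum>p\<in>A\<times>B. (s (fst p) * t (snd p))\<^sup>2) = (\<Sum>a\<in>A. (s a)\<^sup>2) * (\<Sum>b\<in>B. (t b)\<^sup>2)"
      by (simp add: sum_product sum.cartesian_product split_beta' power_mult_distrib)
    show "(\<integral>\<^sup>+g. ?f g s t \<partial>?G) = ennreal (gmom (2 * m)) * (ennreal ((\<Sum>a\<in>A. (s a)\<^sup>2) ^ m) * ennreal ((\<Sum>b\<in>B. (t b)\<^sup>2) ^ m))"
      unfolding 1 nn_integral_gauss_linear_power[OF finite_cartesian_product[OF fin]] 2
      by (simp add: power_mult_distrib ennreal_mult gmom_nonneg sum_nonneg)
  qed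
  also have "\<dots> = ennreal (gmom (2 * m)) * ((\<integral>\<^sup>+s. ennreal ((\<Sum>a\<in>A. (s a)\<^sup>2) ^ m) \<partial>gauss A) * (\<integral>\<^sup>+t. ennreal ((\<Sum>b\<in>B. (t b)\<^sup>2) ^ m) \<partial>gauss B))"
    by (simp add: nn_integral_cmult nn_integral_multc)
  also have "\<dots> \<le> ennreal (gmom (2 * m)) * (ennreal ((4 * real d) ^ m) * ennreal ((4 * real d) ^ m))"
    by (intro mult_left_mono mult_mono nn_integral_gauss_norm_power fin d) auto
  also have "\<dots> = ennreal (gmom (2 * m) * (4 * real d) ^ (2 * m))"
    by (simp add: ennreal_mult[symmetric] gmom_nonneg mult_2 power_add)
  finally show ?thesis .
qed

text \<open>The pattern of the Hermitian dilation: a rectangular matrix and its transpose placed off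
  the diagonal of a symmetric matrix, over the disjoint union of rows and columns.\<close>

definition bip :: "'a + 'b \<Rightarrow> 'a + 'b \<Rightarrow> ('a \<times> 'b) option" where
  "bip z y = (case (z, y) of (Inl a, Inr b) \<Rightarrow> Some (a, b) | (Inr b, Inl a) \<Rightarrow> Some (a, b) | _ \<Rightarrow> None)"

lemma bip_simps[simp]: "bip (Inl a) (Inr b) = Some (a, b)" "bip (Inr b) (Inl a) = Some (a, b)"
  "bip (Inl a) (Inl a') = None" "bip (Inr b) (Inr b') = None"
  by (simp_all add: bip_def)

lemma pattern_bip: "finite A \<Longrightarrow> finite B \<Longrightarrow> pattern (A <+> B) (A \<times> B) bip"
  by unfold_locales auto

text \<open>The Gaussian average bounds the operator norm of the dilation, and passing to the trace
  costs its dimension as a further factor.\<close>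

lemma tr_bip_le:
  assumes fin: "finite A" "finite B" and ne: "A \<noteq> {}" and m: "m > 0"
  shows "ennreal (tr (A <+> B) (mpow (A <+> B) (pat_mat bip g) (2 * m)))
    \<le> ennreal (real (card A + card B) / (gmom (2 * m))\<^sup>2) * bilin_moment A B m (\<lambda>a b. g (a, b))"
proof (cases "bilin_moment A B m (\<lambda>a b. g (a, b))")
  case (real r)
  interpret pattern "A <+> B" "A \<times> B" bip by (rule pattern_bip[OF fin])
  let ?g = "gmom (2 * m)"
  have g: "?g > 0" by (rule gmom_even_pos)
  \<comment> \<open>The bound on the squared operator norm that
    \<open>bilinear_le_bilin_moment\<close> yields after an \<open>m\<close>-th root.\<close>
  define c where "c = root m (r / ?g\<^sup>2)"
  have c: "c \<ge> 0" "c ^ m = r / ?g\<^sup>2" using real m by (auto simp: c_def)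
  have bil: "(\<Sum>a\<in>A. \<Sum>b\<in>B. v a * g (a, b) * w b)\<^sup>2 \<le> (\<Sum>a\<in>A. (v a)\<^sup>2) * (\<Sum>b\<in>B. (w b)\<^sup>2) * c" for v w
  proof -
    have "ennreal (?g\<^sup>2 * (\<Sum>a\<in>A. \<Sum>b\<in>B. v a * g (a, b) * w b) ^ (2 * m))
      \<le> ennreal (((\<Sum>a\<in>A. (v a)\<^sup>2) ^ m * (\<Sum>b\<in>B. (w b)\<^sup>2) ^ m) * r)"
      using bilinear_le_bilin_moment[OF fin, of m v "\<lambda>a b. g (a, b)" w] real by (simp add: ennreal_mult sum_nonneg)
    then have "?g\<^sup>2 * (\<Sum>a\<in>A. \<Sum>b\<in>B. v a * g (a, b) * w b) ^ (2 * m)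
      \<le> ((\<Sum>a\<in>A. (v a)\<^sup>2) ^ m * (\<Sum>b\<in>B. (w b)\<^sup>2) ^ m) * r"
      using real by (subst (asm) ennreal_le_iff) (auto simp: sum_nonneg)
    then have "(\<Sum>a\<in>A. \<Sum>b\<in>B. v a * g (a, b) * w b) ^ (2 * m)
      \<le> (\<Sum>a\<in>A. (v a)\<^sup>2) ^ m * (\<Sum>b\<in>B. (w b)\<^sup>2) ^ m * (r / ?g\<^sup>2)"
      using g by (simp add: field_simps)
    then have "((\<Sum>a\<in>A. \<Sum>b\<in>B. v a * g (a, b) * w b)\<^sup>2) ^ m \<le> ((\<Sum>a\<in>A. (v a)\<^sup>2) * (\<Sum>b\<in>B. (w b)\<^sup>2) * c) ^ m"
      unfolding power_mult_distrib c(2) power_mult .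
    moreover obtain m' where m': "m = Suc m'" using m by (cases m) auto
    moreover have "0 \<le> (\<Sum>a\<in>A. (v a)\<^sup>2) * (\<Sum>b\<in>B. (w b)\<^sup>2) * c" using c by (simp add: sum_nonneg)
    ultimately show ?thesis by (simp only: power_le_imp_le_base[of _ m'])
  qed
  \<comment> \<open>For the bilinear bound at \<open>v = G w\<close>, or at the transposed choice,
    where the squared norm in question stands on both sides.\<close>
  have self: "X \<le> Y * c" if "X\<^sup>2 \<le> X * Y * c" "X \<ge> 0" "Y \<ge> 0" for X Y
  proof (cases "X = 0")
    case False
    then have "X > 0" using that(2) by simp
    moreover have "X * X \<le> X * (Y * c)" using that(1) by (simp add: power2_eq_square mult.assoc)
    ultimately show ?thesis by simp
  qed (use that c in simp)
  have row: "(\<Sum>a\<in>A. (\<Sum>b\<in>B. g (a, b) * w b)\<^sup>2) \<le> (\<Sum>b\<in>B. (w b)\<^sup>2) * c" for w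
  proof (rule self)
    let ?v = "\<lambda>a. \<Sum>b\<in>B. g (a, b) * w b"
    have "(\<Sum>a\<in>A. \<Sum>b\<in>B. ?v a * g (a, b) * w b) = (\<Sum>a\<in>A. (?v a)\<^sup>2)"
      by (simp only: mult.assoc sum_distrib_left[symmetric] power2_eq_square)
    then show "(\<Sum>a\<in>A. (?v a)\<^sup>2)\<^sup>2 \<le> (\<Sum>a\<in>A. (?v a)\<^sup>2) * (\<Sum>b\<in>B. (w b)\<^sup>2) * c"
      using bil[of ?v w] by (simp only:)
  qed (rule sum_nonneg, rule zero_le_power2)+
  have col: "(\<Sum>b\<in>B. (\<Sum>a\<in>A. v a * g (a, b))\<^sup>2) \<le> (\<Sum>a\<in>A. (v a)\<^sup>2) * c" for v
  proof (rule self)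
    let ?w = "\<lambda>b. \<Sum>a\<in>A. v a * g (a, b)"
    have "(\<Sum>a\<in>A. \<Sum>b\<in>B. v a * g (a, b) * ?w b) = (\<Sum>b\<in>B. \<Sum>a\<in>A. v a * g (a, b) * ?w b)"
      by (rule sum.swap)
    also have "\<dots> = (\<Sum>b\<in>B. (?w b)\<^sup>2)"
      by (simp only: sum_distrib_right[symmetric] power2_eq_square)
    finally have "(\<Sum>b\<in>B. (?w b)\<^sup>2)\<^sup>2 \<le> (\<Sum>a\<in>A. (v a)\<^sup>2) * (\<Sum>b\<in>B. (?w b)\<^sup>2) * c"
      using bil[of v ?w] by (simp only:)
    then show "(\<Sum>b\<in>B. (?w b)\<^sup>2)\<^sup>2 \<le> (\<Sum>b\<in>B. (?w b)\<^sup>2) * (\<Sum>a\<in>A. (v a)\<^sup>2) * c"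
      by (simp only: mult.commute)
  qed (rule sum_nonneg, rule zero_le_power2)+
  have "tr (A <+> B) (mpow (A <+> B) (pat_mat bip g) (2 * m)) \<le> real (card (A <+> B)) * c ^ m"
  proof (rule tr_mpow_le)
    fix x :: "'a + 'b \<Rightarrow> real"
    have "(\<Sum>z\<in>A <+> B. (\<Sum>y\<in>A <+> B. pat_mat bip g z y * x y)\<^sup>2) = 
      (\<Sum>a\<in>A. (\<Sum>b\<in>B. g (a, b) * x (Inr b))\<^sup>2) + (\<Sum>b\<in>B. (\<Sum>a\<in>A. x (Inl a) * g (a, b))\<^sup>2)"
      using fin by (simp add: sum.Plus pat_mat_def mult.commute)
    also have "\<dots> \<le> c * (\<Sum>z\<in>A <+> B. (x z)\<^sup>2)"
      using fin row[of "\<lambda>b. x (Inr b)"] col[of "\<lambda>a. x (Inl a)"] by (simp add: sum.Plus algebra_simps)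
    finally show "(\<Sum>z\<in>A <+> B. (\<Sum>y\<in>A <+> B. pat_mat bip g z y * x y)\<^sup>2) \<le> c * (\<Sum>z\<in>A <+> B. (x z)\<^sup>2)" .
  qed (use c finZ pat_mat_sym in auto)
  also have "\<dots> = real (card A + card B) / ?g\<^sup>2 * r" by (simp add: c fin card_Plus)
  finally show ?thesis using real by (simp add: ennreal_mult[symmetric] ennreal_leI)
next
  case top
  \<comment> \<open>A nonempty \<open>A\<close> makes this factor positive, so that its product with
    the infinite moment is infinite.\<close>
  have "real (card A + card B) / (gmom (2 * m))\<^sup>2 > 0"
    using gmom_even_pos[of m] fin ne by (auto simp: card_gt_0_iff add_pos_nonneg)
  then have "ennreal (real (card A + card B) / (gmom (2 * m))\<^sup>2) \<noteq> 0" by (simp add: ennreal_eq_0_iff)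
  then show ?thesis using top by (simp add: ennreal_mult_top)
qed

text \<open>At order \<open>m = d\<close> every loss is a constant to the power \<open>d\<close>:
  the dimension is at most \<open>2 d \<le> 2^d\<close>, the norms contribute
  \<open>(16 d^2)^d\<close>, and the moment in the denominator is at least \<open>(d / 2)^d\<close>.
  Together they give \<open>64 d\<close> to the power \<open>d\<close>.\<close>

lemma F0_bip:
  assumes fin: "finite A" "finite B" and ne: "A \<noteq> {}" and d: "d > 0" "card A \<le> d" "card B \<le> d"
  shows "pattern.F0 (A <+> B) (A \<times> B) bip (2 * d) \<le> (64 * real d) ^ d"
proof -
  interpret pattern "A <+> B" "A \<times> B" bip by (rule pattern_bip[OF fin])
  let ?g = "gmom (2 * d)"
  have g: "?g > 0" by (rule gmom_even_pos)
  have nonneg: "tr (A <+> B) (mpow (A <+> B) (pat_mat bip g) (2 * d)) \<ge> 0" for g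
    using pat_mat_sym finZ by (subst tr_mpow_double) (auto intro!: sum_nonneg)
  have [measurable]: "(\<lambda>g. bilin_moment A B d (\<lambda>a b. g (a, b))) \<in> borel_measurable (gauss (A \<times> B))"
  proof -
    interpret A: prob_space "gauss A" by (rule prob_space_gauss)
    interpret B: prob_space "gauss B" by (rule prob_space_gauss)
    show ?thesis unfolding bilin_moment_def by measurable
  qed
  have "ennreal (F0 (2 * d)) = (\<integral>\<^sup>+g. ennreal (tr (A <+> B) (mpow (A <+> B) (pat_mat bip g) (2 * d))) \<partial>gauss (A \<times> B))"
    unfolding F0_def using integrable_tr_pat_mpow nonneg by (intro nn_integral_eq_integral[symmetric]) auto
  also have "\<dots> \<le> (\<integral>\<^sup>+g. ennreal (real (card A + card B) / ?g\<^sup>2) * bilin_moment A B d (\<lambda>a b. g (a, b)) \<partial>gauss (A \<times> B))"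
    using d by (intro nn_integral_mono tr_bip_le fin ne)
  also have "\<dots> = ennreal (real (card A + card B) / ?g\<^sup>2) * (\<integral>\<^sup>+g. bilin_moment A B d (\<lambda>a b. g (a, b)) \<partial>gauss (A \<times> B))"
    by (rule nn_integral_cmult) measurable
  also have "\<dots> \<le> ennreal (real (card A + card B) / ?g\<^sup>2) * ennreal (?g * (4 * real d) ^ (2 * d))"
    using d by (intro mult_left_mono bilin_moment_gauss fin) auto
  also have "\<dots> = ennreal (real (card A + card B) / ?g\<^sup>2 * (?g * (4 * real d) ^ (2 * d)))"
    using g by (intro ennreal_mult[symmetric]) auto
  finally have "F0 (2 * d) \<le> real (card A + card B) / ?g\<^sup>2 * (?g * (4 * real d) ^ (2 * d))"
    using g by (subst (asm) ennreal_le_iff) (auto intro!: mult_nonneg_nonneg)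
  also have "\<dots> = real (card A + card B) * ((16 * (real d)\<^sup>2) ^ d / ?g)"
  proof -
    have "(4 * real d) ^ (2 * d) = (16 * (real d)\<^sup>2) ^ d"
      unfolding power_mult by (simp add: power2_eq_square)
    then show ?thesis using g by (simp add: power2_eq_square)
  qed
  also have "\<dots> \<le> 2 ^ d * ((16 * (real d)\<^sup>2) ^ d / (real d / 2) ^ d)"
  proof (intro mult_mono divide_left_mono gmom_lower)
    have "2 * d \<le> 2 ^ d" using d(1)
    proof (induction d)
      case (Suc n)
      then show ?case using less_exp[of n] by (cases n) (auto simp: algebra_simps)
    qed simp
    then have "card A + card B \<le> 2 ^ d" using d by linarith
    then show "real (card A + card B) \<le> 2 ^ d" using of_nat_mono by fastforce
  qed (use d g in auto)
  also have "\<dots> = (2 * (16 * (real d)\<^sup>2) / (real d / 2)) ^ d"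
    unfolding power_divide[symmetric] times_divide_eq_right[symmetric] power_mult_distrib[symmetric] ..
  also have "2 * (16 * (real d)\<^sup>2) / (real d / 2) = 64 * real d"
    using d by (simp add: power2_eq_square)
  finally show ?thesis .
qed

text \<open>Decoupling: averaging over an independent copy and rotating the pair by 45 degrees turns
  a centred quadratic form into a bilinear form in independent Gaussian vectors.\<close>

lemma gauss_decoupling_tail:
  fixes tau :: "('s \<Rightarrow> real) \<Rightarrow> ('s \<Rightarrow> real) \<Rightarrow> ennreal"
  assumes fin: "finite S" and m: "m > 0" and s: "s > 0" and b: "b \<ge> 0"
    and meas: "case_prod tau \<in> borel_measurable (gauss S \<Otimes>\<^sub>M gauss S)"
    and bound: "(\<integral>\<^sup>+u. \<integral>\<^sup>+v. tau u v \<partial>gauss S \<partial>gauss S) \<le> ennreal b"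
    and Q: "\<And>k. k \<in> K \<Longrightarrow> integrable (gauss S) (\<lambda>x. Q x k)" "\<And>k. k \<in> K \<Longrightarrow> (\<integral>x. Q x k \<partial>gauss S) = 0"
    and w: "\<And>k. k \<in> K \<Longrightarrow> w k \<ge> 0"
    and tau: "\<And>k x y. k \<in> K \<Longrightarrow> ennreal ((Q y k - Q x k) ^ (2 * m))
      \<le> ennreal ((w k) ^ (2 * m) * 4 ^ m) * tau (\<lambda>s\<in>S. (x s + y s) / sqrt 2) (\<lambda>s\<in>S. (y s - x s) / sqrt 2)"
  shows "\<exists>E\<in>sets (gauss S). measure (gauss S) E \<le> 4 ^ m * b / s ^ (2 * m) \<and>
    (\<forall>x\<in>space (gauss S) - E. \<forall>k\<in>K. \<bar>Q x k\<bar> \<le> s * w k)"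
proof -
  interpret S: prob_space "gauss S" by (rule prob_space_gauss)
  let ?t = "\<lambda>x y. tau (\<lambda>s\<in>S. (x s + y s) / sqrt 2) (\<lambda>s\<in>S. (y s - x s) / sqrt 2)"
  have rm: "(\<lambda>p. ?t (fst p) (snd p)) \<in> borel_measurable (gauss S \<Otimes>\<^sub>M gauss S)"
  proof -
    have c: "(\<lambda>p. fst p s) \<in> borel_measurable (gauss S \<Otimes>\<^sub>M gauss S)" "(\<lambda>p. snd p s) \<in> borel_measurable (gauss S \<Otimes>\<^sub>M gauss S)" if "s \<in> S" for s
      using borel_measurable_gauss_component[OF that] by measurable
    have "(\<lambda>p. (\<lambda>s\<in>S. (fst p s + snd p s) / sqrt 2, \<lambda>s\<in>S. (snd p s - fst p s) / sqrt 2)) \<in> gauss S \<Otimes>\<^sub>M gauss S \<rightarrow>\<^sub>M gauss S \<Otimes>\<^sub>M gauss S"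
      using c by (intro measurable_Pair measurable_restrict) (auto cong: measurable_cong_sets)
    from measurable_compose[OF this meas] show ?thesis by simp
  qed
  define Psi where "Psi x = (\<integral>\<^sup>+y. ?t x y \<partial>gauss S)" for x
  have [measurable]: "Psi \<in> borel_measurable (gauss S)"
    unfolding Psi_def using rm by (intro S.borel_measurable_nn_integral) (simp add: split_beta')
  have "(\<integral>\<^sup>+x. Psi x \<partial>gauss S) = (\<integral>\<^sup>+u. \<integral>\<^sup>+v. tau u v \<partial>gauss S \<partial>gauss S)"
    unfolding Psi_def by (rule nn_integral_gauss_rotation[OF fin meas])
  then have PsiE: "(\<integral>\<^sup>+x. Psi x \<partial>gauss S) \<le> ennreal b" using bound by simp
  define c where "c = 4 ^ m / s ^ (2 * m)"
  have c: "c > 0" using s by (simp add: c_def)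
  \<comment> \<open>The set is defined through \<open>tau\<close> alone, before any \<open>k\<close>
    is chosen, so it serves all of \<open>K\<close> at once. Markov's inequality for
    \<open>Psi\<close> bounds its measure.\<close>
  define E where "E = {x \<in> space (gauss S). 1 \<le> ennreal c * Psi x}"
  have E: "E \<in> sets (gauss S)" unfolding E_def by measurable
  have "emeasure (gauss S) E \<le> ennreal c * (\<integral>\<^sup>+x. Psi x * indicator (space (gauss S)) x \<partial>gauss S)"
    unfolding E_def by (rule nn_integral_Markov_inequality) auto
  also have "\<dots> \<le> ennreal c * ennreal b"
  proof -
    have "(\<integral>\<^sup>+x. Psi x * indicator (space (gauss S)) x \<partial>gauss S) = (\<integral>\<^sup>+x. Psi x \<partial>gauss S)"
      by (intro nn_integral_cong) auto
    then show ?thesis using PsiE by (intro mult_left_mono) auto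
  qed
  finally have "emeasure (gauss S) E \<le> ennreal (c * b)" using c b by (simp add: ennreal_mult)
  then have "measure (gauss S) E \<le> c * b"
    using c b by (simp add: S.emeasure_eq_measure)
  moreover have "\<bar>Q x k\<bar> \<le> s * w k" if x: "x \<in> space (gauss S)" "x \<notin> E" and k: "k \<in> K" for x k
  proof -
    have Psi: "ennreal c * Psi x < 1" using x by (auto simp: E_def)
    have wk: "w k \<ge> 0" using w k by auto
    have mQ[measurable]: "(\<lambda>y. Q y k) \<in> borel_measurable (gauss S)" using Q(1)[OF k] by auto
    have le: "(\<integral>\<^sup>+y. ennreal ((Q y k - Q x k) ^ (2 * m)) \<partial>gauss S) \<le> ennreal ((w k * s) ^ (2 * m))"
    proof -
      have m1: "(\<lambda>y. ?t x y) \<in> borel_measurable (gauss S)"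
        using measurable_compose[OF measurable_Pair1'[OF x(1)] rm] by simp
      have "(\<integral>\<^sup>+y. ennreal ((Q y k - Q x k) ^ (2 * m)) \<partial>gauss S)
        \<le> (\<integral>\<^sup>+y. ennreal ((w k) ^ (2 * m) * 4 ^ m) * ?t x y \<partial>gauss S)"
        by (intro nn_integral_mono tau[OF k])
      also have "\<dots> = ennreal ((w k) ^ (2 * m) * 4 ^ m) * Psi x"
        unfolding Psi_def by (rule nn_integral_cmult[OF m1])
      also have "(w k) ^ (2 * m) * 4 ^ m = (w k * s) ^ (2 * m) * c"
        using s by (simp add: c_def power_mult_distrib)
      also have "ennreal ((w k * s) ^ (2 * m) * c) * Psi x = ennreal ((w k * s) ^ (2 * m)) * (ennreal c * Psi x)"
        using c by (simp add: ennreal_mult mult.assoc zero_le_even_power)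
      also have "\<dots> \<le> ennreal ((w k * s) ^ (2 * m)) * 1"
        using Psi by (intro mult_left_mono) auto
      finally show ?thesis by simp
    qed
    have int: "integrable (gauss S) (\<lambda>y. (Q y k - Q x k) ^ (2 * m))"
      using le by (intro integrableI_bounded) (auto simp: zero_le_even_power le_less_trans)
    \<comment> \<open>As \<open>Q y k\<close> has mean zero, averaging the difference over
      \<open>y\<close> leaves \<open>- Q x k\<close>; Jensen's inequality then passes to the moment
      of the difference.\<close>
    have "Q x k ^ (2 * m) = (\<integral>y. Q y k - Q x k \<partial>gauss S) ^ (2 * m)"
      using Q[OF k] by (simp add: S.prob_space)
    also have "\<dots> \<le> (\<integral>y. (Q y k - Q x k) ^ (2 * m) \<partial>gauss S)"
    proof (rule S.jensens_inequality[where I = UNIV and q = "\<lambda>z. z ^ (2 * m)"])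
      show "convex_on UNIV (\<lambda>z :: real. z ^ (2 * m))"
        by (rule convex_power_even) simp
    qed (use Q[OF k] int in auto)
    also have "\<dots> \<le> (w k * s) ^ (2 * m)"
    proof -
      have "ennreal (\<integral>y. (Q y k - Q x k) ^ (2 * m) \<partial>gauss S) \<le> ennreal ((w k * s) ^ (2 * m))"
        using le int by (subst nn_integral_eq_integral[symmetric]) (auto simp: zero_le_even_power)
      then show ?thesis by (subst (asm) ennreal_le_iff) (auto simp: zero_le_even_power)
    qed
    finally have "\<bar>Q x k\<bar> ^ (2 * m) \<le> (w k * s) ^ (2 * m)" by (simp add: power_even_abs)
    then show ?thesis
      using m wk s by (subst (asm) power_mono_iff) (auto simp: mult.commute)
  qed
  ultimately show ?thesis
    using E by (intro bexI[of _ E]) (auto simp: c_def)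
qed

section \<open>Quadratic forms in Gaussian vectors\<close>

lemma integral_gauss_product:
  assumes "finite S" "p \<in> S" "q \<in> S"
  shows "integrable (gauss S) (\<lambda>x. x p * x q)"
    and "(\<integral>x. x p * x q \<partial>gauss S) = (if p = q then 1 else 0)"
proof -
  have "integrable (gauss S) (\<lambda>x. prod_list (map x [p, q]))"
    using assms by (intro integrable_gauss_prod_list) auto
  then show "integrable (gauss S) (\<lambda>x. x p * x q)" by simp
  have "(\<integral>x. prod_list (map x [p, q]) \<partial>gauss S) = (\<Prod>s\<in>S. gmom (count_list [p, q] s))"
    using assms by (intro integral_gauss_prod_list) auto
  moreover have "gmom 1 = 0" "gmom 2 = 1" by (simp_all add: gmom_def fact_numeral)
  then have "(\<Prod>s\<in>S. gmom (count_list [p, q] s)) = (if p = q then 1 else 0)"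
    using assms by (auto intro!: prod_zero prod.neutral simp: numeral_2_eq_2)
  ultimately show "(\<integral>x. x p * x q \<partial>gauss S) = (if p = q then 1 else 0)" by simp
qed

lemma abs_add_power_le:
  fixes a b :: real
  assumes "a ^ (2 * m) \<le> c" "b ^ (2 * m) \<le> c" "m > 0"
  shows "(a + b) ^ (2 * m) \<le> 4 ^ m * c"
proof -
  let ?M = "max \<bar>a\<bar> \<bar>b\<bar>"
  have M: "?M ^ (2 * m) \<le> c" using assms by (auto simp: max_def power_even_abs)
  have "(a + b) ^ (2 * m) = \<bar>a + b\<bar> ^ (2 * m)" by (simp add: power_even_abs)
  also have "\<dots> \<le> (2 * ?M) ^ (2 * m)" by (intro power_mono) auto
  also have "\<dots> = 4 ^ m * ?M ^ (2 * m)" by (simp add: power_mult_distrib power_mult)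
  also have "\<dots> \<le> 4 ^ m * c" using M by (intro mult_left_mono) auto
  finally show ?thesis .
qed

section \<open>Mixed terms of two legs\<close>

definition sqnorm2 :: "'a set \<Rightarrow> ('a \<Rightarrow> 'a \<Rightarrow> real) \<Rightarrow> real" where
  "sqnorm2 A K = (\<Sum>a\<in>A. \<Sum>a'\<in>A. (K a a')\<^sup>2)"

lemma sqnorm2_nonneg: "sqnorm2 A K \<ge> 0" by (simp add: sqnorm2_def sum_nonneg)

text \<open>The sum over \<open>i\<close> of the inner products of \<open>u_i\<close> with
  \<open>(K \<otimes> L) v_i\<close>, kept bilinear in \<open>u\<close> and \<open>v\<close> so that
  decoupling can insert independent copies.\<close>

definition cross_form :: "'a set \<Rightarrow> 'b set \<Rightarrow> 'i set \<Rightarrow> (('a \<times> 'b) \<times> 'i \<Rightarrow> real) \<Rightarrow> (('a \<times> 'b) \<times> 'i \<Rightarrow> real) \<Rightarrow>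
    ('a \<Rightarrow> 'a \<Rightarrow> real) \<Rightarrow> ('b \<Rightarrow> 'b \<Rightarrow> real) \<Rightarrow> real" where
  "cross_form A B I u v K L =
    (\<Sum>i\<in>I. \<Sum>a\<in>A. \<Sum>a'\<in>A. \<Sum>b\<in>B. \<Sum>b'\<in>B. u ((a, b), i) * K a a' * L b b' * v ((a', b'), i))"

lemma cross_form_add_left: "cross_form A B I (\<lambda>p. u p + u' p) v K L = cross_form A B I u v K L + cross_form A B I u' v K L"
  by (simp add: cross_form_def sum.distrib ring_distribs)

lemma cross_form_diff_left: "cross_form A B I (\<lambda>p. u p - u' p) v K L = cross_form A B I u v K L - cross_form A B I u' v K L"
  by (simp add: cross_form_def sum_subtractf ring_distribs)

lemma cross_form_add_right: "cross_form A B I u (\<lambda>p. v p + v' p) K L = cross_form A B I u v K L + cross_form A B I u v' K L"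
  by (simp add: cross_form_def sum.distrib ring_distribs)

lemma cross_form_diff_right: "cross_form A B I u (\<lambda>p. v p - v' p) K L = cross_form A B I u v K L - cross_form A B I u v' K L"
  by (simp add: cross_form_def sum_subtractf ring_distribs)

lemma cross_form_divide: "cross_form A B I (\<lambda>p. u p / c) (\<lambda>p. v p / c') K L = cross_form A B I u v K L / (c * c')"
  by (simp add: cross_form_def sum_divide_distrib)

lemma cross_form_cong:
  assumes "\<And>p. p \<in> (A \<times> B) \<times> I \<Longrightarrow> u p = u' p" "\<And>p. p \<in> (A \<times> B) \<times> I \<Longrightarrow> v p = v' p"
  shows "cross_form A B I u v K L = cross_form A B I u' v' K L"
  unfolding cross_form_def using assms by (intro sum.cong refl) auto

text \<open>\<open>K\<close> and \<open>L\<close> are not symmetric, so decoupling produces the form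
  in both orders. Transposing both matrices reduces the reversed order to the first, and
  \<open>sqnorm2\<close> does not change.\<close>

lemma cross_form_swap:
  "cross_form A B I v u K L = cross_form A B I u v (\<lambda>a a'. K a' a) (\<lambda>b b'. L b' b)"
proof -
  have "cross_form A B I v u K L = (\<Sum>i\<in>I. \<Sum>a'\<in>A. \<Sum>a\<in>A. \<Sum>b\<in>B. \<Sum>b'\<in>B. v ((a, b), i) * K a a' * L b b' * u ((a', b'), i))"
    unfolding cross_form_def by (intro sum.cong refl sum.swap)
  also have "\<dots> = (\<Sum>i\<in>I. \<Sum>a'\<in>A. \<Sum>a\<in>A. \<Sum>b'\<in>B. \<Sum>b\<in>B. v ((a, b), i) * K a a' * L b b' * u ((a', b'), i))"
    by (intro sum.cong refl sum.swap)
  finally show ?thesis by (simp add: cross_form_def mult_ac)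
qed

lemma sqnorm2_transpose: "sqnorm2 A (\<lambda>a a'. K a' a) = sqnorm2 A K"
  unfolding sqnorm2_def by (rule sum.swap)

text \<open>In the sum of the two orders the products of \<open>x\<close> with \<open>y\<close>
  cancel: a difference of squares for a product that does not commute.\<close>

lemma cross_form_rotate:
  assumes x: "\<And>p. p \<in> (A \<times> B) \<times> I \<Longrightarrow> u p = (x p + y p) / sqrt 2" "\<And>p. p \<in> (A \<times> B) \<times> I \<Longrightarrow> v p = (y p - x p) / sqrt 2"
  shows "cross_form A B I u v K L + cross_form A B I v u K L = cross_form A B I y y K L - cross_form A B I x x K L"
proof -
  have "cross_form A B I u v K L = cross_form A B I (\<lambda>p. (x p + y p) / sqrt 2) (\<lambda>p. (y p - x p) / sqrt 2) K L"
    "cross_form A B I v u K L = cross_form A B I (\<lambda>p. (y p - x p) / sqrt 2) (\<lambda>p. (x p + y p) / sqrt 2) K L"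
    by (intro cross_form_cong x; assumption)+
  then show ?thesis
    by (simp add: cross_form_divide cross_form_add_left cross_form_diff_left cross_form_add_right cross_form_diff_right field_simps)
qed

context
  fixes A :: "'a set" and B :: "'b set" and I :: "'i set"
  assumes fin: "finite A" "finite B" "finite I"
begin

interpretation pattern "A <+> B" "A \<times> B" bip
  by (rule pattern_bip[OF fin(1,2)])

definition cross_tau :: "nat \<Rightarrow> (('a \<times> 'b) \<times> 'i \<Rightarrow> real) \<Rightarrow> (('a \<times> 'b) \<times> 'i \<Rightarrow> real) \<Rightarrow> real" where
  "cross_tau m u v = tr ((A <+> B) \<times> (A <+> B)) (mpow ((A <+> B) \<times> (A <+> B)) (tens I u v) (2 * m))"

text \<open>The roles are exchanged: \<open>K\<close> and \<open>L\<close> become vectors, and the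
  form becomes a matrix element of the tensor sum of the dilations. \<open>U\<close> lives on pairs
  of row indices, \<open>W\<close> on pairs of column indices, and between these two blocks the
  tensor sum has the entries \<open>\<Sum>_i u_i(a, b) v_i(a', b')\<close>.\<close>

lemma cross_form_le:
  assumes m: "m > 0"
  shows "cross_form A B I u v K L ^ (2 * m) \<le> sqnorm2 A K ^ m * sqnorm2 B L ^ m * cross_tau m u v"
proof -
  let ?Z = "A <+> B"
  define U where "U p = (case p of (Inl a, Inl a') \<Rightarrow> K a a' | _ \<Rightarrow> 0)" for p :: "('a + 'b) \<times> ('a + 'b)"
  define W where "W p = (case p of (Inr b, Inr b') \<Rightarrow> L b b' | _ \<Rightarrow> 0)" for p :: "('a + 'b) \<times> ('a + 'b)"
  have [simp]: "U (Inl a, Inl a') = K a a'" "U (Inl a, Inr b) = 0" "U (Inr b, y) = 0" 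
    "W (Inr b, Inr b') = L b b'" "W (Inl a, y) = 0" "W (Inr b, Inl a) = 0" for a a' b b' y
    by (simp_all add: U_def W_def)
  have "(\<Sum>p\<in>?Z\<times>?Z. \<Sum>q\<in>?Z\<times>?Z. U p * tens I u v p q * W q) ^ (2 * m)
    \<le> (\<Sum>p\<in>?Z\<times>?Z. (U p)\<^sup>2) ^ m * (\<Sum>p\<in>?Z\<times>?Z. (W p)\<^sup>2) ^ m * cross_tau m u v"
    unfolding cross_tau_def using finZ m by (intro bilinear_le_tr_mpow tens_sym) auto
  also have "(\<Sum>p\<in>?Z\<times>?Z. (U p)\<^sup>2) = sqnorm2 A K"
    using fin by (simp add: sum.cartesian_product[symmetric, where g = "\<lambda>x y. (U (x, y))\<^sup>2", simplified split_beta' prod.collapse] sum.Plus sqnorm2_def)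
  also have "(\<Sum>p\<in>?Z\<times>?Z. (W p)\<^sup>2) = sqnorm2 B L"
    using fin by (simp add: sum.cartesian_product[symmetric, where g = "\<lambda>x y. (W (x, y))\<^sup>2", simplified split_beta' prod.collapse] sum.Plus sqnorm2_def)
  also have "(\<Sum>p\<in>?Z\<times>?Z. \<Sum>q\<in>?Z\<times>?Z. U p * tens I u v p q * W q) = 
      (\<Sum>z\<in>?Z. \<Sum>z'\<in>?Z. \<Sum>y\<in>?Z. \<Sum>y'\<in>?Z. U (z, z') * tens I u v (z, z') (y, y') * W (y, y'))"
    by (simp add: sum.cartesian_product')
  also have "\<dots> = (\<Sum>a\<in>A. \<Sum>a'\<in>A. \<Sum>b\<in>B. \<Sum>b'\<in>B. K a a' * (\<Sum>i\<in>I. u ((a, b), i) * v ((a', b'), i)) * L b b')"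
    using fin by (simp add: sum.Plus pat_mat_def)
  also have "\<dots> = (\<Sum>a\<in>A. \<Sum>a'\<in>A. \<Sum>b\<in>B. \<Sum>b'\<in>B. \<Sum>i\<in>I. u ((a, b), i) * K a a' * L b b' * v ((a', b'), i))"
    by (auto simp: sum_distrib_left sum_distrib_right mult_ac intro!: sum.cong)
  also have "\<dots> = cross_form A B I u v K L"
    unfolding cross_form_def by (simp only: sum.swap[of _ I])
  finally show ?thesis .
qed

text \<open>The mean of the form is \<open>card I\<close> times the product of the two traces, so
  the trace condition centres it. The moment bound \<open>card I ^ d * (64 d) ^ (2 d)\<close> and
  the factor \<open>4 ^ d\<close> from decoupling combine to the numerator
  \<open>128 sqrt (card I) d\<close>.\<close>

theorem cross_form_tail:
  assumes ne: "A \<noteq> {}" "I \<noteq> {}" and d: "d > 0" "card A \<le> d" "card B \<le> d" and s: "s > 0"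
  shows "\<exists>E\<in>sets (gauss ((A \<times> B) \<times> I)).
    measure (gauss ((A \<times> B) \<times> I)) E \<le> (128 * sqrt (card I) * d / s) ^ (2 * d) \<and>
    (\<forall>x\<in>space (gauss ((A \<times> B) \<times> I)) - E. \<forall>K L. (\<Sum>a\<in>A. K a a) * (\<Sum>b\<in>B. L b b) = 0 \<longrightarrow>
      \<bar>cross_form A B I x x K L\<bar> \<le> s * sqrt (sqnorm2 A K * sqnorm2 B L))"
proof -
  let ?S = "(A \<times> B) \<times> I"
  let ?N = "real (card I)"
  let ?F = "F0 (2 * d)"
  have finS: "finite ?S" using fin by simp
  have F: "0 \<le> ?F" "?F \<le> (64 * real d) ^ d"
    using F0_bip[OF fin(1,2) ne(1) d] F_bounds[OF fin(3), of _ "2 * d"] F0_def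
    by (auto simp: F0_def tr_mpow_double[OF finZ pat_mat_sym] intro!: Bochner_Integration.integral_nonneg sum_nonneg)
  define b where "b = ?N ^ d * ((64 * real d) ^ d)\<^sup>2"
  have b: "b \<ge> 0" by (simp add: b_def)
  have meas: "case_prod (\<lambda>u v. ennreal (cross_tau d u v)) \<in> borel_measurable (gauss ?S \<Otimes>\<^sub>M gauss ?S)"
  proof -
    have 1: "(\<lambda>x. tr (A <+> B) (pat_word (A <+> B) bip x is)) \<in> borel_measurable (gauss ?S)" if "is \<in> words I (2 * d)" for "is"
      using integrable_tr_pat_word[OF fin(3) that] by auto
    have 2: "cross_tau d u v = (\<Sum>is\<in>words I (2 * d). tr (A <+> B) (pat_word (A <+> B) bip u is) * tr (A <+> B) (pat_word (A <+> B) bip v is))" for u v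
      unfolding cross_tau_def by (rule tr_mpow_tensor[OF fin(3) finZ])
    show ?thesis
      unfolding split_beta' 2 using 1
      by (intro measurable_compose[OF _ measurable_ennreal] borel_measurable_sum borel_measurable_times)
        (auto intro: measurable_compose[OF measurable_fst] measurable_compose[OF measurable_snd])
  qed
  have bound: "(\<integral>\<^sup>+u. \<integral>\<^sup>+v. ennreal (cross_tau d u v) \<partial>gauss ?S \<partial>gauss ?S) \<le> ennreal b"
  proof -
    have "(\<integral>\<^sup>+u. \<integral>\<^sup>+v. ennreal (cross_tau d u v) \<partial>gauss ?S \<partial>gauss ?S) \<le> ennreal (?N ^ d * ?F\<^sup>2)"
      unfolding cross_tau_def by (rule tensor_trace_moment[OF fin(3) ne(2)])
    also have "\<dots> \<le> ennreal b"
      unfolding b_def using F by (intro ennreal_leI mult_left_mono power_mono) auto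
    finally show ?thesis .
  qed
  let ?KL = "{(K, L). (\<Sum>a\<in>A. K a a) * (\<Sum>b\<in>B. L b b) = (0 :: real)}"
  let ?Q = "\<lambda>x (K, L). cross_form A B I x x K L"
  let ?w = "\<lambda>(K, L). sqrt (sqnorm2 A K * sqnorm2 B L)"
  have "\<exists>E\<in>sets (gauss ?S). measure (gauss ?S) E \<le> 4 ^ d * b / s ^ (2 * d) \<and>
    (\<forall>x\<in>space (gauss ?S) - E. \<forall>k\<in>?KL. \<bar>?Q x k\<bar> \<le> s * ?w k)"
  proof (rule gauss_decoupling_tail[OF finS d(1) s b meas bound])
    fix k assume "k \<in> ?KL"
    then obtain K L where k: "k = (K, L)" and KL: "(\<Sum>a\<in>A. K a a) * (\<Sum>b\<in>B. L b b) = 0" by auto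
    have tm: "integrable (gauss ?S) (\<lambda>x. x ((a, b), i) * K a a' * L b b' * x ((a', b'), i))"
      "(\<integral>x. x ((a, b), i) * K a a' * L b b' * x ((a', b'), i) \<partial>gauss ?S) = (if a = a' then if b = b' then K a a' * L b b' else 0 else 0)"
      if "a \<in> A" "a' \<in> A" "b \<in> B" "b' \<in> B" "i \<in> I" for a a' b b' i
      using integral_gauss_product[OF finS, of "((a, b), i)" "((a', b'), i)"] that
      by (simp_all add: mult_ac)
    show "integrable (gauss ?S) (\<lambda>x. ?Q x k)"
      unfolding k cross_form_def prod.case using tm by (intro Bochner_Integration.integrable_sum) auto
    have "(\<integral>x. ?Q x k \<partial>gauss ?S) = (\<Sum>i\<in>I. \<Sum>a\<in>A. \<Sum>a'\<in>A. \<Sum>b\<in>B. \<Sum>b'\<in>B. 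
        if a = a' then if b = b' then K a a' * L b b' else 0 else 0)"
      unfolding k cross_form_def prod.case using tm by simp
    also have "\<dots> = (\<Sum>i\<in>I. \<Sum>a\<in>A. \<Sum>b\<in>B. K a a * L b b)"
    proof (intro sum.cong refl)
      fix a assume "a \<in> A"
      have "(\<Sum>a'\<in>A. \<Sum>b\<in>B. \<Sum>b'\<in>B. if a = a' then if b = b' then K a a' * L b b' else 0 else 0)
        = (\<Sum>a'\<in>A. if a = a' then \<Sum>b\<in>B. K a a' * L b b else 0)"
        using fin by (intro sum.cong refl) simp
      also have "\<dots> = (\<Sum>b\<in>B. K a a * L b b)"
        using fin \<open>a \<in> A\<close> by simp
      finally show "(\<Sum>a'\<in>A. \<Sum>b\<in>B. \<Sum>b'\<in>B. if a = a' then if b = b' then K a a' * L b b' else 0 else 0)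
        = (\<Sum>b\<in>B. K a a * L b b)" .
    qed
    also have "\<dots> = 0" using KL by (simp add: sum_product[symmetric])
    finally show "(\<integral>x. ?Q x k \<partial>gauss ?S) = 0" .
    show "?w k \<ge> 0" by (simp add: k sqnorm2_nonneg)
    fix x y
    let ?u = "\<lambda>s\<in>?S. (x s + y s) / sqrt 2" and ?v = "\<lambda>s\<in>?S. (y s - x s) / sqrt 2"
    have eq: "?Q y k - ?Q x k = cross_form A B I ?u ?v K L + cross_form A B I ?v ?u K L"
      unfolding k prod.case by (rule cross_form_rotate[symmetric]) auto
    have w2: "?w k ^ (2 * d) = sqnorm2 A K ^ d * sqnorm2 B L ^ d"
      by (simp add: k power_mult sqnorm2_nonneg power_mult_distrib)
    have "cross_form A B I ?v ?u K L ^ (2 * d) \<le> sqnorm2 A K ^ d * sqnorm2 B L ^ d * cross_tau d ?u ?v"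
      using cross_form_le[OF d(1), of ?u ?v "\<lambda>a a'. K a' a" "\<lambda>b b'. L b' b"]
      unfolding cross_form_swap[of A B I ?v ?u K L] sqnorm2_transpose[of A K] sqnorm2_transpose[of B L] .
    then have "(?Q y k - ?Q x k) ^ (2 * d) \<le> 4 ^ d * (?w k ^ (2 * d) * cross_tau d ?u ?v)"
      unfolding eq w2 by (intro abs_add_power_le cross_form_le d(1))
    then have "ennreal ((?Q y k - ?Q x k) ^ (2 * d)) \<le> ennreal ((?w k ^ (2 * d) * 4 ^ d) * cross_tau d ?u ?v)"
      by (intro ennreal_leI) (simp add: mult_ac)
    also have "\<dots> = ennreal (?w k ^ (2 * d) * 4 ^ d) * ennreal (cross_tau d ?u ?v)"
      unfolding w2 by (intro ennreal_mult') (simp add: sqnorm2_nonneg)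
    finally show "ennreal ((?Q y k - ?Q x k) ^ (2 * d)) \<le> ennreal (?w k ^ (2 * d) * 4 ^ d) * ennreal (cross_tau d ?u ?v)" .
  qed
  moreover have "4 ^ d * b / s ^ (2 * d) = (128 * sqrt (card I) * d / s) ^ (2 * d)"
  proof -
    have "(128 * sqrt (card I) * d / s) ^ (2 * d) = ((128 * sqrt (card I) * d / s)\<^sup>2) ^ d" by (rule power_mult)
    also have "(128 * sqrt (card I) * d / s)\<^sup>2 = 4 * ?N * (64 * real d)\<^sup>2 / s\<^sup>2"
      by (simp add: power2_eq_square)
    also have "\<dots> ^ d = 4 ^ d * (?N ^ d * ((64 * real d)\<^sup>2) ^ d) / s ^ (2 * d)"
      by (simp only: power_mult power_mult_distrib power_divide mult.assoc)
    also have "((64 * real d)\<^sup>2) ^ d = ((64 * real d) ^ d)\<^sup>2"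
      by (simp only: power_mult[symmetric] mult.commute)
    finally show ?thesis by (simp only: b_def)
  qed
  ultimately show ?thesis by (auto simp: Ball_def)
qed

end

section \<open>Wishart matrices\<close>

lemma wishart_moment:
  assumes fin: "finite A" "finite I" and d: "card A \<le> d" "m \<le> d" "m \<le> card I"
  shows "(\<integral>\<^sup>+u. \<integral>\<^sup>+v. bilin_moment A A m (\<lambda>a a'. \<Sum>i\<in>I. u (i, a) * v (i, a')) \<partial>gauss (I \<times> A) \<partial>gauss (I \<times> A))
    \<le> ennreal (gmom (2 * m) * (4 * real (card I)) ^ m * (4 * real d) ^ (2 * m))"
proof -
  let ?G = "gauss (I \<times> A)"
  let ?N = "real (card I)"
  interpret A: prob_space "gauss A" by (rule prob_space_gauss)
  interpret G: prob_space ?G by (rule prob_space_gauss)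
  interpret AG: pair_prob_space "gauss A" ?G by standard
  let ?f = "\<lambda>u v s t. ennreal ((\<Sum>a\<in>A. \<Sum>a'\<in>A. s a * (\<Sum>i\<in>I. u (i, a) * v (i, a')) * t a') ^ (2 * m))"
  have "(\<integral>\<^sup>+u. \<integral>\<^sup>+v. bilin_moment A A m (\<lambda>a a'. \<Sum>i\<in>I. u (i, a) * v (i, a')) \<partial>?G \<partial>?G)
    = (\<integral>\<^sup>+u. \<integral>\<^sup>+v. \<integral>\<^sup>+s. \<integral>\<^sup>+t. ?f u v s t \<partial>gauss A \<partial>gauss A \<partial>?G \<partial>?G)"
    by (simp add: bilin_moment_def)
  also have "\<dots> = (\<integral>\<^sup>+u. \<integral>\<^sup>+s. \<integral>\<^sup>+v. \<integral>\<^sup>+t. ?f u v s t \<partial>gauss A \<partial>?G \<partial>gauss A \<partial>?G)"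
    by (intro nn_integral_cong AG.Fubini') measurable
  also have "\<dots> = (\<integral>\<^sup>+s. \<integral>\<^sup>+u. \<integral>\<^sup>+v. \<integral>\<^sup>+t. ?f u v s t \<partial>gauss A \<partial>?G \<partial>?G \<partial>gauss A)"
    by (intro AG.Fubini') measurable
  also have "\<dots> = (\<integral>\<^sup>+s. \<integral>\<^sup>+u. \<integral>\<^sup>+t. \<integral>\<^sup>+v. ?f u v s t \<partial>?G \<partial>gauss A \<partial>?G \<partial>gauss A)"
    by (intro nn_integral_cong AG.Fubini') measurable
  \<comment> \<open>Given \<open>s\<close>, \<open>t\<close> and \<open>u\<close> the form is linear
    in \<open>v\<close>. What is left depends on \<open>u\<close> through one linear combination per
    \<open>i\<close> with coefficients \<open>s\<close>; once \<open>s\<close> is normalised, these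
    are independent standard normal variables.\<close>
  also have "\<dots> = (\<integral>\<^sup>+s. \<integral>\<^sup>+u. \<integral>\<^sup>+t. ennreal (gmom (2 * m)) * (ennreal ((\<Sum>i\<in>I. (\<Sum>a\<in>A. s a * u (i, a))\<^sup>2) ^ m) * ennreal ((\<Sum>a\<in>A. (t a)\<^sup>2) ^ m)) \<partial>gauss A \<partial>?G \<partial>gauss A)"
  proof (intro nn_integral_cong)
    fix s t :: "'a \<Rightarrow> real" and u :: "'b \<times> 'a \<Rightarrow> real"
    have 1: "(\<Sum>a\<in>A. \<Sum>a'\<in>A. s a * (\<Sum>i\<in>I. u (i, a) * v (i, a')) * t a')
      = (\<Sum>p\<in>I\<times>A. ((\<Sum>a\<in>A. s a * u (fst p, a)) * t (snd p)) * v p)" for v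
    proof -
      have "(\<Sum>a\<in>A. \<Sum>a'\<in>A. s a * (\<Sum>i\<in>I. u (i, a) * v (i, a')) * t a')
        = (\<Sum>a\<in>A. \<Sum>a'\<in>A. \<Sum>i\<in>I. s a * u (i, a) * t a' * v (i, a'))"
        by (simp add: sum_distrib_left sum_distrib_right mult_ac)
      also have "\<dots> = (\<Sum>i\<in>I. \<Sum>a\<in>A. \<Sum>a'\<in>A. s a * u (i, a) * t a' * v (i, a'))"
        by (simp only: sum.swap[of _ I])
      also have "\<dots> = (\<Sum>i\<in>I. \<Sum>a'\<in>A. \<Sum>a\<in>A. s a * u (i, a) * t a' * v (i, a'))"
        by (intro sum.cong refl sum.swap)
      finally show ?thesis by (simp add: sum.cartesian_product' sum_distrib_right)
    qed
    have 2: "(\<Sum>p\<in>I\<times>A. ((\<Sum>a\<in>A. s a * u (fst p, a)) * t (snd p))\<^sup>2) = (\<Sum>i\<in>I. (\<Sum>a\<in>A. s a * u (i, a))\<^sup>2) * (\<Sum>a\<in>A. (t a)\<^sup>2)"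
      by (simp add: sum_product sum.cartesian_product' power_mult_distrib)
    show "(\<integral>\<^sup>+v. ?f u v s t \<partial>?G) = ennreal (gmom (2 * m)) * (ennreal ((\<Sum>i\<in>I. (\<Sum>a\<in>A. s a * u (i, a))\<^sup>2) ^ m) * ennreal ((\<Sum>a\<in>A. (t a)\<^sup>2) ^ m))"
      unfolding 1 nn_integral_gauss_linear_power[OF finite_cartesian_product[OF fin(2,1)]] 2
      by (simp add: power_mult_distrib ennreal_mult gmom_nonneg sum_nonneg)
  qed
  also have "\<dots> = ennreal (gmom (2 * m)) * ((\<integral>\<^sup>+s. \<integral>\<^sup>+u. ennreal ((\<Sum>i\<in>I. (\<Sum>a\<in>A. s a * u (i, a))\<^sup>2) ^ m) \<partial>?G \<partial>gauss A) * (\<integral>\<^sup>+t. ennreal ((\<Sum>a\<in>A. (t a)\<^sup>2) ^ m) \<partial>gauss A))"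
    by (simp add: nn_integral_cmult nn_integral_multc)
  also have "\<dots> \<le> ennreal (gmom (2 * m)) * ((\<integral>\<^sup>+s. ennreal ((4 * ?N) ^ m) * ennreal ((\<Sum>a\<in>A. (s a)\<^sup>2) ^ m) \<partial>gauss A) * ennreal ((4 * real d) ^ m))"
  proof (intro mult_left_mono mult_mono nn_integral_mono)
    show "(\<integral>\<^sup>+t. ennreal ((\<Sum>a\<in>A. (t a)\<^sup>2) ^ m) \<partial>gauss A) \<le> ennreal ((4 * real d) ^ m)"
      by (intro nn_integral_gauss_norm_power fin d)
    fix s :: "'a \<Rightarrow> real"
    let ?q = "\<Sum>a\<in>A. (s a)\<^sup>2"
    show "(\<integral>\<^sup>+u. ennreal ((\<Sum>i\<in>I. (\<Sum>a\<in>A. s a * u (i, a))\<^sup>2) ^ m) \<partial>?G) \<le> ennreal ((4 * ?N) ^ m) * ennreal (?q ^ m)"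
    proof (cases "?q = 0")
      case True
      then have "s a = 0" if "a \<in> A" for a using that fin by (simp add: sum_nonneg_eq_0_iff)
      then show ?thesis by (cases "m = 0") (auto simp: G.emeasure_space_1 power_0_left)
    next
      case False
      then have q: "?q > 0" using sum_nonneg[of A "\<lambda>a. (s a)\<^sup>2"] by (simp add: order_less_le)
      have "(\<integral>\<^sup>+u. ennreal ((\<Sum>i\<in>I. (\<Sum>a\<in>A. s a * u (i, a))\<^sup>2) ^ m) \<partial>?G)
        = (\<integral>\<^sup>+u. (\<lambda>y. ennreal (?q ^ m) * ennreal ((\<Sum>i\<in>I. (y i)\<^sup>2) ^ m)) (\<lambda>i\<in>I. \<Sum>a\<in>A. (s a / sqrt ?q) * u (i, a)) \<partial>?G)"
      proof (intro nn_integral_cong)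
        fix u :: "'b \<times> 'a \<Rightarrow> real"
        have "(\<Sum>a\<in>A. (s a / sqrt ?q) * u (i, a)) = (\<Sum>a\<in>A. s a * u (i, a)) / sqrt ?q" for i
          by (simp add: sum_divide_distrib)
        then have "(\<Sum>i\<in>I. (\<Sum>a\<in>A. s a * u (i, a))\<^sup>2) = ?q * (\<Sum>i\<in>I. ((\<lambda>i\<in>I. \<Sum>a\<in>A. (s a / sqrt ?q) * u (i, a)) i)\<^sup>2)"
          using q by (simp add: power_divide sum_divide_distrib[symmetric])
        then show "ennreal ((\<Sum>i\<in>I. (\<Sum>a\<in>A. s a * u (i, a))\<^sup>2) ^ m) = 
          (\<lambda>y. ennreal (?q ^ m) * ennreal ((\<Sum>i\<in>I. (y i)\<^sup>2) ^ m)) (\<lambda>i\<in>I. \<Sum>a\<in>A. (s a / sqrt ?q) * u (i, a))"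
          using q by (simp only: power_mult_distrib) (subst ennreal_mult, auto simp: sum_nonneg)
      qed
      also have "\<dots> = (\<integral>\<^sup>+y. ennreal (?q ^ m) * ennreal ((\<Sum>i\<in>I. (y i)\<^sup>2) ^ m) \<partial>gauss I)"
        using q by (intro nn_integral_gauss_rows fin) (auto simp: power_divide sum_divide_distrib[symmetric])
      also have "\<dots> = ennreal (?q ^ m) * (\<integral>\<^sup>+y. ennreal ((\<Sum>i\<in>I. (y i)\<^sup>2) ^ m) \<partial>gauss I)"
        by (rule nn_integral_cmult) measurable
      also have "\<dots> \<le> ennreal (?q ^ m) * ennreal ((4 * ?N) ^ m)"
        by (intro mult_left_mono nn_integral_gauss_norm_power fin d) auto
      finally show ?thesis by (simp add: mult.commute)
    qed
  qed auto
  also have "\<dots> = ennreal (gmom (2 * m)) * ((ennreal ((4 * ?N) ^ m) * (\<integral>\<^sup>+s. ennreal ((\<Sum>a\<in>A. (s a)\<^sup>2) ^ m) \<partial>gauss A)) * ennreal ((4 * real d) ^ m))"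
    by (simp add: nn_integral_cmult)
  also have "\<dots> \<le> ennreal (gmom (2 * m)) * ((ennreal ((4 * ?N) ^ m) * ennreal ((4 * real d) ^ m)) * ennreal ((4 * real d) ^ m))"
    by (intro mult_left_mono mult_right_mono nn_integral_gauss_norm_power fin d) auto
  also have "\<dots> = ennreal (gmom (2 * m) * (((4 * ?N) ^ m * (4 * real d) ^ m) * (4 * real d) ^ m))"
    by (simp add: ennreal_mult gmom_nonneg del: power_mult_distrib)
  finally show ?thesis by (simp add: mult_2 power_add mult.assoc)
qed

definition gram_form :: "'a set \<Rightarrow> 'i set \<Rightarrow> ('i \<times> 'a \<Rightarrow> real) \<Rightarrow> ('i \<times> 'a \<Rightarrow> real) \<Rightarrow> ('a \<Rightarrow> real) \<Rightarrow> real" where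
  "gram_form A I u v k = (\<Sum>a\<in>A. \<Sum>a'\<in>A. k a * (\<Sum>i\<in>I. u (i, a) * v (i, a')) * k a')"

lemma gram_form_eq: "gram_form A I u v k = (\<Sum>i\<in>I. (\<Sum>a\<in>A. k a * u (i, a)) * (\<Sum>a\<in>A. k a * v (i, a)))"
proof -
  have "gram_form A I u v k = (\<Sum>a\<in>A. \<Sum>a'\<in>A. \<Sum>i\<in>I. (k a * u (i, a)) * (k a' * v (i, a')))"
    by (simp add: gram_form_def sum_distrib_left sum_distrib_right mult_ac)
  also have "\<dots> = (\<Sum>i\<in>I. \<Sum>a\<in>A. \<Sum>a'\<in>A. (k a * u (i, a)) * (k a' * v (i, a')))"
    by (simp only: sum.swap[of _ I])
  finally show ?thesis by (simp add: sum_product)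
qed

text \<open>The unknown is a single vector \<open>k\<close> here, so after decoupling the averages
  of \<open>bilin_moment\<close> control the form directly, in place of trace moments. The
  assumption \<open>d \<le> card I\<close> is what the norm moment in dimension
  \<open>card I\<close> asks for.\<close>

theorem gram_form_tail:
  assumes fin: "finite A" "finite I" and d: "d > 0" "card A \<le> d" "d \<le> card I" and s: "s > 0"
  shows "\<exists>E\<in>sets (gauss (I \<times> A)).
    measure (gauss (I \<times> A)) E \<le> (23 * sqrt (card I) * sqrt d / s) ^ (2 * d) \<and>
    (\<forall>x\<in>space (gauss (I \<times> A)) - E. \<forall>k :: 'a \<Rightarrow> real.
      \<bar>(\<Sum>i\<in>I. (\<Sum>a\<in>A. k a * x (i, a))\<^sup>2) - card I * (\<Sum>a\<in>A. (k a)\<^sup>2)\<bar> \<le> s * (\<Sum>a\<in>A. (k a)\<^sup>2))"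
proof -
  let ?S = "I \<times> A"
  let ?N = "real (card I)"
  let ?g = "gmom (2 * d)"
  have finS: "finite ?S" using fin by simp
  have g: "?g > 0" by (rule gmom_even_pos)
  define b where "b = (4 * ?N) ^ d * (4 * real d) ^ (2 * d) / ?g"
  have b: "b \<ge> 0" using g by (simp add: b_def)
  define tau where "tau u v = ennreal (1 / ?g\<^sup>2) * bilin_moment A A d (\<lambda>a a'. \<Sum>i\<in>I. u (i, a) * v (i, a'))" for u v :: "'b \<times> 'a \<Rightarrow> real"
  interpret A: prob_space "gauss A" by (rule prob_space_gauss)
  interpret S: prob_space "gauss ?S" by (rule prob_space_gauss)
  have meas: "case_prod tau \<in> borel_measurable (gauss ?S \<Otimes>\<^sub>M gauss ?S)"
    unfolding tau_def bilin_moment_def by measurable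
  have bound: "(\<integral>\<^sup>+u. \<integral>\<^sup>+v. tau u v \<partial>gauss ?S \<partial>gauss ?S) \<le> ennreal b"
  proof -
    have "(\<integral>\<^sup>+u. \<integral>\<^sup>+v. tau u v \<partial>gauss ?S \<partial>gauss ?S) = ennreal (1 / ?g\<^sup>2) * (\<integral>\<^sup>+u. \<integral>\<^sup>+v. bilin_moment A A d (\<lambda>a a'. \<Sum>i\<in>I. u (i, a) * v (i, a')) \<partial>gauss ?S \<partial>gauss ?S)"
      unfolding tau_def bilin_moment_def by (subst nn_integral_cmult, measurable)+
    also have "\<dots> \<le> ennreal (1 / ?g\<^sup>2) * ennreal (?g * (4 * ?N) ^ d * (4 * real d) ^ (2 * d))"
      using d by (intro mult_left_mono wishart_moment fin) auto
    also have "\<dots> = ennreal b"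
      using g by (subst ennreal_mult[symmetric]) (auto simp: b_def power2_eq_square)
    finally show ?thesis .
  qed
  let ?Q = "\<lambda>x k. gram_form A I x x k - ?N * (\<Sum>a\<in>A. (k a)\<^sup>2)"
  let ?w = "\<lambda>k. \<Sum>a\<in>A. (k a)\<^sup>2"
  have "\<exists>E\<in>sets (gauss ?S). measure (gauss ?S) E \<le> 4 ^ d * b / s ^ (2 * d) \<and>
    (\<forall>x\<in>space (gauss ?S) - E. \<forall>k\<in>UNIV. \<bar>?Q x k\<bar> \<le> s * ?w k)"
  proof (rule gauss_decoupling_tail[OF finS d(1) s b meas bound])
    fix k :: "'a \<Rightarrow> real"
    have tm: "integrable (gauss ?S) (\<lambda>x. x (i, a) * x (i, a'))"
      "(\<integral>x. x (i, a) * x (i, a') \<partial>gauss ?S) = (if a = a' then 1 else 0)"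
      if "a \<in> A" "a' \<in> A" "i \<in> I" for a a' i
      using integral_gauss_product[OF finS, of "(i, a)" "(i, a')"] that by simp_all
    have int: "integrable (gauss ?S) (\<lambda>x. gram_form A I x x k)"
      unfolding gram_form_def using tm by auto
    then show "integrable (gauss ?S) (\<lambda>x. ?Q x k)" by auto
    have "(\<integral>x. gram_form A I x x k \<partial>gauss ?S) = (\<Sum>a\<in>A. \<Sum>a'\<in>A. k a * (\<Sum>i\<in>I. if a = a' then 1 else 0) * k a')"
      unfolding gram_form_def using tm by simp
    also have "\<dots> = (\<Sum>a\<in>A. \<Sum>a'\<in>A. if a = a' then ?N * k a * k a' else 0)"
      by (auto intro!: sum.cong)
    also have "\<dots> = ?N * ?w k"
      using fin by (simp add: power2_eq_square sum_distrib_left mult.assoc)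
    finally show "(\<integral>x. ?Q x k \<partial>gauss ?S) = 0" using int by (simp add: S.prob_space)
    show "?w k \<ge> 0" by (simp add: sum_nonneg)
    fix x y :: "'b \<times> 'a \<Rightarrow> real"
    let ?u = "\<lambda>s\<in>?S. (x s + y s) / sqrt 2" and ?v = "\<lambda>s\<in>?S. (y s - x s) / sqrt 2"
    have eq: "?Q y k - ?Q x k = 2 * gram_form A I ?u ?v k"
    proof -
      have "(\<Sum>a\<in>A. k a * ?u (i, a)) = ((\<Sum>a\<in>A. k a * x (i, a)) + (\<Sum>a\<in>A. k a * y (i, a))) / sqrt 2"
        "(\<Sum>a\<in>A. k a * ?v (i, a)) = ((\<Sum>a\<in>A. k a * y (i, a)) - (\<Sum>a\<in>A. k a * x (i, a))) / sqrt 2" if "i \<in> I" for i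
      proof -
        have "(\<Sum>a\<in>A. k a * ?u (i, a)) = (\<Sum>a\<in>A. (k a * x (i, a) + k a * y (i, a)) / sqrt 2)"
          "(\<Sum>a\<in>A. k a * ?v (i, a)) = (\<Sum>a\<in>A. (k a * y (i, a) - k a * x (i, a)) / sqrt 2)"
          using that by (auto intro!: sum.cong simp: distrib_left right_diff_distrib)
        then show "(\<Sum>a\<in>A. k a * ?u (i, a)) = ((\<Sum>a\<in>A. k a * x (i, a)) + (\<Sum>a\<in>A. k a * y (i, a))) / sqrt 2"
          "(\<Sum>a\<in>A. k a * ?v (i, a)) = ((\<Sum>a\<in>A. k a * y (i, a)) - (\<Sum>a\<in>A. k a * x (i, a))) / sqrt 2"
          by (simp_all only: sum_divide_distrib[symmetric] sum.distrib sum_subtractf)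
      qed
      then have "gram_form A I ?u ?v k = (\<Sum>i\<in>I. ((\<Sum>a\<in>A. k a * y (i, a))\<^sup>2 - (\<Sum>a\<in>A. k a * x (i, a))\<^sup>2) / 2)"
        unfolding gram_form_eq by (intro sum.cong refl) (simp add: power2_eq_square algebra_simps)
      then show ?thesis by (simp add: gram_form_eq sum_subtractf sum_divide_distrib[symmetric] power2_eq_square)
    qed
    have "ennreal (?g\<^sup>2 * gram_form A I ?u ?v k ^ (2 * d))
      \<le> ennreal (?w k ^ d * ?w k ^ d) * bilin_moment A A d (\<lambda>a a'. \<Sum>i\<in>I. ?u (i, a) * ?v (i, a'))"
      unfolding gram_form_def by (rule bilinear_le_bilin_moment[OF fin(1) fin(1)])
    then have "ennreal (4 ^ d / ?g\<^sup>2) * ennreal (?g\<^sup>2 * gram_form A I ?u ?v k ^ (2 * d))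
      \<le> ennreal (4 ^ d / ?g\<^sup>2) * (ennreal (?w k ^ d * ?w k ^ d) * bilin_moment A A d (\<lambda>a a'. \<Sum>i\<in>I. ?u (i, a) * ?v (i, a')))"
      by (intro mult_left_mono) auto
    also have "ennreal (4 ^ d / ?g\<^sup>2) * ennreal (?g\<^sup>2 * gram_form A I ?u ?v k ^ (2 * d)) = ennreal ((?Q y k - ?Q x k) ^ (2 * d))"
      unfolding eq using g by (subst ennreal_mult[symmetric]) (auto simp: power_mult_distrib power_mult zero_le_even_power)
    also have "ennreal (4 ^ d / ?g\<^sup>2) * (ennreal (?w k ^ d * ?w k ^ d) * bilin_moment A A d (\<lambda>a a'. \<Sum>i\<in>I. ?u (i, a) * ?v (i, a')))
      = ennreal (?w k ^ (2 * d) * 4 ^ d) * tau ?u ?v"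
    proof -
      have "?w k ^ d * ?w k ^ d = ?w k ^ (2 * d)" by (simp add: mult_2 power_add)
      moreover have "ennreal (4 ^ d / ?g\<^sup>2) * ennreal (?w k ^ (2 * d)) = ennreal (?w k ^ (2 * d) * 4 ^ d) * ennreal (1 / ?g\<^sup>2)"
        by (subst (1 2) ennreal_mult[symmetric]) (auto simp: sum_nonneg)
      ultimately show ?thesis unfolding tau_def mult.assoc[symmetric] by (simp only:)
    qed
    finally show "ennreal ((?Q y k - ?Q x k) ^ (2 * d)) \<le> ennreal (?w k ^ (2 * d) * 4 ^ d) * tau ?u ?v" .
  qed
  moreover have "4 ^ d * b / s ^ (2 * d) \<le> (23 * sqrt (card I) * sqrt d / s) ^ (2 * d)"
  proof -
    have "b \<le> (4 * ?N) ^ d * (4 * real d) ^ (2 * d) / (real d / 2) ^ d"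
      unfolding b_def using g d by (intro divide_left_mono gmom_lower) auto
    also have "\<dots> = (4 * ?N * (4 * real d)\<^sup>2 / (real d / 2)) ^ d"
      by (simp only: power_mult power_mult_distrib power_divide)
    also have "4 * ?N * (4 * real d)\<^sup>2 / (real d / 2) = 128 * ?N * real d"
      using d by (simp add: power2_eq_square)
    finally have "4 ^ d * b / s ^ (2 * d) \<le> 4 ^ d * (128 * ?N * real d) ^ d / s ^ (2 * d)"
      using s by (intro divide_right_mono mult_left_mono) auto
    also have "\<dots> = (4 * (128 * ?N * real d) / s\<^sup>2) ^ d"
      by (simp only: power_mult power_mult_distrib power_divide)
    also have "\<dots> \<le> ((23 * sqrt (card I) * sqrt d / s)\<^sup>2) ^ d"
    proof (rule power_mono)
      \<comment> \<open>\<open>4 * 128 = 512 \<le> 529 = 23^2\<close>.\<close>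
      have "(23 * sqrt (card I) * sqrt d / s)\<^sup>2 = 529 * ?N * real d / s\<^sup>2"
        by (simp add: power_mult_distrib power_divide)
      then show "4 * (128 * ?N * real d) / s\<^sup>2 \<le> (23 * sqrt (card I) * sqrt d / s)\<^sup>2"
        by (simp add: divide_right_mono)
    qed simp
    finally show ?thesis by (simp only: power_mult)
  qed
  ultimately show ?thesis
    by (auto simp: gram_form_eq power2_eq_square[of "sum _ _"] intro: order_trans)
qed

section \<open>Gaussian tensors\<close>

text \<open>Each tail bound is proved over the index set natural to it; this carries its exceptional
  set over to the common index set of the tensor.\<close>

lemma gauss_reindex_event:
  assumes fin: "finite S" and f: "bij_betw f S' S"
    and ex: "\<exists>E\<in>sets (gauss S'). measure (gauss S') E \<le> p \<and> (\<forall>x\<in>space (gauss S') - E. P x)"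
  shows "\<exists>E\<in>sets (gauss S). measure (gauss S) E \<le> p \<and> (\<forall>x\<in>space (gauss S) - E. P (\<lambda>s\<in>S'. x (f s)))"
proof -
  obtain E where E: "E \<in> sets (gauss S')" "measure (gauss S') E \<le> p" "\<And>x. x \<in> space (gauss S') - E \<Longrightarrow> P x"
    using ex by auto
  let ?g = "\<lambda>x. \<lambda>s\<in>S'. x (f s)"
  have inj: "inj_on f S'" "f \<in> S' \<rightarrow> S" using f by (auto simp: bij_betw_def)
  have g: "?g \<in> gauss S \<rightarrow>\<^sub>M gauss S'"
    using inj by (intro measurable_restrict measurable_component_singleton) auto
  have d: "distr (gauss S) (gauss S') ?g = gauss S'"
    using inj by (intro distr_PiM_reindex) (auto simp: std_gauss.prob_space_axioms)
  show ?thesis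
  proof (intro bexI conjI ballI)
    have "measure (gauss S') E = measure (gauss S) (?g -` E \<inter> space (gauss S))"
      using measure_distr[OF g E(1)] d by simp
    then show "measure (gauss S) (?g -` E \<inter> space (gauss S)) \<le> p" using E(2) by simp
    show "?g -` E \<inter> space (gauss S) \<in> sets (gauss S)" using g E(1) by (rule measurable_sets)
    fix x assume x: "x \<in> space (gauss S) - (?g -` E \<inter> space (gauss S))"
    then have "?g x \<in> space (gauss S') - E" using measurable_space[OF g, of x] by auto
    then show "P (?g x)" by (rule E(3))
  qed
qed

section \<open>Multi-indices and single legs\<close>

definition legs :: "'q set \<Rightarrow> ('q \<Rightarrow> nat) \<Rightarrow> ('q \<Rightarrow> nat) set" where
  "legs Q d = (\<Pi>\<^sub>E a\<in>Q. {..<d a})"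

text \<open>Tensors are functions of a sample index and a multi-index; a leg is a position of the multi-index.\<close>

definition act :: "('q \<Rightarrow> nat) \<Rightarrow> 'q \<Rightarrow> (nat \<Rightarrow> nat \<Rightarrow> real) \<Rightarrow> ('i \<times> ('q \<Rightarrow> nat) \<Rightarrow> real) \<Rightarrow> 'i \<times> ('q \<Rightarrow> nat) \<Rightarrow> real" where
  "act d a K x p = (\<Sum>c<d a. K (snd p a) c * x (fst p, (snd p)(a := c)))"

lemma finite_legs: "finite Q \<Longrightarrow> finite (legs Q d)"
  by (simp add: legs_def finite_PiE)

lemma card_legs: "finite Q \<Longrightarrow> card (legs Q d) = (\<Prod>a\<in>Q. d a)"
  by (simp add: legs_def card_PiE)

lemma legs_nonempty: "finite Q \<Longrightarrow> (\<And>a. a \<in> Q \<Longrightarrow> d a > 0) \<Longrightarrow> legs Q d \<noteq> {}"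
  by (auto simp: legs_def PiE_eq_empty_iff)

lemma legs_ext: "\<omega> \<in> legs Q d \<Longrightarrow> a \<notin> Q \<Longrightarrow> \<omega> a = undefined"
  by (auto simp: legs_def PiE_iff extensional_def)

lemma legs_upd:
  assumes "\<rho> \<in> legs (Q - A) d" "B \<subseteq> Q" "\<And>a. a \<in> B \<Longrightarrow> v a < d a" "A = B"
  shows "(\<lambda>a. if a \<in> B then v a else \<rho> a) \<in> legs Q d"
  using assms by (auto simp: legs_def PiE_iff extensional_def)

lemma legs_restrict: "\<omega> \<in> legs Q d \<Longrightarrow> restrict \<omega> (Q - A) \<in> legs (Q - A) d"
  by (auto simp: legs_def PiE_iff)

lemma legs_less: "\<omega> \<in> legs Q d \<Longrightarrow> a \<in> Q \<Longrightarrow> \<omega> a < d a"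
  by (auto simp: legs_def PiE_iff)

text \<open>The unfolding of a tensor along leg \<open>a\<close>: the sample index together with all
  other legs takes the part of the samples.\<close>

lemma bij_betw_leg1:
  assumes a: "a \<in> Q"
  shows "bij_betw (\<lambda>(p, \<alpha>). (fst p, (snd p)(a := \<alpha>))) ((T \<times> legs (Q - {a}) d) \<times> {..<d a}) (T \<times> legs Q d)"
proof (rule bij_betw_byWitness[where f' = "\<lambda>(i, \<omega>). ((i, restrict \<omega> (Q - {a})), \<omega> a)"])
  have 1: "restrict (\<rho>(a := \<alpha>)) (Q - {a}) = \<rho>" if "\<rho> \<in> legs (Q - {a}) d" for \<rho> \<alpha>
    using legs_ext[OF that] by (auto simp: fun_eq_iff)
  have 2: "(restrict \<omega> (Q - {a}))(a := \<omega> a) = \<omega>" if "\<omega> \<in> legs Q d" for \<omega>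
    using legs_ext[OF that] by (auto simp: fun_eq_iff)
  have 3: "\<rho>(a := \<alpha>) \<in> legs Q d" if "\<rho> \<in> legs (Q - {a}) d" "\<alpha> < d a" for \<rho> \<alpha>
  proof -
    have "\<rho>(a := \<alpha>) = (\<lambda>c. if c \<in> {a} then \<alpha> else \<rho> c)" by auto
    then show ?thesis using legs_upd[OF that(1), of "{a}" "\<lambda>_. \<alpha>"] that(2) a by simp
  qed
  show "\<forall>q\<in>(T \<times> legs (Q - {a}) d) \<times> {..<d a}. (case case q of (p, \<alpha>) \<Rightarrow> (fst p, (snd p)(a := \<alpha>)) of
      (i, \<omega>) \<Rightarrow> ((i, restrict \<omega> (Q - {a})), \<omega> a)) = q"
    using 1 by auto
  show "\<forall>q\<in>T \<times> legs Q d. (case case q of (i, \<omega>) \<Rightarrow> ((i, restrict \<omega> (Q - {a})), \<omega> a) of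
      (p, \<alpha>) \<Rightarrow> (fst p, (snd p)(a := \<alpha>))) = q"
    using 2 by auto
  show "(\<lambda>(p, \<alpha>). (fst p, (snd p)(a := \<alpha>))) ` ((T \<times> legs (Q - {a}) d) \<times> {..<d a}) \<subseteq> T \<times> legs Q d"
    using 3 by auto
  show "(\<lambda>(i, \<omega>). ((i, restrict \<omega> (Q - {a})), \<omega> a)) ` (T \<times> legs Q d) \<subseteq> (T \<times> legs (Q - {a}) d) \<times> {..<d a}"
    using legs_restrict legs_less[OF _ a] by auto
qed

lemma bij_betw_leg2:
  assumes ab: "a \<in> Q" "b \<in> Q" "a \<noteq> b"
  shows "bij_betw (\<lambda>(q, p). (fst p, (snd p)(a := fst q, b := snd q)))
    (({..<d a} \<times> {..<d b}) \<times> (T \<times> legs (Q - {a, b}) d)) (T \<times> legs Q d)"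
proof (rule bij_betw_byWitness[where f' = "\<lambda>(i, \<omega>). ((\<omega> a, \<omega> b), (i, restrict \<omega> (Q - {a, b})))"])
  have 1: "restrict (\<rho>(a := \<alpha>, b := \<beta>)) (Q - {a, b}) = \<rho>" if "\<rho> \<in> legs (Q - {a, b}) d" for \<rho> \<alpha> \<beta>
    using legs_ext[OF that] by (auto simp: fun_eq_iff)
  have 2: "(restrict \<omega> (Q - {a, b}))(a := \<omega> a, b := \<omega> b) = \<omega>" if "\<omega> \<in> legs Q d" for \<omega>
    using legs_ext[OF that] by (auto simp: fun_eq_iff)
  have 3: "\<rho>(a := \<alpha>, b := \<beta>) \<in> legs Q d" if "\<rho> \<in> legs (Q - {a, b}) d" "\<alpha> < d a" "\<beta> < d b" for \<rho> \<alpha> \<beta>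
  proof -
    have "\<rho>(a := \<alpha>, b := \<beta>) = (\<lambda>c. if c \<in> {a, b} then (if c = b then \<beta> else \<alpha>) else \<rho> c)" by auto
    moreover have "(\<lambda>c. if c \<in> {a, b} then (if c = b then \<beta> else \<alpha>) else \<rho> c) \<in> legs Q d"
      using that(2,3) ab by (intro legs_upd[OF that(1)]) auto
    ultimately show ?thesis by (simp only:)
  qed
  show "\<forall>r\<in>({..<d a} \<times> {..<d b}) \<times> (T \<times> legs (Q - {a, b}) d). (case case r of (q, p) \<Rightarrow> (fst p, (snd p)(a := fst q, b := snd q)) of
      (i, \<omega>) \<Rightarrow> ((\<omega> a, \<omega> b), (i, restrict \<omega> (Q - {a, b})))) = r"
    using 1 ab(3) by auto
  show "\<forall>r\<in>T \<times> legs Q d. (case case r of (i, \<omega>) \<Rightarrow> ((\<omega> a, \<omega> b), (i, restrict \<omega> (Q - {a, b}))) of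
      (q, p) \<Rightarrow> (fst p, (snd p)(a := fst q, b := snd q))) = r"
    using 2 by auto
  show "(\<lambda>(q, p). (fst p, (snd p)(a := fst q, b := snd q))) ` (({..<d a} \<times> {..<d b}) \<times> (T \<times> legs (Q - {a, b}) d)) \<subseteq> T \<times> legs Q d"
    using 3 by auto
  show "(\<lambda>(i, \<omega>). ((\<omega> a, \<omega> b), (i, restrict \<omega> (Q - {a, b})))) ` (T \<times> legs Q d) \<subseteq> ({..<d a} \<times> {..<d b}) \<times> (T \<times> legs (Q - {a, b}) d)"
    using legs_restrict legs_less[OF _ ab(1)] legs_less[OF _ ab(2)] by auto
qed

text \<open>Unfolded along leg \<open>a\<close>, the tensor is a Gaussian matrix with
  \<open>N\<close> rows. Every row of \<open>K\<close> contributes a Gram form of its own, and their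
  squared norms add up to \<open>sqnorm2\<close>.\<close>

lemma leg_diag:
  fixes T :: "'i set" and Q :: "'q set"
  assumes fin: "finite T" "finite Q" and a: "a \<in> Q" and da: "d a > 0"
    and N: "N = card T * (\<Prod>b\<in>Q - {a}. d b)" "d a \<le> N" and s: "s > 0"
  shows "\<exists>E\<in>sets (gauss (T \<times> legs Q d)). measure (gauss (T \<times> legs Q d)) E \<le> (23 * sqrt N * sqrt (d a) / s) ^ (2 * d a) \<and>
    (\<forall>x\<in>space (gauss (T \<times> legs Q d)) - E. \<forall>K.
      (real N - s) * sqnorm2 {..<d a} K \<le> (\<Sum>p\<in>T \<times> legs Q d. (act d a K x p)\<^sup>2))"
proof -
  let ?S = "T \<times> legs Q d"
  let ?I = "T \<times> legs (Q - {a}) d"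
  let ?f = "\<lambda>(p, \<alpha>). (fst p, (snd p)(a := \<alpha>)) :: 'i \<times> ('q \<Rightarrow> nat)"
  let ?P = "\<lambda>x. \<forall>k :: nat \<Rightarrow> real. \<bar>(\<Sum>i\<in>?I. (\<Sum>a\<in>{..<d a}. k a * x (i, a))\<^sup>2) - card ?I * (\<Sum>a\<in>{..<d a}. (k a)\<^sup>2)\<bar> \<le> s * (\<Sum>a\<in>{..<d a}. (k a)\<^sup>2)"
  have finS: "finite ?S" "finite ?I" using fin by (auto intro: finite_legs)
  have cI: "card ?I = N" using fin by (simp add: card_cartesian_product card_legs N)
  have bij: "bij_betw ?f (?I \<times> {..<d a}) ?S" by (rule bij_betw_leg1[OF a])
  have "\<exists>E\<in>sets (gauss (?I \<times> {..<d a})). measure (gauss (?I \<times> {..<d a})) E \<le> (23 * sqrt N * sqrt (d a) / s) ^ (2 * d a) \<and>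
      (\<forall>x\<in>space (gauss (?I \<times> {..<d a})) - E. ?P x)"
    using gram_form_tail[of "{..<d a}" ?I "d a" s] finS da N s cI by simp
  from gauss_reindex_event[OF finS(1) bij this]
  obtain E where E: "E \<in> sets (gauss ?S)" "measure (gauss ?S) E \<le> (23 * sqrt N * sqrt (d a) / s) ^ (2 * d a)"
    "\<And>x. x \<in> space (gauss ?S) - E \<Longrightarrow> ?P (\<lambda>s\<in>?I \<times> {..<d a}. x (?f s))"
    by auto
  have "(real N - s) * sqnorm2 {..<d a} K \<le> (\<Sum>p\<in>?S. (act d a K x p)\<^sup>2)" if x: "x \<in> space (gauss ?S) - E" for x K
  proof -
    let ?g = "\<lambda>p \<alpha>. x (fst p, (snd p)(a := \<alpha>))"
    have row: "(real N - s) * (\<Sum>c<d a. (K \<alpha> c)\<^sup>2) \<le> (\<Sum>p\<in>?I. (\<Sum>c<d a. K \<alpha> c * ?g p c)\<^sup>2)" for \<alpha>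
    proof -
      have "(\<Sum>i\<in>?I. (\<Sum>c<d a. K \<alpha> c * (\<lambda>s\<in>?I \<times> {..<d a}. x (?f s)) (i, c))\<^sup>2) = (\<Sum>p\<in>?I. (\<Sum>c<d a. K \<alpha> c * ?g p c)\<^sup>2)"
        by (intro sum.cong refl) simp
      moreover have "real N - s = real (card ?I) - s" using cI by simp
      moreover have "(n - s) * C \<le> X" if "\<bar>X - n * C\<bar> \<le> s * C" for X C n :: real
        using that unfolding left_diff_distrib by linarith
      ultimately show ?thesis using E(3)[OF x, THEN spec, of "K \<alpha>"] by (simp only:)
    qed
    have "(\<Sum>p\<in>?S. (act d a K x p)\<^sup>2) = (\<Sum>q\<in>?I \<times> {..<d a}. (act d a K x (?f q))\<^sup>2)"
      by (rule sum.reindex_bij_betw[OF bij, symmetric])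
    also have "\<dots> = (\<Sum>p\<in>?I. \<Sum>\<alpha><d a. (\<Sum>c<d a. K \<alpha> c * ?g p c)\<^sup>2)"
      by (simp add: sum.cartesian_product' act_def)
    also have "\<dots> = (\<Sum>\<alpha><d a. \<Sum>p\<in>?I. (\<Sum>c<d a. K \<alpha> c * ?g p c)\<^sup>2)" by (rule sum.swap)
    finally show ?thesis
      using row by (simp add: sqnorm2_def sum_distrib_left sum_mono)
  qed
  then show ?thesis using E(1,2) by blast
qed

lemma leg_cross:
  fixes T :: "'i set" and Q :: "'q set"
  assumes fin: "finite T" "T \<noteq> {}" "finite Q" and ab: "a \<in> Q" "b \<in> Q" "a \<noteq> b" and d0: "\<And>a. a \<in> Q \<Longrightarrow> d a > 0"
    and N: "N = card T * (\<Prod>c\<in>Q - {a, b}. d c)" and s: "s > 0" and m: "m = max (d a) (d b)"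
  shows "\<exists>E\<in>sets (gauss (T \<times> legs Q d)). measure (gauss (T \<times> legs Q d)) E \<le> (128 * sqrt N * m / s) ^ (2 * m) \<and>
    (\<forall>x\<in>space (gauss (T \<times> legs Q d)) - E. \<forall>K L. (\<Sum>c<d a. K c c) * (\<Sum>c<d b. L c c) = 0 \<longrightarrow>
      \<bar>\<Sum>p\<in>T \<times> legs Q d. act d a K x p * act d b L x p\<bar> \<le> s * sqrt (sqnorm2 {..<d a} K * sqnorm2 {..<d b} L))"
proof -
  let ?S = "T \<times> legs Q d"
  let ?I = "T \<times> legs (Q - {a, b}) d"
  let ?S' = "({..<d a} \<times> {..<d b}) \<times> ?I"
  let ?f = "\<lambda>(q, p). (fst p, (snd p)(a := fst q, b := snd q)) :: 'i \<times> ('q \<Rightarrow> nat)"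
  let ?P = "\<lambda>x. \<forall>K L. (\<Sum>c<d a. K c c) * (\<Sum>c<d b. L c c) = 0 \<longrightarrow>
    \<bar>cross_form {..<d a} {..<d b} ?I x x K L\<bar> \<le> s * sqrt (sqnorm2 {..<d a} K * sqnorm2 {..<d b} L)"
  have finS: "finite ?S" "finite ?I" using fin by (auto intro: finite_legs)
  have cI: "card ?I = N" using fin by (simp add: card_cartesian_product card_legs N)
  have ne: "{..<d a} \<noteq> {}" "?I \<noteq> {}"
    using ab fin d0 legs_nonempty[of "Q - {a, b}" d] by (auto simp: lessThan_empty_iff)
  have bij: "bij_betw ?f ?S' ?S" by (rule bij_betw_leg2[OF ab])
  have "\<exists>E\<in>sets (gauss ?S'). measure (gauss ?S') E \<le> (128 * sqrt N * m / s) ^ (2 * m) \<and>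
      (\<forall>x\<in>space (gauss ?S') - E. ?P x)"
    using cross_form_tail[of "{..<d a}" "{..<d b}" ?I m s] finS s cI ne m d0 ab by (auto simp: max_def)
  from gauss_reindex_event[OF finS(1) bij this]
  obtain E where E: "E \<in> sets (gauss ?S)" "measure (gauss ?S) E \<le> (128 * sqrt N * m / s) ^ (2 * m)"
    "\<And>x. x \<in> space (gauss ?S) - E \<Longrightarrow> ?P (\<lambda>s\<in>?S'. x (?f s))"
    by auto
  have "\<bar>\<Sum>p\<in>?S. act d a K x p * act d b L x p\<bar> \<le> s * sqrt (sqnorm2 {..<d a} K * sqnorm2 {..<d b} L)"
    if x: "x \<in> space (gauss ?S) - E" and t: "(\<Sum>c<d a. K c c) * (\<Sum>c<d b. L c c) = 0" for x K L
  proof -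
    let ?x = "\<lambda>s\<in>?S'. x (?f s)"
    have "(\<Sum>p\<in>?S. act d a K x p * act d b L x p) = (\<Sum>q\<in>?S'. act d a K x (?f q) * act d b L x (?f q))"
      by (rule sum.reindex_bij_betw[OF bij, symmetric])
    also have "\<dots> = (\<Sum>\<alpha><d a. \<Sum>\<beta><d b. \<Sum>p\<in>?I. (\<Sum>c<d a. K \<alpha> c * ?x ((c, \<beta>), p)) * (\<Sum>c<d b. L \<beta> c * ?x ((\<alpha>, c), p)))"
      unfolding sum.cartesian_product'
    proof (intro sum.cong refl)
      fix \<alpha> \<beta> i \<rho> assume *: "\<alpha> \<in> {..<d a}" "\<beta> \<in> {..<d b}" "i \<in> T" "\<rho> \<in> legs (Q - {a, b}) d"
      have "\<rho>(a := \<alpha>, b := \<beta>, a := c) = \<rho>(a := c, b := \<beta>)" "\<rho>(a := \<alpha>, b := \<beta>, b := c) = \<rho>(a := \<alpha>, b := c)" for c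
        using ab(3) by (auto simp: fun_eq_iff)
      then have "act d a K x (?f ((\<alpha>, \<beta>), (i, \<rho>))) = (\<Sum>c<d a. K \<alpha> c * ?x ((c, \<beta>), (i, \<rho>)))"
        "act d b L x (?f ((\<alpha>, \<beta>), (i, \<rho>))) = (\<Sum>c<d b. L \<beta> c * ?x ((\<alpha>, c), (i, \<rho>)))"
        unfolding act_def using ab(3) * by (auto intro!: sum.cong)
      then show "act d a K x (?f ((\<alpha>, \<beta>), (i, \<rho>))) * act d b L x (?f ((\<alpha>, \<beta>), (i, \<rho>))) =
        (\<Sum>c<d a. K \<alpha> c * ?x ((c, \<beta>), (i, \<rho>))) * (\<Sum>c<d b. L \<beta> c * ?x ((\<alpha>, c), (i, \<rho>)))"
        by (simp only:)
    qed
    also have "\<dots> = (\<Sum>\<alpha><d a. \<Sum>\<beta><d b. \<Sum>p\<in>?I. \<Sum>c<d a. \<Sum>c'<d b. ?x ((c, \<beta>), p) * K \<alpha> c * L \<beta> c' * ?x ((\<alpha>, c'), p))"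
      by (simp only: sum_product mult_ac)
    also have "\<dots> = (\<Sum>p\<in>?I. \<Sum>\<alpha><d a. \<Sum>\<beta><d b. \<Sum>c<d a. \<Sum>c'<d b. ?x ((c, \<beta>), p) * K \<alpha> c * L \<beta> c' * ?x ((\<alpha>, c'), p))"
      by (simp only: sum.swap[of _ ?I])
    also have "\<dots> = (\<Sum>p\<in>?I. \<Sum>\<alpha><d a. \<Sum>c<d a. \<Sum>\<beta><d b. \<Sum>c'<d b. ?x ((c, \<beta>), p) * K \<alpha> c * L \<beta> c' * ?x ((\<alpha>, c'), p))"
      by (intro sum.cong refl sum.swap)
    also have "\<dots> = (\<Sum>p\<in>?I. \<Sum>c<d a. \<Sum>\<alpha><d a. \<Sum>\<beta><d b. \<Sum>c'<d b. ?x ((c, \<beta>), p) * K \<alpha> c * L \<beta> c' * ?x ((\<alpha>, c'), p))"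
      by (intro sum.cong refl sum.swap)
    \<comment> \<open>The first tensor is contracted with the second index of \<open>K\<close>,
      hence the transpose; trace and \<open>sqnorm2\<close> do not see it.\<close>
    also have "\<dots> = cross_form {..<d a} {..<d b} ?I ?x ?x (\<lambda>c \<alpha>. K \<alpha> c) L"
      by (simp only: cross_form_def)
    finally show ?thesis
      using E(3)[OF x, THEN spec, THEN spec, of "\<lambda>c \<alpha>. K \<alpha> c" L] t by (simp only: sqnorm2_transpose[of "{..<d a}" K] simp_thms)
  qed
  then show ?thesis using E(1,2) by blast
qed

text \<open>Pairs that meet leg \<open>0\<close> or leg \<open>e\<close> fill two rows and two
  columns. Cauchy-Schwarz bounds each of these by \<open>sqrt k\<close> times the sum of squares, so
  weight \<open>1 / (32 sqrt k)\<close> suffices there, while the remaining block calls for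
  \<open>1 / (32 k)\<close>. The total is \<open>4/32 + 1/32\<close>.\<close>

lemma leg_combination:
  fixes \<kappa> :: "nat \<Rightarrow> real"
  assumes k: "k \<ge> 1" and e: "e \<in> {1..k}" and \<kappa>: "\<And>a. \<kappa> a \<ge> 0"
  defines "th \<equiv> \<lambda>a b. if a \<in> {0, e} \<or> b \<in> {0, e} then 1 / (32 * sqrt k) else 1 / (32 * real k)"
  shows "(\<Sum>a\<le>k. \<Sum>b\<in>{..k} - {a}. th a b * \<kappa> a * \<kappa> b) \<le> 5 / 32 * (\<Sum>a\<le>k. (\<kappa> a)\<^sup>2)"
proof -
  let ?t = "\<Sum>a\<le>k. (\<kappa> a)\<^sup>2"
  have t: "?t \<ge> 0" by (simp add: sum_nonneg)
  have one: "\<kappa> a * (\<Sum>b\<in>{..k} - {a}. \<kappa> b) \<le> sqrt k * ?t" if "a \<le> k" for a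
  proof -
    have "(\<Sum>b\<in>{..k} - {a}. \<kappa> b)\<^sup>2 \<le> (\<Sum>b\<in>{..k} - {a}. 1\<^sup>2) * (\<Sum>b\<in>{..k} - {a}. (\<kappa> b)\<^sup>2)"
      using sum_Cauchy_Schwarz[of "\<lambda>_. 1" \<kappa> "{..k} - {a}"] by simp
    also have "\<dots> \<le> real k * ?t"
      using that by (intro mult_mono sum_mono2) (auto simp: sum_nonneg)
    finally have "(\<Sum>b\<in>{..k} - {a}. \<kappa> b) \<le> sqrt (real k * ?t)"
      by (rule real_le_rsqrt)
    moreover have "\<kappa> a \<le> sqrt ?t"
      using that by (intro real_le_rsqrt member_le_sum) auto
    ultimately have "\<kappa> a * (\<Sum>b\<in>{..k} - {a}. \<kappa> b) \<le> sqrt ?t * sqrt (real k * ?t)"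
      using \<kappa> t by (intro mult_mono) (auto simp: sum_nonneg)
    then show ?thesis using t by (simp add: real_sqrt_mult mult.commute mult.left_commute)
  qed
  let ?R = "{..k} - {0, e}"
  have rest: "(\<Sum>a\<in>?R. \<Sum>b\<in>?R. \<kappa> a * \<kappa> b) \<le> real k * ?t"
  proof -
    have "(\<Sum>a\<in>?R. \<Sum>b\<in>?R. \<kappa> a * \<kappa> b) = (\<Sum>b\<in>?R. 1 * \<kappa> b)\<^sup>2" by (simp add: sum_product power2_eq_square)
    also have "\<dots> \<le> (\<Sum>b\<in>?R. 1\<^sup>2) * (\<Sum>b\<in>?R. (\<kappa> b)\<^sup>2)" by (rule sum_Cauchy_Schwarz)
    also have "\<dots> \<le> real k * ?t"
    proof (intro mult_mono sum_mono2)
      have "card ?R \<le> card ({..k} - {0})" by (intro card_mono) auto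
      then show "(\<Sum>b\<in>?R. 1\<^sup>2) \<le> real k" by simp
    qed (auto simp: sum_nonneg)
    finally show ?thesis .
  qed
  define g where "g a b = (if b \<in> {..k} - {a} then \<kappa> a * \<kappa> b else 0)" for a b
  have g0: "g a b \<ge> 0" for a b using \<kappa> by (simp add: g_def)
  have gr: "(\<Sum>b\<le>k. g a b) = \<kappa> a * (\<Sum>b\<in>{..k} - {a}. \<kappa> b)" for a
    unfolding g_def sum_distrib_left by (rule sum.mono_neutral_cong_right) auto
  have gs: "g a b = g b a" if "a \<le> k" "b \<le> k" for a b using that by (auto simp: g_def)
  have "(\<Sum>a\<le>k. \<Sum>b\<in>{..k} - {a}. th a b * \<kappa> a * \<kappa> b) = (\<Sum>a\<le>k. \<Sum>b\<le>k. th a b * g a b)"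
    by (intro sum.cong refl sum.mono_neutral_cong_left) (auto simp: g_def)
  also have "\<dots> \<le> (\<Sum>a\<le>k. \<Sum>b\<le>k. 1 / (32 * sqrt k) * ((if a = 0 then g a b else 0) + (if a = e then g a b else 0)
      + (if b = 0 then g a b else 0) + (if b = e then g a b else 0)) + 1 / (32 * real k) * (if a \<in> ?R \<and> b \<in> ?R then \<kappa> a * \<kappa> b else 0))"
  proof (intro sum_mono)
    fix a b assume ab: "a \<in> {..k}" "b \<in> {..k}"
    show "th a b * g a b \<le> 1 / (32 * sqrt k) * ((if a = 0 then g a b else 0) + (if a = e then g a b else 0)
      + (if b = 0 then g a b else 0) + (if b = e then g a b else 0)) + 1 / (32 * real k) * (if a \<in> ?R \<and> b \<in> ?R then \<kappa> a * \<kappa> b else 0)"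
    proof (cases "a \<in> {0, e} \<or> b \<in> {0, e}")
      case True
      then have "g a b \<le> (if a = 0 then g a b else 0) + (if a = e then g a b else 0)
        + (if b = 0 then g a b else 0) + (if b = e then g a b else 0)" using g0[of a b] by auto
      then have f1: "1 / (32 * sqrt k) * g a b \<le> 1 / (32 * sqrt k) * ((if a = 0 then g a b else 0) + (if a = e then g a b else 0)
        + (if b = 0 then g a b else 0) + (if b = e then g a b else 0))" by (rule mult_left_mono) simp
      have f2: "0 \<le> 1 / (32 * real k) * (if a \<in> ?R \<and> b \<in> ?R then \<kappa> a * \<kappa> b else 0)" using \<kappa> by simp
      have "th a b = 1 / (32 * sqrt k)" using True by (simp add: th_def)
      then show ?thesis using add_increasing2[OF f2 f1] by (simp only:)
    next
      case False
      then have "a \<in> ?R" "b \<in> ?R" using ab by auto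
      moreover have "g a b \<le> \<kappa> a * \<kappa> b" using \<kappa> by (simp add: g_def)
      ultimately show ?thesis using False by (auto simp: th_def intro: divide_right_mono)
    qed
  qed
  also have "\<dots> = 1 / (32 * sqrt k) * ((\<Sum>b\<le>k. g 0 b) + (\<Sum>b\<le>k. g e b) + (\<Sum>b\<le>k. g b 0) + (\<Sum>b\<le>k. g b e))
      + 1 / (32 * real k) * (\<Sum>a\<in>?R. \<Sum>b\<in>?R. \<kappa> a * \<kappa> b)"
  proof -
    have 1: "(\<Sum>a\<le>k. \<Sum>b\<le>k. if a = c then g a b else 0) = (\<Sum>b\<le>k. g c b)" if "c \<le> k" for c
      using that by (subst sum.swap) simp
    have 2: "(\<Sum>a\<le>k. \<Sum>b\<le>k. if b = c then g a b else 0) = (\<Sum>a\<le>k. g a c)" if "c \<le> k" for c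
      using that by simp
    have 3: "(\<Sum>a\<le>k. \<Sum>b\<le>k. if a \<in> ?R \<and> b \<in> ?R then \<kappa> a * \<kappa> b else 0) = (\<Sum>a\<in>?R. \<Sum>b\<in>?R. \<kappa> a * \<kappa> b)"
    proof -
      have gen: "(\<Sum>a\<le>k. \<Sum>b\<le>k. if a \<in> R \<and> b \<in> R then \<kappa> a * \<kappa> b else 0) = (\<Sum>a\<in>R. \<Sum>b\<in>R. \<kappa> a * \<kappa> b)"
        if "R \<subseteq> {..k}" for R
      proof -
        have i: "(\<Sum>b\<le>k. if b \<in> R then f b else 0) = sum f R" for f :: "nat \<Rightarrow> real"
          using that by (simp add: sum.inter_restrict[symmetric] Int_absorb1)
        have "(\<Sum>b\<le>k. if a \<in> R \<and> b \<in> R then \<kappa> a * \<kappa> b else 0) = (if a \<in> R then \<Sum>b\<in>R. \<kappa> a * \<kappa> b else 0)" for a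
          by (cases "a \<in> R") (simp_all add: i)
        then show ?thesis by (simp only: i)
      qed
      show ?thesis by (rule gen) auto
    qed
    have "e \<le> k" using e by simp
    then show ?thesis
      unfolding sum.distrib sum_distrib_left[symmetric] 3 by (simp only: 1 2 le0)
  qed
  also have "\<dots> \<le> 1 / (32 * sqrt k) * (sqrt k * ?t + sqrt k * ?t + sqrt k * ?t + sqrt k * ?t) + 1 / (32 * real k) * (real k * ?t)"
  proof (intro add_mono mult_left_mono rest)
    have ek: "e \<le> k" using e by simp
    show "(\<Sum>b\<le>k. g 0 b) \<le> sqrt k * ?t" "(\<Sum>b\<le>k. g e b) \<le> sqrt k * ?t"
      unfolding gr using one ek by auto
    have "(\<Sum>b\<le>k. g b 0) = (\<Sum>b\<le>k. g 0 b)" "(\<Sum>b\<le>k. g b e) = (\<Sum>b\<le>k. g e b)"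
      using ek by (auto intro!: sum.cong gs)
    then show "(\<Sum>b\<le>k. g b 0) \<le> sqrt k * ?t" "(\<Sum>b\<le>k. g b e) \<le> sqrt k * ?t"
      unfolding gr using one ek by auto
  qed auto
  also have "\<dots> = 5 / 32 * ?t" using k by (simp add: field_simps)
  finally show ?thesis .
qed

text \<open>Leg \<open>0\<close> carries the scalar component and need not be traceless. The two
  assumptions on \<open>\<rho>\<close> match the two weights of \<open>leg_combination\<close>:
  \<open>row\<close> covers the pairs that contain leg \<open>0\<close> or \<open>e\<close>, and
  \<open>small\<close> covers the others, where the full factor \<open>1 / k\<close> has to be
  paid.\<close>

theorem leg_convexity:
  fixes d :: "nat \<Rightarrow> nat" and \<rho> :: real
  assumes k: "k \<ge> 1" and n: "n \<ge> 1" and d0: "d 0 = 1"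
    and dmin: "dmin \<ge> 1" "\<And>a. a \<in> {1..k} \<Longrightarrow> dmin \<le> d a"
    and D: "D = (\<Prod>a\<le>k. d a)" and \<rho>: "\<rho> \<ge> 2 ^ 24"
    and row: "\<And>a. a \<in> {1..k} \<Longrightarrow> sqrt k * d a * \<rho> \<le> sqrt (n * D)"
    and e: "e \<in> {1..k}" and small: "\<And>a. a \<in> {1..k} - {e} \<Longrightarrow> k * d a * \<rho> \<le> sqrt (n * D)"
  defines "S \<equiv> {..<n} \<times> legs {..k} d"
  shows "\<exists>E\<in>sets (gauss S). measure (gauss S) E \<le> 3 * (real k)\<^sup>2 * (1 / \<rho>) ^ dmin \<and>
    (\<forall>x\<in>space (gauss S) - E. \<forall>K. (\<forall>a\<in>{1..k}. (\<Sum>c<d a. K a c c) = 0) \<longrightarrow>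
      3 / 4 * real (n * D) * (\<Sum>a\<le>k. sqnorm2 {..<d a} (K a)) \<le> (\<Sum>p\<in>S. (\<Sum>a\<le>k. sqrt (d a) * act d a (K a) x p)\<^sup>2))"
proof -
  let ?Q = "{..k}"
  let ?M = "real (n * D)"
  have dpos: "d a > 0" if "a \<in> ?Q" for a
  proof (cases "a = 0")
    case False
    then show ?thesis using dmin(2)[of a] dmin(1) that by force
  qed (simp add: d0)
  have Dpos: "D > 0" using D dpos by (simp add: prod_pos)
  have M: "?M > 0" using n Dpos by simp
  have \<rho>0: "\<rho> > 0" using \<rho> by (rule less_le_trans[rotated]) simp
  \<comment> \<open>\<open>4096^2 = 2^24 \<le> \<rho>\<close>, so one half of the exponent
    \<open>2 m\<close> pays for the constant.\<close>
  have pw: "(4096 / \<rho>) ^ (2 * m) \<le> (1 / \<rho>) ^ dmin" if "m \<ge> dmin" for m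
  proof -
    have "4096\<^sup>2 \<le> \<rho>" using \<rho> by simp
    then have "(4096 / \<rho>)\<^sup>2 \<le> 1 / \<rho>" using \<rho>0 by (simp add: power_divide field_simps power2_eq_square)
    then have "((4096 / \<rho>)\<^sup>2) ^ m \<le> (1 / \<rho>) ^ m" by (intro power_mono) auto
    also have "\<dots> \<le> (1 / \<rho>) ^ dmin" using that \<rho> by (intro power_decreasing) auto
    finally show ?thesis by (simp add: power_mult)
  qed
  define th where "th a b = (if a \<in> {0, e} \<or> b \<in> {0, e} then 1 / (32 * sqrt k) else 1 / (32 * real k))" for a b :: nat
  have th: "th a b > 0" for a b using k by (simp add: th_def)
  have sp: "finite S" by (simp add: S_def finite_legs)
  interpret prob_space "gauss S" by (rule prob_space_gauss)

  have diag: "\<exists>E\<in>sets (gauss S). measure (gauss S) E \<le> (1 / \<rho>) ^ dmin \<and>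
    (\<forall>x\<in>space (gauss S) - E. \<forall>K. 15 / 16 * ?M * sqnorm2 {..<d a} K \<le> real (d a) * (\<Sum>p\<in>S. (act d a K x p)\<^sup>2))"
    if a: "a \<in> {1..k}" for a
  proof -
    define N where "N = n * (\<Prod>b\<in>?Q - {a}. d b)"
    have aQ: "a \<in> ?Q" using a by auto
    have NM: "d a * N = n * D" unfolding D N_def using prod.remove[OF _ aQ, of d] by simp
    then have NM': "real (d a) * real N = ?M" by (simp flip: of_nat_mult)
    have da: "real (d a) > 0" using dpos[OF aQ] by simp
    have Npos: "real N > 0" using NM' M da by (metis zero_less_mult_pos)
    have sk: "sqrt k \<ge> 1" using k by simp
    have r1: "d a * \<rho> \<le> sqrt ?M"
    proof -
      have "1 * (d a * \<rho>) \<le> sqrt k * (d a * \<rho>)" using sk \<rho>0 by (intro mult_right_mono) auto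
      then show ?thesis using row[OF a] by (simp add: mult.assoc)
    qed
    have dN: "d a \<le> N"
    proof -
      have "(real (d a) * 1)\<^sup>2 \<le> (real (d a) * \<rho>)\<^sup>2" using \<rho> by (intro power_mono mult_left_mono) auto
      also have "\<dots> \<le> (sqrt ?M)\<^sup>2" using r1 \<rho>0 by (intro power_mono) auto
      finally have "real (d a) * real (d a) \<le> real (d a) * real N" using NM' by (simp add: power2_eq_square)
      then show ?thesis using da by simp
    qed
    \<comment> \<open>The deviation allowed is \<open>N / 16\<close> from the mean \<open>N\<close>,
      and \<open>368 = 23 * 16\<close>.\<close>
    have "23 * sqrt N * sqrt (d a) / (N / 16) = 368 * (d a / sqrt ?M)"
    proof -
      have "sqrt ?M = sqrt (d a) * sqrt N" unfolding NM'[symmetric] by (rule real_sqrt_mult)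
      moreover have "real N = sqrt N * sqrt N" "real (d a) = sqrt (d a) * sqrt (d a)" by simp_all
      ultimately show ?thesis using da Npos by (simp add: field_simps)
    qed
    also have "\<dots> \<le> 4096 / \<rho>"
    proof -
      have "d a / sqrt ?M \<le> 1 / \<rho>" using r1 \<rho>0 M by (simp add: field_simps)
      then have "368 * (d a / sqrt ?M) \<le> 368 * (1 / \<rho>)" by (intro mult_left_mono) auto
      also have "\<dots> \<le> 4096 / \<rho>" using \<rho>0 by (simp add: divide_right_mono)
      finally show ?thesis .
    qed
    finally have "(23 * sqrt N * sqrt (d a) / (N / 16)) ^ (2 * d a) \<le> (4096 / \<rho>) ^ (2 * d a)"
      using Npos by (intro power_mono) auto
    also have "\<dots> \<le> (1 / \<rho>) ^ dmin" using dmin(2)[OF a] by (rule pw)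
    finally have pb: "(23 * sqrt N * sqrt (d a) / (N / 16)) ^ (2 * d a) \<le> (1 / \<rho>) ^ dmin" .
    obtain E where E: "E \<in> sets (gauss S)" "measure (gauss S) E \<le> (23 * sqrt N * sqrt (d a) / (N / 16)) ^ (2 * d a)"
      "\<And>x K. x \<in> space (gauss S) - E \<Longrightarrow> (real N - N / 16) * sqnorm2 {..<d a} K \<le> (\<Sum>p\<in>S. (act d a K x p)\<^sup>2)"
      using leg_diag[of "{..<n}" ?Q a d N "real N / 16"] aQ dpos[OF aQ] dN Npos unfolding S_def[symmetric] by (auto simp: N_def)
    have "15 / 16 * ?M * sqnorm2 {..<d a} K \<le> real (d a) * (\<Sum>p\<in>S. (act d a K x p)\<^sup>2)" if "x \<in> space (gauss S) - E" for x K
    proof -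
      have "real (d a) * ((real N - N / 16) * sqnorm2 {..<d a} K) \<le> real (d a) * (\<Sum>p\<in>S. (act d a K x p)\<^sup>2)"
        using E(3)[OF that] by (intro mult_left_mono) auto
      moreover have "real (d a) * (real N - N / 16) = 15 / 16 * ?M" using NM' by (simp add: algebra_simps)
      ultimately show ?thesis by (simp only: mult.assoc[symmetric])
    qed
    then show ?thesis using E(1,2) pb by (intro bexI[of _ E]) auto
  qed
  have cross: "\<exists>E\<in>sets (gauss S). measure (gauss S) E \<le> (1 / \<rho>) ^ dmin \<and>
    (\<forall>x\<in>space (gauss S) - E. \<forall>K L. (\<Sum>c<d a. K c c) * (\<Sum>c<d b. L c c) = 0 \<longrightarrow>
      sqrt (d a) * sqrt (d b) * \<bar>\<Sum>p\<in>S. act d a K x p * act d b L x p\<bar> \<le> ?M * th a b * sqrt (sqnorm2 {..<d a} K * sqnorm2 {..<d b} L))"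
    if ab: "a \<in> ?Q" "b \<in> ?Q" "a \<noteq> b" for a b
  proof -
    define N where "N = n * (\<Prod>c\<in>?Q - {a, b}. d c)"
    define m where "m = max (d a) (d b)"
    \<comment> \<open>The weights \<open>sqrt (d a)\<close> and \<open>sqrt (d b)\<close> of the
      final sum are divided out, so that the weighted deviation becomes
      \<open>?M * th a b\<close>.\<close>
    define s where "s = ?M * th a b / (sqrt (d a) * sqrt (d b))"
    have da: "real (d a) > 0" "real (d b) > 0" using dpos ab by auto
    have NM: "d a * d b * N = n * D"
    proof -
      have "D = d a * (d b * (\<Prod>c\<in>?Q - {a} - {b}. d c))"
      proof -
        have "(\<Prod>c\<in>?Q. d c) = d a * (\<Prod>c\<in>?Q - {a}. d c)" using ab by (intro prod.remove) auto
        moreover have "(\<Prod>c\<in>?Q - {a}. d c) = d b * (\<Prod>c\<in>?Q - {a} - {b}. d c)" using ab by (intro prod.remove) auto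
        ultimately show ?thesis by (simp only: D)
      qed
      moreover have "?Q - {a} - {b} = ?Q - {a, b}" by auto
      ultimately show ?thesis by (simp add: N_def)
    qed
    then have NM': "real (d a) * real (d b) * real N = ?M" by (simp flip: of_nat_mult)
    have Npos: "real N > 0" using NM' M da by (metis mult_pos_pos zero_less_mult_pos)
    have s: "s > 0" using M th da by (simp add: s_def)
    have mm: "m \<ge> dmin" "m \<le> d a \<or> m \<le> d b" "m > 0"
    proof -
      from ab have "a \<in> {1..k} \<or> b \<in> {1..k}" by auto
      then show "m \<ge> dmin" using dmin(2)[of a] dmin(2)[of b] by (auto simp: m_def le_max_iff_disj)
      then show "m > 0" using dmin(1) by simp
    qed (auto simp: m_def)
    have mr: "m * \<rho> \<le> 32 * th a b * sqrt ?M"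
    proof (cases "a \<in> {0, e} \<or> b \<in> {0, e}")
      case True
      \<comment> \<open>The maximum is the dimension of a leg other than \<open>0\<close>, because
        \<open>d 0 = 1\<close>.\<close>
      obtain c where c: "c \<in> {1..k}" "m = d c"
      proof -
        consider "a = 0" | "b = 0" | "a \<noteq> 0" "b \<noteq> 0" by auto
        then show ?thesis
        proof cases
          case 1
          then have "m = d b" using dpos[OF ab(2)] d0 by (simp add: m_def)
          then show ?thesis using that[of b] ab 1 by auto
        next
          case 2
          then have "m = d a" using dpos[OF ab(1)] d0 by (simp add: m_def)
          then show ?thesis using that[of a] ab 2 by auto
        next
          case 3
          then show ?thesis using that[of a] that[of b] ab by (cases "d a \<le> d b") (auto simp: m_def)
        qed
      qed
      have "sqrt k * (m * \<rho>) \<le> sqrt ?M" using row[OF c(1)] c(2) by (simp add: mult.assoc)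
      then show ?thesis using True k by (simp add: th_def field_simps)
    next
      case False
      then have "a \<in> {1..k} - {e}" "b \<in> {1..k} - {e}" using ab by auto
      from small[OF this(1)] small[OF this(2)] have "k * (m * \<rho>) \<le> sqrt ?M" by (auto simp: m_def max_def mult.assoc)
      then show ?thesis using False k by (simp add: th_def field_simps)
    qed
    have "128 * sqrt N * m / s = 128 * (m / (th a b * sqrt ?M))"
    proof -
      have sM: "sqrt ?M = sqrt (d a) * sqrt (d b) * sqrt N" unfolding NM'[symmetric] by (simp add: real_sqrt_mult)
      have gen: "X * t / (p * q) = r * Y * t" if "X = Y * (p * q * r)" "p > 0" "q > 0" for X Y p q r t :: real
        using that by simp
      have "?M = sqrt ?M * sqrt ?M" using M by simp
      then have "?M = sqrt ?M * (sqrt (d a) * sqrt (d b) * sqrt N)" by (simp only: sM[symmetric])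
      then have "s = sqrt N * sqrt ?M * th a b"
        unfolding s_def using da by (intro gen) auto
      then show ?thesis using Npos th M by (simp add: field_simps)
    qed
    \<comment> \<open>\<open>4096 = 128 * 32\<close>, where 32 comes from the denominators in
      \<open>th\<close>.\<close>
    also have "\<dots> \<le> 4096 / \<rho>"
    proof -
      have "m / (th a b * sqrt ?M) \<le> 32 / \<rho>" using mr \<rho>0 M th[of a b] by (simp add: field_simps)
      then have "128 * (m / (th a b * sqrt ?M)) \<le> 128 * (32 / \<rho>)" by (intro mult_left_mono) auto
      then show ?thesis by simp
    qed
    finally have "(128 * sqrt N * m / s) ^ (2 * m) \<le> (4096 / \<rho>) ^ (2 * m)"
      using Npos s by (intro power_mono) auto
    also have "\<dots> \<le> (1 / \<rho>) ^ dmin" using mm(1) by (rule pw)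
    finally have pb: "(128 * sqrt N * m / s) ^ (2 * m) \<le> (1 / \<rho>) ^ dmin" .
    have "\<exists>E\<in>sets (gauss S). measure (gauss S) E \<le> (128 * sqrt N * m / s) ^ (2 * m) \<and>
      (\<forall>x\<in>space (gauss S) - E. \<forall>K L. (\<Sum>c<d a. K c c) * (\<Sum>c<d b. L c c) = 0 \<longrightarrow>
        \<bar>\<Sum>p\<in>S. act d a K x p * act d b L x p\<bar> \<le> s * sqrt (sqnorm2 {..<d a} K * sqnorm2 {..<d b} L))"
      unfolding S_def using n ab dpos s by (intro leg_cross) (auto simp: N_def m_def lessThan_empty_iff)
    then obtain E where E: "E \<in> sets (gauss S)" "measure (gauss S) E \<le> (128 * sqrt N * m / s) ^ (2 * m)"
      "\<And>x K L. x \<in> space (gauss S) - E \<Longrightarrow> (\<Sum>c<d a. K c c) * (\<Sum>c<d b. L c c) = 0 \<Longrightarrow>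
        \<bar>\<Sum>p\<in>S. act d a K x p * act d b L x p\<bar> \<le> s * sqrt (sqnorm2 {..<d a} K * sqnorm2 {..<d b} L)"
      by blast
    have "sqrt (d a) * sqrt (d b) * \<bar>\<Sum>p\<in>S. act d a K x p * act d b L x p\<bar> \<le> ?M * th a b * sqrt (sqnorm2 {..<d a} K * sqnorm2 {..<d b} L)"
      if "x \<in> space (gauss S) - E" "(\<Sum>c<d a. K c c) * (\<Sum>c<d b. L c c) = 0" for x K L
    proof -
      have "sqrt (d a) * sqrt (d b) * \<bar>\<Sum>p\<in>S. act d a K x p * act d b L x p\<bar> \<le> sqrt (d a) * sqrt (d b) * (s * sqrt (sqnorm2 {..<d a} K * sqnorm2 {..<d b} L))"
        using E(3)[of x K L, OF that] by (intro mult_left_mono) auto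
      moreover have "sqrt (d a) * sqrt (d b) * s = ?M * th a b" using da by (simp add: s_def)
      ultimately show ?thesis by (simp only: mult.assoc[symmetric])
    qed
    then show ?thesis using E(1,2) pb by (intro bexI[of _ E]) auto
  qed
  from diag obtain E1 where E1: "\<And>a. a \<in> {1..k} \<Longrightarrow> E1 a \<in> sets (gauss S)" "\<And>a. a \<in> {1..k} \<Longrightarrow> measure (gauss S) (E1 a) \<le> (1 / \<rho>) ^ dmin"
    "\<And>a x K. a \<in> {1..k} \<Longrightarrow> x \<in> space (gauss S) - E1 a \<Longrightarrow> 15 / 16 * ?M * sqnorm2 {..<d a} K \<le> real (d a) * (\<Sum>p\<in>S. (act d a K x p)\<^sup>2)"
    by metis
  define P where "P = {(a, b). a \<in> ?Q \<and> b \<in> ?Q \<and> a \<noteq> b}"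
  have "\<forall>q\<in>P. \<exists>E. E \<in> sets (gauss S) \<and> measure (gauss S) E \<le> (1 / \<rho>) ^ dmin \<and>
    (\<forall>x\<in>space (gauss S) - E. \<forall>K L. (\<Sum>c<d (fst q). K c c) * (\<Sum>c<d (snd q). L c c) = 0 \<longrightarrow>
      sqrt (d (fst q)) * sqrt (d (snd q)) * \<bar>\<Sum>p\<in>S. act d (fst q) K x p * act d (snd q) L x p\<bar>
        \<le> ?M * th (fst q) (snd q) * sqrt (sqnorm2 {..<d (fst q)} K * sqnorm2 {..<d (snd q)} L))"
    using cross unfolding P_def by fastforce
  from bchoice[OF this] obtain E2 where E2: "\<forall>q\<in>P. E2 q \<in> sets (gauss S) \<and> measure (gauss S) (E2 q) \<le> (1 / \<rho>) ^ dmin \<and>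
    (\<forall>x\<in>space (gauss S) - E2 q. \<forall>K L. (\<Sum>c<d (fst q). K c c) * (\<Sum>c<d (snd q). L c c) = 0 \<longrightarrow>
      sqrt (d (fst q)) * sqrt (d (snd q)) * \<bar>\<Sum>p\<in>S. act d (fst q) K x p * act d (snd q) L x p\<bar>
        \<le> ?M * th (fst q) (snd q) * sqrt (sqnorm2 {..<d (fst q)} K * sqnorm2 {..<d (snd q)} L))" ..
  have E2s: "\<And>q. q \<in> P \<Longrightarrow> E2 q \<in> sets (gauss S)" and E2m: "\<And>q. q \<in> P \<Longrightarrow> measure (gauss S) (E2 q) \<le> (1 / \<rho>) ^ dmin"
    using E2 by blast+
  have E2c: "sqrt (d (fst q)) * sqrt (d (snd q)) * \<bar>\<Sum>p\<in>S. act d (fst q) K x p * act d (snd q) L x p\<bar>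
        \<le> ?M * th (fst q) (snd q) * sqrt (sqnorm2 {..<d (fst q)} K * sqnorm2 {..<d (snd q)} L)"
    if "q \<in> P" "x \<in> space (gauss S) - E2 q" "(\<Sum>c<d (fst q). K c c) * (\<Sum>c<d (snd q). L c c) = 0" for q x K L
    using bspec[OF E2 that(1), THEN conjunct2, THEN conjunct2, THEN bspec, OF that(2), THEN spec, THEN spec, of K L] that(3)
    by (simp only: simp_thms)
  have finP: "finite P" by (rule finite_subset[of _ "?Q \<times> ?Q"]) (auto simp: P_def)
  have cardP: "card P = (k + 1) * k"
  proof -
    have "P = Sigma ?Q (\<lambda>a. ?Q - {a})" by (auto simp: P_def)
    then show ?thesis by (simp add: card_SigmaI)
  qed
  define E where "E = (\<Union>a\<in>{1..k}. E1 a) \<union> (\<Union>q\<in>P. E2 q)"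
  have U: "(\<Union>a\<in>{1..k}. E1 a) \<in> sets (gauss S)" "(\<Union>q\<in>P. E2 q) \<in> sets (gauss S)"
    by (intro sets.finite_UN E1(1) E2s finP finite_atLeastAtMost; assumption)+
  then have Es: "E \<in> sets (gauss S)" unfolding E_def by (rule sets.Un)
  have "measure (gauss S) E \<le> measure (gauss S) (\<Union>a\<in>{1..k}. E1 a) + measure (gauss S) (\<Union>q\<in>P. E2 q)"
    unfolding E_def using U by (rule measure_Un_le)
  also have "\<dots> \<le> (\<Sum>a\<in>{1..k}. measure (gauss S) (E1 a)) + (\<Sum>q\<in>P. measure (gauss S) (E2 q))"
    using E1(1) E2s finP by (intro add_mono measure_UNION_le) auto
  also have "\<dots> \<le> (\<Sum>a\<in>{1..k}. (1 / \<rho>) ^ dmin) + (\<Sum>q\<in>P. (1 / \<rho>) ^ dmin)"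
    using E1(2) E2m by (intro add_mono sum_mono) auto
  \<comment> \<open>There are \<open>k\<close> diagonal events and \<open>k (k + 1)\<close> ordered
    pairs of distinct legs.\<close>
  also have "\<dots> = (real k * (real k + 2)) * (1 / \<rho>) ^ dmin" by (simp add: cardP algebra_simps)
  also have "\<dots> \<le> (real k * (3 * real k)) * (1 / \<rho>) ^ dmin"
    using k \<rho>0 by (intro mult_right_mono mult_left_mono) auto
  finally have Em: "measure (gauss S) E \<le> 3 * (real k)\<^sup>2 * (1 / \<rho>) ^ dmin"
    by (simp add: power2_eq_square mult_ac)
  have "3 / 4 * ?M * (\<Sum>a\<le>k. sqnorm2 {..<d a} (K a)) \<le> (\<Sum>p\<in>S. (\<Sum>a\<le>k. sqrt (d a) * act d a (K a) x p)\<^sup>2)"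
    if x: "x \<in> space (gauss S) - E" and K: "\<forall>a\<in>{1..k}. (\<Sum>c<d a. K a c c) = 0" for x K
  proof -
    define \<kappa> where "\<kappa> a = sqrt (sqnorm2 {..<d a} (K a))" for a
    have \<kappa>: "\<kappa> a \<ge> 0" "(\<kappa> a)\<^sup>2 = sqnorm2 {..<d a} (K a)" for a by (simp_all add: \<kappa>_def sqnorm2_nonneg)
    define c where "c a b = sqrt (d a) * sqrt (d b) * (\<Sum>p\<in>S. act d a (K a) x p * act d b (K b) x p)" for a b
    have total: "(\<Sum>p\<in>S. (\<Sum>a\<le>k. sqrt (d a) * act d a (K a) x p)\<^sup>2) = (\<Sum>a\<le>k. \<Sum>b\<le>k. c a b)"
    proof -
      have "(\<Sum>p\<in>S. (\<Sum>a\<le>k. sqrt (d a) * act d a (K a) x p)\<^sup>2)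
        = (\<Sum>p\<in>S. \<Sum>a\<le>k. \<Sum>b\<le>k. sqrt (d a) * sqrt (d b) * (act d a (K a) x p * act d b (K b) x p))"
        by (simp only: power2_eq_square sum_product mult_ac)
      also have "\<dots> = (\<Sum>a\<le>k. \<Sum>b\<le>k. \<Sum>p\<in>S. sqrt (d a) * sqrt (d b) * (act d a (K a) x p * act d b (K b) x p))"
        by (simp only: sum.swap[of _ _ S])
      finally show ?thesis by (simp only: c_def sum_distrib_left)
    qed
    have dg1: "15 / 16 * ?M * sqnorm2 {..<d a} L \<le> real (d a) * (\<Sum>p\<in>S. (act d a L x p)\<^sup>2)" if "a \<in> {1..k}" for a L
      using E1(3)[OF that, of x L] x that by (auto simp: E_def)
    have dg: "15 / 16 * ?M * (\<kappa> a)\<^sup>2 \<le> c a a" if a: "a \<le> k" for a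
    proof (cases "a = 0")
      case False
      then have "a \<in> {1..k}" using a by auto
      from dg1[OF this, of "K a"] show ?thesis unfolding \<kappa>(2) c_def by (simp add: power2_eq_square)
    next
      case True
      \<comment> \<open>The diagonal term of leg \<open>0\<close> is a multiple of the squared norm
        of \<open>x\<close>. Inserting the identity matrix on leg \<open>e\<close> extracts a bound
        for that norm from the diagonal event of leg \<open>e\<close>.\<close>
      define L :: "nat \<Rightarrow> nat \<Rightarrow> real" where "L i j = (if i = j then 1 else 0)" for i j
      have ek: "e \<le> k" using e by simp
      have "act d e L x p = x p" if "p \<in> S" for p
      proof -
        have "snd p e < d e" using that ek by (auto simp: S_def legs_def PiE_iff)
        then show ?thesis by (simp add: act_def L_def if_distrib[of "\<lambda>z. z * _"] cong: if_cong)
      qed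
      then have 1: "(\<Sum>p\<in>S. (act d e L x p)\<^sup>2) = (\<Sum>p\<in>S. (x p)\<^sup>2)" by simp
      have "sqnorm2 {..<d e} L = (\<Sum>a<d e. \<Sum>b<d e. if a = b then 1 else 0)"
        unfolding sqnorm2_def by (intro sum.cong refl) (simp add: L_def)
      then have 2: "sqnorm2 {..<d e} L = d e" by simp
      have de: "real (d e) > 0" using dpos[of e] ek by simp
      have "real (d e) * (15 / 16 * ?M) \<le> real (d e) * (\<Sum>p\<in>S. (x p)\<^sup>2)"
        using dg1[OF e, of L] unfolding 1 2 by (simp add: mult_ac)
      then have 3: "15 / 16 * ?M \<le> (\<Sum>p\<in>S. (x p)\<^sup>2)" using de by (simp only: mult_le_cancel_left_pos)
      have "act d 0 (K 0) x p = K 0 0 0 * x p" if "p \<in> S" for p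
      proof -
        have "snd p 0 < d 0" using that by (auto simp: S_def legs_def PiE_iff)
        then have "snd p 0 = 0" using d0 by simp
        then have "(snd p)(0 := 0) = snd p" by (simp add: fun_upd_idem)
        then show ?thesis using \<open>snd p 0 = 0\<close> by (simp add: act_def d0)
      qed
      then have "(\<Sum>p\<in>S. (act d 0 (K 0) x p)\<^sup>2) = (K 0 0 0)\<^sup>2 * (\<Sum>p\<in>S. (x p)\<^sup>2)"
        by (simp add: power_mult_distrib sum_distrib_left)
      then have "c 0 0 = (K 0 0 0)\<^sup>2 * (\<Sum>p\<in>S. (x p)\<^sup>2)" by (simp add: c_def d0 power2_eq_square)
      moreover have "(\<kappa> 0)\<^sup>2 = (K 0 0 0)\<^sup>2" unfolding \<kappa>(2) by (simp add: sqnorm2_def d0)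
      ultimately show ?thesis using True mult_left_mono[OF 3, of "(K 0 0 0)\<^sup>2"] by (simp add: mult_ac)
    qed
    have cr: "\<bar>c a b\<bar> \<le> ?M * (th a b * \<kappa> a * \<kappa> b)" if ab: "a \<le> k" "b \<le> k" "a \<noteq> b" for a b
    proof -
      have q: "(a, b) \<in> P" using ab by (simp add: P_def)
      \<comment> \<open>At most one of two distinct legs is leg \<open>0\<close>, so at least one of
        the traces vanishes.\<close>
      have "a \<in> {1..k} \<or> b \<in> {1..k}" using ab by auto
      then have "(\<Sum>c<d a. K a c c) * (\<Sum>c<d b. K b c c) = 0" using K by auto
      moreover have "x \<in> space (gauss S) - E2 (a, b)" using x q by (auto simp: E_def)
      ultimately have "sqrt (d a) * sqrt (d b) * \<bar>\<Sum>p\<in>S. act d a (K a) x p * act d b (K b) x p\<bar>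
        \<le> ?M * th a b * sqrt (sqnorm2 {..<d a} (K a) * sqnorm2 {..<d b} (K b))"
        using E2c[OF q, of x "K a" "K b"] by (simp only: fst_conv snd_conv)
      then show ?thesis by (simp add: c_def abs_mult \<kappa>_def real_sqrt_mult mult_ac)
    qed
    have "(\<Sum>a\<le>k. \<Sum>b\<le>k. c a b) = (\<Sum>a\<le>k. c a a + (\<Sum>b\<in>{..k} - {a}. c a b))"
      by (intro sum.cong refl sum.remove) auto
    also have "\<dots> \<ge> (\<Sum>a\<le>k. 15 / 16 * ?M * (\<kappa> a)\<^sup>2 - (\<Sum>b\<in>{..k} - {a}. ?M * (th a b * \<kappa> a * \<kappa> b)))"
    proof (intro sum_mono)
      fix a assume a: "a \<in> {..k}"
      have "- (\<Sum>b\<in>{..k} - {a}. ?M * (th a b * \<kappa> a * \<kappa> b)) \<le> (\<Sum>b\<in>{..k} - {a}. c a b)"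
        unfolding sum_negf[symmetric]
      proof (intro sum_mono)
        fix b assume "b \<in> {..k} - {a}"
        then have "\<bar>c a b\<bar> \<le> ?M * (th a b * \<kappa> a * \<kappa> b)" using a by (intro cr) auto
        then show "- (?M * (th a b * \<kappa> a * \<kappa> b)) \<le> c a b" by linarith
      qed
      then show "15 / 16 * ?M * (\<kappa> a)\<^sup>2 - (\<Sum>b\<in>{..k} - {a}. ?M * (th a b * \<kappa> a * \<kappa> b)) \<le> c a a + (\<Sum>b\<in>{..k} - {a}. c a b)"
        using dg[of a] a by simp
    qed
    finally have "(\<Sum>a\<le>k. 15 / 16 * ?M * (\<kappa> a)\<^sup>2 - (\<Sum>b\<in>{..k} - {a}. ?M * (th a b * \<kappa> a * \<kappa> b))) \<le> (\<Sum>a\<le>k. \<Sum>b\<le>k. c a b)" .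
    moreover have "(\<Sum>a\<le>k. 15 / 16 * ?M * (\<kappa> a)\<^sup>2 - (\<Sum>b\<in>{..k} - {a}. ?M * (th a b * \<kappa> a * \<kappa> b)))
      = 15 / 16 * ?M * (\<Sum>a\<le>k. (\<kappa> a)\<^sup>2) - ?M * (\<Sum>a\<le>k. \<Sum>b\<in>{..k} - {a}. th a b * \<kappa> a * \<kappa> b)"
      by (simp only: sum_subtractf sum_distrib_left)
    moreover have "?M * (\<Sum>a\<le>k. \<Sum>b\<in>{..k} - {a}. th a b * \<kappa> a * \<kappa> b) \<le> ?M * (5 / 32 * (\<Sum>a\<le>k. (\<kappa> a)\<^sup>2))"
      unfolding th_def using M by (intro mult_left_mono leg_combination[OF k e \<kappa>(1)]) auto
    ultimately have "15 / 16 * ?M * (\<Sum>a\<le>k. (\<kappa> a)\<^sup>2) - ?M * (5 / 32 * (\<Sum>a\<le>k. (\<kappa> a)\<^sup>2)) \<le> (\<Sum>a\<le>k. \<Sum>b\<le>k. c a b)"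
      by linarith
    moreover have "0 \<le> ?M * (\<Sum>a\<le>k. (\<kappa> a)\<^sup>2)" using M by (intro mult_nonneg_nonneg) (auto simp: sum_nonneg)
    \<comment> \<open>\<open>15/16 - 5/32 = 25/32 \<ge> 3/4\<close>.\<close>
    ultimately have "3 / 4 * (?M * (\<Sum>a\<le>k. (\<kappa> a)\<^sup>2)) \<le> (\<Sum>a\<le>k. \<Sum>b\<le>k. c a b)" by linarith
    then show ?thesis unfolding total \<kappa>(2) by (simp only: mult.assoc)
  qed
  then show ?thesis using Es Em by (intro bexI[of _ E]) auto
qed

section \<open>Spectral calculus of symmetric matrices\<close>

lemma sym_matsD: "A \<in> sym_mats d \<Longrightarrow> A \<in> carrier_mat d d" "A \<in> sym_mats d \<Longrightarrow> transpose_mat A = A"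
  by (auto simp: sym_mats_def)

lemma sym_mats_index: "A \<in> sym_mats d \<Longrightarrow> i < d \<Longrightarrow> j < d \<Longrightarrow> A $$ (i, j) = A $$ (j, i)"
  using sym_matsD[of A d] by (metis carrier_matD index_transpose_mat(1))

lemma sym_matsI: "A \<in> carrier_mat d d \<Longrightarrow> (\<And>i j. i < d \<Longrightarrow> j < d \<Longrightarrow> A $$ (i, j) = A $$ (j, i)) \<Longrightarrow> A \<in> sym_mats d"
  unfolding sym_mats_def by (auto intro!: eq_matI)

lemma sym_mats_conj:
  assumes A: "A \<in> sym_mats d" and U: "U \<in> carrier_mat d e"
  shows "transpose_mat U * A * U \<in> sym_mats e"
proof -
  note Ac = sym_matsD[OF A]
  have "transpose_mat (transpose_mat U * A * U) = transpose_mat U * transpose_mat (transpose_mat U * A)"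
    using Ac U by (intro transpose_mult) auto
  also have "transpose_mat (transpose_mat U * A) = A * U"
    using Ac U transpose_mult[of "transpose_mat U" e d A d] by simp
  finally show ?thesis using Ac U by (auto simp: sym_mats_def assoc_mult_mat[of _ e d _ d _ e])
qed

lemma mult_mat_vec_index: "A \<in> carrier_mat n m \<Longrightarrow> v \<in> carrier_vec m \<Longrightarrow> i < n \<Longrightarrow> vec_index (A *\<^sub>v v) i = (\<Sum>j<m. A $$ (i, j) * vec_index v j)"
  by (auto simp: scalar_prod_def atLeast0LessThan intro!: sum.cong)

lemma mult_mat_index: "A \<in> carrier_mat n m \<Longrightarrow> B \<in> carrier_mat m p \<Longrightarrow> i < n \<Longrightarrow> j < p \<Longrightarrow>
  (A * B) $$ (i, j) = (\<Sum>k<m. A $$ (i, k) * B $$ (k, j))"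
  by (auto simp: scalar_prod_def atLeast0LessThan intro!: sum.cong)

text \<open>A complex eigenvalue exists. The Hermitian form of a real symmetric matrix takes real
  values, so the eigenvalue is real; being a root of the real characteristic polynomial, it has a
  real eigenvector.\<close>

lemma symmetric_real_eigenvector:
  assumes A: "A \<in> sym_mats d" and d: "d > 0"
  shows "\<exists>v l. v \<in> carrier_vec d \<and> v \<noteq> 0\<^sub>v d \<and> A *\<^sub>v v = l \<cdot>\<^sub>v v"
proof -
  note Ac = sym_matsD[OF A]
  let ?C = "map_mat complex_of_real A"
  have C: "?C \<in> carrier_mat d d" using Ac by simp
  from spectrum_non_empty[OF C d] obtain k where k: "eigenvalue ?C k" by (auto simp: spectrum_def)
  then obtain v where "eigenvector ?C v k" by (auto simp: eigenvalue_def)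
  then have v: "v \<in> carrier_vec d" "v \<noteq> 0\<^sub>v d" "?C *\<^sub>v v = k \<cdot>\<^sub>v v" using C by (auto simp: eigenvector_def)
  define s where "s = (\<Sum>i<d. \<Sum>j<d. complex_of_real (A $$ (i, j)) * vec_index v j * cnj (vec_index v i))"
  define q where "q = (\<Sum>i<d. (cmod (vec_index v i))\<^sup>2)"
  have "s = (\<Sum>i<d. (\<Sum>j<d. ?C $$ (i, j) * vec_index v j) * cnj (vec_index v i))"
    unfolding s_def using Ac(1) by (auto simp: sum_distrib_right intro!: sum.cong)
  also have "\<dots> = (\<Sum>i<d. vec_index (?C *\<^sub>v v) i * cnj (vec_index v i))"
    using mult_mat_vec_index[OF C v(1)] by (intro sum.cong) auto
  also have "\<dots> = (\<Sum>i<d. k * of_real ((cmod (vec_index v i))\<^sup>2))"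
    unfolding v(3) using v(1) by (intro sum.cong refl) (simp add: complex_mult_cnj cmod_power2 mult.assoc)
  also have "\<dots> = k * of_real q" by (simp add: q_def sum_distrib_left)
  finally have s: "s = k * of_real q" .
  have "cnj s = (\<Sum>i<d. \<Sum>j<d. complex_of_real (A $$ (i, j)) * cnj (vec_index v j) * vec_index v i)"
    by (simp add: s_def)
  also have "\<dots> = (\<Sum>j<d. \<Sum>i<d. complex_of_real (A $$ (i, j)) * cnj (vec_index v j) * vec_index v i)"
    by (rule sum.swap)
  also have "\<dots> = s" unfolding s_def
    by (intro sum.cong refl) (simp add: sym_mats_index[OF A] mult_ac)
  finally have "cnj s = s" .
  obtain i where i: "i < d" "vec_index v i \<noteq> 0" using v(1,2) by (metis carrier_vecD eq_vecI index_zero_vec)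
  have "q > 0" unfolding q_def using i by (intro sum_pos2[of _ i]) auto
  with \<open>cnj s = s\<close> s have "cnj k = k" by simp
  then have kr: "k = of_real (Re k)" by (simp add: complex_eq_iff)
  have "poly (char_poly ?C) k = 0" using k eigenvalue_root_char_poly[OF C] by simp
  then have "poly (char_poly A) (Re k) = 0"
    unfolding of_real_hom.char_poly_hom[OF Ac(1)] by (subst (asm) kr) simp
  then have "eigenvalue A (Re k)" using eigenvalue_root_char_poly[OF Ac(1)] by simp
  then show ?thesis using Ac(1) by (auto simp: eigenvalue_def eigenvector_def)
qed

section \<open>Orthogonal diagonalisation\<close>

definition orth :: "nat \<Rightarrow> real mat \<Rightarrow> bool" where
  "orth d U \<longleftrightarrow> U \<in> carrier_mat d d \<and> transpose_mat U * U = 1\<^sub>m d \<and> U * transpose_mat U = 1\<^sub>m d"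

lemma orth_carrier: "orth d U \<Longrightarrow> U \<in> carrier_mat d d" by (simp add: orth_def)

lemma orth_mult:
  assumes U: "orth d U" and V: "orth d V"
  shows "orth d (U * V)"
proof -
  note c = orth_carrier[OF U] orth_carrier[OF V]
  have t: "transpose_mat (U * V) = transpose_mat V * transpose_mat U" using c by (rule transpose_mult)
  have "transpose_mat V * transpose_mat U * (U * V) = transpose_mat V * (transpose_mat U * U) * V"
    using c by (simp add: assoc_mult_mat[of _ d d _ d _ d])
  moreover have "U * V * (transpose_mat V * transpose_mat U) = U * (V * transpose_mat V) * transpose_mat U"
    using c by (simp add: assoc_mult_mat[of _ d d _ d _ d])
  ultimately show ?thesis using U V c by (simp add: orth_def t)
qed

text \<open>The Householder reflection that exchanges the first unit vector with the normalised
  \<open>v\<close>.\<close>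

lemma reflection_exists:
  assumes v: "v \<in> carrier_vec d" "v \<noteq> 0\<^sub>v d" and d: "d > 0"
  shows "\<exists>H c. orth d H \<and> transpose_mat H = H \<and> c \<noteq> 0 \<and> col H 0 = c \<cdot>\<^sub>v v"
proof -
  define r where "r = sqrt (\<Sum>i<d. (vec_index v i)\<^sup>2)"
  obtain i where i: "i < d" "vec_index v i \<noteq> 0" using v by (metis carrier_vecD eq_vecI index_zero_vec)
  have "(\<Sum>i<d. (vec_index v i)\<^sup>2) > 0" using i by (intro sum_pos2[of _ i]) auto
  then have r: "r > 0" "r\<^sup>2 = (\<Sum>i<d. (vec_index v i)\<^sup>2)" by (simp_all add: r_def)
  define u where "u i = vec_index v i / r" for i
  have u1: "(\<Sum>i<d. (u i)\<^sup>2) = 1"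
    unfolding u_def power_divide sum_divide_distrib[symmetric] r(2)[symmetric] using r(1) by simp
  define w where "w i = u i - (if i = 0 then 1 else 0)" for i
  have ww: "(\<Sum>i<d. w i * w i) = 2 - 2 * u 0"
  proof -
    have "(\<Sum>i<d. w i * w i) = (\<Sum>i<d. (u i)\<^sup>2 + (if i = 0 then 1 - 2 * u i else 0))"
      by (intro sum.cong) (auto simp: w_def power2_eq_square algebra_simps)
    also have "\<dots> = 1 + (1 - 2 * u 0)" using d by (simp add: sum.distrib u1)
    finally show ?thesis by simp
  qed
  \<comment> \<open>This is \<open>2 / |w|^2\<close>. If \<open>v\<close> already points along the
    first axis, then \<open>w = 0\<close> and the reflection degenerates to the identity.\<close>
  define b where "b = (if u 0 = 1 then 0 else 2 / (2 - 2 * u 0))"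
  define H where "H = Matrix.mat d d (\<lambda>(i, j). (if i = j then 1 else 0) - b * w i * w j)"
  have Hc: "H \<in> carrier_mat d d" by (simp add: H_def)
  have Ht: "transpose_mat H = H" by (auto simp: H_def intro!: eq_matI)
  have bb: "b * b * (\<Sum>i<d. w i * w i) = 2 * b"
  proof (cases "u 0 = 1")
    case False
    then have "b = 2 / (2 - 2 * u 0)" "2 - 2 * u 0 \<noteq> 0" by (simp_all add: b_def)
    then have "b * (2 - 2 * u 0) = 2" by (metis nonzero_eq_divide_eq)
    then show ?thesis by (simp only: ww mult.assoc mult.commute)
  qed (simp add: b_def)
  have HH: "H * H = 1\<^sub>m d"
  proof (rule eq_matI)
    fix i j assume ij: "i < dim_row (1\<^sub>m d :: real mat)" "j < dim_col (1\<^sub>m d :: real mat)"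
    then have ij: "i < d" "j < d" by auto
    have "(H * H) $$ (i, j) = (\<Sum>k<d. ((if i = k then 1 else 0) - b * w i * w k) * ((if k = j then 1 else 0) - b * w k * w j))"
      using ij by (subst mult_mat_index[OF Hc Hc]) (auto simp: H_def intro!: sum.cong)
    also have "\<dots> = (\<Sum>k<d. (if i = k then (if k = j then 1 else 0) - b * w k * w j else 0) - (if k = j then b * w i * w k else 0) + (b * b * w i * w j) * (w k * w k))"
      by (intro sum.cong refl) (auto simp: algebra_simps)
    also have "\<dots> = (if i = j then 1 else 0) - b * w i * w j - b * w i * w j + w i * w j * (b * b * (\<Sum>k<d. w k * w k))"
      using ij by (simp add: sum.distrib sum_subtractf sum_distrib_left[symmetric])
    finally show "(H * H) $$ (i, j) = (1\<^sub>m d) $$ (i, j)" using ij by (simp add: bb)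
  qed (use Hc in auto)
  have "col H 0 = (1 / r) \<cdot>\<^sub>v v"
  proof (rule eq_vecI)
    fix i assume "i < dim_vec ((1 / r) \<cdot>\<^sub>v v)"
    then have i: "i < d" using v by simp
    have c: "vec_index (col H 0) i = (if i = 0 then 1 else 0) - b * w i * w 0"
      using i d by (simp add: H_def)
    show "vec_index (col H 0) i = vec_index ((1 / r) \<cdot>\<^sub>v v) i"
    proof (cases "u 0 = 1")
      case True
      have "(\<Sum>i<d. w i * w i) = 0" using ww True by simp
      then have "w i * w i = 0" using i by (subst (asm) sum_nonneg_eq_0_iff) auto
      then have "w i = 0" by simp
      then have "u i = (if i = 0 then 1 else 0)" by (simp add: w_def split: if_splits)
      then show ?thesis using c True i v by (simp add: b_def u_def)
    next
      case False
      then have "b * w 0 = - 1" by (simp add: b_def w_def field_simps)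
      then have "b * w i * w 0 = - w i" by (metis mult.assoc mult.commute mult_minus1)
      then show ?thesis using c i v by (simp add: w_def u_def)
    qed
  qed (use Hc v in auto)
  then show ?thesis using Hc Ht HH r by (intro exI[of _ H] exI[of _ "1 / r"]) (auto simp: orth_def)
qed

lemma mat_diag_mult_simps:
  "1\<^sub>m n * mat_diag n f = (mat_diag n f :: real mat)" "0\<^sub>m m n * mat_diag n f = (0\<^sub>m m n :: real mat)"
  "mat_diag n f * 1\<^sub>m n = (mat_diag n f :: real mat)" "mat_diag n f * 0\<^sub>m n m = (0\<^sub>m n m :: real mat)"
  by (rule left_mult_one_mat[OF mat_diag_dim], rule left_mult_zero_mat[OF mat_diag_dim],
      rule right_mult_one_mat[OF mat_diag_dim], rule right_mult_zero_mat[OF mat_diag_dim])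

text \<open>Deflation: the reflection moves an eigenvector to the first axis, symmetry clears the
  rest of the first row, and the induction hypothesis diagonalises the remaining block.\<close>

theorem spectral_theorem:
  "A \<in> sym_mats d \<Longrightarrow> \<exists>U l. orth d U \<and> A = U * mat_diag d l * transpose_mat U"
proof (induction d arbitrary: A)
  case 0
  then have "A \<in> carrier_mat 0 0" by (simp add: sym_mats_def)
  then have "orth 0 (1\<^sub>m 0)" "A = 1\<^sub>m 0 * mat_diag 0 (\<lambda>_. 0) * transpose_mat (1\<^sub>m 0)"
    by (auto simp: orth_def intro!: eq_matI)
  then show ?case by blast
next
  case (Suc d)
  note A = sym_matsD[OF Suc.prems]
  let ?n = "Suc d"
  obtain v l where v: "v \<in> carrier_vec ?n" "v \<noteq> 0\<^sub>v ?n" "A *\<^sub>v v = l \<cdot>\<^sub>v v"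
    using symmetric_real_eigenvector[OF Suc.prems] by auto
  obtain H c where H: "orth ?n H" "transpose_mat H = H" "c \<noteq> 0" "col H 0 = c \<cdot>\<^sub>v v"
    using reflection_exists[OF v(1,2)] by auto
  have Hc: "H \<in> carrier_mat ?n ?n" using H by (auto simp: orth_def)
  have HH: "H * H = 1\<^sub>m ?n" using H by (simp add: orth_def)
  define B where "B = H * A * H"
  have Bc: "B \<in> carrier_mat ?n ?n" using A Hc by (simp add: B_def)
  have Bs: "B \<in> sym_mats ?n" using sym_mats_conj[OF Suc.prems Hc] H(2) by (simp add: B_def)
  have B0: "B $$ (i, 0) = (if i = 0 then l else 0)" if i: "i < ?n" for i
  proof -
    have "col B 0 = H * A *\<^sub>v col H 0" unfolding B_def using A Hc by (intro col_mult2) auto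
    also have "\<dots> = H *\<^sub>v (A *\<^sub>v (c \<cdot>\<^sub>v v))" using A Hc v by (simp add: H(4))
    also have "A *\<^sub>v (c \<cdot>\<^sub>v v) = l \<cdot>\<^sub>v (c \<cdot>\<^sub>v v)"
      using A v by (simp add: mult_mat_vec[of _ ?n ?n] smult_smult_assoc mult.commute)
    also have "\<dots> = l \<cdot>\<^sub>v col H 0" by (simp add: H(4))
    also have "H *\<^sub>v (l \<cdot>\<^sub>v col H 0) = l \<cdot>\<^sub>v (H *\<^sub>v col H 0)"
      using Hc by (intro mult_mat_vec[of _ ?n ?n] carrier_vecI) auto
    also have "H *\<^sub>v col H 0 = col (H * H) 0" using Hc by (intro col_mult2[symmetric]) auto
    finally have "col B 0 = l \<cdot>\<^sub>v col (1\<^sub>m ?n) 0" by (simp add: HH)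
    then have "vec_index (col B 0) i = vec_index (l \<cdot>\<^sub>v col (1\<^sub>m ?n) 0) i" by simp
    then show ?thesis using i Bc by auto
  qed
  define A' where "A' = Matrix.mat d d (\<lambda>(i, j). B $$ (Suc i, Suc j))"
  have A's: "A' \<in> sym_mats d"
    by (rule sym_matsI) (auto simp: A'_def intro!: sym_mats_index[OF Bs])
  then obtain U' l' where U': "orth d U'" "A' = U' * mat_diag d l' * transpose_mat U'"
    using Suc.IH by blast
  have U'c: "U' \<in> carrier_mat d d" using U' by (auto simp: orth_def)
  let ?z1 = "0\<^sub>m 1 d :: real mat" and ?z2 = "0\<^sub>m d 1 :: real mat"
  define V where "V = four_block_mat (1\<^sub>m 1) ?z1 ?z2 U'"
  define lam where "lam i = (if i = 0 then l else l' (i - 1))" for i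
  have Vc: "V \<in> carrier_mat ?n ?n" unfolding V_def using U'c by auto
  have Vt: "transpose_mat V = four_block_mat (1\<^sub>m 1) ?z1 ?z2 (transpose_mat U')"
    unfolding V_def using U'c by (subst transpose_four_block_mat[of _ 1 1 _ d _ d]) auto
  have one: "four_block_mat (1\<^sub>m 1) ?z1 ?z2 (1\<^sub>m d) = 1\<^sub>m ?n"
    by (rule eq_matI) auto
  have "orth ?n V"
  proof -
    have "transpose_mat V * V = four_block_mat (1\<^sub>m 1) ?z1 ?z2 (transpose_mat U' * U')"
      unfolding Vt unfolding V_def using U'c by (subst mult_four_block_mat[of _ 1 1 _ d _ d _ _ 1 _ d]) auto
    moreover have "V * transpose_mat V = four_block_mat (1\<^sub>m 1) ?z1 ?z2 (U' * transpose_mat U')"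
      unfolding Vt unfolding V_def using U'c by (subst mult_four_block_mat[of _ 1 1 _ d _ d _ _ 1 _ d]) auto
    ultimately show ?thesis using U'(1) Vc one by (simp add: orth_def)
  qed
  have D: "mat_diag ?n lam = four_block_mat (mat_diag 1 (\<lambda>_. l)) ?z1 ?z2 (mat_diag d l')"
    by (rule eq_matI) (auto simp: mat_diag_def lam_def)
  have "B = four_block_mat (mat_diag 1 (\<lambda>_. l)) ?z1 ?z2 A'"
  proof (rule eq_matI)
    fix i j assume "i < dim_row (four_block_mat (mat_diag 1 (\<lambda>_. l)) ?z1 ?z2 A')" "j < dim_col (four_block_mat (mat_diag 1 (\<lambda>_. l)) ?z1 ?z2 A')"
    then have ij: "i < ?n" "j < ?n" by (auto simp: A'_def mat_diag_def)
    show "B $$ (i, j) = four_block_mat (mat_diag 1 (\<lambda>_. l)) ?z1 ?z2 A' $$ (i, j)"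
    proof (cases "j = 0")
      case True
      then show ?thesis using ij B0[of i] by (auto simp: A'_def mat_diag_def)
    next
      case j: False
      show ?thesis
      proof (cases "i = 0")
        case True
        have "B $$ (i, j) = B $$ (j, i)" using ij by (rule sym_mats_index[OF Bs])
        then show ?thesis using ij j True B0[of j] by (auto simp: A'_def mat_diag_def)
      next
        case False
        then show ?thesis using ij j by (auto simp: A'_def mat_diag_def)
      qed
    qed
  qed (use Bc in \<open>auto simp: A'_def mat_diag_def\<close>)
  also have "\<dots> = V * mat_diag ?n lam * transpose_mat V"
  proof -
    have "V * mat_diag ?n lam = four_block_mat (mat_diag 1 (\<lambda>_. l)) ?z1 ?z2 (U' * mat_diag d l')"
      unfolding V_def D using U'c by (subst mult_four_block_mat[of _ 1 1 _ d _ d _ _ 1 _ d]) (auto simp: mat_diag_mult_simps)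
    moreover have c: "U' * mat_diag d l' \<in> carrier_mat d d" "U' * mat_diag d l' * transpose_mat U' \<in> carrier_mat d d"
      using U'c by auto
    ultimately show ?thesis
      unfolding Vt U'(2) using U'c by (simp only:) (subst mult_four_block_mat[of _ 1 1 _ d _ d _ _ 1 _ d],
        auto simp: mat_diag_mult_simps right_mult_zero_mat[OF c(1)] left_add_zero_mat[OF c(2)])
  qed
  finally have B: "B = V * mat_diag ?n lam * transpose_mat V" .
  have "A = H * B * H"
  proof -
    have "H * B * H = (H * H) * A * (H * H)"
      unfolding B_def using A Hc by (simp add: assoc_mult_mat[of _ ?n ?n _ ?n _ ?n])
    then show ?thesis using A HH by simp
  qed
  also have "\<dots> = (H * V) * mat_diag ?n lam * transpose_mat (H * V)"
    unfolding B using Hc Vc H(2) by (simp add: transpose_mult[of _ ?n ?n] assoc_mult_mat[of _ ?n ?n _ ?n _ ?n] mult_carrier_mat[of _ ?n ?n _ ?n])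
  finally show ?case using orth_mult[OF H(1) \<open>orth ?n V\<close>] by blast
qed

section \<open>Functional calculus\<close>

definition spec :: "nat \<Rightarrow> real mat \<Rightarrow> (nat \<Rightarrow> real) \<Rightarrow> real mat" where
  "spec d U l = U * mat_diag d l * transpose_mat U"

lemma spec_exists: "A \<in> sym_mats d \<Longrightarrow> \<exists>U l. orth d U \<and> A = spec d U l"
  unfolding spec_def by (rule spectral_theorem)

lemma spec_carrier: "orth d U \<Longrightarrow> spec d U l \<in> carrier_mat d d"
  by (auto simp: spec_def orth_def)

lemma orth_transpose_carrier: "orth d U \<Longrightarrow> transpose_mat U \<in> carrier_mat d d"
  by (simp add: orth_def)

lemma spec_index:
  assumes U: "orth d U" and ij: "i < d" "j < d"
  shows "spec d U l $$ (i, j) = (\<Sum>k<d. U $$ (i, k) * l k * U $$ (j, k))"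
proof -
  note c = orth_carrier[OF U]
  have "U * mat_diag d l = Matrix.mat d d (\<lambda>(i, j). U $$ (i, j) * l j)"
    using c by (rule mat_diag_mult_right)
  moreover have "U * mat_diag d l \<in> carrier_mat d d" using c by auto
  ultimately show ?thesis
    unfolding spec_def using ij c
    by (subst mult_mat_index[of _ d d _ d]) (auto intro!: sum.cong)
qed

lemma spec_sym: "orth d U \<Longrightarrow> spec d U l \<in> sym_mats d"
  by (rule sym_matsI) (auto simp: spec_carrier spec_index mult_ac)

lemma square_assoc: "A \<in> carrier_mat d d \<Longrightarrow> B \<in> carrier_mat d d \<Longrightarrow> C \<in> carrier_mat d d \<Longrightarrow> A * B * C = A * (B * C)"
  by (rule assoc_mult_mat)

lemma square_one: "A \<in> carrier_mat d d \<Longrightarrow> 1\<^sub>m d * A = (A :: real mat)" "A \<in> carrier_mat d d \<Longrightarrow> A * 1\<^sub>m d = (A :: real mat)"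
  by (rule left_mult_one_mat, assumption) (rule right_mult_one_mat)

lemma square_mult: "A \<in> carrier_mat d d \<Longrightarrow> B \<in> carrier_mat d d \<Longrightarrow> A * B \<in> carrier_mat d d"
  by (rule mult_carrier_mat)

lemma spec_mult: "orth d U \<Longrightarrow> spec d U l * spec d U m = spec d U (\<lambda>i. l i * m i)"
proof -
  assume U: "orth d U"
  note c = orth_carrier[OF U] orth_transpose_carrier[OF U]
  have "spec d U l * spec d U m = U * (mat_diag d l * ((transpose_mat U * U) * (mat_diag d m * transpose_mat U)))"
    unfolding spec_def using c by (simp add: square_assoc[of _ d] square_mult[of _ d])
  also have "\<dots> = U * ((mat_diag d l * mat_diag d m) * transpose_mat U)"
  proof -
    have "transpose_mat U * U * (mat_diag d m * transpose_mat U) = mat_diag d m * transpose_mat U"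
      using U c left_mult_one_mat[OF square_mult[OF mat_diag_dim c(2)]] by (simp add: orth_def)
    then show ?thesis using c square_assoc[OF mat_diag_dim mat_diag_dim c(2)] by simp
  qed
  finally show ?thesis
    unfolding spec_def using c square_assoc[OF c(1) mat_diag_dim c(2)] by simp
qed

lemma spec_one: "orth d U \<Longrightarrow> spec d U (\<lambda>_. 1) = 1\<^sub>m d"
  by (simp add: spec_def orth_def right_mult_one_mat[of U d d])

lemma spec_cong: "(\<And>i. i < d \<Longrightarrow> l i = m i) \<Longrightarrow> spec d U l = spec d U m"
  unfolding spec_def by (rule arg_cong[where f = "\<lambda>D. U * D * transpose_mat U"]) (auto simp: mat_diag_def intro!: eq_matI)

text \<open>The matrix \<open>C = V^T U\<close> intertwines the two diagonal forms. Where an entry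
  of \<open>C\<close> is nonzero, the transformed eigenvalues agree, hence so do the eigenvalues.
  With squaring and with \<open>exp\<close> this yields the uniqueness that the definite
  descriptions of square root and logarithm require.\<close>

lemma spec_inj:
  assumes U: "orth d U" and V: "orth d V"
    and eq: "spec d U (\<lambda>i. f (l i)) = spec d V (\<lambda>i. f (m i))"
    and inj: "\<And>i j. i < d \<Longrightarrow> j < d \<Longrightarrow> f (l i) = f (m j) \<Longrightarrow> l i = m j"
  shows "spec d U l = spec d V m"
proof -
  note c = orth_carrier[OF U] orth_carrier[OF V] orth_transpose_carrier[OF U] orth_transpose_carrier[OF V]
  define C where "C = transpose_mat V * U"
  have Cc: "C \<in> carrier_mat d d" using c by (simp add: C_def square_mult[of _ d])
  have L: "transpose_mat V * spec d U g * U = C * mat_diag d g" for g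
  proof -
    have "transpose_mat V * spec d U g * U = C * (mat_diag d g * (transpose_mat U * U))"
      unfolding spec_def C_def using c by (simp add: square_assoc[of _ d] square_mult[of _ d])
    then show ?thesis using U by (simp add: orth_def mat_diag_mult_simps)
  qed
  have R: "transpose_mat V * spec d V g * U = mat_diag d g * C" for g
  proof -
    have "transpose_mat V * spec d V g * U = (transpose_mat V * V) * (mat_diag d g * C)"
      unfolding spec_def C_def using c by (simp add: square_assoc[of _ d] square_mult[of _ d])
    then show ?thesis using V square_one(1)[OF square_mult[OF mat_diag_dim Cc]] by (simp add: orth_def)
  qed
  have e: "C * mat_diag d (\<lambda>i. f (l i)) = mat_diag d (\<lambda>i. f (m i)) * C"
    unfolding L[symmetric] R[symmetric] eq ..
  have "C * mat_diag d l = mat_diag d m * C"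
  proof (rule eq_matI)
    fix i j assume "i < dim_row (mat_diag d m * C)" "j < dim_col (mat_diag d m * C)"
    then have ij: "i < d" "j < d" using Cc by (auto simp: mat_diag_def)
    have "(C * mat_diag d (\<lambda>i. f (l i))) $$ (i, j) = (mat_diag d (\<lambda>i. f (m i)) * C) $$ (i, j)" using e by simp
    then have "C $$ (i, j) * f (l j) = f (m i) * C $$ (i, j)"
      using ij by (simp add: mat_diag_mult_left[OF Cc] mat_diag_mult_right[OF Cc])
    then have "C $$ (i, j) = 0 \<or> f (l j) = f (m i)" by (auto simp: mult.commute)
    then have "C $$ (i, j) * l j = m i * C $$ (i, j)" using inj[OF ij(2,1)] by auto
    then show "(C * mat_diag d l) $$ (i, j) = (mat_diag d m * C) $$ (i, j)"
      using ij by (simp add: mat_diag_mult_left[OF Cc] mat_diag_mult_right[OF Cc])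
  qed (use Cc in \<open>auto simp: mat_diag_def\<close>)
  then have e2: "transpose_mat V * spec d U l * U = transpose_mat V * spec d V m * U" unfolding L R .
  have X: "V * (transpose_mat V * A * U) * transpose_mat U = A" if A: "A \<in> carrier_mat d d" for A
  proof -
    have "V * (transpose_mat V * A * U) * transpose_mat U = (V * transpose_mat V) * (A * (U * transpose_mat U))"
      using c A by (simp add: square_assoc[of _ d] square_mult[of _ d])
    then show ?thesis using U V A by (simp add: orth_def square_one[of _ d])
  qed
  show ?thesis using X[OF spec_carrier[OF U, of l]] X[OF spec_carrier[OF V, of m]] e2 by metis
qed

lemma mult_vec_square: "A \<in> carrier_mat d d \<Longrightarrow> B \<in> carrier_mat d d \<Longrightarrow> v \<in> carrier_vec d \<Longrightarrow> (A * B) *\<^sub>v v = A *\<^sub>v (B *\<^sub>v v)"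
  by (rule assoc_mult_mat_vec)

lemma scalar_prod_sum: "w \<in> carrier_vec d \<Longrightarrow> scalar_prod v w = (\<Sum>i<d. vec_index v i * vec_index w i)"
  by (auto simp: scalar_prod_def atLeast0LessThan)

lemma scalar_prod_adjoint:
  assumes "A \<in> carrier_mat n m" "v \<in> carrier_vec n" "w \<in> carrier_vec m"
  shows "scalar_prod v (A *\<^sub>v w) = scalar_prod (transpose_mat A *\<^sub>v v) (w :: real vec)"
  using transpose_vec_mult_scalar[OF assms(1,3,2)] by simp

lemma orth_norm:
  assumes U: "orth d U" and v: "v \<in> carrier_vec d"
  shows "scalar_prod (U *\<^sub>v v) (U *\<^sub>v v) = scalar_prod v v" "scalar_prod (transpose_mat U *\<^sub>v v) (transpose_mat U *\<^sub>v v) = scalar_prod v v"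
proof -
  note c = orth_carrier[OF U] orth_transpose_carrier[OF U]
  have "scalar_prod (U *\<^sub>v v) (U *\<^sub>v v) = scalar_prod (transpose_mat U *\<^sub>v (U *\<^sub>v v)) v"
    using c v by (intro scalar_prod_adjoint) auto
  also have "transpose_mat U *\<^sub>v (U *\<^sub>v v) = v"
    using U c v by (simp add: mult_vec_square[symmetric] orth_def)
  finally show "scalar_prod (U *\<^sub>v v) (U *\<^sub>v v) = scalar_prod v v" .
  have "scalar_prod (transpose_mat U *\<^sub>v v) (transpose_mat U *\<^sub>v v) = scalar_prod v (U *\<^sub>v (transpose_mat U *\<^sub>v v))"
    using c v by (intro scalar_prod_adjoint[symmetric]) auto
  also have "U *\<^sub>v (transpose_mat U *\<^sub>v v) = v"
    using U c v by (simp add: mult_vec_square[symmetric] orth_def)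
  finally show "scalar_prod (transpose_mat U *\<^sub>v v) (transpose_mat U *\<^sub>v v) = scalar_prod v v" .
qed

lemma spec_quadratic:
  assumes U: "orth d U" and v: "v \<in> carrier_vec d"
  shows "scalar_prod v (spec d U l *\<^sub>v v) = (\<Sum>k<d. l k * (vec_index (transpose_mat U *\<^sub>v v) k)\<^sup>2)"
proof -
  note c = orth_carrier[OF U] orth_transpose_carrier[OF U]
  let ?w = "transpose_mat U *\<^sub>v v"
  have w: "?w \<in> carrier_vec d" using c v by auto
  have "spec d U l *\<^sub>v v = (U * mat_diag d l) *\<^sub>v ?w"
    unfolding spec_def by (rule mult_vec_square[OF square_mult[OF c(1) mat_diag_dim] c(2) v])
  also have "\<dots> = U *\<^sub>v (mat_diag d l *\<^sub>v ?w)" by (rule mult_vec_square[OF c(1) mat_diag_dim w])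
  finally have "spec d U l *\<^sub>v v = U *\<^sub>v (mat_diag d l *\<^sub>v ?w)" .
  moreover have "mat_diag d l *\<^sub>v ?w \<in> carrier_vec d" by (rule mult_mat_vec_carrier[OF mat_diag_dim w])
  ultimately have "scalar_prod v (spec d U l *\<^sub>v v) = scalar_prod ?w (mat_diag d l *\<^sub>v ?w)"
    using scalar_prod_adjoint[OF c(1) v] by (simp only:)
  also have "\<dots> = (\<Sum>k<d. vec_index ?w k * vec_index (mat_diag d l *\<^sub>v ?w) k)"
    by (rule scalar_prod_sum[OF mult_mat_vec_carrier[OF mat_diag_dim w]])
  also have "\<dots> = (\<Sum>k<d. l k * (vec_index ?w k)\<^sup>2)"
  proof (intro sum.cong refl)
    fix k assume k: "k \<in> {..<d}"
    have "vec_index (mat_diag d l *\<^sub>v ?w) k = (\<Sum>j<d. mat_diag d l $$ (k, j) * vec_index ?w j)"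
      using w k by (intro mult_mat_vec_index[of _ d d]) auto
    also have "\<dots> = (\<Sum>j<d. if j = k then l k * vec_index ?w k else 0)"
      using k by (intro sum.cong) (auto simp: mat_diag_def)
    also have "\<dots> = l k * vec_index ?w k" using k by simp
    finally show "vec_index ?w k * vec_index (mat_diag d l *\<^sub>v ?w) k = l k * (vec_index ?w k)\<^sup>2"
      by (simp add: power2_eq_square)
  qed
  finally show ?thesis .
qed

lemma orth_unit:
  assumes U: "orth d U" and k: "k < d"
  shows "transpose_mat U *\<^sub>v col U k = unit_vec d k" "col U k \<in> carrier_vec d"
proof -
  note c = orth_carrier[OF U]
  show "col U k \<in> carrier_vec d" using c by (intro carrier_vecI) simp
  have "transpose_mat U *\<^sub>v col U k = col (transpose_mat U * U) k"
    by (rule col_mult2[OF orth_transpose_carrier[OF U] c k, symmetric])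
  then show "transpose_mat U *\<^sub>v col U k = unit_vec d k" using U k by (simp add: orth_def)
qed

text \<open>Evaluating the quadratic form at the \<open>k\<close>-th column of \<open>U\<close>
  isolates \<open>l k\<close>.\<close>

lemma PD_spec_pos:
  assumes "spec d U l \<in> PD d" and U: "orth d U" and k: "k < d"
  shows "l k > 0"
proof -
  note u = orth_unit[OF U k]
  have "col U k \<noteq> 0\<^sub>v d"
  proof
    assume "col U k = 0\<^sub>v d"
    then have "scalar_prod (unit_vec d k) (unit_vec d k) = scalar_prod (0\<^sub>v d) (0\<^sub>v d :: real vec)"
      using orth_norm(2)[OF U u(2)] u(1) by simp
    then show False using k by simp
  qed
  then have "0 < scalar_prod (col U k) (spec d U l *\<^sub>v col U k)"
    using assms u by (auto simp: PD_def)
  also have "\<dots> = (\<Sum>j<d. if j = k then l k else 0)"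
    unfolding spec_quadratic[OF U u(2)] u(1) using k by (intro sum.cong) auto
  finally show ?thesis using k by simp
qed

lemma spec_PD:
  assumes U: "orth d U" and l: "\<And>k. k < d \<Longrightarrow> l k > 0"
  shows "spec d U l \<in> PD d"
proof -
  have "0 < scalar_prod v (spec d U l *\<^sub>v v)" if v: "v \<in> carrier_vec d" "v \<noteq> 0\<^sub>v d" for v
  proof -
    let ?w = "transpose_mat U *\<^sub>v v"
    have w: "?w \<in> carrier_vec d" using orth_transpose_carrier[OF U] v by auto
    have "\<exists>k<d. vec_index ?w k \<noteq> 0"
    proof (rule ccontr)
      assume "\<not> ?thesis"
      then have "?w = 0\<^sub>v d" using w orth_carrier[OF U] by (intro eq_vecI) auto
      then have "scalar_prod v v = 0" using orth_norm(2)[OF U v(1)] by simp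
      then have "(\<Sum>i<d. vec_index v i * vec_index v i) = 0" using v(1) by (simp add: scalar_prod_sum)
      then have "\<forall>i<d. vec_index v i = 0" by (subst (asm) sum_nonneg_eq_0_iff) auto
      then show False using v by (metis carrier_vecD eq_vecI index_zero_vec)
    qed
    then obtain k where k: "k < d" "vec_index ?w k \<noteq> 0" by auto
    then show ?thesis unfolding spec_quadratic[OF U v(1)]
      using l by (intro sum_pos2[of _ k]) (auto intro!: mult_nonneg_nonneg simp: less_imp_le)
  qed
  then show ?thesis using spec_sym[OF U] by (simp add: PD_def)
qed

lemma PD_spec_exists:
  assumes "A \<in> PD d"
  shows "\<exists>U l. orth d U \<and> A = spec d U l \<and> (\<forall>k<d. l k > 0)"
proof -
  have "A \<in> sym_mats d" using assms by (simp add: PD_def)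
  from spec_exists[OF this] obtain U l where U: "orth d U" "A = spec d U l" by auto
  then show ?thesis using PD_spec_pos[of d U l] assms by blast
qed

lemma mat_sqrt_spec:
  assumes U: "orth d U" and l: "\<And>k. k < d \<Longrightarrow> l k > 0"
  shows "mat_sqrt (spec d U l) = spec d U (\<lambda>k. sqrt (l k))"
proof -
  have dim: "dim_row (spec d U l) = d" using spec_carrier[OF U, of l] by simp
  show ?thesis unfolding mat_sqrt_def dim
  proof (rule the_equality)
    have "spec d U (\<lambda>k. sqrt (l k)) * spec d U (\<lambda>k. sqrt (l k)) = spec d U l"
      unfolding spec_mult[OF U] using l by (intro spec_cong) (simp add: less_imp_le)
    then show "spec d U (\<lambda>k. sqrt (l k)) \<in> PD d \<and> spec d U (\<lambda>k. sqrt (l k)) * spec d U (\<lambda>k. sqrt (l k)) = spec d U l"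
      using spec_PD[OF U, of "\<lambda>k. sqrt (l k)"] l by simp
    fix B assume B: "B \<in> PD d \<and> B * B = spec d U l"
    then obtain V m where V: "orth d V" "B = spec d V m" "\<And>k. k < d \<Longrightarrow> m k > 0"
      using PD_spec_exists[of B d] by auto
    have "spec d V (\<lambda>i. (m i)\<^sup>2) = spec d U (\<lambda>i. (sqrt (l i))\<^sup>2)"
    proof -
      have "spec d V (\<lambda>i. (m i)\<^sup>2) = spec d V (\<lambda>i. m i * m i)" by (simp only: power2_eq_square)
      also have "\<dots> = B * B" unfolding V(2) by (rule spec_mult[OF V(1), symmetric])
      also have "\<dots> = spec d U l" using B by (rule conjunct2)
      also have "\<dots> = spec d U (\<lambda>i. (sqrt (l i))\<^sup>2)"
      proof (rule spec_cong)
        fix i assume "i < d"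
        from l[OF this] show "l i = (sqrt (l i))\<^sup>2" by simp
      qed
      finally show ?thesis .
    qed
    then have "spec d V m = spec d U (\<lambda>k. sqrt (l k))"
    proof (rule spec_inj[OF V(1) U, where f = "\<lambda>x. x\<^sup>2" and m = "\<lambda>k. sqrt (l k)"])
      fix i j assume ij: "i < d" "j < d" and e: "(m i)\<^sup>2 = (sqrt (l j))\<^sup>2"
      show "m i = sqrt (l j)"
        by (rule power2_eq_imp_eq[OF e less_imp_le[OF V(3)[OF ij(1)]]]) (use l[OF ij(2)] in simp)
    qed
    then show "B = spec d U (\<lambda>k. sqrt (l k))" using V(2) by simp
  qed
qed

lemma spec_pow: "orth d U \<Longrightarrow> spec d U l ^\<^sub>m n = spec d U (\<lambda>k. l k ^ n)"
proof (induction n)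
  case 0
  then show ?case using spec_carrier[OF 0, of l] by (simp add: spec_one)
next
  case (Suc n)
  then show ?case by (simp add: spec_mult mult.commute)
qed

lemma mat_exp_spec:
  assumes U: "orth d U"
  shows "mat_exp (spec d U l) = spec d U (\<lambda>k. exp (l k))"
proof (rule eq_matI)
  have dim: "dim_row (spec d U l) = d" "dim_row (spec d U (\<lambda>k. exp (l k))) = d" "dim_col (spec d U (\<lambda>k. exp (l k))) = d"
    using spec_carrier[OF U, of l] spec_carrier[OF U, of "\<lambda>k. exp (l k)"] by simp_all
  show "dim_row (mat_exp (spec d U l)) = dim_row (spec d U (\<lambda>k. exp (l k)))" "dim_col (mat_exp (spec d U l)) = dim_col (spec d U (\<lambda>k. exp (l k)))"
    by (simp_all add: mat_exp_def dim)
  fix i j assume "i < dim_row (spec d U (\<lambda>k. exp (l k)))" "j < dim_col (spec d U (\<lambda>k. exp (l k)))"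
  then have ij: "i < d" "j < d" by (simp_all add: dim)
  have "(\<lambda>n. l k ^ n / fact n) sums exp (l k)" for k
    using exp_converges[of "l k"] by (simp add: divide_inverse mult.commute)
  then have "(\<lambda>n. \<Sum>k<d. U $$ (i, k) * (l k ^ n / fact n) * U $$ (j, k)) sums (\<Sum>k<d. U $$ (i, k) * exp (l k) * U $$ (j, k))"
    by (intro sums_sum sums_mult sums_mult2)
  moreover have "(\<Sum>k<d. U $$ (i, k) * (l k ^ n / fact n) * U $$ (j, k)) = (spec d U l ^\<^sub>m n) $$ (i, j) / fact n" for n
    using ij U by (simp add: spec_pow spec_index sum_divide_distrib)
  ultimately have "(\<Sum>n. (spec d U l ^\<^sub>m n) $$ (i, j) / fact n) = spec d U (\<lambda>k. exp (l k)) $$ (i, j)"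
    using ij U by (simp add: spec_index sums_unique[symmetric])
  then show "mat_exp (spec d U l) $$ (i, j) = spec d U (\<lambda>k. exp (l k)) $$ (i, j)"
    using ij by (simp add: mat_exp_def dim)
qed

lemma mat_log_spec:
  assumes U: "orth d U" and l: "\<And>k. k < d \<Longrightarrow> l k > 0"
  shows "mat_log (spec d U l) = spec d U (\<lambda>k. ln (l k))"
proof -
  have dim: "dim_row (spec d U l) = d" using spec_carrier[OF U, of l] by simp
  have e: "spec d U l = spec d U (\<lambda>k. exp (ln (l k)))" using l by (intro spec_cong) simp
  show ?thesis unfolding mat_log_def dim
  proof (rule the_equality)
    show "spec d U (\<lambda>k. ln (l k)) \<in> sym_mats d \<and> mat_exp (spec d U (\<lambda>k. ln (l k))) = spec d U l"
      using spec_sym[OF U] mat_exp_spec[OF U] e by simp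
    fix L assume L: "L \<in> sym_mats d \<and> mat_exp L = spec d U l"
    then obtain V m where V: "orth d V" "L = spec d V m" using spec_exists by blast
    have "spec d V (\<lambda>k. exp (m k)) = spec d U (\<lambda>k. exp (ln (l k)))"
      using L V mat_exp_spec[OF V(1)] e by simp
    then have "spec d V m = spec d U (\<lambda>k. ln (l k))"
      by (rule spec_inj[OF V(1) U, where f = exp and m = "\<lambda>k. ln (l k)"]) simp
    then show "L = spec d U (\<lambda>k. ln (l k))" using V(2) by simp
  qed
qed

text \<open>The value at the \<open>k\<close>-th eigenvector. That the set is bounded has to be
  shown too, since the supremum is an upper bound only then.\<close>

lemma op_norm_spec_ge:
  assumes U: "orth d U" and k: "k < d"
  shows "\<bar>l k\<bar> \<le> op_norm (spec d U l)"
proof -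
  let ?A = "spec d U l"
  have A: "?A \<in> carrier_mat d d" "transpose_mat ?A = ?A" using spec_sym[OF U, of l] by (auto simp: sym_mats_def)
  have sq: "scalar_prod (?A *\<^sub>v v) (?A *\<^sub>v v) = (\<Sum>j<d. (l j)\<^sup>2 * (vec_index (transpose_mat U *\<^sub>v v) j)\<^sup>2)" if v: "v \<in> carrier_vec d" for v
  proof -
    have "scalar_prod (?A *\<^sub>v v) (?A *\<^sub>v v) = scalar_prod (transpose_mat ?A *\<^sub>v (?A *\<^sub>v v)) v"
      using A(1) v by (intro scalar_prod_adjoint) auto
    also have "\<dots> = scalar_prod v (?A *\<^sub>v (?A *\<^sub>v v))" unfolding A(2) using A(1) v by (intro comm_scalar_prod) auto
    also have "?A *\<^sub>v (?A *\<^sub>v v) = spec d U (\<lambda>k. (l k)\<^sup>2) *\<^sub>v v"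
      using A(1) v spec_mult[OF U, of l l] by (simp add: mult_vec_square[symmetric] power2_eq_square)
    finally show ?thesis by (simp add: spec_quadratic[OF U v])
  qed
  let ?S = "{v \<in> carrier_vec d. scalar_prod v v \<le> (1 :: real)}"
  have op: "op_norm ?A = (SUP v \<in> ?S. sqrt (scalar_prod (?A *\<^sub>v v) (?A *\<^sub>v v)))"
    using A(1) by (simp add: op_norm_def)
  have bdd: "bdd_above ((\<lambda>v. sqrt (scalar_prod (?A *\<^sub>v v) (?A *\<^sub>v v))) ` ?S)"
  proof (rule bdd_aboveI2)
    fix v assume v: "v \<in> ?S"
    let ?w = "transpose_mat U *\<^sub>v v"
    have w: "?w \<in> carrier_vec d" using orth_transpose_carrier[OF U] v by auto
    have "(\<Sum>j<d. (vec_index ?w j)\<^sup>2) = scalar_prod ?w ?w" using w by (simp add: scalar_prod_sum power2_eq_square)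
    also have "\<dots> \<le> 1" using v orth_norm(2)[OF U] by auto
    finally have 1: "(\<Sum>j<d. (vec_index ?w j)\<^sup>2) \<le> 1" .
    have "scalar_prod (?A *\<^sub>v v) (?A *\<^sub>v v) \<le> (\<Sum>j<d. (l j)\<^sup>2 * 1)"
      unfolding sq[of v] using v
    proof (subst sq, simp, intro sum_mono mult_left_mono)
      fix j assume "j \<in> {..<d}"
      then have "(vec_index ?w j)\<^sup>2 \<le> (\<Sum>j<d. (vec_index ?w j)\<^sup>2)" by (intro member_le_sum) auto
      then show "(vec_index ?w j)\<^sup>2 \<le> 1" using 1 by simp
    qed simp
    then show "sqrt (scalar_prod (?A *\<^sub>v v) (?A *\<^sub>v v)) \<le> sqrt (\<Sum>j<d. (l j)\<^sup>2)" by simp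
  qed
  note u = orth_unit[OF U k]
  have "scalar_prod (col U k) (col U k) = scalar_prod (unit_vec d k) (unit_vec d k :: real vec)"
    using orth_norm(2)[OF U u(2)] u(1) by simp
  then have "col U k \<in> ?S" using u(2) k by simp
  then have "sqrt (scalar_prod (?A *\<^sub>v col U k) (?A *\<^sub>v col U k)) \<le> op_norm ?A"
    unfolding op by (rule cSUP_upper[OF _ bdd])
  moreover have "scalar_prod (?A *\<^sub>v col U k) (?A *\<^sub>v col U k) = (\<Sum>j<d. if j = k then (l k)\<^sup>2 else 0)"
    unfolding sq[OF u(2)] u(1) using k by (intro sum.cong) auto
  ultimately show ?thesis using k by simp
qed

text \<open>The distance to the identity is the norm of the logarithm, so every eigenvalue of
  \<open>T\<close> is at least \<open>exp (- c)\<close>. Closeness of a point to the identity enters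
  the estimates only through this bound.\<close>

lemma d_op_one_lower:
  assumes T: "T \<in> PD d" and c: "d_op T (1\<^sub>m d) \<le> c" and v: "v \<in> carrier_vec d"
  shows "exp (- c) * scalar_prod v v \<le> scalar_prod v (T *\<^sub>v v)"
proof -
  obtain U l where U: "orth d U" "T = spec d U l" "\<And>k. k < d \<Longrightarrow> l k > 0" using PD_spec_exists[OF T] by blast
  have one: "orth d (1\<^sub>m d)" by (simp add: orth_def)
  have sq: "mat_sqrt (1\<^sub>m d) = 1\<^sub>m d"
    using mat_sqrt_spec[OF one, of "\<lambda>_. 1"] spec_one[OF one] by simp
  have inv: "the (mat_inverse (1\<^sub>m d :: real mat)) = 1\<^sub>m d"
  proof (cases "mat_inverse (1\<^sub>m d :: real mat)")
    case None
    have "(1\<^sub>m d :: real mat) \<in> Units (ring_mat TYPE(real) d ())"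
      by (auto simp: Units_def ring_mat_def intro!: bexI[of _ "1\<^sub>m d"])
    then show ?thesis using mat_inverse(1)[OF one_carrier_mat None, where b = "()"] by blast
  next
    case (Some B)
    from mat_inverse(2)[OF one_carrier_mat Some] show ?thesis using Some by auto
  qed
  have Tc: "T \<in> carrier_mat d d" using U spec_carrier by simp
  have "d_op T (1\<^sub>m d) = op_norm (mat_log T)" using Tc by (simp add: d_op_def sq inv)
  also have "mat_log T = spec d U (\<lambda>k. ln (l k))" unfolding U(2) using U by (intro mat_log_spec) auto
  finally have ln: "\<bar>ln (l k)\<bar> \<le> c" if "k < d" for k
    using op_norm_spec_ge[OF U(1) that, of "\<lambda>k. ln (l k)"] c by simp
  have l: "exp (- c) \<le> l k" if "k < d" for k
  proof -
    have "exp (- c) \<le> exp (ln (l k))" using ln[OF that] by simp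
    then show ?thesis using U(3)[OF that] by simp
  qed
  let ?w = "transpose_mat U *\<^sub>v v"
  have w: "?w \<in> carrier_vec d" using orth_transpose_carrier[OF U(1)] v by auto
  have "scalar_prod v v = (\<Sum>k<d. (vec_index ?w k)\<^sup>2)"
    using orth_norm(2)[OF U(1) v] w by (simp add: scalar_prod_sum power2_eq_square)
  then have "exp (- c) * scalar_prod v v = (\<Sum>k<d. exp (- c) * (vec_index ?w k)\<^sup>2)" by (simp add: sum_distrib_left)
  also have "\<dots> \<le> (\<Sum>k<d. l k * (vec_index ?w k)\<^sup>2)" using l by (intro sum_mono mult_right_mono) auto
  finally show ?thesis unfolding U(2) spec_quadratic[OF U(1) v] .
qed

section \<open>Kronecker products\<close>

lemma sum_div_mod:
  fixes f :: "nat \<Rightarrow> nat \<Rightarrow> 'a :: comm_monoid_add"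
  shows "(\<Sum>k<m * n. f (k div n) (k mod n)) = (\<Sum>a<m. \<Sum>b<n. f a b)"
proof (cases "n = 0")
  case False
  have lt: "a * n + b < m * n" if "a < m" "b < n" for a b
  proof -
    have "a * n + b < a * n + n" using that by simp
    also have "\<dots> = Suc a * n" by simp
    also have "\<dots> \<le> m * n" using that by (intro mult_le_mono1) simp
    finally show ?thesis .
  qed
  have "(\<Sum>k<m * n. f (k div n) (k mod n)) = (\<Sum>(a, b)\<in>{..<m} \<times> {..<n}. f a b)"
    by (rule sum.reindex_bij_witness[of _ "\<lambda>(a, b). a * n + b" "\<lambda>k. (k div n, k mod n)"])
      (use False in \<open>auto simp: less_mult_imp_div_less lt\<close>)
  then show ?thesis by (simp add: sum.cartesian_product)
qed simp

lemma kron_carrier: "A \<in> carrier_mat a b \<Longrightarrow> B \<in> carrier_mat c d \<Longrightarrow> kron A B \<in> carrier_mat (a * c) (b * d)"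
  by (auto simp: kron_def)

lemma kron_index:
  "A \<in> carrier_mat a b \<Longrightarrow> B \<in> carrier_mat c d \<Longrightarrow> i < a * c \<Longrightarrow> j < b * d \<Longrightarrow>
    kron A B $$ (i, j) = A $$ (i div c, j div d) * B $$ (i mod c, j mod d)"
  by (auto simp: kron_def)

lemma mod_less_of_less_mult: "i < a * c \<Longrightarrow> i mod c < (c :: nat)"
  by (cases "c = 0") auto

text \<open>Splitting the summation index into quotient and remainder separates the two
  factors.\<close>

lemma kron_mult:
  assumes A: "A \<in> carrier_mat a a" "A' \<in> carrier_mat a a" and B: "B \<in> carrier_mat b b" "B' \<in> carrier_mat b b"
  shows "kron (A * A') (B * B') = kron A B * kron A' B'"
proof (rule eq_matI)
  note c = kron_carrier[OF A(1) B(1)] kron_carrier[OF A(2) B(2)]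
  have AB: "A * A' \<in> carrier_mat a a" "B * B' \<in> carrier_mat b b" using A B by (auto intro: mult_carrier_mat)
  have P: "kron A B * kron A' B' \<in> carrier_mat (a * b) (a * b)" using c by (rule mult_carrier_mat)
  fix i j assume "i < dim_row (kron A B * kron A' B')" "j < dim_col (kron A B * kron A' B')"
  then have ij: "i < a * b" "j < a * b" using c by simp_all
  have d: "i div b < a" "j div b < a" using ij by (auto intro: less_mult_imp_div_less)
  have m: "i mod b < b" "j mod b < b" using ij by (auto intro: mod_less_of_less_mult)
  have "(kron A B * kron A' B') $$ (i, j) = (\<Sum>k<a * b. kron A B $$ (i, k) * kron A' B' $$ (k, j))"
    by (rule mult_mat_index[OF c ij])
  also have "\<dots> = (\<Sum>k<a * b. (A $$ (i div b, k div b) * B $$ (i mod b, k mod b)) * (A' $$ (k div b, j div b) * B' $$ (k mod b, j mod b)))"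
    using ij by (intro sum.cong refl arg_cong2[where f = times] kron_index[OF A(1) B(1)] kron_index[OF A(2) B(2)]) auto
  also have "\<dots> = (\<Sum>k<a. \<Sum>l<b. (A $$ (i div b, k) * B $$ (i mod b, l)) * (A' $$ (k, j div b) * B' $$ (l, j mod b)))"
    by (rule sum_div_mod[where f = "\<lambda>k l. (A $$ (i div b, k) * B $$ (i mod b, l)) * (A' $$ (k, j div b) * B' $$ (l, j mod b))"])
  also have "\<dots> = (\<Sum>k<a. A $$ (i div b, k) * A' $$ (k, j div b)) * (\<Sum>l<b. B $$ (i mod b, l) * B' $$ (l, j mod b))"
    by (simp only: sum_product mult_ac)
  also have "\<dots> = (A * A') $$ (i div b, j div b) * (B * B') $$ (i mod b, j mod b)"
    unfolding mult_mat_index[OF A d] mult_mat_index[OF B m] ..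
  also have "\<dots> = kron (A * A') (B * B') $$ (i, j)"
    by (rule kron_index[OF AB ij, symmetric])
  finally show "kron (A * A') (B * B') $$ (i, j) = (kron A B * kron A' B') $$ (i, j)" by simp
qed (use A B in \<open>simp_all add: kron_def\<close>)

text \<open>Mixed-radix digits, most significant first, as in the lexicographic order of \<^const>\<open>kron\<close>.\<close>

fun dig :: "nat list \<Rightarrow> nat \<Rightarrow> nat \<Rightarrow> nat" where
  "dig [] i a = 0"
| "dig (d # ds) i 0 = i div prod_list ds"
| "dig (d # ds) i (Suc a) = dig ds (i mod prod_list ds) a"

lemma dig_less: "i < prod_list ds \<Longrightarrow> a < length ds \<Longrightarrow> dig ds i a < ds ! a"
proof (induction ds arbitrary: i a)
  case (Cons d ds)
  then show ?case
    by (cases a) (auto intro: less_mult_imp_div_less mod_less_of_less_mult)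
qed simp

lemma dig_inj: "i < prod_list ds \<Longrightarrow> j < prod_list ds \<Longrightarrow> (\<And>a. a < length ds \<Longrightarrow> dig ds i a = dig ds j a) \<Longrightarrow> i = j"
proof (induction ds arbitrary: i j)
  case (Cons d ds)
  have "i div prod_list ds = j div prod_list ds" using Cons.prems(3)[of 0] by simp
  moreover have "i mod prod_list ds = j mod prod_list ds"
  proof (rule Cons.IH)
    show "i mod prod_list ds < prod_list ds" "j mod prod_list ds < prod_list ds"
      using Cons.prems(1,2) by (auto intro: mod_less_of_less_mult)
    fix a assume "a < length ds"
    then show "dig ds (i mod prod_list ds) a = dig ds (j mod prod_list ds) a"
      using Cons.prems(3)[of "Suc a"] by simp
  qed
  ultimately show ?case by (metis div_mult_mod_eq)
qed simp

lemma prod_list_nth: "prod_list ds = (\<Prod>a<length ds. (ds ! a :: nat))"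
proof (induction ds)
  case (Cons d ds)
  then show ?case by (simp add: prod.lessThan_Suc_shift del: prod.lessThan_Suc)
qed simp

definition digf :: "nat list \<Rightarrow> nat \<Rightarrow> nat \<Rightarrow> nat" where
  "digf ds i = (\<lambda>a\<in>{..<length ds}. dig ds i a)"

text \<open>Injectivity is \<open>dig_inj\<close>; surjectivity follows by counting, as both sets
  have \<open>prod_list ds\<close> elements.\<close>

lemma bij_betw_digf: "bij_betw (digf ds) {..<prod_list ds} (\<Pi>\<^sub>E a\<in>{..<length ds}. {..<ds ! a})"
proof -
  have inj: "inj_on (digf ds) {..<prod_list ds}"
  proof (rule inj_onI)
    fix i j assume ij: "i \<in> {..<prod_list ds}" "j \<in> {..<prod_list ds}" and e: "digf ds i = digf ds j"
    have "dig ds i a = dig ds j a" if "a < length ds" for a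
      using fun_cong[OF e, of a] that by (simp add: digf_def)
    then show "i = j" using dig_inj[of i ds j] ij by auto
  qed
  have sub: "digf ds ` {..<prod_list ds} \<subseteq> (\<Pi>\<^sub>E a\<in>{..<length ds}. {..<ds ! a})"
  proof (rule image_subsetI)
    fix i assume i: "i \<in> {..<prod_list ds}"
    show "digf ds i \<in> (\<Pi>\<^sub>E a\<in>{..<length ds}. {..<ds ! a})"
      unfolding digf_def using i dig_less[of i ds] by (intro restrict_PiE[THEN iffD2] Pi_I) auto
  qed
  have "card (digf ds ` {..<prod_list ds}) = prod_list ds" using card_image[OF inj] by simp
  moreover have "card (\<Pi>\<^sub>E a\<in>{..<length ds}. {..<ds ! a}) = prod_list ds"
    by (simp add: card_PiE prod_list_nth)
  ultimately have "digf ds ` {..<prod_list ds} = (\<Pi>\<^sub>E a\<in>{..<length ds}. {..<ds ! a})"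
    using sub by (intro card_subset_eq) (auto simp: finite_PiE)
  then show ?thesis using inj by (simp add: bij_betw_def)
qed

section \<open>Kronecker products of families\<close>

definition sq_mats :: "nat list \<Rightarrow> (nat \<Rightarrow> real mat) \<Rightarrow> bool" where
  "sq_mats ds A \<longleftrightarrow> (\<forall>a<length ds. A a \<in> carrier_mat (ds ! a) (ds ! a))"

text \<open>The factors form a family indexed by positions instead of a list, so that products,
  transposes and diagonal forms can be taken factor by factor.\<close>

definition kronf :: "nat list \<Rightarrow> (nat \<Rightarrow> real mat) \<Rightarrow> real mat" where
  "kronf ds A = kron_list (map A [0..<length ds])"

lemma kronf_Nil: "kronf [] A = 1\<^sub>m 1"
  by (simp add: kronf_def kron_list_def)

lemma kronf_Cons: "kronf (d # ds) A = kron (A 0) (kronf ds (\<lambda>a. A (Suc a)))"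
proof -
  have "map A [0..<Suc (length ds)] = A 0 # map (\<lambda>a. A (Suc a)) [0..<length ds]"
    by (simp add: upt_conv_Cons map_Suc_upt[symmetric] del: upt_Suc)
  then show ?thesis by (simp add: kronf_def kron_list_def del: upt_Suc)
qed

lemma sq_mats_Cons: "sq_mats (d # ds) A \<longleftrightarrow> A 0 \<in> carrier_mat d d \<and> sq_mats ds (\<lambda>a. A (Suc a))"
  by (auto simp: sq_mats_def nth_Cons split: nat.splits)

lemma kronf_carrier: "sq_mats ds A \<Longrightarrow> kronf ds A \<in> carrier_mat (prod_list ds) (prod_list ds)"
proof (induction ds arbitrary: A)
  case (Cons d ds)
  then show ?case unfolding kronf_Cons by (auto simp: sq_mats_Cons intro: kron_carrier)
qed (simp add: kronf_Nil)

lemma kronf_index: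
  "sq_mats ds A \<Longrightarrow> i < prod_list ds \<Longrightarrow> j < prod_list ds \<Longrightarrow>
    kronf ds A $$ (i, j) = (\<Prod>a<length ds. A a $$ (dig ds i a, dig ds j a))"
proof (induction ds arbitrary: A i j)
  case (Cons d ds)
  let ?P = "prod_list ds"
  have A: "A 0 \<in> carrier_mat d d" "sq_mats ds (\<lambda>a. A (Suc a))" using Cons.prems by (simp_all add: sq_mats_Cons)
  have ij: "i < d * ?P" "j < d * ?P" using Cons.prems by auto
  have "kronf (d # ds) A $$ (i, j) = A 0 $$ (i div ?P, j div ?P) * kronf ds (\<lambda>a. A (Suc a)) $$ (i mod ?P, j mod ?P)"
    unfolding kronf_Cons by (rule kron_index[OF A(1) kronf_carrier[OF A(2)] ij])
  also have "kronf ds (\<lambda>a. A (Suc a)) $$ (i mod ?P, j mod ?P) = (\<Prod>a<length ds. A (Suc a) $$ (dig ds (i mod ?P) a, dig ds (j mod ?P) a))"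
    using mod_less_of_less_mult[OF ij(1)] mod_less_of_less_mult[OF ij(2)] by (rule Cons.IH[OF A(2)])
  finally show ?case by (simp add: prod.lessThan_Suc_shift del: prod.lessThan_Suc)
qed (simp add: kronf_Nil)

lemma kronf_cong: "(\<And>a. a < length ds \<Longrightarrow> A a = B a) \<Longrightarrow> kronf ds A = kronf ds B"
  unfolding kronf_def by (rule arg_cong[where f = kron_list]) simp

lemma kronf_mult: "sq_mats ds A \<Longrightarrow> sq_mats ds B \<Longrightarrow> kronf ds (\<lambda>a. A a * B a) = kronf ds A * kronf ds B"
proof (induction ds arbitrary: A B)
  case (Cons d ds)
  then have c: "A 0 \<in> carrier_mat d d" "B 0 \<in> carrier_mat d d" "sq_mats ds (\<lambda>a. A (Suc a))" "sq_mats ds (\<lambda>a. B (Suc a))"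
    by (simp_all add: sq_mats_Cons)
  show ?case unfolding kronf_Cons Cons.IH[OF c(3,4)]
    by (rule kron_mult[OF c(1,2) kronf_carrier[OF c(3)] kronf_carrier[OF c(4)]])
qed (simp add: kronf_Nil)

lemma kronf_transpose:
  assumes A: "sq_mats ds A"
  shows "transpose_mat (kronf ds A) = kronf ds (\<lambda>a. transpose_mat (A a))"
proof (rule eq_matI)
  have At: "sq_mats ds (\<lambda>a. transpose_mat (A a))" using A by (simp add: sq_mats_def)
  note c = kronf_carrier[OF A] kronf_carrier[OF At]
  fix i j assume "i < dim_row (kronf ds (\<lambda>a. transpose_mat (A a)))" "j < dim_col (kronf ds (\<lambda>a. transpose_mat (A a)))"
  then have ij: "i < prod_list ds" "j < prod_list ds" using c by auto
  have "transpose_mat (kronf ds A) $$ (i, j) = kronf ds A $$ (j, i)" using ij c by simp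
  also have "\<dots> = (\<Prod>a<length ds. A a $$ (dig ds j a, dig ds i a))" by (rule kronf_index[OF A ij(2,1)])
  also have "\<dots> = (\<Prod>a<length ds. transpose_mat (A a) $$ (dig ds i a, dig ds j a))"
  proof (intro prod.cong refl)
    fix a assume "a \<in> {..<length ds}"
    then have "A a \<in> carrier_mat (ds ! a) (ds ! a)" "dig ds i a < ds ! a" "dig ds j a < ds ! a"
      using A dig_less[OF ij(1)] dig_less[OF ij(2)] by (auto simp: sq_mats_def)
    then show "A a $$ (dig ds j a, dig ds i a) = transpose_mat (A a) $$ (dig ds i a, dig ds j a)" by simp
  qed
  also have "\<dots> = kronf ds (\<lambda>a. transpose_mat (A a)) $$ (i, j)" by (rule kronf_index[OF At ij, symmetric])
  finally show "transpose_mat (kronf ds A) $$ (i, j) = kronf ds (\<lambda>a. transpose_mat (A a)) $$ (i, j)" .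
next
  have At: "sq_mats ds (\<lambda>a. transpose_mat (A a))" using A by (simp add: sq_mats_def)
  show "dim_row (transpose_mat (kronf ds A)) = dim_row (kronf ds (\<lambda>a. transpose_mat (A a)))"
    "dim_col (transpose_mat (kronf ds A)) = dim_col (kronf ds (\<lambda>a. transpose_mat (A a)))"
    using kronf_carrier[OF A] kronf_carrier[OF At] by simp_all
qed

lemma kronf_diag: "kronf ds (\<lambda>a. mat_diag (ds ! a) (l a)) = mat_diag (prod_list ds) (\<lambda>i. \<Prod>a<length ds. l a (dig ds i a))"
proof (rule eq_matI)
  have A: "sq_mats ds (\<lambda>a. mat_diag (ds ! a) (l a))" by (simp add: sq_mats_def)
  fix i j assume "i < dim_row (mat_diag (prod_list ds) (\<lambda>i. \<Prod>a<length ds. l a (dig ds i a)))" "j < dim_col (mat_diag (prod_list ds) (\<lambda>i. \<Prod>a<length ds. l a (dig ds i a)))"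
  then have ij: "i < prod_list ds" "j < prod_list ds" by (simp_all add: mat_diag_def)
  have "kronf ds (\<lambda>a. mat_diag (ds ! a) (l a)) $$ (i, j) = (\<Prod>a<length ds. mat_diag (ds ! a) (l a) $$ (dig ds i a, dig ds j a))"
    by (rule kronf_index[OF A ij])
  also have "\<dots> = (\<Prod>a<length ds. if dig ds i a = dig ds j a then l a (dig ds j a) else 0)"
    using dig_less[OF ij(1)] dig_less[OF ij(2)] by (intro prod.cong refl) (simp add: mat_diag_def)
  also have "\<dots> = (if i = j then (\<Prod>a<length ds. l a (dig ds j a)) else 0)"
  proof (cases "i = j")
    case False
    then obtain a where "a < length ds" "dig ds i a \<noteq> dig ds j a" using dig_inj[OF ij] by auto
    then have "(\<Prod>a<length ds. if dig ds i a = dig ds j a then l a (dig ds j a) else 0) = 0"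
      by (intro prod_zero) (auto intro!: bexI[of _ a])
    then show ?thesis using False by simp
  qed simp
  finally show "kronf ds (\<lambda>a. mat_diag (ds ! a) (l a)) $$ (i, j) = mat_diag (prod_list ds) (\<lambda>i. \<Prod>a<length ds. l a (dig ds i a)) $$ (i, j)"
    using ij by (simp add: mat_diag_def)
next
  have A: "sq_mats ds (\<lambda>a. mat_diag (ds ! a) (l a))" by (simp add: sq_mats_def)
  from kronf_carrier[OF this]
  show "dim_row (kronf ds (\<lambda>a. mat_diag (ds ! a) (l a))) = dim_row (mat_diag (prod_list ds) (\<lambda>i. \<Prod>a<length ds. l a (dig ds i a)))"
    "dim_col (kronf ds (\<lambda>a. mat_diag (ds ! a) (l a))) = dim_col (mat_diag (prod_list ds) (\<lambda>i. \<Prod>a<length ds. l a (dig ds i a)))"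
    by (simp_all add: mat_diag_def)
qed

lemma kronf_one: "kronf ds (\<lambda>a. 1\<^sub>m (ds ! a)) = 1\<^sub>m (prod_list ds)"
  using kronf_diag[of ds "\<lambda>_ _. 1"] by simp

lemma orth_kronf:
  assumes U: "\<And>a. a < length ds \<Longrightarrow> orth (ds ! a) (U a)"
  shows "orth (prod_list ds) (kronf ds U)"
proof -
  have s: "sq_mats ds U" "sq_mats ds (\<lambda>a. transpose_mat (U a))" using orth_carrier[OF U] by (auto simp: sq_mats_def)
  have "transpose_mat (kronf ds U) * kronf ds U = kronf ds (\<lambda>a. transpose_mat (U a) * U a)"
    unfolding kronf_transpose[OF s(1)] by (rule kronf_mult[OF s(2,1), symmetric])
  also have "\<dots> = kronf ds (\<lambda>a. 1\<^sub>m (ds ! a))" using U by (intro kronf_cong) (simp add: orth_def)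
  finally have 1: "transpose_mat (kronf ds U) * kronf ds U = 1\<^sub>m (prod_list ds)" by (simp add: kronf_one)
  have "kronf ds U * transpose_mat (kronf ds U) = kronf ds (\<lambda>a. U a * transpose_mat (U a))"
    unfolding kronf_transpose[OF s(1)] by (rule kronf_mult[OF s, symmetric])
  also have "\<dots> = kronf ds (\<lambda>a. 1\<^sub>m (ds ! a))" using U by (intro kronf_cong) (simp add: orth_def)
  finally have 2: "kronf ds U * transpose_mat (kronf ds U) = 1\<^sub>m (prod_list ds)" by (simp add: kronf_one)
  show ?thesis using 1 2 kronf_carrier[OF s(1)] by (simp add: orth_def)
qed

text \<open>Diagonalising each factor diagonalises the product, with eigenvalues multiplied along
  the digits of the index. Roots, exponentials and determinants are all computed in such a
  basis.\<close>

lemma kronf_spec: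
  assumes U: "\<And>a. a < length ds \<Longrightarrow> orth (ds ! a) (U a)"
  shows "kronf ds (\<lambda>a. spec (ds ! a) (U a) (l a)) = spec (prod_list ds) (kronf ds U) (\<lambda>i. \<Prod>a<length ds. l a (dig ds i a))"
proof -
  have s: "sq_mats ds U" "sq_mats ds (\<lambda>a. transpose_mat (U a))" using orth_carrier[OF U] by (auto simp: sq_mats_def)
  have d: "sq_mats ds (\<lambda>a. mat_diag (ds ! a) (l a))" by (simp add: sq_mats_def)
  have ud: "sq_mats ds (\<lambda>a. U a * mat_diag (ds ! a) (l a))" using s(1) by (auto simp: sq_mats_def intro: square_mult)
  show ?thesis unfolding spec_def
    by (simp only: kronf_mult[OF ud s(2)] kronf_mult[OF s(1) d] kronf_transpose[OF s(1)] kronf_diag)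
qed

section \<open>Determinants\<close>

lemma det_mat_diag: "Determinant.det (mat_diag n l) = (\<Prod>i<n. l i :: real)"
proof -
  have "upper_triangular (mat_diag n l)" by (auto simp: mat_diag_def)
  then have "Determinant.det (mat_diag n l) = prod_list (diag_mat (mat_diag n l))"
    by (rule det_upper_triangular[OF _ mat_diag_dim])
  also have "diag_mat (mat_diag n l) = map l [0..<n]" by (auto simp: diag_mat_def mat_diag_def)
  also have "prod_list (map l [0..<n]) = (\<Prod>i<n. l i)" by (simp add: prod.distinct_set_conv_list[symmetric] atLeast0LessThan)
  finally show ?thesis .
qed

lemma det_spec:
  assumes U: "orth d U"
  shows "Determinant.det (spec d U l) = (\<Prod>i<d. l i)"
proof -
  note c = orth_carrier[OF U] orth_transpose_carrier[OF U]
  have "Determinant.det U * Determinant.det (transpose_mat U) = Determinant.det (U * transpose_mat U)"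
    by (rule det_mult[OF c, symmetric])
  then have 1: "Determinant.det U * Determinant.det (transpose_mat U) = 1" using U by (simp add: orth_def)
  have "Determinant.det (spec d U l) = Determinant.det U * (\<Prod>i<d. l i) * Determinant.det (transpose_mat U)"
    unfolding spec_def det_mult[OF square_mult[OF c(1) mat_diag_dim] c(2)] det_mult[OF c(1) mat_diag_dim] det_mat_diag ..
  also have "\<dots> = (\<Prod>i<d. l i) * (Determinant.det U * Determinant.det (transpose_mat U))" by simp
  finally show ?thesis using 1 by simp
qed

section \<open>The second derivative along a geodesic\<close>

definition emb :: "nat list \<Rightarrow> nat \<Rightarrow> real mat \<Rightarrow> real mat" where
  "emb ds a K = kronf ds (\<lambda>b. if b = a then K else 1\<^sub>m (ds ! b))"

definition sqrt_point :: "nat list \<Rightarrow> real mat list \<Rightarrow> real mat" where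
  "sqrt_point ds Ts = kronf ds (\<lambda>a. mat_sqrt (Ts ! a))"

text \<open>The operator \<open>M\<close> of the overview applied to \<open>x\<close>, or
  \<open>M'\<close> when the matrices \<open>K a\<close> are the conjugated, nonsymmetric
  ones.\<close>

definition leg_sum :: "nat list \<Rightarrow> real \<Rightarrow> (nat \<Rightarrow> real mat) \<Rightarrow> real Matrix.vec \<Rightarrow> real Matrix.vec" where
  "leg_sum ds h K x = Matrix.vec (prod_list ds) (\<lambda>I. h * vec_index x I +
     (\<Sum>a<length ds. sqrt (real (ds ! a)) * vec_index (emb ds a (K a) *\<^sub>v x) I))"

definition hess :: "nat list \<Rightarrow> nat \<Rightarrow> real mat list \<Rightarrow> real \<times> real mat list \<Rightarrow> (nat \<Rightarrow> real Matrix.vec) \<Rightarrow> real" where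
  "hess ds n Ts H x = 1 / (real n * real (prod_list ds)) *
     (\<Sum>i<n. let v = leg_sum ds (fst H) (\<lambda>a. snd H ! a) (sqrt_point ds Ts *\<^sub>v x i) in scalar_prod v v)"

lemma spec_smult: "orth d U \<Longrightarrow> c \<cdot>\<^sub>m spec d U l = spec d U (\<lambda>k. c * l k)"
proof (rule eq_matI)
  assume U: "orth d U"
  fix i j assume "i < dim_row (spec d U (\<lambda>k. c * l k))" "j < dim_col (spec d U (\<lambda>k. c * l k))"
  then have ij: "i < d" "j < d" using spec_carrier[OF U, of "\<lambda>k. c * l k"] by auto
  then show "(c \<cdot>\<^sub>m spec d U l) $$ (i, j) = spec d U (\<lambda>k. c * l k) $$ (i, j)"
    using spec_carrier[OF U, of l] by (simp add: spec_index[OF U] sum_distrib_left mult_ac)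
next
  assume U: "orth d U"
  show "dim_row (c \<cdot>\<^sub>m spec d U l) = dim_row (spec d U (\<lambda>k. c * l k))" "dim_col (c \<cdot>\<^sub>m spec d U l) = dim_col (spec d U (\<lambda>k. c * l k))"
    using spec_carrier[OF U, of l] spec_carrier[OF U, of "\<lambda>k. c * l k"] by simp_all
qed

lemma spec_norm:
  assumes U: "orth d U" and v: "v \<in> carrier_vec d"
  shows "scalar_prod (spec d U l *\<^sub>v v) (spec d U l *\<^sub>v v) = (\<Sum>k<d. (l k)\<^sup>2 * (vec_index (transpose_mat U *\<^sub>v v) k)\<^sup>2)"
proof -
  let ?A = "spec d U l"
  have A: "?A \<in> carrier_mat d d" "transpose_mat ?A = ?A" using spec_sym[OF U, of l] by (auto simp: sym_mats_def)
  have Av: "?A *\<^sub>v v \<in> carrier_vec d" by (rule mult_mat_vec_carrier[OF A(1) v])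
  have "scalar_prod (?A *\<^sub>v v) (?A *\<^sub>v v) = scalar_prod v (?A *\<^sub>v (?A *\<^sub>v v))"
    using scalar_prod_adjoint[OF A(1) v Av] A(2) by simp
  also have "?A *\<^sub>v (?A *\<^sub>v v) = spec d U (\<lambda>k. l k * l k) *\<^sub>v v"
    unfolding mult_vec_square[OF A(1) A(1) v, symmetric] spec_mult[OF U] ..
  finally show ?thesis by (simp add: spec_quadratic[OF U v] power2_eq_square)
qed

lemma emb_carrier: "a < length ds \<Longrightarrow> K \<in> carrier_mat (ds ! a) (ds ! a) \<Longrightarrow> emb ds a K \<in> carrier_mat (prod_list ds) (prod_list ds)"
  unfolding emb_def by (rule kronf_carrier) (auto simp: sq_mats_def)

context
  fixes ds :: "nat list" and Ts :: "real mat list"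
  assumes Ts: "Ts \<in> PD_tuples ds"
begin

lemma Ts_PD: "a < length ds \<Longrightarrow> Ts ! a \<in> PD (ds ! a)" and length_Ts: "length Ts = length ds"
  using Ts by (auto simp: PD_tuples_def)

lemma point_spec:
  obtains V r where "\<And>a. a < length ds \<Longrightarrow> orth (ds ! a) (V a)"
    "\<And>a. a < length ds \<Longrightarrow> Ts ! a = spec (ds ! a) (V a) (r a)"
    "\<And>a k. a < length ds \<Longrightarrow> k < ds ! a \<Longrightarrow> r a k > 0"
    "\<And>a. a < length ds \<Longrightarrow> mat_sqrt (Ts ! a) = spec (ds ! a) (V a) (\<lambda>k. sqrt (r a k))"
proof -
  have "\<forall>a\<in>{..<length ds}. \<exists>p. orth (ds ! a) (fst p) \<and> Ts ! a = spec (ds ! a) (fst p) (snd p) \<and> (\<forall>k<ds ! a. snd p k > 0)"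
    using PD_spec_exists[OF Ts_PD] by auto
  from bchoice[OF this] obtain p where p: "\<forall>a\<in>{..<length ds}. orth (ds ! a) (fst (p a)) \<and>
      Ts ! a = spec (ds ! a) (fst (p a)) (snd (p a)) \<and> (\<forall>k<ds ! a. snd (p a) k > 0)" ..
  show thesis
  proof (rule that[of "\<lambda>a. fst (p a)" "\<lambda>a. snd (p a)"])
    fix a assume a: "a < length ds"
    show "orth (ds ! a) (fst (p a))" "Ts ! a = spec (ds ! a) (fst (p a)) (snd (p a))" using p a by auto
    show "snd (p a) k > 0" if "k < ds ! a" for k using p a that by auto
    have "mat_sqrt (spec (ds ! a) (fst (p a)) (snd (p a))) = spec (ds ! a) (fst (p a)) (\<lambda>k. sqrt (snd (p a) k))"
      using p a by (intro mat_sqrt_spec) auto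
    then show "mat_sqrt (Ts ! a) = spec (ds ! a) (fst (p a)) (\<lambda>k. sqrt (snd (p a) k))" using p a by auto
  qed
qed

lemma sq_mats_sqrt: "sq_mats ds (\<lambda>a. mat_sqrt (Ts ! a))"
proof -
  obtain V r where V: "\<And>a. a < length ds \<Longrightarrow> orth (ds ! a) (V a)"
    "\<And>a. a < length ds \<Longrightarrow> mat_sqrt (Ts ! a) = spec (ds ! a) (V a) (\<lambda>k. sqrt (r a k))"
    using point_spec by metis
  then show ?thesis using spec_carrier[OF V(1)] by (auto simp: sq_mats_def)
qed

lemma sqrt_point_carrier: "sqrt_point ds Ts \<in> carrier_mat (prod_list ds) (prod_list ds)"
  unfolding sqrt_point_def by (rule kronf_carrier[OF sq_mats_sqrt])

lemma point_facts:
  shows "transpose_mat (sqrt_point ds Ts) = sqrt_point ds Ts"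
    and "sqrt_point ds Ts * sqrt_point ds Ts = kron_list Ts"
    and "Determinant.det (sqrt_point ds Ts) > 0"
    and "kron_list Ts \<in> PD (prod_list ds)"
proof -
  let ?D = "prod_list ds"
  obtain V r where V: "\<And>a. a < length ds \<Longrightarrow> orth (ds ! a) (V a)"
    "\<And>a. a < length ds \<Longrightarrow> Ts ! a = spec (ds ! a) (V a) (r a)"
    "\<And>a k. a < length ds \<Longrightarrow> k < ds ! a \<Longrightarrow> r a k > 0"
    "\<And>a. a < length ds \<Longrightarrow> mat_sqrt (Ts ! a) = spec (ds ! a) (V a) (\<lambda>k. sqrt (r a k))"
    by (rule point_spec) blast
  have W: "orth ?D (kronf ds V)" by (rule orth_kronf[OF V(1)])
  have S: "sqrt_point ds Ts = spec ?D (kronf ds V) (\<lambda>i. \<Prod>a<length ds. sqrt (r a (dig ds i a)))"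
  proof -
    have "sqrt_point ds Ts = kronf ds (\<lambda>a. spec (ds ! a) (V a) (\<lambda>k. sqrt (r a k)))"
      unfolding sqrt_point_def by (rule kronf_cong) (rule V(4))
    also have "\<dots> = spec ?D (kronf ds V) (\<lambda>i. \<Prod>a<length ds. sqrt (r a (dig ds i a)))" by (rule kronf_spec[OF V(1)])
    finally show ?thesis .
  qed
  have "kron_list Ts = kronf ds (\<lambda>a. Ts ! a)" unfolding kronf_def length_Ts[symmetric] map_nth ..
  also have "\<dots> = kronf ds (\<lambda>a. spec (ds ! a) (V a) (r a))" by (rule kronf_cong) (rule V(2))
  also have "\<dots> = spec ?D (kronf ds V) (\<lambda>i. \<Prod>a<length ds. r a (dig ds i a))" by (rule kronf_spec[OF V(1)])
  finally have T: "kron_list Ts = spec ?D (kronf ds V) (\<lambda>i. \<Prod>a<length ds. r a (dig ds i a))" .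
  have pos: "r a (dig ds i a) > 0" if "a < length ds" "i < ?D" for a i
    by (rule V(3)[OF that(1) dig_less[OF that(2,1)]])
  show "transpose_mat (sqrt_point ds Ts) = sqrt_point ds Ts"
    unfolding S using spec_sym[OF W] by (simp add: sym_mats_def)
  show "sqrt_point ds Ts * sqrt_point ds Ts = kron_list Ts"
    unfolding S T spec_mult[OF W] prod.distrib[symmetric]
    using pos by (intro spec_cong prod.cong refl) (simp add: less_imp_le)
  show "Determinant.det (sqrt_point ds Ts) > 0"
    unfolding S det_spec[OF W] using pos by (intro prod_pos) auto
  show "kron_list Ts \<in> PD ?D"
    unfolding T using pos by (intro spec_PD[OF W] prod_pos) auto
qed

text \<open>Matrices acting on different legs commute, so there is a joint eigenbasis. In it the
  exponent of the geodesic is \<open>t\<close> times the diagonal matrix with entries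
  \<open>\<mu>\<close>, and this diagonal matrix represents \<open>M\<close>.\<close>

lemma exp_map_spec:
  assumes H: "H \<in> HH ds"
  obtains U \<mu> where "orth (prod_list ds) U"
    "\<And>t. exp_map ds Ts (HH_scale t H) = sqrt_point ds Ts * spec (prod_list ds) U (\<lambda>J. exp (t * \<mu> J)) * sqrt_point ds Ts"
    "\<And>y. y \<in> carrier_vec (prod_list ds) \<Longrightarrow> spec (prod_list ds) U \<mu> *\<^sub>v y = leg_sum ds (fst H) (\<lambda>a. snd H ! a) y"
proof -
  let ?D = "prod_list ds" and ?k = "length ds"
  obtain h Hs where H': "H = (h, Hs)" by force
  have Hs: "length Hs = ?k" "\<And>a. a < ?k \<Longrightarrow> Hs ! a \<in> sym_mats (ds ! a)" using H by (auto simp: HH_def H')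
  have "\<forall>a\<in>{..<?k}. \<exists>p. orth (ds ! a) (fst p) \<and> Hs ! a = spec (ds ! a) (fst p) (snd p)"
    using spec_exists[OF Hs(2)] by auto
  from bchoice[OF this] obtain p where p: "\<forall>a\<in>{..<?k}. orth (ds ! a) (fst (p a)) \<and> Hs ! a = spec (ds ! a) (fst (p a)) (snd (p a))" ..
  define W where "W a = fst (p a)" for a
  define l where "l a = snd (p a)" for a
  have W: "\<And>a. a < ?k \<Longrightarrow> orth (ds ! a) (W a)" and l: "\<And>a. a < ?k \<Longrightarrow> Hs ! a = spec (ds ! a) (W a) (l a)"
    using p by (auto simp: W_def l_def)
  define U where "U = kronf ds W"
  define \<mu> where "\<mu> J = h + (\<Sum>a<?k. sqrt (real (ds ! a)) * l a (dig ds J a))" for J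
  have U: "orth ?D U" unfolding U_def by (rule orth_kronf[OF W])
  note Rc = sqrt_point_carrier
  have e: "exp_map ds Ts (HH_scale t H) = sqrt_point ds Ts * spec ?D U (\<lambda>J. exp (t * \<mu> J)) * sqrt_point ds Ts" for t
  proof -
    let ?E = "\<lambda>a. spec (ds ! a) (W a) (\<lambda>k. exp (sqrt (real (ds ! a)) * (t * l a k)))"
    have E: "mat_exp (sqrt (real (ds ! a)) \<cdot>\<^sub>m (snd (HH_scale t H) ! a)) = ?E a" if a: "a < ?k" for a
    proof -
      have "snd (HH_scale t H) ! a = t \<cdot>\<^sub>m (Hs ! a)" using a Hs(1) by (simp add: HH_scale_def H')
      then have "sqrt (real (ds ! a)) \<cdot>\<^sub>m (snd (HH_scale t H) ! a) = spec (ds ! a) (W a) (\<lambda>k. sqrt (real (ds ! a)) * (t * l a k))"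
        by (simp only: l[OF a] spec_smult[OF W[OF a]])
      then show ?thesis by (simp only: mat_exp_spec[OF W[OF a]])
    qed
    have sE: "sq_mats ds ?E" using spec_carrier[OF W] by (auto simp: sq_mats_def)
    have sR: "sq_mats ds (\<lambda>a. mat_sqrt (Ts ! a))" by (rule sq_mats_sqrt)
    have sRE: "sq_mats ds (\<lambda>a. mat_sqrt (Ts ! a) * ?E a)" using sR sE by (auto simp: sq_mats_def intro: square_mult)
    have "exp_map ds Ts (HH_scale t H) = exp (t * h) \<cdot>\<^sub>m kronf ds (\<lambda>a. mat_sqrt (Ts ! a) * mat_exp (sqrt (real (ds ! a)) \<cdot>\<^sub>m (snd (HH_scale t H) ! a)) * mat_sqrt (Ts ! a))"
      by (simp add: exp_map_def kronf_def HH_scale_def H')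
    also have "kronf ds (\<lambda>a. mat_sqrt (Ts ! a) * mat_exp (sqrt (real (ds ! a)) \<cdot>\<^sub>m (snd (HH_scale t H) ! a)) * mat_sqrt (Ts ! a))
      = kronf ds (\<lambda>a. mat_sqrt (Ts ! a) * ?E a * mat_sqrt (Ts ! a))"
      by (rule kronf_cong) (simp only: E)
    also have "\<dots> = sqrt_point ds Ts * kronf ds ?E * sqrt_point ds Ts"
      unfolding kronf_mult[OF sRE sR] kronf_mult[OF sR sE] sqrt_point_def ..
    also have "kronf ds ?E = spec ?D U (\<lambda>J. \<Prod>a<?k. exp (sqrt (real (ds ! a)) * (t * l a (dig ds J a))))"
      unfolding U_def by (rule kronf_spec[OF W])
    also have "exp (t * h) \<cdot>\<^sub>m (sqrt_point ds Ts * spec ?D U (\<lambda>J. \<Prod>a<?k. exp (sqrt (real (ds ! a)) * (t * l a (dig ds J a)))) * sqrt_point ds Ts)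
      = sqrt_point ds Ts * (exp (t * h) \<cdot>\<^sub>m spec ?D U (\<lambda>J. \<Prod>a<?k. exp (sqrt (real (ds ! a)) * (t * l a (dig ds J a))))) * sqrt_point ds Ts"
      by (simp only: mult_smult_assoc_mat[OF square_mult[OF Rc spec_carrier[OF U]] Rc] mult_smult_distrib[OF Rc spec_carrier[OF U]])
    also have "exp (t * h) \<cdot>\<^sub>m spec ?D U (\<lambda>J. \<Prod>a<?k. exp (sqrt (real (ds ! a)) * (t * l a (dig ds J a)))) = spec ?D U (\<lambda>J. exp (t * \<mu> J))"
      unfolding spec_smult[OF U]
      by (rule spec_cong) (simp add: \<mu>_def distrib_left exp_add exp_sum sum_distrib_left mult_ac)
    finally show ?thesis .
  qed
  have emb: "emb ds a (Hs ! a) = spec ?D U (\<lambda>J. l a (dig ds J a))" if a: "a < ?k" for a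
  proof -
    have "emb ds a (Hs ! a) = kronf ds (\<lambda>b. spec (ds ! b) (W b) (if b = a then l a else (\<lambda>_. 1)))"
      unfolding emb_def using l[OF a] spec_one[OF W] by (intro kronf_cong) auto
    also have "\<dots> = spec ?D U (\<lambda>J. \<Prod>b<?k. (if b = a then l a else (\<lambda>_. 1)) (dig ds J b))"
      unfolding U_def by (rule kronf_spec[OF W])
    also have "\<dots> = spec ?D U (\<lambda>J. l a (dig ds J a))"
    proof (rule spec_cong)
      fix J
      have "(\<Prod>b<?k. (if b = a then l a else (\<lambda>_. 1)) (dig ds J b)) = (\<Prod>b<?k. if b = a then l a (dig ds J a) else 1)"
        by (intro prod.cong) auto
      then show "(\<Prod>b<?k. (if b = a then l a else (\<lambda>_. 1)) (dig ds J b)) = l a (dig ds J a)" using a by simp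
    qed
    finally show ?thesis .
  qed
  have m: "spec ?D U \<mu> *\<^sub>v y = leg_sum ds (fst H) (\<lambda>a. snd H ! a) y" if y: "y \<in> carrier_vec ?D" for y
  proof (rule eq_vecI)
    have dim: "spec ?D U \<mu> *\<^sub>v y \<in> carrier_vec ?D" by (rule mult_mat_vec_carrier[OF spec_carrier[OF U] y])
    show "dim_vec (spec ?D U \<mu> *\<^sub>v y) = dim_vec (leg_sum ds (fst H) (\<lambda>a. snd H ! a) y)"
      unfolding carrier_vecD[OF dim] by (simp add: leg_sum_def)
    fix I assume "I < dim_vec (leg_sum ds (fst H) (\<lambda>a. snd H ! a) y)"
    then have I: "I < ?D" by (simp add: leg_sum_def)
    have entry: "spec ?D U \<mu> $$ (I, J) = h * spec ?D U (\<lambda>_. 1) $$ (I, J) + (\<Sum>a<?k. sqrt (real (ds ! a)) * emb ds a (Hs ! a) $$ (I, J))"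
      if J: "J < ?D" for J
    proof -
      have "(\<Sum>a<?k. sqrt (real (ds ! a)) * emb ds a (Hs ! a) $$ (I, J)) = (\<Sum>a<?k. \<Sum>K<?D. U $$ (I, K) * (sqrt (real (ds ! a)) * l a (dig ds K a)) * U $$ (J, K))"
        by (intro sum.cong refl) (simp add: emb spec_index[OF U I J] sum_distrib_left mult_ac)
      also have "\<dots> = (\<Sum>K<?D. \<Sum>a<?k. U $$ (I, K) * (sqrt (real (ds ! a)) * l a (dig ds K a)) * U $$ (J, K))" by (rule sum.swap)
      also have "\<dots> = (\<Sum>K<?D. U $$ (I, K) * (\<mu> K - h) * U $$ (J, K))"
        by (simp add: \<mu>_def sum_distrib_left sum_distrib_right)
      finally have "(\<Sum>a<?k. sqrt (real (ds ! a)) * emb ds a (Hs ! a) $$ (I, J)) = (\<Sum>K<?D. U $$ (I, K) * (\<mu> K - h) * U $$ (J, K))" .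
      moreover have "h * spec ?D U (\<lambda>_. 1) $$ (I, J) = (\<Sum>K<?D. U $$ (I, K) * h * U $$ (J, K))"
        by (simp add: spec_index[OF U I J] sum_distrib_left mult_ac)
      moreover have "spec ?D U \<mu> $$ (I, J) = (\<Sum>K<?D. U $$ (I, K) * h * U $$ (J, K) + U $$ (I, K) * (\<mu> K - h) * U $$ (J, K))"
        unfolding spec_index[OF U I J] by (intro sum.cong refl) (simp add: algebra_simps)
      ultimately show ?thesis by (simp add: sum.distrib)
    qed
    have "vec_index (spec ?D U \<mu> *\<^sub>v y) I = (\<Sum>J<?D. spec ?D U \<mu> $$ (I, J) * vec_index y J)"
      by (rule mult_mat_vec_index[OF spec_carrier[OF U] y I])
    also have "\<dots> = (\<Sum>J<?D. h * (spec ?D U (\<lambda>_. 1) $$ (I, J) * vec_index y J) + (\<Sum>a<?k. sqrt (real (ds ! a)) * (emb ds a (Hs ! a) $$ (I, J) * vec_index y J)))"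
      using entry by (intro sum.cong refl) (simp add: distrib_right sum_distrib_right mult.assoc)
    also have "\<dots> = h * (\<Sum>J<?D. spec ?D U (\<lambda>_. 1) $$ (I, J) * vec_index y J) + (\<Sum>a<?k. sqrt (real (ds ! a)) * (\<Sum>J<?D. emb ds a (Hs ! a) $$ (I, J) * vec_index y J))"
      unfolding sum.distrib by (subst sum.swap) (simp only: sum_distrib_left)
    also have "(\<Sum>J<?D. spec ?D U (\<lambda>_. 1) $$ (I, J) * vec_index y J) = vec_index (spec ?D U (\<lambda>_. 1) *\<^sub>v y) I"
      by (rule mult_mat_vec_index[OF spec_carrier[OF U] y I, symmetric])
    also have "spec ?D U (\<lambda>_. 1) *\<^sub>v y = y" using y by (simp add: spec_one[OF U])
    also have "(\<Sum>a<?k. sqrt (real (ds ! a)) * (\<Sum>J<?D. emb ds a (Hs ! a) $$ (I, J) * vec_index y J))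
      = (\<Sum>a<?k. sqrt (real (ds ! a)) * vec_index (emb ds a (Hs ! a) *\<^sub>v y) I)"
      using sym_matsD(1)[OF Hs(2)] by (intro sum.cong refl arg_cong2[where f = times] mult_mat_vec_index[OF emb_carrier y I, symmetric]) auto
    finally show "vec_index (spec ?D U \<mu> *\<^sub>v y) I = vec_index (leg_sum ds (fst H) (\<lambda>a. snd H ! a) y) I"
      using I by (simp add: leg_sum_def H')
  qed
  show thesis using U e m by (rule that)
qed

text \<open>Along the geodesic the logarithm of the determinant is affine in \<open>t\<close> and
  drops out of the second derivative. The rest is a combination of the functions
  \<open>exp (t * \<mu> J)\<close>, whose second derivatives at 0 are the eigenvalues of
  \<open>M\<close> squared.\<close>

lemma second_derivative:
  assumes H: "H \<in> HH ds" and x: "\<And>i. i < n \<Longrightarrow> x i \<in> carrier_vec (prod_list ds)"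
  obtains g where
    "\<And>t. ((\<lambda>u. objective n (prod_list ds) x (exp_map ds Ts (HH_scale u H))) has_real_derivative g t) (at t)"
    "(g has_real_derivative hess ds n Ts H x) (at 0)"
proof -
  let ?D = "prod_list ds"
  let ?R = "sqrt_point ds Ts"
  obtain U \<mu> where U: "orth ?D U"
    and e: "\<And>t. exp_map ds Ts (HH_scale t H) = ?R * spec ?D U (\<lambda>J. exp (t * \<mu> J)) * ?R"
    and m: "\<And>y. y \<in> carrier_vec ?D \<Longrightarrow> spec ?D U \<mu> *\<^sub>v y = leg_sum ds (fst H) (\<lambda>a. snd H ! a) y"
    by (rule exp_map_spec[OF H]) blast
  note Rc = sqrt_point_carrier and Rt = point_facts(1) and Rdet = point_facts(3)
  have Rx: "?R *\<^sub>v x i \<in> carrier_vec ?D" if "i < n" for i by (rule mult_mat_vec_carrier[OF Rc x[OF that]])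
  define w where "w i J = (vec_index (transpose_mat U *\<^sub>v (?R *\<^sub>v x i)) J)\<^sup>2" for i J
  have quad: "scalar_prod (x i) (?R * spec ?D U l * ?R *\<^sub>v x i) = (\<Sum>J<?D. l J * w i J)" if i: "i < n" for i l
  proof -
    note S = spec_carrier[OF U, of l]
    have "?R * spec ?D U l * ?R *\<^sub>v x i = ?R *\<^sub>v (spec ?D U l *\<^sub>v (?R *\<^sub>v x i))"
      unfolding mult_vec_square[OF square_mult[OF Rc S] Rc x[OF i]] mult_vec_square[OF Rc S Rx[OF i]] ..
    then have "scalar_prod (x i) (?R * spec ?D U l * ?R *\<^sub>v x i) = scalar_prod (?R *\<^sub>v x i) (spec ?D U l *\<^sub>v (?R *\<^sub>v x i))"
      using scalar_prod_adjoint[OF Rc x[OF i] mult_mat_vec_carrier[OF S Rx[OF i]]] Rt by simp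
    then show ?thesis unfolding spec_quadratic[OF U Rx[OF i]] w_def .
  qed
  have lndet: "ln (Determinant.det (?R * spec ?D U (\<lambda>J. exp (t * \<mu> J)) * ?R)) = 2 * ln (Determinant.det ?R) + t * (\<Sum>J<?D. \<mu> J)" for t
  proof -
    note S = spec_carrier[OF U, of "\<lambda>J. exp (t * \<mu> J)"]
    have "Determinant.det (?R * spec ?D U (\<lambda>J. exp (t * \<mu> J)) * ?R) = Determinant.det ?R * exp (t * (\<Sum>J<?D. \<mu> J)) * Determinant.det ?R"
      unfolding det_mult[OF square_mult[OF Rc S] Rc] det_mult[OF Rc S] det_spec[OF U]
      by (simp add: exp_sum sum_distrib_left)
    then show ?thesis using Rdet by (simp add: ln_mult)
  qed
  define F where "F t = 1 / (real n * real ?D) * (\<Sum>i<n. \<Sum>J<?D. exp (t * \<mu> J) * w i J) - 1 / real ?D * (2 * ln (Determinant.det ?R) + t * (\<Sum>J<?D. \<mu> J))" for t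
  define g where "g t = 1 / (real n * real ?D) * (\<Sum>i<n. \<Sum>J<?D. \<mu> J * exp (t * \<mu> J) * w i J) - 1 / real ?D * (\<Sum>J<?D. \<mu> J)" for t
  have obj: "(\<lambda>u. objective n ?D x (exp_map ds Ts (HH_scale u H))) = F"
    unfolding objective_def e F_def lndet using quad by (auto intro!: ext)
  have d1: "(F has_real_derivative g t) (at t)" for t
  proof -
    have "((\<lambda>t. \<Sum>i<n. \<Sum>J<?D. exp (t * \<mu> J) * w i J) has_real_derivative (\<Sum>i<n. \<Sum>J<?D. \<mu> J * exp (t * \<mu> J) * w i J)) (at t)"
      by (intro DERIV_sum) (auto intro!: derivative_eq_intros)
    moreover have "((\<lambda>t. 2 * ln (Determinant.det ?R) + t * (\<Sum>J<?D. \<mu> J)) has_real_derivative (\<Sum>J<?D. \<mu> J)) (at t)"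
      by (auto intro!: derivative_eq_intros)
    ultimately show ?thesis unfolding F_def g_def by (intro DERIV_diff DERIV_cmult)
  qed
  have d2: "(g has_real_derivative 1 / (real n * real ?D) * (\<Sum>i<n. \<Sum>J<?D. (\<mu> J)\<^sup>2 * w i J)) (at 0)"
  proof -
    have "((\<lambda>t. \<Sum>i<n. \<Sum>J<?D. \<mu> J * exp (t * \<mu> J) * w i J) has_real_derivative (\<Sum>i<n. \<Sum>J<?D. (\<mu> J)\<^sup>2 * w i J)) (at 0)"
      by (intro DERIV_sum) (auto intro!: derivative_eq_intros simp: power2_eq_square)
    then have "(g has_real_derivative 1 / (real n * real ?D) * (\<Sum>i<n. \<Sum>J<?D. (\<mu> J)\<^sup>2 * w i J) - 0) (at 0)"
      unfolding g_def by (intro DERIV_diff DERIV_cmult DERIV_const)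
    then show ?thesis by simp
  qed
  have "hess ds n Ts H x = 1 / (real n * real ?D) * (\<Sum>i<n. \<Sum>J<?D. (\<mu> J)\<^sup>2 * w i J)"
    unfolding hess_def Let_def
  proof (intro arg_cong2[where f = times] refl sum.cong)
    fix i assume "i \<in> {..<n}"
    then have i: "i < n" by simp
    show "scalar_prod (leg_sum ds (fst H) (\<lambda>a. snd H ! a) (?R *\<^sub>v x i)) (leg_sum ds (fst H) (\<lambda>a. snd H ! a) (?R *\<^sub>v x i)) = (\<Sum>J<?D. (\<mu> J)\<^sup>2 * w i J)"
      unfolding m[OF Rx[OF i], symmetric] spec_norm[OF U Rx[OF i]] w_def ..
  qed
  then have "(g has_real_derivative hess ds n Ts H x) (at 0)" using d2 by simp
  then show thesis using d1 unfolding obj[symmetric] by (intro that)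
qed

end

text \<open>Derivatives are unique, so the existentially quantified \<open>g\<close> and
  \<open>s\<close> must be the computed ones. An equivalence is proved instead of one implication
  because the measurability of the event rests on an exact description of it.\<close>

lemma strongly_convex_at_iff:
  assumes x: "\<And>i. i < n \<Longrightarrow> x i \<in> carrier_vec (prod_list ds)"
  shows "strongly_convex_at ds lam (objective n (prod_list ds) x) T \<longleftrightarrow>
    (\<forall>Ts\<in>PD_tuples ds. kron_list Ts = T \<longrightarrow> (\<forall>H\<in>HH ds. lam * (HH_norm H)\<^sup>2 \<le> hess ds n Ts H x))"
proof -
  have key: "(\<exists>g s. (\<forall>\<^sub>F t in nhds 0. ((\<lambda>u. objective n (prod_list ds) x (exp_map ds Ts (HH_scale u H))) has_real_derivative g t) (at t)) \<and>
        (g has_real_derivative s) (at 0) \<and> s \<ge> c) \<longleftrightarrow> c \<le> hess ds n Ts H x"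
    if Ts: "Ts \<in> PD_tuples ds" and H: "H \<in> HH ds" for Ts H c
  proof -
    obtain g0 where g0: "\<And>t. ((\<lambda>u. objective n (prod_list ds) x (exp_map ds Ts (HH_scale u H))) has_real_derivative g0 t) (at t)"
      "(g0 has_real_derivative hess ds n Ts H x) (at 0)"
      by (rule second_derivative[where x = x and n = n, OF Ts H x]) (assumption, rule that)
    show ?thesis
    proof
      assume "\<exists>g s. (\<forall>\<^sub>F t in nhds 0. ((\<lambda>u. objective n (prod_list ds) x (exp_map ds Ts (HH_scale u H))) has_real_derivative g t) (at t)) \<and>
        (g has_real_derivative s) (at 0) \<and> s \<ge> c"
      then obtain g s where g: "\<forall>\<^sub>F t in nhds 0. ((\<lambda>u. objective n (prod_list ds) x (exp_map ds Ts (HH_scale u H))) has_real_derivative g t) (at t)"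
        "(g has_real_derivative s) (at 0)" "s \<ge> c" by blast
      have ev: "\<forall>\<^sub>F t in nhds 0. g t = g0 t"
        using g(1) by (rule eventually_mono) (rule DERIV_unique[OF _ g0(1)])
      then have "(g0 has_real_derivative s) (at 0)"
        by (rule DERIV_cong_ev[OF refl _ refl, THEN iffD1, OF _ g(2)])
      then have "s = hess ds n Ts H x" using g0(2) by (rule DERIV_unique)
      then show "c \<le> hess ds n Ts H x" using g(3) by simp
    next
      assume "c \<le> hess ds n Ts H x"
      then show "\<exists>g s. (\<forall>\<^sub>F t in nhds 0. ((\<lambda>u. objective n (prod_list ds) x (exp_map ds Ts (HH_scale u H))) has_real_derivative g t) (at t)) \<and>
        (g has_real_derivative s) (at 0) \<and> s \<ge> c"
        using g0 by (intro exI[of _ g0] exI[of _ "hess ds n Ts H x"]) (auto intro: always_eventually)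
    qed
  qed
  show ?thesis unfolding strongly_convex_at_def by (intro ball_cong imp_cong refl) (rule key)
qed

section \<open>Conjugation of a direction by the square root of the point\<close>

lemma mat_trace_mult:
  assumes "A \<in> carrier_mat d d" "B \<in> carrier_mat d d"
  shows "mat_trace (A * B) = (\<Sum>i<d. \<Sum>j<d. A $$ (i, j) * B $$ (j, i))"
proof -
  have "dim_row (A * B) = d" using assms by simp
  then show ?thesis unfolding mat_trace_def using mult_mat_index[OF assms] by simp
qed

lemma mat_trace_commute:
  assumes "A \<in> carrier_mat d d" "B \<in> carrier_mat d d"
  shows "mat_trace (A * B) = mat_trace (B * A)"
  unfolding mat_trace_mult[OF assms] mat_trace_mult[OF assms(2,1)]
  by (subst sum.swap) (simp add: mult.commute)

text \<open>\<open>Tr (K K)\<close> is invariant under conjugation and at most the squared Frobenius norm of \<open>K\<close>.\<close>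

lemma conjugate_symmetric:
  assumes H: "H \<in> sym_mats d" and R: "R \<in> carrier_mat d d" and Q: "Q \<in> carrier_mat d d" and RQ: "R * Q = 1\<^sub>m d"
  defines "K \<equiv> Q * H * R"
  shows "K \<in> carrier_mat d d" "R * K = H * R" "mat_trace K = mat_trace H"
    "mat_trace (transpose_mat H * H) \<le> (\<Sum>i<d. \<Sum>j<d. (K $$ (i, j))\<^sup>2)"
proof -
  note Hc = sym_matsD[OF H]
  have HR: "H * R \<in> carrier_mat d d" and QH: "Q * H \<in> carrier_mat d d" using square_mult Hc R Q by blast+
  have K: "K = Q * (H * R)" unfolding K_def by (rule square_assoc[OF Q Hc(1) R])
  show Kc: "K \<in> carrier_mat d d" unfolding K by (rule square_mult[OF Q HR])
  have "R * K = (R * Q) * (H * R)" unfolding K by (rule square_assoc[OF R Q HR, symmetric])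
  then show RK: "R * K = H * R" unfolding RQ square_one(1)[OF HR] .
  have "mat_trace K = mat_trace (R * (Q * H))" unfolding K_def by (rule mat_trace_commute[OF QH R])
  also have "R * (Q * H) = (R * Q) * H" by (rule square_assoc[OF R Q Hc(1), symmetric])
  finally show "mat_trace K = mat_trace H" unfolding RQ square_one(1)[OF Hc(1)] .
  have "mat_trace (transpose_mat H * H) = mat_trace (H * H)" unfolding Hc(2) ..
  also have "\<dots> = mat_trace (K * K)"
  proof -
    have "mat_trace (K * K) = mat_trace ((Q * H) * (R * K))"
      unfolding square_assoc[OF QH R Kc, symmetric] K_def[symmetric] ..
    also have "\<dots> = mat_trace ((Q * H) * H * R)" unfolding RK square_assoc[OF QH Hc(1) R] ..
    also have "\<dots> = mat_trace (R * (Q * H * H))" by (rule mat_trace_commute[OF square_mult[OF QH Hc(1)] R])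
    also have "R * (Q * H * H) = (R * Q) * (H * H)"
      unfolding square_assoc[OF Q Hc(1) Hc(1)] by (rule square_assoc[OF R Q square_mult[OF Hc(1) Hc(1)], symmetric])
    finally show ?thesis unfolding RQ square_one(1)[OF square_mult[OF Hc(1) Hc(1)]] ..
  qed
  also have "\<dots> = (\<Sum>i<d. \<Sum>j<d. K $$ (i, j) * K $$ (j, i))" by (rule mat_trace_mult[OF Kc Kc])
  also have "\<dots> \<le> (\<Sum>i<d. \<Sum>j<d. ((K $$ (i, j))\<^sup>2 + (K $$ (j, i))\<^sup>2) / 2)"
  proof (intro sum_mono)
    fix i j
    have "0 \<le> (K $$ (i, j) - K $$ (j, i))\<^sup>2" by simp
    then show "K $$ (i, j) * K $$ (j, i) \<le> ((K $$ (i, j))\<^sup>2 + (K $$ (j, i))\<^sup>2) / 2"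
      by (simp add: power2_diff)
  qed
  also have "\<dots> = ((\<Sum>i<d. \<Sum>j<d. (K $$ (i, j))\<^sup>2) + (\<Sum>i<d. \<Sum>j<d. (K $$ (j, i))\<^sup>2)) / 2"
    by (simp only: sum.distrib add_divide_distrib sum_divide_distrib)
  also have "(\<Sum>i<d. \<Sum>j<d. (K $$ (j, i))\<^sup>2) = (\<Sum>i<d. \<Sum>j<d. (K $$ (i, j))\<^sup>2)" by (rule sum.swap)
  finally show "mat_trace (transpose_mat H * H) \<le> (\<Sum>i<d. \<Sum>j<d. (K $$ (i, j))\<^sup>2)" by simp
qed

text \<open>Moving the square root of the point to the left turns the legs of the direction into
  traceless matrices that need not be symmetric, and the point only enters through its smallest eigenvalue.\<close>

lemma hess_lower:
  assumes Ts: "Ts \<in> PD_tuples ds" and H: "H \<in> HH ds" and c: "d_op (kron_list Ts) (1\<^sub>m (prod_list ds)) \<le> c"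
  obtains K where "\<And>a. a < length ds \<Longrightarrow> K a \<in> carrier_mat (ds ! a) (ds ! a)"
    "\<And>a. a < length ds \<Longrightarrow> mat_trace (K a) = 0"
    "(HH_norm H)\<^sup>2 \<le> (fst H)\<^sup>2 + (\<Sum>a<length ds. \<Sum>i<ds ! a. \<Sum>j<ds ! a. (K a $$ (i, j))\<^sup>2)"
    "\<And>x n. (\<And>i. i < n \<Longrightarrow> x i \<in> carrier_vec (prod_list ds)) \<Longrightarrow>
      exp (- c) / (real n * real (prod_list ds)) * (\<Sum>i<n. \<Sum>J<prod_list ds. (vec_index (leg_sum ds (fst H) K (x i)) J)\<^sup>2) \<le> hess ds n Ts H x"
proof -
  let ?D = "prod_list ds" and ?k = "length ds" and ?R = "sqrt_point ds Ts"
  obtain h Hs where H': "H = (h, Hs)" by force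
  have Hs: "length Hs = ?k" "\<And>a. a < ?k \<Longrightarrow> Hs ! a \<in> sym_mats (ds ! a)" "\<And>a. a < ?k \<Longrightarrow> mat_trace (Hs ! a) = 0"
    using H by (auto simp: HH_def H')
  obtain V r where V: "\<And>a. a < ?k \<Longrightarrow> orth (ds ! a) (V a)"
    "\<And>a k. a < ?k \<Longrightarrow> k < ds ! a \<Longrightarrow> r a k > 0"
    "\<And>a. a < ?k \<Longrightarrow> mat_sqrt (Ts ! a) = spec (ds ! a) (V a) (\<lambda>k. sqrt (r a k))"
    by (rule point_spec[OF Ts]) blast
  define Q where "Q a = spec (ds ! a) (V a) (\<lambda>k. 1 / sqrt (r a k))" for a
  define K where "K a = Q a * Hs ! a * mat_sqrt (Ts ! a)" for a
  have Rc: "mat_sqrt (Ts ! a) \<in> carrier_mat (ds ! a) (ds ! a)" "Q a \<in> carrier_mat (ds ! a) (ds ! a)"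
    "mat_sqrt (Ts ! a) * Q a = 1\<^sub>m (ds ! a)" if a: "a < ?k" for a
  proof -
    show "mat_sqrt (Ts ! a) \<in> carrier_mat (ds ! a) (ds ! a)" "Q a \<in> carrier_mat (ds ! a) (ds ! a)"
      unfolding V(3)[OF a] Q_def by (rule spec_carrier[OF V(1)[OF a]])+
    have "mat_sqrt (Ts ! a) * Q a = spec (ds ! a) (V a) (\<lambda>k. sqrt (r a k) * (1 / sqrt (r a k)))"
      unfolding V(3)[OF a] Q_def by (rule spec_mult[OF V(1)[OF a]])
    also have "\<dots> = spec (ds ! a) (V a) (\<lambda>_. 1)"
    proof (rule spec_cong)
      fix k assume "k < ds ! a"
      from V(2)[OF a this] show "sqrt (r a k) * (1 / sqrt (r a k)) = 1" by simp
    qed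
    finally show "mat_sqrt (Ts ! a) * Q a = 1\<^sub>m (ds ! a)" unfolding spec_one[OF V(1)[OF a]] .
  qed
  note K = conjugate_symmetric[OF Hs(2) Rc, folded K_def]
  have Kc: "K a \<in> carrier_mat (ds ! a) (ds ! a)" if "a < ?k" for a using K(1) that by blast
  \<comment> \<open>Leg by leg: \<open>conjugate_symmetric\<close> on leg \<open>a\<close>, and the
    identity on all other legs.\<close>
  have comm: "emb ds a (Hs ! a) * ?R = ?R * emb ds a (K a)" if a: "a < ?k" for a
  proof -
    have s: "sq_mats ds (\<lambda>b. if b = a then Hs ! a else 1\<^sub>m (ds ! b))" "sq_mats ds (\<lambda>b. if b = a then K a else 1\<^sub>m (ds ! b))"
      "sq_mats ds (\<lambda>a. mat_sqrt (Ts ! a))"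
      using sym_matsD(1)[OF Hs(2)[OF a]] Kc[OF a] Rc(1) by (auto simp: sq_mats_def)
    have "(if b = a then Hs ! a else 1\<^sub>m (ds ! b)) * mat_sqrt (Ts ! b) = mat_sqrt (Ts ! b) * (if b = a then K a else 1\<^sub>m (ds ! b))" if b: "b < ?k" for b
      using K(2)[OF a a a a] square_one[OF Rc(1)[OF b]] by auto
    then show ?thesis
      unfolding emb_def sqrt_point_def kronf_mult[OF s(1,3), symmetric] kronf_mult[OF s(3,2), symmetric] by (intro kronf_cong)
  qed
  note RC = sqrt_point_carrier[OF Ts] and P = point_facts[OF Ts]
  have low: "exp (- c) * (\<Sum>J<?D. (vec_index (leg_sum ds h K y) J)\<^sup>2) \<le>
    scalar_prod (leg_sum ds h (\<lambda>a. Hs ! a) (?R *\<^sub>v y)) (leg_sum ds h (\<lambda>a. Hs ! a) (?R *\<^sub>v y))"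
    if y: "y \<in> carrier_vec ?D" for y
  proof -
    let ?z = "leg_sum ds h K y"
    have z: "?z \<in> carrier_vec ?D" by (simp add: leg_sum_def)
    have "leg_sum ds h (\<lambda>a. Hs ! a) (?R *\<^sub>v y) = ?R *\<^sub>v ?z"
    proof (rule eq_vecI)
      show "dim_vec (leg_sum ds h (\<lambda>a. Hs ! a) (?R *\<^sub>v y)) = dim_vec (?R *\<^sub>v ?z)" using RC by (simp add: leg_sum_def)
      fix I assume "I < dim_vec (?R *\<^sub>v ?z)"
      then have I: "I < ?D" using RC by simp
      have e: "emb ds a (Hs ! a) *\<^sub>v (?R *\<^sub>v y) = ?R *\<^sub>v (emb ds a (K a) *\<^sub>v y)" if a: "a < ?k" for a
        unfolding mult_vec_square[OF emb_carrier[OF a sym_matsD(1)[OF Hs(2)[OF a]]] RC y, symmetric]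
          mult_vec_square[OF RC emb_carrier[OF a Kc[OF a]] y, symmetric] comm[OF a] ..
      have "vec_index (?R *\<^sub>v ?z) I = (\<Sum>J<?D. ?R $$ (I, J) * vec_index ?z J)" by (rule mult_mat_vec_index[OF RC z I])
      also have "\<dots> = (\<Sum>J<?D. h * (?R $$ (I, J) * vec_index y J) + (\<Sum>a<?k. sqrt (real (ds ! a)) * (?R $$ (I, J) * vec_index (emb ds a (K a) *\<^sub>v y) J)))"
        by (intro sum.cong refl) (simp add: leg_sum_def distrib_left sum_distrib_left mult_ac)
      also have "\<dots> = h * (\<Sum>J<?D. ?R $$ (I, J) * vec_index y J) + (\<Sum>a<?k. sqrt (real (ds ! a)) * (\<Sum>J<?D. ?R $$ (I, J) * vec_index (emb ds a (K a) *\<^sub>v y) J))"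
        unfolding sum.distrib by (subst sum.swap) (simp only: sum_distrib_left)
      also have "(\<Sum>J<?D. ?R $$ (I, J) * vec_index y J) = vec_index (?R *\<^sub>v y) I" by (rule mult_mat_vec_index[OF RC y I, symmetric])
      also have "(\<Sum>a<?k. sqrt (real (ds ! a)) * (\<Sum>J<?D. ?R $$ (I, J) * vec_index (emb ds a (K a) *\<^sub>v y) J))
        = (\<Sum>a<?k. sqrt (real (ds ! a)) * vec_index (emb ds a (Hs ! a) *\<^sub>v (?R *\<^sub>v y)) I)"
      proof (intro sum.cong refl arg_cong2[where f = times])
        fix a assume "a \<in> {..<?k}"
        then have a: "a < ?k" by simp
        show "(\<Sum>J<?D. ?R $$ (I, J) * vec_index (emb ds a (K a) *\<^sub>v y) J) = vec_index (emb ds a (Hs ! a) *\<^sub>v (?R *\<^sub>v y)) I"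
          unfolding e[OF a] by (rule mult_mat_vec_index[OF RC mult_mat_vec_carrier[OF emb_carrier[OF a Kc[OF a]] y] I, symmetric])
      qed
      finally show "vec_index (leg_sum ds h (\<lambda>a. Hs ! a) (?R *\<^sub>v y)) I = vec_index (?R *\<^sub>v ?z) I"
        using I by (simp add: leg_sum_def)
    qed
    then have "scalar_prod (leg_sum ds h (\<lambda>a. Hs ! a) (?R *\<^sub>v y)) (leg_sum ds h (\<lambda>a. Hs ! a) (?R *\<^sub>v y)) = scalar_prod (?R *\<^sub>v ?z) (?R *\<^sub>v ?z)" by simp
    also have "\<dots> = scalar_prod ?z (?R *\<^sub>v (?R *\<^sub>v ?z))"
      using scalar_prod_adjoint[OF RC z mult_mat_vec_carrier[OF RC z]] P(1) by simp
    \<comment> \<open>The two square roots recombine to the point, so that its smallest eigenvalue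
      bounds the form from below.\<close>
    also have "?R *\<^sub>v (?R *\<^sub>v ?z) = kron_list Ts *\<^sub>v ?z"
      unfolding mult_vec_square[OF RC RC z, symmetric] P(2) ..
    finally have "scalar_prod (leg_sum ds h (\<lambda>a. Hs ! a) (?R *\<^sub>v y)) (leg_sum ds h (\<lambda>a. Hs ! a) (?R *\<^sub>v y)) = scalar_prod ?z (kron_list Ts *\<^sub>v ?z)" .
    moreover have "scalar_prod ?z ?z = (\<Sum>J<?D. (vec_index ?z J)\<^sup>2)" by (simp add: scalar_prod_sum[OF z] power2_eq_square)
    ultimately show ?thesis using d_op_one_lower[OF P(4) c z] by simp
  qed
  show thesis
  proof (rule that[of K])
    show "K a \<in> carrier_mat (ds ! a) (ds ! a)" if "a < ?k" for a by (rule Kc[OF that])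
    show "mat_trace (K a) = 0" if a: "a < ?k" for a using K(3)[OF a a a a] Hs(3)[OF a] by simp
    have "(HH_norm H)\<^sup>2 = HH_inner H H"
      unfolding HH_norm_def
    proof (rule real_sqrt_pow2)
      have "0 \<le> mat_trace (transpose_mat (Hs ! a) * Hs ! a)" if a: "a < ?k" for a
      proof -
        note c = sym_matsD[OF Hs(2)[OF a]]
        show ?thesis unfolding c(2) mat_trace_mult[OF c(1) c(1)]
          by (intro sum_nonneg) (use sym_mats_index[OF Hs(2)[OF a]] in auto)
      qed
      then show "0 \<le> HH_inner H H" by (auto simp: HH_inner_def H' Hs(1) intro!: add_nonneg_nonneg sum_nonneg)
    qed
    also have "\<dots> \<le> (fst H)\<^sup>2 + (\<Sum>a<?k. \<Sum>i<ds ! a. \<Sum>j<ds ! a. (K a $$ (i, j))\<^sup>2)"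
      unfolding HH_inner_def H' using K(4) Hs(1) by (auto simp: power2_eq_square intro!: sum_mono)
    finally show "(HH_norm H)\<^sup>2 \<le> (fst H)\<^sup>2 + (\<Sum>a<?k. \<Sum>i<ds ! a. \<Sum>j<ds ! a. (K a $$ (i, j))\<^sup>2)" .
    fix x :: "nat \<Rightarrow> real Matrix.vec" and n :: nat
    assume x: "\<And>i. i < n \<Longrightarrow> x i \<in> carrier_vec ?D"
    have "exp (- c) / (real n * real ?D) * (\<Sum>i<n. \<Sum>J<?D. (vec_index (leg_sum ds (fst H) K (x i)) J)\<^sup>2)
      = 1 / (real n * real ?D) * (\<Sum>i<n. exp (- c) * (\<Sum>J<?D. (vec_index (leg_sum ds (fst H) K (x i)) J)\<^sup>2))"
      by (simp add: sum_distrib_left)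
    also have "\<dots> \<le> hess ds n Ts H x"
      unfolding hess_def Let_def H' fst_conv snd_conv using low x by (intro mult_left_mono sum_mono) auto
    finally show "exp (- c) / (real n * real ?D) * (\<Sum>i<n. \<Sum>J<?D. (vec_index (leg_sum ds (fst H) K (x i)) J)\<^sup>2) \<le> hess ds n Ts H x" .
  qed
qed

section \<open>Strong convexity near the identity\<close>

abbreviation undig :: "nat list \<Rightarrow> (nat \<Rightarrow> nat) \<Rightarrow> nat" where
  "undig ds \<equiv> the_inv_into {..<prod_list ds} (digf ds)"

lemma undig_fun_upd:
  assumes a: "a < length ds" and I: "I < prod_list ds" and c: "c < ds ! a"
  shows "undig ds ((digf ds I)(a := c)) < prod_list ds" "digf ds (undig ds ((digf ds I)(a := c))) = (digf ds I)(a := c)"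
proof -
  let ?E = "\<Pi>\<^sub>E a\<in>{..<length ds}. {..<ds ! a}"
  have inj: "inj_on (digf ds) {..<prod_list ds}" and img: "digf ds ` {..<prod_list ds} = ?E"
    using bij_betw_digf[of ds] by (auto simp: bij_betw_def)
  have "digf ds I \<in> ?E" using img I by blast
  then have "(digf ds I)(a := c) \<in> (\<Pi>\<^sub>E b\<in>insert a {..<length ds}. {..<ds ! b})"
    using c by (intro PiE_fun_upd) auto
  then have "(digf ds I)(a := c) \<in> digf ds ` {..<prod_list ds}" using a img by (simp add: insert_absorb)
  from the_inv_into_into[OF inj this order.refl] f_the_inv_into_f[OF inj this]
  show "undig ds ((digf ds I)(a := c)) < prod_list ds" "digf ds (undig ds ((digf ds I)(a := c))) = (digf ds I)(a := c)" by auto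
qed

text \<open>In row \<open>I\<close> only those columns survive whose digits agree with the digits of
  \<open>I\<close> away from leg \<open>a\<close>. This is the bridge from Kronecker matrices acting
  on vectors to \<open>act\<close> on tensors.\<close>

lemma emb_vec:
  assumes a: "a < length ds" and K: "K \<in> carrier_mat (ds ! a) (ds ! a)" and x: "x \<in> carrier_vec (prod_list ds)"
    and I: "I < prod_list ds"
  shows "vec_index (emb ds a K *\<^sub>v x) I =
    (\<Sum>c<ds ! a. K $$ (dig ds I a, c) * vec_index x (undig ds ((digf ds I)(a := c))))"
proof -
  let ?D = "prod_list ds"
  let ?u = "undig ds"
  have inj: "inj_on (digf ds) {..<?D}" using bij_betw_digf[of ds] by (auto simp: bij_betw_def)
  define g where "g c = (digf ds I)(a := c)" for c
  have u: "?u (g c) < ?D" "digf ds (?u (g c)) = g c" if "c < ds ! a" for c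
    using undig_fun_upd[OF a I that] by (auto simp: g_def)
  have injg: "inj_on (\<lambda>c. ?u (g c)) {..<ds ! a}"
  proof (rule inj_onI)
    fix c c' assume c: "c \<in> {..<ds ! a}" "c' \<in> {..<ds ! a}" and e: "?u (g c) = ?u (g c')"
    have "g c = digf ds (?u (g c))" using u(2) c by auto
    also have "\<dots> = digf ds (?u (g c'))" by (rule arg_cong[OF e])
    also have "\<dots> = g c'" using u(2) c by auto
    finally have "g c = g c'" .
    from fun_cong[OF this, of a] show "c = c'" by (simp add: g_def)
  qed
  have s: "sq_mats ds (\<lambda>b. if b = a then K else 1\<^sub>m (ds ! b))" using K by (auto simp: sq_mats_def)
  have entry: "emb ds a K $$ (I, J) = (\<Prod>b<length ds. if b = a then K $$ (dig ds I a, dig ds J a) else if dig ds I b = dig ds J b then 1 else 0)"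
    if J: "J < ?D" for J
    unfolding emb_def kronf_index[OF s I J] using dig_less[OF I] dig_less[OF J] by (intro prod.cong) auto
  have val: "emb ds a K $$ (I, ?u (g c)) = K $$ (dig ds I a, c)" if c: "c < ds ! a" for c
  proof -
    have d: "dig ds (?u (g c)) b = g c b" if "b < length ds" for b
      using fun_cong[OF u(2)[OF c], of b] that by (simp add: digf_def)
    have "emb ds a K $$ (I, ?u (g c)) = (\<Prod>b<length ds. if b = a then K $$ (dig ds I a, c) else 1)"
      unfolding entry[OF u(1)[OF c]] using d by (intro prod.cong) (auto simp: g_def digf_def)
    then show ?thesis using a by simp
  qed
  have zero: "emb ds a K $$ (I, J) = 0" if J: "J < ?D" and ni: "J \<notin> (\<lambda>c. ?u (g c)) ` {..<ds ! a}" for J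
  proof -
    have c: "dig ds J a < ds ! a" using dig_less[OF J a] .
    have "\<exists>b<length ds. b \<noteq> a \<and> dig ds I b \<noteq> dig ds J b"
    proof (rule ccontr)
      assume "\<not> (\<exists>b<length ds. b \<noteq> a \<and> dig ds I b \<noteq> dig ds J b)"
      then have "digf ds J = g (dig ds J a)" using a by (auto simp: digf_def g_def fun_eq_iff)
      then have "J = ?u (g (dig ds J a))" using the_inv_into_f_f[OF inj, of J] J by simp
      then show False using ni c by blast
    qed
    then show ?thesis unfolding entry[OF J] by (intro prod_zero) auto
  qed
  have "vec_index (emb ds a K *\<^sub>v x) I = (\<Sum>J<?D. emb ds a K $$ (I, J) * vec_index x J)"
    by (rule mult_mat_vec_index[OF emb_carrier[OF a K] x I])
  also have "\<dots> = (\<Sum>J\<in>(\<lambda>c. ?u (g c)) ` {..<ds ! a}. emb ds a K $$ (I, J) * vec_index x J)"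
    using u(1) zero by (intro sum.mono_neutral_right) auto
  also have "\<dots> = (\<Sum>c<ds ! a. emb ds a K $$ (I, ?u (g c)) * vec_index x (?u (g c)))"
    by (simp add: sum.reindex[OF injg])
  also have "\<dots> = (\<Sum>c<ds ! a. K $$ (dig ds I a, c) * vec_index x (?u (g c)))"
    using val by (intro sum.cong) auto
  finally show ?thesis unfolding g_def .
qed

lemma kron_one: "kron (1\<^sub>m 1) A = A"
  by (rule eq_matI) (auto simp: kron_def)

text \<open>A leading leg of dimension 1 leaves the linear index unchanged, so the scalar leg can be
  added without touching the matrices.\<close>

lemma emb_Cons_one: "emb (1 # ds) (Suc a) K = emb ds a K"
  unfolding emb_def kronf_Cons by (simp add: kron_one[unfolded One_nat_def] cong: if_cong)

text \<open>The scalar component of a direction becomes the matrix \<open>(h)\<close> on an additional leg of dimension \<open>1\<close>.\<close>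

definition leg_mats :: "real \<Rightarrow> (nat \<Rightarrow> real mat) \<Rightarrow> nat \<Rightarrow> nat \<Rightarrow> nat \<Rightarrow> real" where
  "leg_mats h K a = (case a of 0 \<Rightarrow> \<lambda>_ _. h | Suc b \<Rightarrow> \<lambda>c c'. K b $$ (c, c'))"

lemma leg_sum_act:
  assumes K: "\<And>a. a < length ds \<Longrightarrow> K a \<in> carrier_mat (ds ! a) (ds ! a)"
    and x: "x = Matrix.vec (prod_list ds) (w i)" and I: "I < prod_list ds"
  shows "vec_index (leg_sum ds h K x) I = (\<Sum>a\<le>length ds. sqrt (real ((1 # ds) ! a)) *
    act ((!) (1 # ds)) a (leg_mats h K a) (\<lambda>p. w (fst p) (undig (1 # ds) (snd p))) (i, digf (1 # ds) I))"
proof -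
  let ?ds = "1 # ds"
  have D: "prod_list ?ds = prod_list ds" by simp
  have I': "I < prod_list ?ds" using I by simp
  have inj: "inj_on (digf ?ds) {..<prod_list ?ds}" using bij_betw_digf[of ?ds] by (auto simp: bij_betw_def)
  have d0: "digf ?ds I 0 = 0" using I by (simp add: digf_def)
  have "(digf ?ds I)(0 := 0) = digf ?ds I" using d0 by (simp add: fun_upd_idem)
  then have u0: "undig ?ds ((digf ?ds I)(0 := 0)) = I" using the_inv_into_f_f[OF inj, of I] I' by simp
  have 0: "act ((!) ?ds) 0 (leg_mats h K 0) (\<lambda>p. w (fst p) (undig ?ds (snd p))) (i, digf ?ds I) = h * w i I"
    using u0 by (simp add: act_def leg_mats_def)
  have S: "act ((!) ?ds) (Suc a) (leg_mats h K (Suc a)) (\<lambda>p. w (fst p) (undig ?ds (snd p))) (i, digf ?ds I)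
      = vec_index (emb ds a (K a) *\<^sub>v x) I" if a: "a < length ds" for a
  proof -
    have "vec_index (emb ?ds (Suc a) (K a) *\<^sub>v x) I =
      (\<Sum>c<?ds ! Suc a. K a $$ (dig ?ds I (Suc a), c) * vec_index x (undig ?ds ((digf ?ds I)(Suc a := c))))"
      using a K[OF a] x I by (intro emb_vec) auto
    also have "\<dots> = act ((!) ?ds) (Suc a) (leg_mats h K (Suc a)) (\<lambda>p. w (fst p) (undig ?ds (snd p))) (i, digf ?ds I)"
      unfolding act_def fst_conv snd_conv
    proof (intro sum.cong refl arg_cong2[where f = times])
      fix c assume "c \<in> {..<?ds ! Suc a}"
      then have "undig ?ds ((digf ?ds I)(Suc a := c)) < prod_list ?ds" using a I' by (intro undig_fun_upd) auto
      then show "vec_index x (undig ?ds ((digf ?ds I)(Suc a := c))) = w i (undig ?ds ((digf ?ds I)(Suc a := c)))"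
        unfolding x D by (rule index_vec)
      show "K a $$ (dig ?ds I (Suc a), c) = leg_mats h K (Suc a) (digf ?ds I (Suc a)) c"
        using a by (simp add: leg_mats_def digf_def)
    qed
    finally show ?thesis unfolding emb_Cons_one by simp
  qed
  have "(\<Sum>a\<le>length ds. sqrt (real (?ds ! a)) * act ((!) ?ds) a (leg_mats h K a) (\<lambda>p. w (fst p) (undig ?ds (snd p))) (i, digf ?ds I))
    = h * w i I + (\<Sum>a<length ds. sqrt (real (ds ! a)) * vec_index (emb ds a (K a) *\<^sub>v x) I)"
    unfolding lessThan_Suc_atMost[symmetric] sum.lessThan_Suc_shift 0 using S by (simp cong: sum.cong_simp)
  then show ?thesis using I x by (simp add: leg_sum_def)
qed

lemma sum_leg_sum_sq:
  assumes K: "\<And>a. a < length ds \<Longrightarrow> K a \<in> carrier_mat (ds ! a) (ds ! a)"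
    and x: "\<And>i. i < n \<Longrightarrow> x i = Matrix.vec (prod_list ds) (w i)"
  shows "(\<Sum>i<n. \<Sum>J<prod_list ds. (vec_index (leg_sum ds h K (x i)) J)\<^sup>2)
    = (\<Sum>p\<in>{..<n} \<times> legs {..length ds} ((!) (1 # ds)). (\<Sum>a\<le>length ds. sqrt (real ((1 # ds) ! a)) *
    act ((!) (1 # ds)) a (leg_mats h K a) (\<lambda>p. w (fst p) (undig (1 # ds) (snd p))) p)\<^sup>2)"
proof -
  let ?ds = "1 # ds"
  let ?F = "\<lambda>p. (\<Sum>a\<le>length ds. sqrt (real (?ds ! a)) * act ((!) ?ds) a (leg_mats h K a) (\<lambda>p. w (fst p) (undig ?ds (snd p))) p)\<^sup>2"
  have bij: "bij_betw (digf ?ds) {..<prod_list ds} (legs {..length ds} ((!) ?ds))"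
    using bij_betw_digf[of ?ds] by (simp add: legs_def lessThan_Suc_atMost)
  have "(\<Sum>i<n. \<Sum>J<prod_list ds. (vec_index (leg_sum ds h K (x i)) J)\<^sup>2) = (\<Sum>i<n. \<Sum>J<prod_list ds. ?F (i, digf ?ds J))"
  proof (intro sum.cong refl)
    fix i J assume "i \<in> {..<n}" "J \<in> {..<prod_list ds}"
    then have iJ: "i < n" "J < prod_list ds" by auto
    show "(vec_index (leg_sum ds h K (x i)) J)\<^sup>2 = ?F (i, digf ?ds J)"
      by (rule arg_cong[where f = "\<lambda>t. t\<^sup>2"]) (rule leg_sum_act[OF _ _ iJ(2)], rule K, assumption, rule x[OF iJ(1)])
  qed
  also have "\<dots> = (\<Sum>i<n. \<Sum>\<omega>\<in>legs {..length ds} ((!) ?ds). ?F (i, \<omega>))"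
  proof (rule sum.cong[OF refl])
    fix i
    show "(\<Sum>J<prod_list ds. ?F (i, digf ?ds J)) = (\<Sum>\<omega>\<in>legs {..length ds} ((!) ?ds). ?F (i, \<omega>))"
      by (rule sum.reindex_bij_betw[OF bij])
  qed
  also have "\<dots> = (\<Sum>p\<in>{..<n} \<times> legs {..length ds} ((!) ?ds). ?F p)"
    by (simp add: sum.cartesian_product split_beta)
  finally show ?thesis .
qed

text \<open>The factor \<open>2 ^ 50\<close> is \<open>4 * 2 ^ 48\<close>: in
  \<open>leg_bound\<close> two of the \<open>k\<close> legs are set aside, and only
  \<open>2 ^ (k - 2)\<close> is available.\<close>

lemma square_le_power_two: "k \<ge> 65 \<Longrightarrow> k\<^sup>2 * 2 ^ 50 \<le> (2 :: nat) ^ k"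
proof (induction k rule: dec_induct)
  case (step k)
  have "k * 3 \<le> k * k" using step(1) by (intro mult_left_mono) auto
  then have "(Suc k)\<^sup>2 \<le> 2 * k\<^sup>2" using step(1) unfolding power2_eq_square by (simp only: mult_Suc mult_Suc_right)
  then have "(Suc k)\<^sup>2 * 2 ^ 50 \<le> 2 * (k\<^sup>2 * 2 ^ 50)" by simp
  also have "\<dots> \<le> 2 * 2 ^ k" using step by (intro mult_left_mono) auto
  finally show ?case by simp
qed simp

text \<open>The only place where the exponent \<open>1/12\<close> matters: for \<open>d\<^sub>m\<^sub>i\<^sub>n = 1\<close> and \<open>k \<ge> 2\<close> a
  nontrivial bound forces \<open>r > 4^12 = 2^24\<close>, while \<open>d\<^sub>m\<^sub>i\<^sub>n \<ge> 2\<close> makes \<open>D\<close> exponentially large in \<open>k\<close>.\<close>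

lemma leg_bound:
  fixes d :: "nat \<Rightarrow> nat" and r :: real
  assumes dmin: "dmin \<ge> 1" "\<And>b. b \<in> {1..k} \<Longrightarrow> dmin \<le> d b" and d0: "d 0 = 1"
    and e: "e \<in> {1..k}" and a: "a \<in> {1..k} - {e}" and ae: "d a \<le> d e" and n: "n \<ge> 1"
    and big: "2 ^ 54 * real k * (real (d e))\<^sup>2 \<le> real n * real (\<Prod>b\<le>k. d b)"
    and r: "r > 1" "r < 2 ^ 24" and nontrivial: "(real k)\<^sup>2 * r powr (- (1 / 12) * real dmin) < 1"
  shows "real k * real (d a) * 2 ^ 24 \<le> sqrt (real n * real (\<Prod>b\<le>k. d b))"
proof (rule real_le_rsqrt)
  let ?D = "\<Prod>b\<le>k. d b"
  have k: "k \<ge> 2" using e a by auto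
  have d2: "dmin \<ge> 2"
  proof (rule ccontr)
    assume "\<not> dmin \<ge> 2"
    then have "dmin = 1" using dmin(1) by simp
    then have "(real k)\<^sup>2 < r powr (1 / 12)"
      using nontrivial r(1) by (simp add: powr_minus field_simps)
    moreover have "(2 :: real)\<^sup>2 \<le> (real k)\<^sup>2" using k by (intro power_mono) auto
    ultimately have "4 < r powr (1 / 12)" by simp
    then have "4 powr 12 < (r powr (1 / 12)) powr 12" by (intro powr_less_mono2) auto
    then show False using r by (simp add: powr_powr)
  qed
  have "(real k * real (d a) * 2 ^ 24)\<^sup>2 = ((real k)\<^sup>2 * 2 ^ 48) * (real (d a))\<^sup>2" by (simp add: power_mult_distrib)
  also have "\<dots> \<le> real n * real ?D"
  \<comment> \<open>\<open>64 = 2^54 / 2^48\<close>: up to this \<open>k\<close> the assumed sample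
    size suffices. Beyond it the other \<open>k - 2\<close> legs, each of dimension at least 2,
    contribute \<open>2^(k - 2) \<ge> k^2 * 2^48\<close>.\<close>
  proof (cases "k \<le> 64")
    case True
    have "(real k)\<^sup>2 * 2 ^ 48 \<le> 2 ^ 54 * real k"
      using mult_right_mono[of "real k" 64 "real k"] True by (simp add: power2_eq_square)
    then have "((real k)\<^sup>2 * 2 ^ 48) * (real (d a))\<^sup>2 \<le> (2 ^ 54 * real k) * (real (d e))\<^sup>2"
      by (rule mult_mono) (use ae in \<open>auto intro!: power_mono\<close>)
    then show ?thesis using big by simp
  next
    case False
    have fin: "finite {1..k}" "{1..k} = insert e (insert a ({1..k} - {e, a}))" using e a by auto
    have "{..k} = insert 0 {1..k}" by auto
    then have "?D = (\<Prod>b\<in>{1..k}. d b)" using d0 by simp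
    also have "\<dots> = d e * (d a * (\<Prod>b\<in>{1..k} - {e, a}. d b))"
      using a by (subst fin(2)) simp
    finally have D: "?D = d e * (d a * (\<Prod>b\<in>{1..k} - {e, a}. d b))" .
    have "(\<Prod>b\<in>{1..k} - {e, a}. 2) \<le> (\<Prod>b\<in>{1..k} - {e, a}. d b)"
      using dmin(2) d2 by (intro prod_mono) force
    moreover have "card ({1..k} - {e, a}) = k - 2" using e a by (subst card_Diff_subset) auto
    ultimately have p: "2 ^ (k - 2) \<le> (\<Prod>b\<in>{1..k} - {e, a}. d b)" by simp
    have "k\<^sup>2 * 2 ^ 50 \<le> (2 :: nat) ^ k" using False by (intro square_le_power_two) simp
    moreover have "(2 :: nat) ^ k = 2 ^ (2 + (k - 2))" by (rule arg_cong[where f = "(^) 2"]) (use k in simp)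
    then have "(2 :: nat) ^ k = 4 * 2 ^ (k - 2)" unfolding power_add by simp
    ultimately have q: "k\<^sup>2 * 2 ^ 48 \<le> (2 :: nat) ^ (k - 2)" by simp
    have "k\<^sup>2 * 2 ^ 48 * (d a)\<^sup>2 = d a * (d a * (k\<^sup>2 * 2 ^ 48))" by (simp add: power2_eq_square)
    also have "\<dots> \<le> d e * (d a * (\<Prod>b\<in>{1..k} - {e, a}. d b))"
      using p q ae by (intro mult_mono order.refl) auto
    also have "\<dots> \<le> n * ?D" unfolding D using n by simp
    finally have "real (k\<^sup>2 * 2 ^ 48 * (d a)\<^sup>2) \<le> real (n * ?D)" by (rule of_nat_mono)
    then show ?thesis by simp
  qed
  finally show "(real k * real (d a) * 2 ^ 24)\<^sup>2 \<le> real n * real ?D" .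
qed

text \<open>Lowering the exponent from 1 to \<open>1/12\<close> leaves a spare factor
  \<open>\<rho> powr (11/12) \<ge> 2 ^ 22\<close>, which absorbs the 3 of
  \<open>leg_convexity\<close>.\<close>

lemma three_power_le_powr:
  fixes r \<rho> :: real
  assumes "dmin \<ge> 1" "1 < r" "r \<le> \<rho>" "\<rho> \<ge> 2 ^ 24"
  shows "3 * (1 / \<rho>) ^ dmin \<le> r powr (- (1 / 12) * real dmin)"
proof -
  have \<rho>: "\<rho> > 1" using assms by simp
  have "(2 :: real) powr 22 = (2 powr 24) powr (11 / 12)" unfolding powr_powr by simp
  also have "\<dots> \<le> \<rho> powr (11 / 12)" using assms by (intro powr_mono2) auto
  also have "\<dots> \<le> \<rho> powr (11 / 12 * real dmin)" using assms \<rho> by (intro powr_mono) auto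
  finally have "3 \<le> \<rho> powr (11 / 12 * real dmin)" by simp
  then have "3 * \<rho> powr (- real dmin) \<le> \<rho> powr (11 / 12 * real dmin) * \<rho> powr (- real dmin)"
    by (intro mult_right_mono) auto
  also have "\<dots> = \<rho> powr (- (1 / 12) * real dmin)" unfolding powr_add[symmetric] by (simp add: field_simps)
  also have "\<dots> \<le> r powr (- (1 / 12) * real dmin)" using assms by (intro powr_mono2') auto
  finally show ?thesis using \<rho> by (simp add: powr_minus powr_realpow power_one_over inverse_eq_divide)
qed

text \<open>Elements of a product space are extensional, so the tensor read off from the samples has
  to be restricted. Replacing one digit by an admissible one stays inside the index set, hence
  \<open>act\<close> does not notice.\<close>

lemma act_restrict:
  assumes a: "a \<in> Q" and p: "p \<in> J \<times> legs Q d"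
  shows "act d a K (restrict x (J \<times> legs Q d)) p = act d a K x p"
  unfolding act_def
proof (intro sum.cong refl arg_cong2[where f = times])
  fix c assume c: "c \<in> {..<d a}"
  have "snd p \<in> (\<Pi>\<^sub>E a\<in>Q. {..<d a})" using p by (auto simp: legs_def)
  then have "(snd p)(a := c) \<in> (\<Pi>\<^sub>E a\<in>insert a Q. {..<d a})" using c by (intro PiE_fun_upd) auto
  then show "restrict x (J \<times> legs Q d) (fst p, (snd p)(a := c)) = x (fst p, (snd p)(a := c))"
    using a p by (auto simp: legs_def insert_absorb)
qed

section \<open>The probability space of the samples\<close>

lemma gaussian_samples_gauss: "gaussian_samples n D = PiM {..<n} (\<lambda>_. gauss {..<D})"
  by (simp add: gaussian_samples_def std_gauss_def)

text \<open>Flattening the nested product and renaming its indices both preserve the measure, so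
  tail bounds for Gaussian tensors carry over to the samples.\<close>

lemma gaussian_samples_event:
  assumes f: "bij_betw f S' ({..<n} \<times> {..<D})"
    and ex: "\<exists>E\<in>sets (gauss S'). measure (gauss S') E \<le> p \<and> (\<forall>x\<in>space (gauss S') - E. P x)"
  shows "\<exists>E\<in>sets (gaussian_samples n D). measure (gaussian_samples n D) E \<le> p \<and>
    (\<forall>w\<in>space (gaussian_samples n D) - E. P (\<lambda>s\<in>S'. w (fst (f s)) (snd (f s))))"
proof -
  let ?S = "{..<n} \<times> {..<D}" and ?M = "PiM {..<n} (\<lambda>_. gauss {..<D})"
  let ?g = "\<lambda>w. \<lambda>p\<in>?S. w (fst p) (snd p)"
  obtain E where E: "E \<in> sets (gauss ?S)" "measure (gauss ?S) E \<le> p"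
    "\<And>x. x \<in> space (gauss ?S) - E \<Longrightarrow> P (\<lambda>s\<in>S'. x (f s))"
    using gauss_reindex_event[OF _ f ex] by auto
  have g: "?g \<in> ?M \<rightarrow>\<^sub>M gauss ?S" by (rule measurable_gauss_flatten)
  let ?E = "?g -` E \<inter> space ?M"
  have "measure ?M ?E = measure (distr ?M (gauss ?S) ?g) E" by (rule measure_distr[OF g E(1), symmetric])
  also have "\<dots> = measure (gauss ?S) E" by (subst distr_gauss_nested) auto
  finally have m: "measure ?M ?E \<le> p" using E(2) by simp
  have "P (\<lambda>s\<in>S'. w (fst (f s)) (snd (f s)))" if w: "w \<in> space ?M - ?E" for w
  proof -
    have "?g w \<in> space (gauss ?S) - E" using w measurable_space[OF g] by auto
    from E(3)[OF this] have "P (\<lambda>s\<in>S'. ?g w (f s))" .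
    moreover have "(\<lambda>s\<in>S'. ?g w (f s)) = (\<lambda>s\<in>S'. w (fst (f s)) (snd (f s)))"
    proof (rule restrict_ext)
      fix s assume "s \<in> S'"
      then have "f s \<in> ?S" using f by (auto simp: bij_betw_def)
      then show "?g w (f s) = w (fst (f s)) (snd (f s))" by simp
    qed
    ultimately show ?thesis by simp
  qed
  then show ?thesis unfolding gaussian_samples_gauss
    using m measurable_sets[OF g E(1)] by (intro bexI[of _ ?E]) auto
qed

section \<open>Measurability of the event\<close>

lemma continuous_mult_vec_index:
  fixes v :: "'t :: topological_space \<Rightarrow> real Matrix.vec"
  assumes A: "A \<in> carrier_mat D D" and v: "\<And>w. v w \<in> carrier_vec D"
    and c: "\<And>I. I < D \<Longrightarrow> continuous_on UNIV (\<lambda>w. vec_index (v w) I)" and I: "I < D"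
  shows "continuous_on UNIV (\<lambda>w. vec_index (A *\<^sub>v v w) I)"
  unfolding mult_mat_vec_index[OF A v I] by (intro continuous_intros c) auto

lemma continuous_hess:
  assumes Ts: "Ts \<in> PD_tuples ds" and H: "H \<in> HH ds"
  shows "continuous_on UNIV (\<lambda>w. hess ds n Ts H (samples (prod_list ds) w))"
proof -
  let ?D = "prod_list ds" and ?k = "length ds"
  obtain h Hs where H': "H = (h, Hs)" by force
  have Hs: "\<And>a. a < ?k \<Longrightarrow> Hs ! a \<in> carrier_mat (ds ! a) (ds ! a)" using H by (auto simp: HH_def H' sym_mats_def)
  note R = sqrt_point_carrier[OF Ts]
  let ?v = "\<lambda>i w. sqrt_point ds Ts *\<^sub>v samples ?D w i"
  have v: "?v i w \<in> carrier_vec ?D" for i w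
    by (rule mult_mat_vec_carrier[OF R]) (simp add: samples_def)
  have cs: "continuous_on UNIV (\<lambda>w. vec_index (samples ?D w i) I)" if "I < ?D" for i I
  proof -
    have "continuous_on UNIV (\<lambda>w::nat \<Rightarrow> nat \<Rightarrow> real. w i I)"
      by (rule continuous_on_product_then_coordinatewise) (rule continuous_on_product_coordinates)
    then show ?thesis using that by (simp add: samples_def)
  qed
  have cv: "continuous_on UNIV (\<lambda>w. vec_index (?v i w) I)" if I: "I < ?D" for i I
    by (rule continuous_mult_vec_index[OF R _ cs I]) (simp add: samples_def)
  have cl: "continuous_on UNIV (\<lambda>w. vec_index (leg_sum ds h (\<lambda>a. Hs ! a) (?v i w)) I)" if I: "I < ?D" for i I
    unfolding leg_sum_def index_vec[OF I]
    by (intro continuous_intros cv continuous_mult_vec_index[OF emb_carrier v cv] Hs I) auto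
  have "leg_sum ds h (\<lambda>a. Hs ! a) y \<in> carrier_vec ?D" for y by (simp add: leg_sum_def)
  note sp = scalar_prod_sum[OF this]
  show ?thesis
    unfolding hess_def Let_def H' fst_conv snd_conv sp by (intro continuous_intros cl) auto
qed

text \<open>Closed sets live in the full function space with its product topology, whereas samples
  are extensional. Outside the index range every coordinate is constant, hence measurable as
  well.\<close>

lemma gaussian_samples_borel: "(\<lambda>w. w) \<in> borel_measurable (gaussian_samples n D)"
proof (rule measurable_coordinatewise_then_product, rule measurable_coordinatewise_then_product)
  fix i j
  let ?M = "PiM {..<n} (\<lambda>_. gauss {..<D})"
  show "(\<lambda>w. w i j) \<in> borel_measurable (gaussian_samples n D)"
  proof (cases "i < n \<and> j < D")
    case True
    then have 1: "(\<lambda>w. w i) \<in> ?M \<rightarrow>\<^sub>M gauss {..<D}" by (intro measurable_component_singleton) auto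
    have 2: "(\<lambda>x. x j) \<in> borel_measurable (gauss {..<D})" using True by (intro borel_measurable_gauss_component) auto
    show ?thesis unfolding gaussian_samples_gauss using measurable_compose[OF 1 2] .
  next
    case False
    have eq: "w i j = (if i < n then undefined else (undefined :: nat \<Rightarrow> real) j)" if w: "w \<in> space ?M" for w
    proof (cases "i < n")
      case True
      then have "w i \<in> space (gauss {..<D})" using w by (auto simp: space_PiM)
      then show ?thesis using True False by (auto simp: space_PiM PiE_def extensional_def)
    next
      case i: False
      then show ?thesis using w by (auto simp: space_PiM PiE_def extensional_def)
    qed
    show ?thesis unfolding gaussian_samples_gauss by (subst measurable_cong[OF eq]) simp_all
  qed
qed

lemma strongly_convex_event_eq:
  "(\<forall>T\<in>PP ds. d_op T (1\<^sub>m (prod_list ds)) \<le> c \<longrightarrow>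
      strongly_convex_at ds lam (objective n (prod_list ds) (samples (prod_list ds) w)) T) \<longleftrightarrow>
   (\<forall>Ts\<in>PD_tuples ds. d_op (kron_list Ts) (1\<^sub>m (prod_list ds)) \<le> c \<longrightarrow>
      (\<forall>H\<in>HH ds. lam * (HH_norm H)\<^sup>2 \<le> hess ds n Ts H (samples (prod_list ds) w)))"
proof -
  have "samples (prod_list ds) w i \<in> carrier_vec (prod_list ds)" for i by (simp add: samples_def)
  note iff = strongly_convex_at_iff[OF this]
  show ?thesis unfolding iff PP_def by auto
qed

text \<open>The event is an intersection over uncountably many points and directions, yet each
  single condition is closed in the samples, and closedness survives arbitrary
  intersections.\<close>

lemma strongly_convex_event_sets:
  "{w \<in> space (gaussian_samples n (prod_list ds)). \<forall>T\<in>PP ds. d_op T (1\<^sub>m (prod_list ds)) \<le> c \<longrightarrow>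
      strongly_convex_at ds lam (objective n (prod_list ds) (samples (prod_list ds) w)) T} \<in> sets (gaussian_samples n (prod_list ds))"
proof -
  let ?M = "gaussian_samples n (prod_list ds)"
  let ?I = "{Ts \<in> PD_tuples ds. d_op (kron_list Ts) (1\<^sub>m (prod_list ds)) \<le> c} \<times> HH ds"
  let ?Z = "\<Inter>p\<in>?I. {w. lam * (HH_norm (snd p))\<^sup>2 \<le> hess ds n (fst p) (snd p) (samples (prod_list ds) w)}"
  have "closed ?Z"
    by (intro closed_INT ballI closed_Collect_le continuous_intros continuous_hess) auto
  then have "?Z \<in> sets borel" by (rule borel_closed)
  from measurable_sets[OF gaussian_samples_borel this]
  have "(\<lambda>w. w) -` ?Z \<inter> space ?M \<in> sets ?M" .
  also have "(\<lambda>w. w) -` ?Z \<inter> space ?M = {w \<in> space ?M. \<forall>T\<in>PP ds. d_op T (1\<^sub>m (prod_list ds)) \<le> c \<longrightarrow>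
      strongly_convex_at ds lam (objective n (prod_list ds) (samples (prod_list ds) w)) T}"
    unfolding strongly_convex_event_eq by auto
  finally show ?thesis .
qed

lemma hess_event:
  fixes ds :: "nat list" and n :: nat
  defines "k \<equiv> length ds" and "D \<equiv> prod_list ds" and "dmax \<equiv> Max (set ds)" and "dmin \<equiv> Min (set ds)"
  defines "r \<equiv> sqrt (real n * real D) / (real k * real dmax)"
  assumes ds: "ds \<noteq> []" "\<forall>d\<in>set ds. 0 < d" and n: "n \<ge> 1"
    and big: "2 ^ 54 * real k * (real dmax)\<^sup>2 \<le> real n * real D"
    and r: "r > 1" and nontrivial: "(real k)\<^sup>2 * r powr (- (1 / 12) * real dmin) < 1"
  shows "\<exists>E\<in>sets (gaussian_samples n D). measure (gaussian_samples n D) E \<le> (real k)\<^sup>2 * r powr (- (1 / 12) * real dmin) \<and>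
    (\<forall>w\<in>space (gaussian_samples n D) - E. \<forall>Ts\<in>PD_tuples ds. d_op (kron_list Ts) (1\<^sub>m D) \<le> 1 / 4 \<longrightarrow>
      (\<forall>H\<in>HH ds. 1 / 2 * (HH_norm H)\<^sup>2 \<le> hess ds n Ts H (samples D w)))"
proof -
  define d where "d = (!) (1 # ds)"
  \<comment> \<open>\<open>leg_convexity\<close> asks for at least \<open>2 ^ 24\<close>. If
    \<open>r\<close> is smaller, the assumed sample size supplies its \<open>row\<close> bound, and
    \<open>leg_bound\<close> supplies \<open>small\<close>.\<close>
  define \<rho> where "\<rho> = max r (2 ^ 24)"
  have k: "k \<ge> 1" using ds by (cases ds) (auto simp: k_def)
  have d0: "d 0 = 1" and dS: "\<And>a. d (Suc a) = ds ! a" by (simp_all add: d_def)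
  have mem: "d a \<in> set ds" if a: "a \<in> {1..k}" for a
  proof -
    obtain b where "a = Suc b" "b < k" using a by (cases a) auto
    then show ?thesis by (simp add: dS k_def)
  qed
  have dmin: "dmin \<le> d a" and dmax: "d a \<le> dmax" if "a \<in> {1..k}" for a
    using mem[OF that] by (auto simp: dmin_def dmax_def)
  have "dmin \<in> set ds" "dmax \<in> set ds" using ds by (auto simp: dmin_def dmax_def)
  then have dmin1: "dmin \<ge> 1" and dmax1: "dmax \<ge> 1" using ds(2) by (auto simp: Suc_le_eq)
  obtain e' where "e' < k" "ds ! e' = dmax" using \<open>dmax \<in> set ds\<close> by (auto simp: in_set_conv_nth k_def)
  then have e: "Suc e' \<in> {1..k}" "d (Suc e') = dmax" by (auto simp: dS)
  have D: "D = (\<Prod>a\<le>k. d a)"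
    using prod_list_nth[of "1 # ds"] by (simp add: D_def d_def k_def lessThan_Suc_atMost)
  have rk: "real k * real dmax * r = sqrt (real n * real D)" using k dmax1 by (simp add: r_def)
  have \<rho>: "\<rho> \<ge> 2 ^ 24" "r \<le> \<rho>" by (auto simp: \<rho>_def)
  have row: "sqrt (real k) * real (d a) * \<rho> \<le> sqrt (real n * real D)" if a: "a \<in> {1..k}" for a
  proof (cases "r \<ge> 2 ^ 24")
    case True
    have "sqrt (real k) \<le> real k" using k by (intro real_le_lsqrt) (auto simp: power2_eq_square)
    then have "sqrt (real k) * real (d a) * r \<le> real k * real dmax * r"
      using dmax[OF a] r by (intro mult_right_mono mult_mono) auto
    then show ?thesis unfolding rk using True by (simp add: \<rho>_def max_def)
  next
    case False
    have "(sqrt (real k) * real (d a) * 2 ^ 24)\<^sup>2 = 2 ^ 48 * (real k * (real (d a))\<^sup>2)" by (simp add: power_mult_distrib)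
    also have "\<dots> \<le> 2 ^ 54 * (real k * (real dmax)\<^sup>2)" using dmax[OF a] by (intro mult_mono power_mono) auto
    also have "\<dots> \<le> real n * real D" using big by (simp add: mult.assoc)
    finally have "sqrt (real k) * real (d a) * 2 ^ 24 \<le> sqrt (real n * real D)" by (rule real_le_rsqrt)
    then show ?thesis using False by (simp add: \<rho>_def max_def)
  qed
  have small: "real k * real (d a) * \<rho> \<le> sqrt (real n * real D)" if a: "a \<in> {1..k} - {Suc e'}" for a
  proof (cases "r \<ge> 2 ^ 24")
    case True
    have "real k * real (d a) * r \<le> real k * real dmax * r"
      using dmax[of a] a r by (intro mult_right_mono mult_mono) auto
    then show ?thesis unfolding rk using True by (simp add: \<rho>_def max_def)
  next
    case False
    have "real k * real (d a) * 2 ^ 24 \<le> sqrt (real n * real (\<Prod>b\<le>k. d b))"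
      using False dmax[of a] a big
      by (intro leg_bound[where k = k and dmin = dmin and d = d and e = "Suc e'" and a = a and n = n and r = r, OF dmin1 dmin d0 e(1) a _ n _ r _ nontrivial]) (auto simp: e(2) D[symmetric])
    then show ?thesis using False by (simp add: \<rho>_def max_def D[symmetric])
  qed
  let ?S = "{..<n} \<times> legs {..k} d"
  define f where "f p = (fst p, undig (1 # ds) (snd p))" for p :: "nat \<times> (nat \<Rightarrow> nat)"
  have bij: "bij_betw f ?S ({..<n} \<times> {..<D})"
  proof -
    have "bij_betw (undig (1 # ds)) (legs {..k} d) {..<D}"
      using bij_betw_the_inv_into[OF bij_betw_digf[of "1 # ds"]] by (simp add: legs_def d_def D_def k_def lessThan_Suc_atMost)
    from bij_betw_map_prod[OF bij_betw_id this] have "bij_betw (map_prod id (undig (1 # ds))) ?S ({..<n} \<times> {..<D})" .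
    then show ?thesis by (rule bij_betw_cong[THEN iffD1, rotated]) (auto simp: f_def)
  qed
  have "\<exists>E\<in>sets (gauss ?S). measure (gauss ?S) E \<le> 3 * (real k)\<^sup>2 * (1 / \<rho>) ^ dmin \<and>
    (\<forall>x\<in>space (gauss ?S) - E. \<forall>K. (\<forall>a\<in>{1..k}. (\<Sum>c<d a. K a c c) = 0) \<longrightarrow>
      3 / 4 * real (n * D) * (\<Sum>a\<le>k. sqnorm2 {..<d a} (K a)) \<le> (\<Sum>p\<in>?S. (\<Sum>a\<le>k. sqrt (d a) * act d a (K a) x p)\<^sup>2))"
    by (rule leg_convexity[OF k n d0 dmin1 dmin D \<rho>(1) _ e(1)]) (use row small in simp_all)
  from gaussian_samples_event[OF bij this] obtain E where E: "E \<in> sets (gaussian_samples n D)"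
    "measure (gaussian_samples n D) E \<le> 3 * (real k)\<^sup>2 * (1 / \<rho>) ^ dmin"
    "\<And>w K. w \<in> space (gaussian_samples n D) - E \<Longrightarrow> \<forall>a\<in>{1..k}. (\<Sum>c<d a. K a c c) = 0 \<Longrightarrow>
      3 / 4 * real (n * D) * (\<Sum>a\<le>k. sqnorm2 {..<d a} (K a)) \<le>
      (\<Sum>p\<in>?S. (\<Sum>a\<le>k. sqrt (d a) * act d a (K a) (\<lambda>s\<in>?S. w (fst (f s)) (snd (f s))) p)\<^sup>2)"
    by blast
  have "3 * (1 / \<rho>) ^ dmin \<le> r powr (- (1 / 12) * real dmin)" by (rule three_power_le_powr[OF dmin1 r \<rho>(2,1)])
  then have "(real k)\<^sup>2 * (3 * (1 / \<rho>) ^ dmin) \<le> (real k)\<^sup>2 * r powr (- (1 / 12) * real dmin)" by (intro mult_left_mono) auto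
  then have m: "measure (gaussian_samples n D) E \<le> (real k)\<^sup>2 * r powr (- (1 / 12) * real dmin)" using E(2) by (simp add: mult_ac)
  have "1 / 2 * (HH_norm H)\<^sup>2 \<le> hess ds n Ts H (samples D w)"
    if w: "w \<in> space (gaussian_samples n D) - E" and Ts: "Ts \<in> PD_tuples ds"
      and c: "d_op (kron_list Ts) (1\<^sub>m (prod_list ds)) \<le> 1 / 4" and H: "H \<in> HH ds" for w Ts H
  proof -
    obtain K where K: "\<And>a. a < length ds \<Longrightarrow> K a \<in> carrier_mat (ds ! a) (ds ! a)"
      "\<And>a. a < length ds \<Longrightarrow> mat_trace (K a) = 0"
      "(HH_norm H)\<^sup>2 \<le> (fst H)\<^sup>2 + (\<Sum>a<length ds. \<Sum>i<ds ! a. \<Sum>j<ds ! a. (K a $$ (i, j))\<^sup>2)"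
      "\<And>x n. (\<And>i. i < n \<Longrightarrow> x i \<in> carrier_vec (prod_list ds)) \<Longrightarrow>
        exp (- (1 / 4)) / (real n * real (prod_list ds)) * (\<Sum>i<n. \<Sum>J<prod_list ds. (vec_index (leg_sum ds (fst H) K (x i)) J)\<^sup>2) \<le> hess ds n Ts H x"
      by (rule hess_lower[OF Ts H c]) blast
    let ?K = "leg_mats (fst H) K"
    let ?X = "\<lambda>p. w (fst p) (undig (1 # ds) (snd p))"
    have tr: "\<forall>a\<in>{1..k}. (\<Sum>c<d a. ?K a c c) = 0"
    proof
      fix a assume "a \<in> {1..k}"
      then obtain b where b: "a = Suc b" "b < length ds" by (cases a) (auto simp: k_def)
      then show "(\<Sum>c<d a. ?K a c c) = 0" using K(1,2)[OF b(2)] by (simp add: leg_mats_def dS mat_trace_def)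
    qed
    have X: "(\<lambda>s\<in>?S. w (fst (f s)) (snd (f s))) = restrict ?X ?S" by (simp add: f_def)
    have nrm: "(HH_norm H)\<^sup>2 \<le> (\<Sum>a\<le>k. sqnorm2 {..<d a} (?K a))"
      using K(3) unfolding lessThan_Suc_atMost[symmetric] sum.lessThan_Suc_shift
      by (simp add: d0 dS k_def sqnorm2_def leg_mats_def)
    have "(\<Sum>i<n. \<Sum>J<D. (vec_index (leg_sum ds (fst H) K (samples D w i)) J)\<^sup>2)
      = (\<Sum>p\<in>?S. (\<Sum>a\<le>k. sqrt (d a) * act d a (?K a) ?X p)\<^sup>2)"
      unfolding D_def k_def d_def by (rule sum_leg_sum_sq[OF K(1)]) (simp_all add: samples_def)
    also have "\<dots> = (\<Sum>p\<in>?S. (\<Sum>a\<le>k. sqrt (d a) * act d a (?K a) (restrict ?X ?S) p)\<^sup>2)"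
      by (intro sum.cong refl arg_cong[where f = "\<lambda>t. t\<^sup>2"] arg_cong2[where f = times] act_restrict[symmetric])
    also have "\<dots> \<ge> 3 / 4 * real (n * D) * (\<Sum>a\<le>k. sqnorm2 {..<d a} (?K a))"
      using E(3)[where w = w and K = ?K, OF w tr] unfolding X .
    finally have low: "3 / 4 * real (n * D) * (\<Sum>a\<le>k. sqnorm2 {..<d a} (?K a)) \<le>
      (\<Sum>i<n. \<Sum>J<D. (vec_index (leg_sum ds (fst H) K (samples D w i)) J)\<^sup>2)" .
    have "D > 0" using ds(2) unfolding D_def by (metis gr0I less_irrefl prod_list_zero_iff)
    \<comment> \<open>\<open>exp (- 1/4) * 3/4 \<ge> 9/16 \<ge> 1/2\<close>.\<close>
    have "3 / 4 \<le> exp (- (1 / 4) :: real)" using exp_ge_add_one_self[of "- (1 / 4)"] by simp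
    then have "1 / 2 \<le> exp (- (1 / 4)) * (3 / 4 :: real)" by simp
    then have "1 / 2 * (HH_norm H)\<^sup>2 \<le> exp (- (1 / 4)) * (3 / 4) * (\<Sum>a\<le>k. sqnorm2 {..<d a} (?K a))"
      using nrm by (intro mult_mono) auto
    also have "\<dots> = exp (- (1 / 4)) / (real n * real D) * (3 / 4 * real (n * D) * (\<Sum>a\<le>k. sqnorm2 {..<d a} (?K a)))"
      using n \<open>D > 0\<close> by simp
    also have "\<dots> \<le> exp (- (1 / 4)) / (real n * real D) * (\<Sum>i<n. \<Sum>J<D. (vec_index (leg_sum ds (fst H) K (samples D w i)) J)\<^sup>2)"
      using low by (intro mult_left_mono) auto
    also have "\<dots> \<le> hess ds n Ts H (samples D w)"
      unfolding D_def by (rule K(4)) (simp add: samples_def)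
    finally show ?thesis .
  qed
  then show ?thesis using E(1) m unfolding D_def by (intro bexI[of _ E]) auto
qed

theorem proposition2p18:
  shows "\<exists>C c c' :: real. C > 0 \<and> c > 0 \<and> c' > 0 \<and>
    (\<forall>(ds :: nat list) (n :: nat). ds \<noteq> [] \<longrightarrow> (\<forall>d \<in> set ds. 0 < d) \<longrightarrow>
      (let k = length ds; D = prod_list ds; dmax = Max (set ds); dmin = Min (set ds) in
        real n \<ge> C * real k * (real dmax)\<^sup>2 / real D \<longrightarrow>
        measure (gaussian_samples n D)
          {w \<in> space (gaussian_samples n D).
             \<forall>T \<in> PP ds. d_op T (1\<^sub>m D) \<le> c \<longrightarrow>
               strongly_convex_at ds (1 / 2) (objective n D (samples D w)) T}
        \<ge> 1 - (real k)\<^sup>2 * (sqrt (real n * real D) / (real k * real dmax)) powr (- c' * real dmin)))"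
  unfolding Let_def
\<comment> \<open>\<open>2 ^ 54 = 64 * 2 ^ 48\<close> and \<open>1/12\<close>, with
  \<open>4 ^ 12 = 2 ^ 24\<close>, are dictated by \<open>leg_bound\<close>; \<open>1/4\<close> is
  chosen so that \<open>exp (- 1/4) * 3/4 \<ge> 1/2\<close>.\<close>
proof (rule exI[of _ "2 ^ 54"], rule exI[of _ "1 / 4"], rule exI[of _ "1 / 12"], intro conjI allI impI)
  fix ds :: "nat list" and n :: nat
  let ?k = "length ds" and ?D = "prod_list ds" and ?dmax = "Max (set ds)" and ?dmin = "Min (set ds)"
  let ?r = "sqrt (real n * real ?D) / (real ?k * real ?dmax)"
  let ?M = "gaussian_samples n ?D"
  let ?G = "{w \<in> space ?M. \<forall>T \<in> PP ds. d_op T (1\<^sub>m ?D) \<le> 1 / 4 \<longrightarrow>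
     strongly_convex_at ds (1 / 2) (objective n ?D (samples ?D w)) T}"
  let ?b = "(real ?k)\<^sup>2 * ?r powr (- (1 / 12) * real ?dmin)"
  assume ds: "ds \<noteq> []" "\<forall>d \<in> set ds. 0 < d" and C: "2 ^ 54 * real ?k * (real ?dmax)\<^sup>2 / real ?D \<le> real n"
  have k: "?k > 0" and dmax: "?dmax > 0" using ds by auto
  have D: "?D > 0" using ds(2) by (metis gr0I less_irrefl prod_list_zero_iff)
  have big: "2 ^ 54 * real ?k * (real ?dmax)\<^sup>2 \<le> real n * real ?D" using C D by (simp add: field_simps)
  have "0 < 2 ^ 54 * real ?k * (real ?dmax)\<^sup>2 / real ?D" using k D dmax by simp
  then have n: "n \<ge> 1" using C by (cases n) auto
  show "measure ?M ?G \<ge> 1 - ?b"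
  proof (cases "?r > 1 \<and> ?b < 1")
    case True
    interpret prob_space ?M unfolding gaussian_samples_gauss by (intro prob_space_PiM prob_space_gauss)
    obtain E where E: "E \<in> sets ?M" "measure ?M E \<le> ?b"
      "\<And>w Ts H. w \<in> space ?M - E \<Longrightarrow> Ts \<in> PD_tuples ds \<Longrightarrow> d_op (kron_list Ts) (1\<^sub>m ?D) \<le> 1 / 4 \<Longrightarrow> H \<in> HH ds \<Longrightarrow>
        1 / 2 * (HH_norm H)\<^sup>2 \<le> hess ds n Ts H (samples ?D w)"
      using hess_event[OF ds n big] True by blast
    have sub: "space ?M - E \<subseteq> ?G" unfolding strongly_convex_event_eq using E(3) by auto
    have "1 - ?b \<le> 1 - prob E" using E(2) by simp
    also have "\<dots> = prob (space ?M - E)" using prob_compl[OF E(1)] by simp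
    also have "\<dots> \<le> prob ?G" by (rule finite_measure_mono[OF sub strongly_convex_event_sets])
    finally show ?thesis .
  next
    case False
    \<comment> \<open>For \<open>?r \<le> 1\<close> the negative exponent makes the power at least
      1. In either case the asserted probability is at most 0.\<close>
    have "?b \<ge> 1"
    proof (cases "?r > 1")
      case r: False
      have "?r > 0" using n D k dmax by simp
      then have "1 \<le> ?r powr (- (1 / 12) * real ?dmin)"
        using r powr_mono2'[of "- (1 / 12) * real ?dmin" ?r 1] by simp
      moreover have "1 \<le> (real ?k)\<^sup>2" using k by (simp add: Suc_le_eq)
      ultimately show ?thesis using mult_mono[of 1 "(real ?k)\<^sup>2" 1 "?r powr (- (1 / 12) * real ?dmin)"] by simp
    qed (use False in simp)
    then show ?thesis using measure_nonneg[of ?M ?G] by linarith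
  qed
qed simp_all

end
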